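(* For any non-degenerate ellipsoid $\mathcal{E}\subset\mathbb{R}^d$, any $k\in\{0,1,\dots,d\}$, and any real number $p>-d+k-1$, $$\int_{\mathcal{E}^{k+1}}|\operatorname{conv}(\mathbf{x}_0,\dots,\mathbf{x}_k)|^p\,d\mathbf{x}_0\dots d\mathbf{x}_k=\frac{1}{(k!)^p}\,\frac{\kappa_{d+p}^{k+1}}{\kappa_k^{p+d+1}}\,\frac{\kappa_{k(d+p)+k}}{\kappa_{(k+1)(d+p)}}\,\frac{b_{d,k}}{b_{d+p,k}}\int_{A_{d,k}}|\mathcal{E}\cap E|^{p+d+1}\,\mu_{d,k}(dE).$$
   Context: $|\cdot|$ denotes $k$-dimensional volume of convex hulls of $k+1$ points and of intersections with $k$-dimensional affine subspaces (for $k=0$ a point has volume $1$). For real $q>-1$, $\kappa_q:=\pi^{q/2}/\Gamma(q/2+1)$ (so $\kappa_0=1$); for $q>0$, $\omega_q:=q\kappa_q$. For real $q>k-1$, $b_{q,k}:=\dfrac{\omega_{q-k+1}\,\omega_{q-k+2}\cdots\omega_q}{\omega_1\cdots\omega_k}$ (numerator and denominator have $k$ factors each; $b_{q,0}=1$). $A_{d,k}$ is the affine Grassmannian of $k$-dimensional affine subspaces of $\mathbb{R}^d$, equipped with the unique rigid motion invariant measure $\mu_{d,k}$ normalized by $\mu_{d,k}(\{E\in A_{d,k}: E\cap\mathbb{B}^d\neq\emptyset\})=\kappa_{d-k}$, where $\mathbb{B}^d$ is the unit ball of $\mathbb{R}^d$. *)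

theory Defs
  imports "HOL-Analysis.Analysis"
begin

text \<open>
  The constants \<open>\<kappa>\<^sub>q\<close> are the library's \<^const>\<open>unit_ball_vol\<close>, which is defined for real \<open>q\<close> by
  \<open>\<pi> powr (q/2) / Gamma (q/2 + 1)\<close>.
\<close>

definition omega :: "real \<Rightarrow> real" where
  "omega q = q * unit_ball_vol q"

definition b_coeff :: "real \<Rightarrow> nat \<Rightarrow> real" where
  "b_coeff q k = (\<Prod>i=1..k. omega (q - real k + real i)) / (\<Prod>i=1..k. omega (real i))"

definition nondegenerate_ellipsoid :: "(real^'n) set \<Rightarrow> bool" where
  "nondegenerate_ellipsoid S \<longleftrightarrow>
     (\<exists>(A :: real^'n^'n) c. invertible A \<and> S = (\<lambda>v. c + A *v v) ` cball 0 1)"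

definition orthonormal_family :: "nat \<Rightarrow> (nat \<Rightarrow> real^'n) \<Rightarrow> bool" where
  "orthonormal_family k b \<longleftrightarrow> (\<forall>i<k. \<forall>j<k. b i \<bullet> b j = (if i = j then 1 else 0))"

definition flat_point :: "nat \<Rightarrow> real^'n \<Rightarrow> (nat \<Rightarrow> real^'n) \<Rightarrow> (nat \<Rightarrow> real) \<Rightarrow> real^'n" where
  "flat_point k a b t = a + (\<Sum>i<k. t i *\<^sub>R b i)"

text \<open>
  \<open>k\<close>-dimensional volume of a set contained in some \<open>k\<close>-dimensional flat: the \<open>k\<close>-dimensional
  Lebesgue measure of the set in Cartesian coordinates \<open>(t\<^sub>0, \<dots>, t\<^sub>k\<^sub>-\<^sub>1)\<close> of such a flat. Lebesgue
  measure is invariant under isometries, so the chosen origin \<open>a\<close> and orthonormal directions \<open>b\<close>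
  do not matter; if the set lies in several \<open>k\<close>-flats it is null in each of them. For \<open>k = 0\<close> the
  coordinate space is a single point of mass 1. The value is meaningless for sets contained in
  no \<open>k\<close>-flat.
\<close>

definition k_volume :: "nat \<Rightarrow> (real^'n) set \<Rightarrow> real" where
  "k_volume k S =
     (let (a, b) = (SOME (a, b). orthonormal_family k b \<and> S \<subseteq> range (flat_point k a b))
      in measure (\<Pi>\<^sub>M i\<in>{..<k}. (lborel :: real measure))
           {t \<in> space (\<Pi>\<^sub>M i\<in>{..<k}. (lborel :: real measure)). flat_point k a b t \<in> S})"

definition affine_grassmannian :: "nat \<Rightarrow> (real^'n) set set" where
  "affine_grassmannian k = {E. affine E \<and> aff_dim E = int k}"

definition flats_hitting :: "nat \<Rightarrow> (real^'n) set \<Rightarrow> (real^'n) set set" where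
  "flats_hitting k K = {E \<in> affine_grassmannian k. E \<inter> K \<noteq> {}}"

text \<open>
  The sets of flats hitting a compact set generate the Borel \<open>\<sigma>\<close>-algebra of the Fell topology, whose
  trace on the affine Grassmannian is the usual topology.
\<close>

definition affine_grassmannian_algebra :: "nat \<Rightarrow> (real^'n) set set set" where
  "affine_grassmannian_algebra k =
     sigma_sets (affine_grassmannian k) {flats_hitting k K | K. compact K}"

definition rigid_motion :: "(real^'n \<Rightarrow> real^'n) \<Rightarrow> bool" where
  "rigid_motion g \<longleftrightarrow> (\<exists>Q a. rotation_matrix Q \<and> g = (\<lambda>x. a + Q *v x))"

text \<open>
  The measure \<open>\<mu>\<^sub>d\<^sub>,\<^sub>k\<close> is the unique measure satisfying this predicate, where \<open>d = CARD('n)\<close>. Rigid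
  motions are taken to be orientation preserving; the measure is then also invariant under
  improper motions.
\<close>

definition invariant_flat_measure :: "nat \<Rightarrow> (real^'n) set measure \<Rightarrow> bool" where
  "invariant_flat_measure k \<mu> \<longleftrightarrow>
     space \<mu> = affine_grassmannian k \<and>
     sets \<mu> = affine_grassmannian_algebra k \<and>
     (\<forall>g. rigid_motion g \<longrightarrow> (\<forall>\<A>\<in>sets \<mu>. emeasure \<mu> ((\<lambda>E. g ` E) ` \<A>) = emeasure \<mu> \<A>)) \<and>
     emeasure \<mu> (flats_hitting k (cball 0 1)) = ennreal (unit_ball_vol (real CARD('n) - real k))"

end

theory Submission
  imports Defs
begin

text \<open>
  Both sides are compared with averages over a random isometry. The affine Blaschke--Petkantschin
  formula turns the left-hand side into an average over random directions \<open>W\<close> of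
  \<open>\<integral> M(K \<inter> (u + W)) du\<close>, where \<open>u\<close> runs through the orthogonal complement of \<open>W\<close> and
  \<open>M\<close> is the moment of order \<open>p + d - k\<close> of the \<open>k\<close>-volume of random simplices.
  A section of an ellipsoid is an affine image of a \<open>k\<close>-ball, so its moment is the moment of the
  unit ball times the \<open>(p + d + 1)\<close>-th power of its relative volume. The moment of the unit
  ball (Miles) is computed from points weighted by \<open>(1 - |z|\<^sup>2)\<close> to the power \<open>-1/2\<close> in one dimension more, whose
  projections are uniform in the ball.

  On the other side, the invariant measure is not known explicitly. Averaging over translations and
  rotations with Fubini's theorem, using only invariance and the normalisation, shows that it
  integrates the power of the section volume to the same average over random directions.
\<close>

section \<open>Orthogonal projections and Gram--Schmidt volumes\<close>

text \<open>No measure on subspaces or on isometries is constructed: Lebesgue measure on a subspace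
  is an ambient Gaussian average, polar coordinates compare a radial profile with a Gaussian one,
  and a random isometry is a weighted tuple of vectors. All integrals take values in
  \<open>ennreal\<close>, so Fubini needs only measurability and sigma-finiteness, and constants are
  cancelled once they are positive and finite. Restricting \<open>k\<close> edge vectors to
  \<open>W\<close> costs the factor \<open>pvol ^ (d - k)\<close>, whence moments of order
  \<open>q = p + d - k\<close>; the hypothesis on \<open>p\<close> says \<open>q > -1\<close>, which
  makes the \<open>q\<close>-th power of a distance integrable across a hyperplane. An affine map
  with Jacobian \<open>t\<close> on \<open>W\<close> contributes \<open>t ^ (k + 1)\<close> for the
  points and \<open>t powr q\<close> for the volume, and \<open>k + 1 + q = p + d + 1\<close>. The
  exponent \<open>-1/2\<close> is the one for which the integral of the weight along a chord does
  not depend on the chord. One dimension higher, the simplex on the origin and \<open>k + 1\<close>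
  points has a volume moment that factorises point by point. Its height over the hyperplane of the
  points costs a quotient of Beta values, the tilt of that hyperplane a quotient of
  \<open>omega\<close> values.\<close>

definition proj :: "'a::euclidean_space set \<Rightarrow> 'a \<Rightarrow> 'a" where
  "proj W x = (THE y. y \<in> W \<and> (\<forall>w\<in>W. (x - y) \<bullet> w = 0))"

lemma proj_eqI:
  assumes "subspace W" "y \<in> W" "\<And>w. w \<in> W \<Longrightarrow> (x - y) \<bullet> w = 0"
  shows "proj W x = y"
  unfolding proj_def
proof (rule the_equality)
  show "y \<in> W \<and> (\<forall>w\<in>W. (x - y) \<bullet> w = 0)" using assms by auto
next
  fix z assume z: "z \<in> W \<and> (\<forall>w\<in>W. (x - z) \<bullet> w = 0)"
  have "z - y \<in> W" using z assms by (auto intro: subspace_diff)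
  then have "(x - y) \<bullet> (z - y) = 0" "(x - z) \<bullet> (z - y) = 0" using z assms by auto
  then have "(z - y) \<bullet> (z - y) = 0" by (simp add: inner_diff_left inner_diff_right)
  then show "z = y" by simp
qed

lemma proj_exists:
  assumes "subspace W"
  shows "proj W x \<in> W \<and> (\<forall>w\<in>W. (x - proj W x) \<bullet> w = 0)"
proof -
  obtain y z where "y \<in> span W" "\<And>w. w \<in> span W \<Longrightarrow> orthogonal z w" "x = y + z"
    using orthogonal_subspace_decomp_exists[of W x] by metis
  then have y: "y \<in> W" "\<And>w. w \<in> W \<Longrightarrow> (x - y) \<bullet> w = 0"
    using assms by (auto simp: orthogonal_def span_eq_iff[THEN iffD2] span_base)
  with proj_eqI[OF assms this] show ?thesis by auto
qed

lemma proj_in: "subspace W \<Longrightarrow> proj W x \<in> W"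
  using proj_exists by auto

lemma proj_orth: "subspace W \<Longrightarrow> w \<in> W \<Longrightarrow> (x - proj W x) \<bullet> w = 0"
  using proj_exists by auto

lemma inner_proj_eq: "subspace W \<Longrightarrow> w \<in> W \<Longrightarrow> proj W x \<bullet> w = x \<bullet> w"
  using proj_orth[of W w x] by (simp add: inner_diff_left)

lemma proj_id [simp]: "subspace W \<Longrightarrow> x \<in> W \<Longrightarrow> proj W x = x"
  by (rule proj_eqI) auto

lemma proj_add: "subspace W \<Longrightarrow> proj W (x + y) = proj W x + proj W y"
  by (rule proj_eqI) (auto simp: proj_in subspace_add inner_add_left inner_diff_left inner_proj_eq)

lemma proj_scaleR: "subspace W \<Longrightarrow> proj W (c *\<^sub>R x) = c *\<^sub>R proj W x"
  by (rule proj_eqI) (auto simp: proj_in subspace_scale inner_diff_left inner_proj_eq)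

lemma linear_proj: "subspace W \<Longrightarrow> linear (proj W)"
  by (rule linearI) (simp_all add: proj_add proj_scaleR)

lemma proj_zero_iff: "subspace W \<Longrightarrow> proj W x = 0 \<longleftrightarrow> (\<forall>w\<in>W. x \<bullet> w = 0)"
  by (metis inner_proj_eq inner_zero_left proj_eqI subspace_0 diff_zero)

lemma norm_proj_Pythagoras:
  assumes "subspace W"
  shows "(norm x)\<^sup>2 = (norm (proj W x))\<^sup>2 + (norm (x - proj W x))\<^sup>2"
  using proj_orth[OF assms proj_in[OF assms, of x], of x]
  by (simp add: power2_norm_eq_inner algebra_simps inner_commute)

lemma measurable_linear:
  fixes f :: "'a::euclidean_space \<Rightarrow> 'b::euclidean_space"
  shows "linear f \<Longrightarrow> f \<in> borel_measurable borel"
  by (intro borel_measurable_continuous_onI linear_continuous_on) (simp add: linear_conv_bounded_linear)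

lemma measurable_proj: "subspace W \<Longrightarrow> proj W \<in> borel_measurable borel"
  by (intro measurable_linear linear_proj)

lemma measurable_proj' [measurable]:
  assumes "subspace W" "f \<in> borel_measurable M"
  shows "(\<lambda>x. proj W (f x)) \<in> borel_measurable M"
  using measurable_compose[OF assms(2) measurable_proj[OF assms(1)]] .

lemma proj_insert:
  assumes W: "subspace W" and b: "norm b = 1" "\<And>w. w \<in> W \<Longrightarrow> b \<bullet> w = 0"
  shows "proj (span (insert b W)) x = proj W x + (x \<bullet> b) *\<^sub>R b"
proof (rule proj_eqI)
  show "proj W x + (x \<bullet> b) *\<^sub>R b \<in> span (insert b W)"
    by (intro span_add span_mul span_base) (auto simp: proj_in[OF W])
  have bb: "b \<bullet> b = 1" using b(1) by (simp add: norm_eq_1)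
  fix w assume "w \<in> span (insert b W)"
  then obtain s where "w - s *\<^sub>R b \<in> span W" by (auto simp: span_insert)
  then have ws: "w - s *\<^sub>R b \<in> W" using W by (simp add: span_eq_iff[THEN iffD2])
  then obtain v where v: "v \<in> W" "w = v + s *\<^sub>R b" by (metis diff_add_cancel)
  show "(x - (proj W x + (x \<bullet> b) *\<^sub>R b)) \<bullet> w = 0"
    using v b(2)[OF v(1)] b(2)[OF proj_in[OF W, of x]] proj_orth[OF W v(1), of x]
    by (simp add: algebra_simps bb inner_commute)
qed auto

text \<open>Gram--Schmidt without normalisation. If \<open>y j\<close> depends on its predecessors,
  its residual is 0; division by 0 gives 0, so the step leaves \<open>x\<close> unchanged. Hence
  \<open>perp\<close> is the residual of an orthogonal projection for every tuple, independent or
  not.\<close>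

primrec perp :: "(nat \<Rightarrow> 'a::euclidean_space) \<Rightarrow> nat \<Rightarrow> 'a \<Rightarrow> 'a" where
  "perp y 0 x = x"
| "perp y (Suc j) x = perp y j x
     - ((perp y j x \<bullet> perp y j (y j)) / (perp y j (y j) \<bullet> perp y j (y j))) *\<^sub>R perp y j (y j)"

text \<open>Base times height, repeated: the volume of the parallelotope spanned by the first
  \<open>k\<close> vectors, that is, the square root of their Gram determinant. For the edge vectors
  of a simplex it is \<open>fact k\<close> times the volume of the simplex.\<close>

definition pvol :: "nat \<Rightarrow> (nat \<Rightarrow> 'a::euclidean_space) \<Rightarrow> real" where
  "pvol k y = (\<Prod>j<k. norm (perp y j (y j)))"

lemma pvol_0 [simp]: "pvol 0 y = 1"
  by (simp add: pvol_def)

lemma pvol_Suc: "pvol (Suc k) y = pvol k y * norm (perp y k (y k))"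
  by (simp add: pvol_def)

lemma pvol_nonneg [simp]: "pvol k y \<ge> 0"
  by (simp add: pvol_def prod_nonneg)

lemma perp_eq_proj: "perp y k x = x - proj (span (y ` {..<k})) x"
proof (induction k arbitrary: x)
  case 0
  have "proj {0} x = 0" by (rule proj_eqI) auto
  then show ?case by simp
next
  case (Suc k)
  let ?V = "span (y ` {..<k})"
  define e where "e = perp y k (y k)"
  define z where "z = perp y (Suc k) x"
  have z: "z = perp y k x - ((perp y k x \<bullet> e) / (e \<bullet> e)) *\<^sub>R e" by (simp add: z_def e_def)
  have sp: "span (y ` {..<Suc k}) = span (insert (y k) ?V)"
    by (simp add: lessThan_Suc span_insert span_span)
  \<comment> \<open>Exchanging \<open>y k\<close> for its residual \<open>e\<close> keeps the span,
    and \<open>e\<close> is orthogonal to the old span, so only the component along \<open>e\<close>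
    remains to be removed.\<close>
  have ey: "y k = e + proj ?V (y k)" by (simp add: e_def Suc)
  have e_orth: "e \<bullet> w = 0" if "w \<in> ?V" for w
    using proj_orth[OF subspace_span that, of "y k"] by (simp add: e_def Suc)
  have pV: "perp y k x \<bullet> w = 0" if "w \<in> ?V" for w
    using proj_orth[OF subspace_span that, of x] by (simp add: Suc)
  have e_in: "e \<in> span (y ` {..<Suc k})"
    unfolding sp e_def Suc
    by (intro span_diff span_base) (auto intro: proj_in[OF subspace_span])
  have "proj (span (y ` {..<Suc k})) x = x - z"
  proof (rule proj_eqI)
    have "x - z = proj ?V x + ((perp y k x \<bullet> e) / (e \<bullet> e)) *\<^sub>R e"
      by (simp add: z Suc)
    also have "\<dots> \<in> span (y ` {..<Suc k})"
      by (intro span_add span_mul e_in) (auto simp: sp intro!: span_base proj_in)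
    finally show "x - z \<in> span (y ` {..<Suc k})" .
  next
    fix w assume "w \<in> span (y ` {..<Suc k})"
    then obtain s where s: "w - s *\<^sub>R y k \<in> ?V" by (auto simp: sp span_insert span_span)
    have "w - s *\<^sub>R e = w - s *\<^sub>R y k + s *\<^sub>R proj ?V (y k)"
      by (subst ey) (simp add: algebra_simps)
    also have "\<dots> \<in> ?V" by (intro span_add s span_mul proj_in subspace_span)
    finally obtain v where v: "v \<in> ?V" "w = v + s *\<^sub>R e" by (metis diff_add_cancel)
    have "z \<bullet> v = 0" using pV[OF v(1)] e_orth[OF v(1)] by (simp add: z inner_diff_left)
    moreover have "z \<bullet> e = 0" by (simp add: z inner_diff_left)
    ultimately show "(x - (x - z)) \<bullet> w = 0" by (simp add: v inner_add_right)
  qed simp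
  then show ?case by (simp add: z_def)
qed

lemma perp_eqI:
  assumes "x - z \<in> span (y ` {..<k})" "\<And>i. i < k \<Longrightarrow> z \<bullet> y i = 0"
  shows "perp y k x = z"
proof -
  have "orthogonal z w" if "w \<in> span (y ` {..<k})" for w
    by (rule orthogonal_to_span[OF that]) (use assms(2) in \<open>auto simp: orthogonal_def\<close>)
  then have "proj (span (y ` {..<k})) x = x - z"
    by (intro proj_eqI) (use assms in \<open>auto simp: orthogonal_def\<close>)
  then show ?thesis by (simp add: perp_eq_proj)
qed

lemma perp_diff_in_span: "x - perp y k x \<in> span (y ` {..<k})"
  by (simp add: perp_eq_proj proj_in)

lemma perp_orth_span: "w \<in> span (y ` {..<k}) \<Longrightarrow> perp y k x \<bullet> w = 0"
  by (simp add: perp_eq_proj proj_orth)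

lemma perp_orth: "i < k \<Longrightarrow> perp y k x \<bullet> y i = 0"
  by (intro perp_orth_span span_base) auto

lemma perp_cong: "(\<And>i. i < k \<Longrightarrow> y i = z i) \<Longrightarrow> perp y k x = perp z k x"
proof -
  assume "\<And>i. i < k \<Longrightarrow> y i = z i"
  then have "y ` {..<k} = z ` {..<k}" by auto
  then show ?thesis by (simp add: perp_eq_proj)
qed

lemma pvol_cong: "(\<And>i. i < k \<Longrightarrow> y i = z i) \<Longrightarrow> pvol k y = pvol k z"
  unfolding pvol_def
proof (intro prod.cong refl)
  fix j assume eq: "\<And>i. i < k \<Longrightarrow> y i = z i" and "j \<in> {..<k}"
  then have "perp y j (y j) = perp z j (y j)" "y j = z j" by (auto intro!: perp_cong)
  then show "norm (perp y j (y j)) = norm (perp z j (z j))" by simp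
qed

lemma linear_perp: "linear (perp y k)"
proof -
  have "perp y k = (\<lambda>x. x - proj (span (y ` {..<k})) x)" by (simp add: perp_eq_proj fun_eq_iff)
  then show ?thesis by (simp add: linear_compose_sub linear_proj linear_id[unfolded id_def])
qed

lemma perp_zero_iff: "perp y k x = 0 \<longleftrightarrow> x \<in> span (y ` {..<k})"
  by (metis perp_eq_proj proj_id proj_in subspace_span eq_iff_diff_eq_0)

lemma pvol_pos_iff: "pvol k y > 0 \<longleftrightarrow> (\<forall>j<k. y j \<notin> span (y ` {..<j}))"
  unfolding pvol_def perp_zero_iff[symmetric]
  by (metis (no_types, lifting) finite_lessThan lessThan_iff less_irrefl norm_eq_zero norm_ge_zero
      order_le_less prod_pos prod_zero_iff)

lemma dim_span_pvol: "pvol k y > 0 \<Longrightarrow> dim (span (y ` {..<k})) = k"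
proof (induction k)
  case (Suc k)
  have k: "pvol k y > 0" "y k \<notin> span (y ` {..<k})"
    using Suc.prems by (auto simp: pvol_pos_iff)
  have "dim (insert (y k) (y ` {..<k})) = Suc k"
    using Suc.IH[OF k(1)] k(2) by (simp add: dim_insert)
  then show ?case by (simp add: lessThan_Suc)
qed simp

lemma dim_span_less_pvol_zero:
  assumes "pvol k y = 0"
  shows "dim (span (y ` {..<k})) < k"
proof -
  have "dim (y ` {..<k}) \<noteq> k"
  proof
    assume d: "dim (y ` {..<k}) = k"
    \<comment> \<open>Each vector raises the dimension by at most one; dimension \<open>j\<close>
      after \<open>j\<close> vectors therefore forces each of them to lie outside the span of its
      predecessors.\<close>
    have "\<forall>j\<le>k. dim (y ` {..<j}) \<le> j \<and> (\<forall>i<j. dim (y ` {..<j}) = j \<longrightarrow> y i \<notin> span (y ` {..<i}))"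
    proof (intro allI impI)
      fix j assume "j \<le> k"
      then show "dim (y ` {..<j}) \<le> j \<and> (\<forall>i<j. dim (y ` {..<j}) = j \<longrightarrow> y i \<notin> span (y ` {..<i}))"
        by (induction j) (auto simp: lessThan_Suc dim_insert less_Suc_eq split: if_splits)
    qed
    with d have "pvol k y > 0" by (auto simp: pvol_pos_iff)
    with assms show False by simp
  qed
  moreover have "dim (y ` {..<k}) \<le> k"
    using dim_le_card'[of "y ` {..<k}"] card_image_le[of "{..<k}" y] by simp
  ultimately show ?thesis by simp
qed

lemma perp_isometry:
  assumes "linear Q" "\<And>x y. Q x \<bullet> Q y = x \<bullet> y"
  shows "perp (\<lambda>i. Q (y i)) k (Q x) = Q (perp y k x)"
  by (induction k arbitrary: x) (simp_all add: assms linear_diff linear_scale)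

lemma pvol_isometry:
  assumes "linear Q" "\<And>x y. Q x \<bullet> Q y = x \<bullet> y"
  shows "pvol k (\<lambda>i. Q (y i)) = pvol k y"
proof -
  have "norm (Q x) = norm x" for x by (simp add: norm_eq_sqrt_inner assms)
  then show ?thesis by (simp add: pvol_def perp_isometry[OF assms])
qed

lemma perp_scale:
  assumes "r \<noteq> 0" shows "perp (\<lambda>i. r *\<^sub>R y i) k x = perp y k x"
proof (rule perp_eqI)
  have "(\<lambda>i. r *\<^sub>R y i) ` {..<k} = (\<lambda>x. r *\<^sub>R x) ` (y ` {..<k})" by (simp add: image_image)
  then show "x - perp y k x \<in> span ((\<lambda>i. r *\<^sub>R y i) ` {..<k})"
    using perp_diff_in_span[of x y k] assms
      by (simp add: span_image_scale)
qed (simp add: perp_orth)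

lemma pvol_scale: "r > 0 \<Longrightarrow> pvol k (\<lambda>i. r *\<^sub>R y i) = r ^ k * pvol k y"
  by (simp add: pvol_def perp_scale linear_scale[OF linear_perp] prod.distrib)

text \<open>The area of a parallelogram, with either side taken as base. The squares of both
  products are the Gram determinant of \<open>x\<close> and \<open>a\<close>.\<close>

lemma norm_perp_swap:
  fixes a x :: "'a::euclidean_space"
  shows "norm x * norm (a - ((a \<bullet> x) / (x \<bullet> x)) *\<^sub>R x) = norm a * norm (x - ((x \<bullet> a) / (a \<bullet> a)) *\<^sub>R a)"
proof -
  have *: "(norm x * norm (a - ((a \<bullet> x) / (x \<bullet> x)) *\<^sub>R x))\<^sup>2 = (x \<bullet> x) * (a \<bullet> a) - (a \<bullet> x)\<^sup>2"
    for x a :: 'a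
    by (cases "x = 0", simp)
      (simp add: power_mult_distrib power2_norm_eq_inner inner_diff_left inner_diff_right
        inner_commute[of x a], simp add: field_simps power2_eq_square)
  have "(norm x * norm (a - ((a \<bullet> x) / (x \<bullet> x)) *\<^sub>R x))\<^sup>2 = (norm a * norm (x - ((x \<bullet> a) / (a \<bullet> a)) *\<^sub>R a))\<^sup>2"
    unfolding * by (simp add: inner_commute)
  then show ?thesis by (simp add: power2_eq_iff_nonneg)
qed

text \<open>Both sides are the component of \<open>v\<close> orthogonal to \<open>x\<close> and all
  \<open>y i\<close>; on the left the direction \<open>x\<close> is removed first, on the right
  last.\<close>

lemma perp_remove_line:
  fixes x :: "'a::euclidean_space"
  defines "P \<equiv> (\<lambda>v. v - ((v \<bullet> x) / (x \<bullet> x)) *\<^sub>R x)"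
  shows "perp (\<lambda>i. P (y i)) k (P v)
     = perp y k v - ((perp y k v \<bullet> perp y k x) / (perp y k x \<bullet> perp y k x)) *\<^sub>R perp y k x"
proof -
  let ?V = "span (y ` {..<k})"
  define a where "a = perp y k v"
  define x' where "x' = perp y k x"
  define c where "c = (a \<bullet> x') / (x' \<bullet> x')"
  have linP: "linear P" unfolding P_def
    by (rule linearI) (auto simp: algebra_simps add_divide_distrib)
  have Px: "P u \<bullet> x = 0" for u by (simp add: P_def inner_diff_left)
  have Px0: "P x = 0" by (simp add: P_def)
  have im: "(\<lambda>i. P (y i)) ` {..<k} = P ` (y ` {..<k})" by auto
  have PV: "P w \<in> span ((\<lambda>i. P (y i)) ` {..<k})" if "w \<in> ?V" for w
    unfolding im using that linP by (simp add: linear_span_image)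
  have zx: "(a - c *\<^sub>R x') \<bullet> x = 0"
  proof -
    have x: "x = x' + (x - x')" and xin: "x - x' \<in> ?V"
      using perp_diff_in_span[of x y k] by (simp_all add: x'_def)
    have "a \<bullet> (x - x') = 0" "x' \<bullet> (x - x') = 0"
      using xin by (auto simp: a_def x'_def perp_orth_span)
    then have "(a - c *\<^sub>R x') \<bullet> x = a \<bullet> x' - c * (x' \<bullet> x')"
      by (subst x) (simp add: inner_diff_left inner_diff_right)
    then show ?thesis by (simp add: c_def)
  qed
  have "perp (\<lambda>i. P (y i)) k (P v) = a - c *\<^sub>R x'"
  proof (rule perp_eqI)
    have "P (a - c *\<^sub>R x') = a - c *\<^sub>R x'" by (simp add: P_def[abs_def] zx)
    then have "P v - (a - c *\<^sub>R x') = P (v - a) + c *\<^sub>R P x'"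
      using \<open>P (a - c *\<^sub>R x') = a - c *\<^sub>R x'\<close>
      by (simp add: linear_diff[OF linP] linear_scale[OF linP] del: add_uminus_conv_diff) (metis minus_diff_eq)
    also have "P x' = - P (x - x')" using linear_diff[OF linP] by (simp add: Px0)
    also have "P (v - a) + c *\<^sub>R - P (x - x') \<in> span ((\<lambda>i. P (y i)) ` {..<k})"
      by (intro span_add span_mul span_neg PV) (auto simp: a_def x'_def perp_diff_in_span)
    finally show "P v - (a - c *\<^sub>R x') \<in> span ((\<lambda>i. P (y i)) ` {..<k})" .
  next
    fix i assume "i < k"
    then have "(a - c *\<^sub>R x') \<bullet> y i = 0" by (simp add: a_def x'_def inner_diff_left perp_orth)
    then show "(a - c *\<^sub>R x') \<bullet> P (y i) = 0" by (simp add: P_def inner_diff_right zx)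
  qed
  then show ?thesis by (simp add: a_def x'_def c_def)
qed

text \<open>
  Both sides are the volume of the parallelotope spanned by \<open>x\<close> and the \<open>y\<^sub>i\<close>.
\<close>

lemma pvol_remove_line:
  fixes x :: "'a::euclidean_space"
  shows "norm x * pvol k (\<lambda>i. y i - ((y i \<bullet> x) / (x \<bullet> x)) *\<^sub>R x) = pvol k y * norm (perp y k x)"
proof (induction k)
  case (Suc k)
  have "norm x * pvol (Suc k) (\<lambda>i. y i - ((y i \<bullet> x) / (x \<bullet> x)) *\<^sub>R x)
     = pvol k y * (norm (perp y k x) * norm (perp y k (y k)
         - ((perp y k (y k) \<bullet> perp y k x) / (perp y k x \<bullet> perp y k x)) *\<^sub>R perp y k x))"
    by (simp add: pvol_Suc perp_remove_line Suc.IH[symmetric])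
  also have "\<dots> = pvol (Suc k) y * norm (perp y (Suc k) x)"
    by (subst norm_perp_swap) (simp add: pvol_Suc)
  finally show ?case .
qed simp

text \<open>The last factor is the distance of the origin from the affine hull of the points: the
  simplex with an additional vertex at the origin has volume base times height. This links linear
  with affine moments.\<close>

lemma pvol_differences:
  "pvol (Suc k) z = pvol k (\<lambda>i. z i - z k) * norm (perp (\<lambda>i. z i - z k) k (z k))"
proof -
  have "(z i - z k) - (((z i - z k) \<bullet> z k) / (z k \<bullet> z k)) *\<^sub>R z k
      = z i - ((z i \<bullet> z k) / (z k \<bullet> z k)) *\<^sub>R z k" for i
    by (cases "z k = 0") (simp_all add: inner_diff_left diff_divide_distrib algebra_simps)
  then show ?thesis
    unfolding pvol_Suc pvol_remove_line[symmetric] by (simp only:)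
qed

section \<open>Lebesgue measure on linear subspaces\<close>

lemma nn_integral_swap:
  assumes "sigma_finite_measure M" "sigma_finite_measure N"
    and "case_prod f \<in> borel_measurable (M \<Otimes>\<^sub>M N)"
  shows "(\<integral>\<^sup>+x. \<integral>\<^sup>+y. f x y \<partial>N \<partial>M) = (\<integral>\<^sup>+y. \<integral>\<^sup>+x. f x y \<partial>M \<partial>N)"
proof -
  interpret pair_sigma_finite M N using assms(1,2) by (rule pair_sigma_finite.intro)
  show ?thesis by (rule Fubini'[OF assms(3), symmetric])
qed

lemma nn_integral_lborel_shift:
  fixes f :: "'a::euclidean_space \<Rightarrow> ennreal"
  assumes [measurable]: "f \<in> borel_measurable borel"
  shows "(\<integral>\<^sup>+x. f (x + c) \<partial>lborel) = (\<integral>\<^sup>+x. f x \<partial>lborel)"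
proof -
  have "(\<integral>\<^sup>+x. f x \<partial>lborel) = (\<integral>\<^sup>+x. f x \<partial>distr lborel borel ((+) c))"
    by (simp add: lborel_distr_plus)
  also have "\<dots> = (\<integral>\<^sup>+x. f (c + x) \<partial>lborel)" by (subst nn_integral_distr) auto
  finally show ?thesis by (simp add: add.commute)
qed

lemma nn_integral_lborel_uminus:
  fixes f :: "real \<Rightarrow> ennreal"
  assumes [measurable]: "f \<in> borel_measurable borel"
  shows "(\<integral>\<^sup>+x. f (- x) \<partial>lborel) = (\<integral>\<^sup>+x. f x \<partial>lborel)"
  using nn_integral_real_affine[OF assms, of "-1" 0] by simp

text \<open>Substitution on compact intervals, followed by monotone convergence. The bound
  \<open>Suc n\<close> keeps the intervals nondegenerate.\<close>

lemma nn_integral_square_subst: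
  fixes f :: "real \<Rightarrow> ennreal"
  assumes [measurable]: "f \<in> borel_measurable borel"
  shows "(\<integral>\<^sup>+t. f t * indicator {0..} t \<partial>lborel)
    = (\<integral>\<^sup>+h. f (h\<^sup>2) * ennreal (2 * h) * indicator {0..} h \<partial>lborel)"
proof -
  have step: "(\<integral>\<^sup>+t. f t * indicator {0..(real (Suc n))\<^sup>2} t \<partial>lborel)
    = (\<integral>\<^sup>+h. f (h\<^sup>2) * ennreal (2 * h) * indicator {0..real (Suc n)} h \<partial>lborel)" for n
  proof -
    have "((\<lambda>x. x\<^sup>2) has_real_derivative 2 * x) (at x)" for x :: real
      by (auto intro!: derivative_eq_intros)
    then show ?thesis
      using nn_integral_substitution_aux[of f 0 "real (Suc n)" "\<lambda>x. x\<^sup>2" "\<lambda>x. 2 * x"]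
      by (simp add: continuous_on_mult_left)
  qed
  have sup1: "(SUP n. indicator {0..(real (Suc n))\<^sup>2} t :: ennreal) = indicator {0..} t" for t :: real
  proof -
    obtain n where n: "t \<le> real n" by (meson real_arch_simple)
    have "real n \<le> (real (Suc n))\<^sup>2" by (simp add: power2_eq_square algebra_simps)
    then have "indicator {0..} t \<le> (indicator {0..(real (Suc n))\<^sup>2} t :: ennreal)"
      using n by (auto simp: indicator_def)
    then have "indicator {0..} t \<le> (SUP n. indicator {0..(real (Suc n))\<^sup>2} t :: ennreal)"
      by (rule order_trans) (auto intro: SUP_upper)
    then show ?thesis by (intro antisym SUP_least) (auto simp: indicator_def)
  qed
  have sup2: "(SUP n. indicator {0..real (Suc n)} t :: ennreal) = indicator {0..} t" for t :: real
  proof -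
    obtain n where n: "t \<le> real n" by (meson real_arch_simple)
    then have "indicator {0..} t \<le> (indicator {0..real (Suc n)} t :: ennreal)"
      by (auto simp: indicator_def)
    then have "indicator {0..} t \<le> (SUP n. indicator {0..real (Suc n)} t :: ennreal)"
      by (rule order_trans) (auto intro: SUP_upper)
    then show ?thesis by (intro antisym SUP_least) (auto simp: indicator_def)
  qed
  have "(\<integral>\<^sup>+t. f t * indicator {0..} t \<partial>lborel)
      = (\<integral>\<^sup>+t. (SUP n. f t * indicator {0..(real (Suc n))\<^sup>2} t) \<partial>lborel)"
    by (simp only: SUP_mult_left_ennreal[symmetric] sup1)
  also have "\<dots> = (SUP n. \<integral>\<^sup>+t. f t * indicator {0..(real (Suc n))\<^sup>2} t \<partial>lborel)"
  proof (intro nn_integral_monotone_convergence_SUP)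
    show "incseq (\<lambda>n t. f t * indicator {0..(real (Suc n))\<^sup>2} t)"
    proof (intro monoI le_funI mult_left_mono)
      fix m n :: nat and t :: real assume "m \<le> n"
      then have "(real (Suc m))\<^sup>2 \<le> (real (Suc n))\<^sup>2" by (intro power_mono) auto
      then show "indicator {0..(real (Suc m))\<^sup>2} t \<le> (indicator {0..(real (Suc n))\<^sup>2} t :: ennreal)"
        by (auto simp: indicator_def simp del: of_nat_Suc intro: order_trans)
    qed simp
  qed simp
  also have "\<dots> = (SUP n. \<integral>\<^sup>+h. f (h\<^sup>2) * ennreal (2 * h) * indicator {0..real (Suc n)} h \<partial>lborel)"
    by (simp only: step)
  also have "\<dots> = (\<integral>\<^sup>+h. (SUP n. f (h\<^sup>2) * ennreal (2 * h) * indicator {0..real (Suc n)} h) \<partial>lborel)"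
    by (intro nn_integral_monotone_convergence_SUP[symmetric])
      (auto simp: incseq_def le_fun_def indicator_def)
  also have "\<dots> = (\<integral>\<^sup>+h. f (h\<^sup>2) * ennreal (2 * h) * indicator {0..} h \<partial>lborel)"
    by (simp only: SUP_mult_left_ennreal[symmetric] sup2)
  finally show ?thesis .
qed

text \<open>Euler's integral for \<open>Gamma (a / 2)\<close> with the variable
  \<open>pi * h ^ 2\<close>.\<close>

lemma nn_integral_gauss_powr:
  assumes a: "a > 0"
  shows "(\<integral>\<^sup>+h. ennreal (h powr (a - 1) * exp (- pi * h\<^sup>2)) * indicator {0<..} h \<partial>lborel)
    = ennreal (pi powr (- a / 2) * Gamma (a / 2) / 2)"
proof -
  have "ennreal (Gamma (a / 2)) = (\<integral>\<^sup>+t. ennreal (t powr (a / 2 - 1) / exp t) * indicator {0..} t \<partial>lborel)"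
    using a by (subst Gamma_conv_nn_integral_real)
      (auto intro!: nn_integral_cong simp: indicator_def)
  also have "\<dots> = ennreal pi * (\<integral>\<^sup>+t. ennreal ((pi * t) powr (a / 2 - 1) / exp (pi * t)) * indicator {0..} (pi * t) \<partial>lborel)"
    by (subst nn_integral_real_affine[where c=pi and t=0]) simp_all
  also have "(\<integral>\<^sup>+t. ennreal ((pi * t) powr (a / 2 - 1) / exp (pi * t)) * indicator {0..} (pi * t) \<partial>lborel)
     = (\<integral>\<^sup>+t. ennreal ((pi * t) powr (a / 2 - 1) / exp (pi * t)) * indicator {0..} t \<partial>lborel)"
  proof (intro nn_integral_cong arg_cong2[where f="(*)"] refl)
    show "indicator {0..} (pi * t) = (indicator {0..} t :: ennreal)" for t
      using mult_le_cancel_left_pos[of pi 0 t] by (simp add: indicator_def)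
  qed
  also have "\<dots> = (\<integral>\<^sup>+h. ennreal ((pi * h\<^sup>2) powr (a / 2 - 1) / exp (pi * h\<^sup>2)) * ennreal (2 * h) * indicator {0..} h \<partial>lborel)"
    by (subst nn_integral_square_subst) auto
  also have "\<dots> = (\<integral>\<^sup>+h. ennreal (2 * pi powr (a / 2 - 1)) * (ennreal (h powr (a - 1) * exp (- pi * h\<^sup>2)) * indicator {0<..} h) \<partial>lborel)"
  proof (intro nn_integral_cong)
    fix h :: real
    show "ennreal ((pi * h\<^sup>2) powr (a / 2 - 1) / exp (pi * h\<^sup>2)) * ennreal (2 * h) * indicator {0..} h
      = ennreal (2 * pi powr (a / 2 - 1)) * (ennreal (h powr (a - 1) * exp (- pi * h\<^sup>2)) * indicator {0<..} h)"
    proof (cases "h > 0")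
      case True
      have "(h\<^sup>2) powr (a / 2 - 1) * h = (h powr 2) powr (a / 2 - 1) * h powr 1"
        using True by (simp add: powr_numeral)
      also have "\<dots> = h powr (2 * (a / 2 - 1)) * h powr 1"
        by (simp only: powr_powr)
      also have "\<dots> = h powr (a - 1)" unfolding powr_add[symmetric] by simp
      finally show ?thesis using True
        by (simp add: ennreal_mult[symmetric] powr_mult exp_minus field_simps)
    next
      case False then show ?thesis by (cases "h = 0") (auto simp: indicator_def)
    qed
  qed
  also have "\<dots> = ennreal (2 * pi powr (a / 2 - 1)) * (\<integral>\<^sup>+h. ennreal (h powr (a - 1) * exp (- pi * h\<^sup>2)) * indicator {0<..} h \<partial>lborel)"
    by (subst nn_integral_cmult) auto
  finally have *: "ennreal (Gamma (a / 2)) = ennreal pi * (ennreal (2 * pi powr (a / 2 - 1)) *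
      (\<integral>\<^sup>+h. ennreal (h powr (a - 1) * exp (- pi * h\<^sup>2)) * indicator {0<..} h \<partial>lborel))" (is "_ = _ * (_ * ?J)") .
  have pp: "pi * pi powr (a / 2 - 1) = pi powr (a / 2)"
    by (simp add: powr_diff)
  have "pi * (2 * pi powr (a / 2 - 1)) = 2 * pi powr (a / 2)"
    by (subst mult.left_commute) (simp only: pp)
  then have "ennreal pi * (ennreal (2 * pi powr (a / 2 - 1)) * ?J) = ennreal (2 * pi powr (a / 2)) * ?J"
    by (subst mult.assoc[symmetric], subst ennreal_mult[symmetric]) (simp_all only: pi_ge_zero mult_nonneg_nonneg powr_ge_zero zero_le_numeral)
  with * have "ennreal (Gamma (a / 2)) = ennreal (2 * pi powr (a / 2)) * ?J" by simp
  then have "ennreal (1 / (2 * pi powr (a / 2))) * ennreal (Gamma (a / 2))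
      = (ennreal (1 / (2 * pi powr (a / 2))) * ennreal (2 * pi powr (a / 2))) * ?J"
    by (simp only: mult.assoc)
  also have "ennreal (1 / (2 * pi powr (a / 2))) * ennreal (2 * pi powr (a / 2)) = 1"
    by (subst ennreal_mult[symmetric]) auto
  finally show ?thesis using a
    by (simp add: ennreal_mult[symmetric] Gamma_real_pos less_imp_le powr_minus field_simps)
qed

text \<open>The factor \<open>pi\<close> in the exponent makes the total mass 1 in every dimension,
  so Gaussian factors can be inserted and integrated out without constants.\<close>

definition gauss :: "'a::euclidean_space \<Rightarrow> ennreal" where
  "gauss x = ennreal (exp (- pi * (norm x)\<^sup>2))"

lemma measurable_gauss [measurable]: "gauss \<in> borel_measurable borel"
  unfolding gauss_def by measurable

lemma nn_integral_gauss_real: "(\<integral>\<^sup>+x. gauss (x::real) \<partial>lborel) = 1"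
proof -
  let ?J = "\<integral>\<^sup>+h. ennreal (exp (- pi * h\<^sup>2)) * indicator {0<..} h \<partial>lborel"
  have J: "?J = ennreal (1 / 2)"
  proof -
    have "?J = (\<integral>\<^sup>+h. ennreal (h powr (1 - 1) * exp (- pi * h\<^sup>2)) * indicator {0<..} h \<partial>lborel)"
      by (intro nn_integral_cong) (auto simp: indicator_def)
    also have "\<dots> = ennreal (pi powr (- 1 / 2) * Gamma (1 / 2) / 2)"
      by (rule nn_integral_gauss_powr) simp
    also have "pi powr (- 1 / 2) * Gamma (1 / 2) / 2 = (1 / 2 :: real)"
      by (simp add: Gamma_one_half_real powr_minus powr_half_sqrt)
    finally show ?thesis .
  qed
  have J': "(\<integral>\<^sup>+h. ennreal (exp (- pi * h\<^sup>2)) * indicator {..<0} h \<partial>lborel) = ?J"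
    by (subst nn_integral_lborel_uminus[symmetric]) (auto intro!: nn_integral_cong simp: indicator_def)
  have "(\<integral>\<^sup>+x. gauss (x::real) \<partial>lborel) = (\<integral>\<^sup>+h. ennreal (exp (- pi * h\<^sup>2)) * indicator {0<..} h
      + ennreal (exp (- pi * h\<^sup>2)) * indicator {..<0} h \<partial>lborel)"
    by (intro nn_integral_cong_AE, rule AE_mp[OF AE_lborel_singleton[of 0]])
      (auto simp: gauss_def indicator_def)
  also have "\<dots> = ?J + ?J" by (subst nn_integral_add) (simp, simp, simp only: J')
  also have "\<dots> = 1" unfolding J by (subst ennreal_plus[symmetric]) simp_all
  finally show ?thesis .
qed

lemma nn_integral_gauss: "(\<integral>\<^sup>+x. gauss (x::'a::euclidean_space) \<partial>lborel) = 1"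
proof -
  have "gauss x = (\<Prod>b\<in>Basis. gauss (x \<bullet> b))" for x :: 'a
  proof -
    have "(norm x)\<^sup>2 = (\<Sum>b\<in>Basis. (x \<bullet> b)\<^sup>2)"
      unfolding power2_norm_eq_inner by (subst euclidean_inner) (simp add: power2_eq_square)
    then show ?thesis
      by (simp add: gauss_def prod_ennreal exp_sum sum_distrib_left)
  qed
  then have "(\<integral>\<^sup>+x. gauss (x::'a) \<partial>lborel) = (\<integral>\<^sup>+x. (\<Prod>b\<in>Basis. gauss (x \<bullet> b)) \<partial>(lborel :: 'a measure))" by simp
  also have "\<dots> = 1" by (subst nn_integral_lborel_prod) (auto simp: nn_integral_gauss_real)
  finally show ?thesis .
qed

text \<open>
  Lebesgue measure on a linear subspace, as a measure on the whole space: the Gaussian density in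
  the orthogonal directions has total mass 1, so that integrating it out leaves Lebesgue measure.
\<close>

definition slb :: "'a::euclidean_space set \<Rightarrow> 'a measure" where
  "slb W = distr (density lborel (\<lambda>x. gauss (x - proj W x))) borel (proj W)"

lemma sets_slb [simp, measurable_cong]: "sets (slb W) = sets borel"
  by (simp add: slb_def)

lemma space_slb [simp]: "space (slb W) = UNIV"
  by (simp add: slb_def)

lemma nn_integral_slb:
  assumes "subspace W" and [measurable]: "f \<in> borel_measurable borel"
  shows "(\<integral>\<^sup>+x. f x \<partial>slb W) = (\<integral>\<^sup>+x. gauss (x - proj W x) * f (proj W x) \<partial>lborel)"
proof -
  note [measurable] = measurable_proj[OF assms(1)]
  show ?thesis unfolding slb_def by (simp add: nn_integral_distr nn_integral_density)
qed

lemma slb_UNIV [simp]: "slb UNIV = lborel"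
proof (rule measure_eqI)
  fix A assume "A \<in> sets (slb (UNIV::'a set))"
  then have [measurable]: "A \<in> sets borel" by simp
  have "emeasure (slb UNIV) A = (\<integral>\<^sup>+x. indicator A x \<partial>slb UNIV)" by simp
  also have "\<dots> = emeasure lborel A" by (subst nn_integral_slb) (auto simp: gauss_def)
  finally show "emeasure (slb UNIV) A = emeasure lborel A" .
qed simp

lemma nn_integral_slb_gauss: "subspace W \<Longrightarrow> (\<integral>\<^sup>+x. gauss x \<partial>slb W) = 1"
proof -
  assume W: "subspace W"
  have "gauss (x - proj W x) * gauss (proj W x) = gauss x" for x
    by (subst (3) gauss_def, subst norm_proj_Pythagoras[OF W])
      (simp add: gauss_def ennreal_mult[symmetric] exp_add[symmetric] algebra_simps)
  then show ?thesis by (simp add: nn_integral_slb W nn_integral_gauss)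
qed

lemma AE_slb: "subspace W \<Longrightarrow> AE x in slb W. x \<in> W"
proof -
  assume W: "subspace W"
  note [measurable] = measurable_proj[OF W] borel_closed[OF closed_subspace[OF W]]
  show ?thesis unfolding slb_def by (subst AE_distr_iff) (auto simp: proj_in[OF W])
qed

lemma sigma_finite_slb: "subspace W \<Longrightarrow> sigma_finite_measure (slb W)"
proof
  assume W: "subspace W"
  have fin: "emeasure (slb W) (cball 0 (real n)) \<noteq> \<infinity>" for n
  proof -
    have "emeasure (slb W) (cball 0 (real n)) = (\<integral>\<^sup>+x. indicator (cball 0 (real n)) x \<partial>slb W)" by simp
    also have "\<dots> \<le> (\<integral>\<^sup>+x. ennreal (exp (pi * (real n)\<^sup>2)) * gauss x \<partial>slb W)"
    proof (intro nn_integral_mono)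
      fix x :: 'a
      have "1 \<le> exp (pi * (real n)\<^sup>2) * exp (- pi * (norm x)\<^sup>2)" if "norm x \<le> real n"
        using that by (simp add: exp_add[symmetric] power_mono)
      then show "indicator (cball 0 (real n)) x \<le> ennreal (exp (pi * (real n)\<^sup>2)) * gauss x"
        by (auto simp: indicator_def gauss_def ennreal_mult[symmetric] ennreal_1[symmetric]
            simp del: ennreal_1 intro!: ennreal_leI)
    qed
    also have "\<dots> = ennreal (exp (pi * (real n)\<^sup>2))"
      by (subst nn_integral_cmult) (auto simp: nn_integral_slb_gauss W)
    finally show ?thesis by (auto simp: top_unique)
  qed
  have "\<Union>(range (\<lambda>n. cball (0::'a) (real n))) = UNIV"
    by (auto intro: real_arch_simple)
  then show "\<exists>A. countable A \<and> A \<subseteq> sets (slb W) \<and> \<Union>A = space (slb W) \<and> (\<forall>a\<in>A. emeasure (slb W) a \<noteq> \<infinity>)"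
    by (intro exI[of _ "range (\<lambda>n. cball (0::'a) (real n))"]) (auto simp: fin[unfolded infinity_ennreal_def])
qed

lemma nn_integral_slb_shift:
  assumes W: "subspace W" and w: "w \<in> W" and [measurable]: "f \<in> borel_measurable borel"
  shows "(\<integral>\<^sup>+x. f (x + w) \<partial>slb W) = (\<integral>\<^sup>+x. f x \<partial>slb W)"
proof -
  note [measurable] = measurable_proj[OF W]
  have "(\<integral>\<^sup>+x. f (x + w) \<partial>slb W) = (\<integral>\<^sup>+x. gauss (x + w - proj W (x + w)) * f (proj W (x + w)) \<partial>lborel)"
    by (subst nn_integral_slb[OF W]) (simp_all add: proj_add W w)
  also have "\<dots> = (\<integral>\<^sup>+x. gauss (x - proj W x) * f (proj W x) \<partial>lborel)"
    by (rule nn_integral_lborel_shift[where f = "\<lambda>x. gauss (x - proj W x) * f (proj W x)"]) measurable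
  finally show ?thesis by (simp add: nn_integral_slb W)
qed

lemma nn_integral_slb_zero: "f \<in> borel_measurable borel \<Longrightarrow> (\<integral>\<^sup>+x. f x \<partial>slb {0}) = f 0"
proof -
  assume [measurable]: "f \<in> borel_measurable borel"
  have "proj {0} x = 0" for x :: 'a by (rule proj_eqI) auto
  then show ?thesis by (simp add: nn_integral_slb nn_integral_multc nn_integral_gauss)
qed

text \<open>
  Three shears of the Lebesgue measures in \<open>x\<close> and \<open>s\<close> exchange the coordinate of \<open>x\<close> along
  \<open>b\<close> with \<open>s\<close>.
\<close>

lemma nn_integral_slb_insert:
  fixes f :: "'a::euclidean_space \<Rightarrow> ennreal"
  assumes W: "subspace W" and b: "norm b = 1" "\<And>w. w \<in> W \<Longrightarrow> b \<bullet> w = 0"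
    and f [measurable]: "f \<in> borel_measurable borel"
  shows "(\<integral>\<^sup>+x. f x \<partial>slb (span (insert b W))) = (\<integral>\<^sup>+s. \<integral>\<^sup>+x. f (x + s *\<^sub>R b) \<partial>slb W \<partial>lborel)"
proof -
  define W' where "W' = span (insert b W)"
  have W': "subspace W'" by (simp add: W'_def)
  note [measurable] = measurable_proj[OF W] measurable_proj[OF W']
  have bb: "b \<bullet> b = 1" using b(1) by (simp add: norm_eq_1)
  have p': "proj W' x = proj W x + (x \<bullet> b) *\<^sub>R b" for x
    unfolding W'_def by (rule proj_insert[OF W b])
  have pb: "proj W b = 0" by (simp add: proj_zero_iff W b)
  define E where "E = (\<lambda>x. gauss (x - proj W' x))"
  have [measurable]: "E \<in> borel_measurable borel" unfolding E_def by measurable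
  \<comment> \<open>Three roles are kept apart: \<open>x\<close> matters only up to multiples of
    \<open>b\<close>, \<open>a\<close> feeds a one-dimensional Gaussian, and \<open>s\<close> is the
    coordinate along \<open>b\<close> that \<open>f\<close> sees. The shears only move
    \<open>x \<bullet> b\<close> between the last two slots.\<close>
  define H where "H = (\<lambda>x (a::real) s. E x * gauss a * f (proj W x + s *\<^sub>R b))"
  have [measurable]: "(\<lambda>x. H (u x) (v x) (w x)) \<in> borel_measurable M"
    if "u \<in> borel_measurable M" "v \<in> borel_measurable M" "w \<in> borel_measurable M" for u v w M
    using that unfolding H_def by measurable
  have Hinv: "H (x + t *\<^sub>R b) a s = H x a s" for x t a s
    by (simp add: H_def E_def p' proj_add proj_scaleR W pb inner_add_left bb algebra_simps)
  have G: "gauss (x - proj W x) = E x * gauss (x \<bullet> b)" for x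
  proof -
    have d: "x - proj W x = (x - proj W' x) + (x \<bullet> b) *\<^sub>R b" by (simp add: p')
    have "(x - proj W' x) \<bullet> b = 0"
      by (intro proj_orth[OF W']) (auto simp: W'_def span_base)
    then have "(norm (x - proj W x))\<^sup>2 = (norm (x - proj W' x))\<^sup>2 + (x \<bullet> b)\<^sup>2"
      unfolding d by (subst norm_add_Pythagorean) (simp_all add: orthogonal_def power_mult_distrib b(1))
    then show ?thesis by (simp add: gauss_def E_def ennreal_mult[symmetric] exp_add[symmetric] algebra_simps)
  qed
  have "(\<integral>\<^sup>+s. \<integral>\<^sup>+x. f (x + s *\<^sub>R b) \<partial>slb W \<partial>lborel) = (\<integral>\<^sup>+s. \<integral>\<^sup>+x. H x (x \<bullet> b) s \<partial>lborel \<partial>lborel)"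
    by (subst nn_integral_slb[OF W]) (simp_all add: G H_def)
  also have "\<dots> = (\<integral>\<^sup>+s. \<integral>\<^sup>+x. H x (x \<bullet> b) (- s) \<partial>lborel \<partial>lborel)"
    by (rule nn_integral_lborel_uminus[symmetric]) measurable
  also have "\<dots> = (\<integral>\<^sup>+s. \<integral>\<^sup>+x. H (x + s *\<^sub>R b) ((x + s *\<^sub>R b) \<bullet> b) (- s) \<partial>lborel \<partial>lborel)"
    by (rule nn_integral_cong, rule nn_integral_lborel_shift[where f="\<lambda>x. H x (x \<bullet> b) (- s)" for s, symmetric]) measurable
  also have "\<dots> = (\<integral>\<^sup>+s. \<integral>\<^sup>+x. H x (x \<bullet> b + s) (- s) \<partial>lborel \<partial>lborel)"
    by (simp add: Hinv inner_add_left bb)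
  also have "\<dots> = (\<integral>\<^sup>+x. \<integral>\<^sup>+s. H x (x \<bullet> b + s) (- s) \<partial>lborel \<partial>lborel)"
    by (rule nn_integral_swap) (auto intro: lborel.sigma_finite_measure_axioms)
  also have "\<dots> = (\<integral>\<^sup>+x. \<integral>\<^sup>+s. H x (x \<bullet> b + (s + - (x \<bullet> b))) (- (s + - (x \<bullet> b))) \<partial>lborel \<partial>lborel)"
    by (rule nn_integral_cong, rule nn_integral_lborel_shift[where f="\<lambda>s. H x (x \<bullet> b + s) (- s)" for x, symmetric]) measurable
  also have "\<dots> = (\<integral>\<^sup>+x. \<integral>\<^sup>+s. H x s (x \<bullet> b - s) \<partial>lborel \<partial>lborel)" by simp
  also have "\<dots> = (\<integral>\<^sup>+s. \<integral>\<^sup>+x. H x s (x \<bullet> b - s) \<partial>lborel \<partial>lborel)"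
    by (rule nn_integral_swap) (auto intro: lborel.sigma_finite_measure_axioms)
  also have "\<dots> = (\<integral>\<^sup>+s. \<integral>\<^sup>+x. H (x + s *\<^sub>R b) s ((x + s *\<^sub>R b) \<bullet> b - s) \<partial>lborel \<partial>lborel)"
    by (rule nn_integral_cong, rule nn_integral_lborel_shift[where f="\<lambda>x. H x s (x \<bullet> b - s)" for s, symmetric]) measurable
  also have "\<dots> = (\<integral>\<^sup>+s. \<integral>\<^sup>+x. H x s (x \<bullet> b) \<partial>lborel \<partial>lborel)"
    by (simp add: Hinv inner_add_left bb)
  also have "\<dots> = (\<integral>\<^sup>+s. gauss (s::real) * (\<integral>\<^sup>+x. E x * f (proj W' x) \<partial>lborel) \<partial>lborel)"
    by (subst nn_integral_cmult[symmetric]) (auto simp: H_def p' mult_ac)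
  also have "\<dots> = (\<integral>\<^sup>+x. f x \<partial>slb W')"
    by (subst nn_integral_multc) (auto simp: nn_integral_gauss_real nn_integral_slb[OF W'] E_def)
  finally show ?thesis by (simp add: W'_def)
qed

interpretation lborel_product: product_sigma_finite "\<lambda>_. lborel"
  by standard

lemma product_sigma_finite_slb: "subspace W \<Longrightarrow> product_sigma_finite (\<lambda>_. slb W)"
  by (rule product_sigma_finite.intro) (rule sigma_finite_slb)

definition lincomb :: "nat \<Rightarrow> (nat \<Rightarrow> 'a::real_vector) \<Rightarrow> (nat \<Rightarrow> real) \<Rightarrow> 'a" where
  "lincomb k y t = (\<Sum>i<k. t i *\<^sub>R y i)"

lemma measurable_lincomb [measurable]:
  fixes y :: "nat \<Rightarrow> 'a::euclidean_space"
  shows "lincomb k y \<in> borel_measurable (Pi\<^sub>M {..<k} (\<lambda>_. lborel))"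
  unfolding lincomb_def[abs_def]
  by (intro borel_measurable_sum borel_measurable_scaleR measurable_compose[OF measurable_component_singleton]) auto

text \<open>\<open>pvol k y\<close> is the Jacobian of the linear parametrisation. In the induction
  the new vector is an element \<open>w0\<close> of the old span plus \<open>norm e\<close> times a
  unit normal \<open>b\<close>: the part along \<open>w0\<close> disappears by translation
  invariance, the normal part contributes the factor \<open>norm e\<close>.\<close>

theorem nn_integral_slb_span:
  fixes y :: "nat \<Rightarrow> 'a::euclidean_space"
  assumes "pvol k y > 0" and "f \<in> borel_measurable borel"
  shows "ennreal (pvol k y) * (\<integral>\<^sup>+t. f (lincomb k y t) \<partial>Pi\<^sub>M {..<k} (\<lambda>_. lborel))
    = (\<integral>\<^sup>+x. f x \<partial>slb (span (y ` {..<k})))"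
  using assms
proof (induction k arbitrary: f)
  case 0
  then show ?case by (simp add: PiM_empty nn_integral_count_space_finite nn_integral_slb_zero lincomb_def)
next
  case (Suc k)
  note [measurable] = Suc.prems(2)
  define W where "W = span (y ` {..<k})"
  have W: "subspace W" by (simp add: W_def)
  interpret slbW: sigma_finite_measure "slb W" by (rule sigma_finite_slb[OF W])
  define e where "e = perp y k (y k)"
  have pk: "pvol k y > 0" using Suc.prems(1) by (auto simp: pvol_pos_iff)
  have e0: "norm e > 0" using Suc.prems(1) pvol_nonneg[of k y]
    by (auto simp: pvol_Suc e_def zero_less_mult_iff)
  define b where "b = e /\<^sub>R norm e"
  have b1: "norm b = 1" using e0 by (simp add: b_def)
  have bW: "b \<bullet> w = 0" if "w \<in> W" for w
    using that by (simp add: b_def e_def W_def perp_orth_span)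
  define w0 where "w0 = y k - e"
  have w0: "w0 \<in> W" by (simp add: w0_def e_def W_def perp_diff_in_span)
  have yk: "y k = w0 + norm e *\<^sub>R b" using e0 by (simp add: w0_def b_def)
  have sp: "span (y ` {..<Suc k}) = span (insert b W)"
  proof -
    have "span (insert (y k) W) = span (insert b W)"
    proof (rule span_eq[THEN iffD2], intro conjI)
      have "y k \<in> span (insert b W)"
        unfolding yk by (intro span_add span_mul) (auto intro: span_base w0)
      then show "insert (y k) W \<subseteq> span (insert b W)" by (auto intro: span_base)
      have "b = (1 / norm e) *\<^sub>R (y k - w0)" using e0 by (simp add: yk)
      also have "\<dots> \<in> span (insert (y k) W)"
        by (intro span_mul span_diff) (auto intro: span_base w0)
      finally show "insert b W \<subseteq> span (insert (y k) W)" by (auto intro: span_base)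
    qed
    moreover have "span (y ` {..<Suc k}) = span (insert (y k) W)"
      by (simp add: lessThan_Suc span_insert W_def span_span)
    ultimately show ?thesis by simp
  qed
  have lin: "lincomb (Suc k) y (t(k := \<tau>)) = lincomb k y t + \<tau> *\<^sub>R y k" for t \<tau>
    by (simp add: lincomb_def)
  have "(\<integral>\<^sup>+t. f (lincomb (Suc k) y t) \<partial>Pi\<^sub>M {..<Suc k} (\<lambda>_. lborel))
     = (\<integral>\<^sup>+\<tau>. \<integral>\<^sup>+t. f (lincomb k y t + \<tau> *\<^sub>R y k) \<partial>Pi\<^sub>M {..<k} (\<lambda>_. lborel) \<partial>lborel)"
  proof -
    have [measurable]: "(\<lambda>t. f (lincomb (Suc k) y t)) \<in> borel_measurable (Pi\<^sub>M (insert k {..<k}) (\<lambda>_. lborel))"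
      using measurable_lincomb[of "Suc k" y] by (simp add: lessThan_Suc[symmetric])
    show ?thesis
      unfolding lessThan_Suc by (subst lborel_product.product_nn_integral_insert_rev) (auto simp: lin)
  qed
  moreover have "ennreal (pvol k y) * (\<integral>\<^sup>+t. f (lincomb k y t + \<tau> *\<^sub>R y k) \<partial>Pi\<^sub>M {..<k} (\<lambda>_. lborel))
      = (\<integral>\<^sup>+x. f (x + (norm e * \<tau>) *\<^sub>R b) \<partial>slb W)" for \<tau>
  proof -
    have "ennreal (pvol k y) * (\<integral>\<^sup>+t. f (lincomb k y t + \<tau> *\<^sub>R y k) \<partial>Pi\<^sub>M {..<k} (\<lambda>_. lborel))
      = (\<integral>\<^sup>+x. f (x + \<tau> *\<^sub>R y k) \<partial>slb W)"
      unfolding W_def by (rule Suc.IH[OF pk]) measurable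
    also have "\<dots> = (\<integral>\<^sup>+x. f ((x + \<tau> *\<^sub>R w0) + (norm e * \<tau>) *\<^sub>R b) \<partial>slb W)"
      by (simp add: yk scaleR_add_right add.assoc mult.commute)
    also have "\<dots> = (\<integral>\<^sup>+x. f (x + (norm e * \<tau>) *\<^sub>R b) \<partial>slb W)"
      by (rule nn_integral_slb_shift[OF W, where f="\<lambda>x. f (x + (norm e * \<tau>) *\<^sub>R b)"])
        (auto intro: subspace_scale W w0)
    finally show ?thesis .
  qed
  ultimately have "ennreal (pvol k y) * (\<integral>\<^sup>+t. f (lincomb (Suc k) y t) \<partial>Pi\<^sub>M {..<Suc k} (\<lambda>_. lborel))
     = (\<integral>\<^sup>+\<tau>. \<integral>\<^sup>+x. f (x + (norm e * \<tau>) *\<^sub>R b) \<partial>slb W \<partial>lborel)"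
    by (simp add: nn_integral_cmult[symmetric] lborel_product.sigma_finite
        sigma_finite_measure.borel_measurable_nn_integral)
  then have "ennreal (pvol (Suc k) y) * (\<integral>\<^sup>+t. f (lincomb (Suc k) y t) \<partial>Pi\<^sub>M {..<Suc k} (\<lambda>_. lborel))
     = ennreal (norm e) * (\<integral>\<^sup>+\<tau>. \<integral>\<^sup>+x. f (x + (norm e * \<tau>) *\<^sub>R b) \<partial>slb W \<partial>lborel)"
    by (simp add: pvol_Suc ennreal_mult e_def[symmetric] mult_ac)
  also have "\<dots> = (\<integral>\<^sup>+s. \<integral>\<^sup>+x. f (x + s *\<^sub>R b) \<partial>slb W \<partial>lborel)"
    using e0 by (subst (2) nn_integral_real_affine[where c="norm e" and t=0]) simp_all
  also have "\<dots> = (\<integral>\<^sup>+x. f x \<partial>slb (span (y ` {..<Suc k})))"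
    unfolding sp by (rule nn_integral_slb_insert[OF W b1 bW, symmetric]) simp_all
  finally show ?case .
qed

section \<open>Linear images and orthogonal decompositions\<close>

lemma orthonormal_pvol:
  assumes "\<And>i j. i < k \<Longrightarrow> j < k \<Longrightarrow> b i \<bullet> b j = (if i = j then 1 else 0)"
  shows "pvol k b = 1"
proof -
  have "norm (perp b j (b j)) = 1" if "j < k" for j
  proof -
    have "perp b j (b j) = b j" by (rule perp_eqI) (use assms that in \<open>auto simp: span_zero\<close>)
    then show ?thesis using assms[OF that that] by (simp add: norm_eq_1)
  qed
  then show ?thesis by (simp add: pvol_def)
qed

lemma orthonormal_enumeration:
  fixes W :: "'a::euclidean_space set"
  assumes "subspace W" "dim W = k"
  obtains b where "\<And>i j. i < k \<Longrightarrow> j < k \<Longrightarrow> b i \<bullet> b j = (if i = j then 1 else 0)"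
    "span (b ` {..<k}) = W"
proof -
  obtain B where B: "B \<subseteq> W" "pairwise orthogonal B" "\<And>x. x \<in> B \<Longrightarrow> norm x = 1"
    "independent B" "card B = dim W" "span B = W"
    using orthonormal_basis_subspace[OF assms(1)] by metis
  have "finite B" using B(4) by (rule independent_imp_finite)
  then obtain b where b: "bij_betw b {0..<card B} B" using ex_bij_betw_nat_finite by blast
  have b': "bij_betw b {..<k} B" using b B(5) assms(2) by (simp add: atLeast0LessThan)
  show thesis
  proof (rule that[of b])
    show "b i \<bullet> b j = (if i = j then 1 else 0)" if "i < k" "j < k" for i j
    proof (cases "i = j")
      case True
      then show ?thesis using B(3)[of "b i"] b' that by (auto simp: norm_eq_1 bij_betw_def)
    next
      case False
      then have "b i \<noteq> b j" using b' that by (auto simp: bij_betw_def inj_on_def)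
      then show ?thesis using False B(2) b' that
        by (auto simp: pairwise_def orthogonal_def bij_betw_def)
    qed
    show "span (b ` {..<k}) = W" using b' B(6) by (simp add: bij_betw_def)
  qed
qed

lemma linear_lincomb: "linear T \<Longrightarrow> T (lincomb k y t) = lincomb k (\<lambda>i. T (y i)) t"
  by (simp add: lincomb_def linear_sum linear_scale)

lemma span_image_linear: "linear T \<Longrightarrow> span ((\<lambda>i. T (y i)) ` A) = T ` span (y ` A)"
  by (simp add: linear_span_image[symmetric] image_image)

text \<open>The same \<open>\<delta>\<close> is the Jacobian of \<open>T\<close> on \<open>W\<close>
  and the factor by which \<open>T\<close> multiplies volumes of tuples in \<open>W\<close>. It is
  read off from the image of an orthonormal basis; any other basis of \<open>W\<close> must yield
  the same value because the change of variables is unique.\<close>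

lemma slb_linear_image:
  fixes T :: "'a::euclidean_space \<Rightarrow> 'b::euclidean_space"
  assumes W: "subspace W" "dim W = k" and T: "linear T" "inj_on T W"
  obtains \<delta> where "\<delta> > 0"
    and "\<And>f. f \<in> borel_measurable borel \<Longrightarrow> ennreal \<delta> * (\<integral>\<^sup>+x. f (T x) \<partial>slb W) = (\<integral>\<^sup>+x. f x \<partial>slb (T ` W))"
    and "\<And>y. (\<And>i. i < k \<Longrightarrow> y i \<in> W) \<Longrightarrow> pvol k (\<lambda>i. T (y i)) = \<delta> * pvol k y"
proof -
  obtain b where b: "\<And>i j. i < k \<Longrightarrow> j < k \<Longrightarrow> b i \<bullet> b j = (if i = j then 1 else 0)"
    "span (b ` {..<k}) = W"
    using orthonormal_enumeration[OF W] by metis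
  have TW: "subspace (T ` W)" using W(1) T(1) by (simp add: linear_subspace_image)
  have dTW: "dim (T ` W) = k" using T W by (metis dim_image_eq span_eq_iff)
  note [measurable] = measurable_linear[OF T(1)]
  have main: "ennreal (pvol k (\<lambda>i. T (y i))) * (\<integral>\<^sup>+x. f (T x) \<partial>slb W)
       = ennreal (pvol k y) * (\<integral>\<^sup>+x. f x \<partial>slb (T ` W)) \<and> pvol k (\<lambda>i. T (y i)) > 0"
    if y: "span (y ` {..<k}) = W" "pvol k y > 0" and [measurable]: "f \<in> borel_measurable borel" for y f
  proof -
    have sp: "span ((\<lambda>i. T (y i)) ` {..<k}) = T ` W" by (simp add: span_image_linear T y)
    have pos: "pvol k (\<lambda>i. T (y i)) > 0"
      using dim_span_less_pvol_zero[of k "\<lambda>i. T (y i)"] pvol_nonneg[of k "\<lambda>i. T (y i)"]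
      by (auto simp: sp dTW less_le)
    have "ennreal (pvol k (\<lambda>i. T (y i))) * (\<integral>\<^sup>+x. f (T x) \<partial>slb W)
      = ennreal (pvol k (\<lambda>i. T (y i))) * (ennreal (pvol k y) * (\<integral>\<^sup>+t. f (lincomb k (\<lambda>i. T (y i)) t) \<partial>Pi\<^sub>M {..<k} (\<lambda>_. lborel)))"
      unfolding y(1)[symmetric] using nn_integral_slb_span[OF y(2), of "\<lambda>x. f (T x)"]
      by (simp add: linear_lincomb T)
    also have "\<dots> = ennreal (pvol k y) * (ennreal (pvol k (\<lambda>i. T (y i))) * (\<integral>\<^sup>+t. f (lincomb k (\<lambda>i. T (y i)) t) \<partial>Pi\<^sub>M {..<k} (\<lambda>_. lborel)))"
      by (simp only: mult_ac)
    also have "\<dots> = ennreal (pvol k y) * (\<integral>\<^sup>+x. f x \<partial>slb (T ` W))"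
      by (subst nn_integral_slb_span[OF pos]) (simp_all add: sp)
    finally show ?thesis using pos by simp
  qed
  define \<delta> where "\<delta> = pvol k (\<lambda>i. T (b i))"
  have pb: "pvol k b = 1" by (rule orthonormal_pvol) (rule b)
  have \<delta>: "\<delta> > 0" using main[OF b(2), of "\<lambda>_. 0"] pb by (simp add: \<delta>_def)
  have int: "ennreal \<delta> * (\<integral>\<^sup>+x. f (T x) \<partial>slb W) = (\<integral>\<^sup>+x. f x \<partial>slb (T ` W))"
    if "f \<in> borel_measurable borel" for f
    using main[OF b(2) _ that] pb by (simp add: \<delta>_def)
  have vol: "pvol k (\<lambda>i. T (y i)) = \<delta> * pvol k y" if y: "\<And>i. i < k \<Longrightarrow> y i \<in> W" for y
  proof (cases "pvol k y = 0")
    case True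
    then have "dim (span (y ` {..<k})) < k" by (rule dim_span_less_pvol_zero)
    then have "dim (span ((\<lambda>i. T (y i)) ` {..<k})) < k"
      unfolding span_image_linear[OF T(1)] using dim_image_le[OF T(1), of "span (y ` {..<k})"] by simp
    then have "\<not> pvol k (\<lambda>i. T (y i)) > 0" using dim_span_pvol by fastforce
    then have "pvol k (\<lambda>i. T (y i)) = 0" using pvol_nonneg[of k "\<lambda>i. T (y i)"] by linarith
    then show ?thesis using True by simp
  next
    case False
    then have py: "pvol k y > 0" using pvol_nonneg[of k y] by linarith
    have sp: "span (y ` {..<k}) = W"
    proof (rule subspace_dim_equal[OF subspace_span W(1)])
      show "span (y ` {..<k}) \<subseteq> W" using y W(1) by (intro span_minimal) auto
      show "dim W \<le> dim (span (y ` {..<k}))" using dim_span_pvol[OF py] W(2) by simp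
    qed
    \<comment> \<open>The Gaussian serves as a test function with integral 1 over the image of
      \<open>W\<close>; the two change-of-variables formulas for it determine the ratio of the
      volumes.\<close>
    have g: "(\<integral>\<^sup>+x. gauss x \<partial>slb (T ` W)) = 1" by (rule nn_integral_slb_gauss[OF TW])
    let ?I = "\<integral>\<^sup>+x. gauss (T x) \<partial>slb W"
    have 1: "ennreal \<delta> * ?I = 1" using int[of gauss] g by simp
    have 2: "ennreal (pvol k (\<lambda>i. T (y i))) * ?I = ennreal (pvol k y)"
      using main[OF sp py, of gauss] g by simp
    have "ennreal (pvol k (\<lambda>i. T (y i))) = ennreal (pvol k (\<lambda>i. T (y i))) * (ennreal \<delta> * ?I)"
      using 1 by simp
    also have "\<dots> = ennreal \<delta> * (ennreal (pvol k (\<lambda>i. T (y i))) * ?I)" by (simp only: mult_ac)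
    also have "\<dots> = ennreal (\<delta> * pvol k y)" using 2 \<delta> by (simp add: ennreal_mult)
    finally show ?thesis using \<delta> by simp
  qed
  show thesis by (rule that[OF \<delta> int vol])
qed

lemma nn_integral_slb_isometry:
  fixes Q :: "'a::euclidean_space \<Rightarrow> 'b::euclidean_space"
  assumes W: "subspace W" and Q: "linear Q" "\<And>x y. Q x \<bullet> Q y = x \<bullet> y"
    and f: "f \<in> borel_measurable borel"
  shows "(\<integral>\<^sup>+x. f (Q x) \<partial>slb W) = (\<integral>\<^sup>+x. f x \<partial>slb (Q ` W))"
proof -
  have "Q x = 0 \<Longrightarrow> x = 0" for x using Q(2)[of x x] by simp
  then have "inj_on Q W" using Q(1) by (metis inj_on_subset linear_injective_0 subset_UNIV)
  then obtain \<delta> where \<delta>: "\<delta> > 0"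
    "\<And>f. f \<in> borel_measurable borel \<Longrightarrow> ennreal \<delta> * (\<integral>\<^sup>+x. f (Q x) \<partial>slb W) = (\<integral>\<^sup>+x. f x \<partial>slb (Q ` W))"
    "\<And>y. (\<And>i. i < dim W \<Longrightarrow> y i \<in> W) \<Longrightarrow> pvol (dim W) (\<lambda>i. Q (y i)) = \<delta> * pvol (dim W) y"
    using slb_linear_image[OF W refl Q(1)] by metis
  obtain b where b: "\<And>i j. i < dim W \<Longrightarrow> j < dim W \<Longrightarrow> b i \<bullet> b j = (if i = j then 1 else 0)"
    "span (b ` {..<dim W}) = W"
    using orthonormal_enumeration[OF W refl] by metis
  have "pvol (dim W) (\<lambda>i. Q (b i)) = \<delta> * pvol (dim W) b"
    by (rule \<delta>(3)) (use b(2) in \<open>auto intro: span_base\<close>)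
  then have "\<delta> = 1" by (simp add: pvol_isometry Q orthonormal_pvol[OF b(1)])
  then show ?thesis using \<delta>(2)[OF f] by simp
qed

lemma nn_integral_lborel_isometry:
  fixes Q :: "'a::euclidean_space \<Rightarrow> 'a"
  assumes Q: "linear Q" "\<And>x y. Q x \<bullet> Q y = x \<bullet> y" and f: "f \<in> borel_measurable borel"
  shows "(\<integral>\<^sup>+x. f (Q x) \<partial>lborel) = (\<integral>\<^sup>+x. f x \<partial>lborel)"
proof -
  have "Q x = 0 \<Longrightarrow> x = 0" for x using Q(2)[of x x] by simp
  then have "inj Q" using Q(1) by (metis linear_injective_0)
  then have "Q ` UNIV = UNIV" using Q(1) linear_injective_imp_surjective by blast
  then show ?thesis using nn_integral_slb_isometry[OF subspace_UNIV Q f] by simp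
qed

lemma nn_integral_slb_scale:
  assumes W: "subspace W" and r: "r > 0" and f: "f \<in> borel_measurable borel"
  shows "ennreal (r ^ dim W) * (\<integral>\<^sup>+x. f (r *\<^sub>R x) \<partial>slb W) = (\<integral>\<^sup>+x. f x \<partial>slb W)"
proof -
  have lin: "linear (\<lambda>x. r *\<^sub>R x)" by (simp add: linear_scale_self)
  have "(\<lambda>x. r *\<^sub>R x) ` W = W"
  proof -
    have "x \<in> (\<lambda>x. r *\<^sub>R x) ` W" if "x \<in> W" for x
      using r that W by (intro image_eqI[of _ _ "(1 / r) *\<^sub>R x"]) (auto intro: subspace_scale)
    then show ?thesis using W by (auto intro: subspace_scale)
  qed
  moreover have "inj_on (\<lambda>x. r *\<^sub>R x) W" using r by (auto simp: inj_on_def)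
  ultimately obtain \<delta> where \<delta>: "\<delta> > 0"
    "\<And>f. f \<in> borel_measurable borel \<Longrightarrow> ennreal \<delta> * (\<integral>\<^sup>+x. f (r *\<^sub>R x) \<partial>slb W) = (\<integral>\<^sup>+x. f x \<partial>slb W)"
    "\<And>y. (\<And>i. i < dim W \<Longrightarrow> y i \<in> W) \<Longrightarrow> pvol (dim W) (\<lambda>i. r *\<^sub>R (y i)) = \<delta> * pvol (dim W) y"
    using slb_linear_image[OF W refl lin] by metis
  obtain b where b: "\<And>i j. i < dim W \<Longrightarrow> j < dim W \<Longrightarrow> b i \<bullet> b j = (if i = j then 1 else 0)"
    "span (b ` {..<dim W}) = W"
    using orthonormal_enumeration[OF W refl] by metis
  have "pvol (dim W) (\<lambda>i. r *\<^sub>R (b i)) = \<delta> * pvol (dim W) b"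
    by (rule \<delta>(3)) (use b(2) in \<open>auto intro: span_base\<close>)
  then have "\<delta> = r ^ dim W" using r by (simp add: pvol_scale orthonormal_pvol[OF b(1)])
  then show ?thesis using \<delta>(2)[OF f] by simp
qed

text \<open>Fubini for an orthogonal decomposition: the vectors of \<open>C\<close> are adjoined one
  at a time, and each enlarges \<open>span (V \<union> C)\<close> and \<open>span C\<close> by the
  same line.\<close>

lemma nn_integral_slb_span_insert_set:
  assumes V: "subspace V" and C: "finite C" "pairwise orthogonal C" "\<And>c. c \<in> C \<Longrightarrow> norm c = 1"
    "\<And>c v. c \<in> C \<Longrightarrow> v \<in> V \<Longrightarrow> c \<bullet> v = 0"
    and f: "f \<in> borel_measurable borel"
  shows "(\<integral>\<^sup>+x. f x \<partial>slb (span (V \<union> C))) = (\<integral>\<^sup>+v. \<integral>\<^sup>+u. f (v + u) \<partial>slb (span C) \<partial>slb V)"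
  using C f
proof (induction C arbitrary: f rule: finite_induct)
  case empty
  then show ?case using V by (simp add: nn_integral_slb_zero span_eq_iff[THEN iffD2])
next
  case (insert c C)
  note [measurable] = insert.prems(4)
  interpret C: sigma_finite_measure "slb (span C)" by (rule sigma_finite_slb) simp
  have orth: "c \<bullet> u = 0" if "u \<in> span C" for u
  proof -
    have "orthogonal c u"
      by (rule orthogonal_to_span[OF that]) (use insert.prems(1) insert.hyps in \<open>auto simp: pairwise_def\<close>)
    then show ?thesis by (simp add: orthogonal_def)
  qed
  have orth': "c \<bullet> u = 0" if "u \<in> span (V \<union> C)" for u
  proof -
    have "orthogonal c u"
      by (rule orthogonal_to_span[OF that])
        (use insert.prems(1,3) insert.hyps in \<open>auto simp: pairwise_def orthogonal_def\<close>)
    then show ?thesis by (simp add: orthogonal_def)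
  qed
  have 1: "span (V \<union> insert c C) = span (insert c (span (V \<union> C)))" "span (insert c C) = span (insert c (span C))"
    by (simp_all add: span_insert span_span)
  have c1: "norm c = 1" using insert.prems by auto
  have "(\<integral>\<^sup>+x. f x \<partial>slb (span (V \<union> insert c C))) = (\<integral>\<^sup>+s. \<integral>\<^sup>+x. f (x + s *\<^sub>R c) \<partial>slb (span (V \<union> C)) \<partial>lborel)"
    unfolding 1 by (rule nn_integral_slb_insert[OF subspace_span c1 orth']) simp_all
  also have "\<dots> = (\<integral>\<^sup>+s. \<integral>\<^sup>+v. \<integral>\<^sup>+u. f (v + u + s *\<^sub>R c) \<partial>slb (span C) \<partial>slb V \<partial>lborel)"
    by (intro nn_integral_cong insert.IH) (use insert.prems in \<open>auto simp: pairwise_insert\<close>)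
  also have "\<dots> = (\<integral>\<^sup>+v. \<integral>\<^sup>+s. \<integral>\<^sup>+u. f (v + u + s *\<^sub>R c) \<partial>slb (span C) \<partial>lborel \<partial>slb V)"
    by (rule nn_integral_swap) (simp_all add: sigma_finite_slb[OF V] lborel.sigma_finite_measure_axioms)
  also have "\<dots> = (\<integral>\<^sup>+v. \<integral>\<^sup>+u. f (v + u) \<partial>slb (span (insert c C)) \<partial>slb V)"
    unfolding 1 by (intro nn_integral_cong, subst nn_integral_slb_insert[OF subspace_span c1 orth])
      (simp_all add: add.assoc)
  finally show ?case .
qed

definition orth_in :: "'a::euclidean_space set \<Rightarrow> 'a set \<Rightarrow> 'a set" where
  "orth_in X V = {x \<in> X. \<forall>v\<in>V. x \<bullet> v = 0}"

lemma subspace_orth_in: "subspace X \<Longrightarrow> subspace (orth_in X V)"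
  by (auto simp: subspace_def orth_in_def inner_add_left)

lemma dim_orth_in:
  assumes "subspace X" "subspace V" "V \<subseteq> X"
  shows "dim (orth_in X V) = dim X - dim V"
proof -
  have "orth_in X V = {y \<in> X. \<forall>x\<in>V. orthogonal x y}"
    by (auto simp: orth_in_def orthogonal_def inner_commute)
  then show ?thesis using dim_subspace_orthogonal_to_vectors[OF assms(2,1,3)] by simp
qed

lemma nn_integral_slb_split:
  assumes X: "subspace X" and V: "subspace V" "V \<subseteq> X" and f: "f \<in> borel_measurable borel"
  shows "(\<integral>\<^sup>+x. f x \<partial>slb X) = (\<integral>\<^sup>+v. \<integral>\<^sup>+u. f (v + u) \<partial>slb (orth_in X V) \<partial>slb V)"
proof -
  obtain C where C: "C \<subseteq> orth_in X V" "pairwise orthogonal C" "\<And>x. x \<in> C \<Longrightarrow> norm x = 1"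
    "independent C" "span C = orth_in X V"
    using orthonormal_basis_subspace[OF subspace_orth_in[OF X]] by metis
  have "span (V \<union> C) = X"
  proof (rule antisym)
    show "span (V \<union> C) \<subseteq> X" using V C(1) X by (intro span_minimal) (auto simp: orth_in_def)
    show "X \<subseteq> span (V \<union> C)"
    proof
      fix x assume x: "x \<in> X"
      have "x - proj V x \<in> orth_in X V"
        using x V X proj_in[OF V(1), of x] by (auto simp: orth_in_def proj_orth intro: subspace_diff)
      then have "x - proj V x \<in> span (V \<union> C)" using C(5) span_mono[of C "V \<union> C"] by auto
      moreover have "proj V x \<in> span (V \<union> C)" by (intro span_base UnI1 proj_in V)
      ultimately show "x \<in> span (V \<union> C)" by (metis diff_add_cancel span_add)
    qed
  qed
  then show ?thesis
    using nn_integral_slb_span_insert_set[OF V(1) independent_imp_finite[OF C(4)] C(2,3) _ f] C(1,5)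
    by (auto simp: orth_in_def)
qed

section \<open>Radial and homogeneous integrands\<close>

lemma measurable_perp [measurable (raw)]:
  assumes "\<And>i. i < k \<Longrightarrow> (\<lambda>\<omega>. y \<omega> i) \<in> borel_measurable M" "f \<in> borel_measurable M"
  shows "(\<lambda>\<omega>. perp (y \<omega>) k (f \<omega>)) \<in> borel_measurable M"
  using assms
proof (induction k arbitrary: f)
  case (Suc k)
  have [measurable]: "(\<lambda>\<omega>. perp (y \<omega>) k (f \<omega>)) \<in> borel_measurable M"
    "(\<lambda>\<omega>. perp (y \<omega>) k (y \<omega> k)) \<in> borel_measurable M"
    by (auto intro!: Suc.IH Suc.prems less_SucI)
  show ?case by simp
qed simp

lemma measurable_pvol [measurable (raw)]:
  assumes "\<And>i. i < k \<Longrightarrow> (\<lambda>\<omega>. y \<omega> i) \<in> borel_measurable M"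
  shows "(\<lambda>\<omega>. pvol k (y \<omega>)) \<in> borel_measurable M"
  unfolding pvol_def using assms
  by (intro borel_measurable_prod borel_measurable_norm measurable_compose[OF _ borel_measurable_norm] measurable_perp) auto

text \<open>The radial part of integration in polar coordinates in dimension \<open>a\<close>.
  Non-integral \<open>a\<close> occur because a weight homogeneous of degree \<open>q\<close> acts
  like \<open>q\<close> additional dimensions.\<close>

definition radial :: "real \<Rightarrow> (real \<Rightarrow> ennreal) \<Rightarrow> ennreal" where
  "radial a f = (\<integral>\<^sup>+h. f h * ennreal (h powr (a - 1)) * indicator {0<..} h \<partial>lborel)"

lemma radial_scale:
  assumes [measurable]: "f \<in> borel_measurable borel" and c: "c > 0"
  shows "ennreal (c powr a) * radial a (\<lambda>h. f (c * h)) = radial a f"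
proof -
  have "radial a f = ennreal c * (\<integral>\<^sup>+h. f (c * h) * ennreal ((c * h) powr (a - 1)) * indicator {0<..} (c * h) \<partial>lborel)"
    unfolding radial_def using c by (subst nn_integral_real_affine[where c=c and t=0]) simp_all
  also have "\<dots> = (\<integral>\<^sup>+h. ennreal (c powr a) * (f (c * h) * ennreal (h powr (a - 1)) * indicator {0<..} h) \<partial>lborel)"
  proof (subst nn_integral_cmult[symmetric], measurable, intro nn_integral_cong)
    fix h :: real
    have "c * (c * h) powr (a - 1) = c powr a * h powr (a - 1)" if "h > 0"
      using c that by (simp add: powr_mult powr_diff)
    then have "h > 0 \<Longrightarrow> ennreal c * ennreal ((c * h) powr (a - 1)) = ennreal (c powr a) * ennreal (h powr (a - 1))"
      using c by (simp add: ennreal_mult[symmetric])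
    then show "ennreal c * (f (c * h) * ennreal ((c * h) powr (a - 1)) * indicator {0<..} (c * h))
      = ennreal (c powr a) * (f (c * h) * ennreal (h powr (a - 1)) * indicator {0<..} h)"
      using c by (cases "h > 0") (simp_all add: zero_less_mult_iff mult_ac, metis mult.left_commute)
  qed
  also have "\<dots> = ennreal (c powr a) * radial a (\<lambda>h. f (c * h))"
    unfolding radial_def by (rule nn_integral_cmult) measurable
  finally show ?thesis by simp
qed

lemma omega_pos: "q > 0 \<Longrightarrow> omega q > 0"
  by (simp add: omega_def)

lemma omega_Gamma: "q > 0 \<Longrightarrow> omega q = 2 * pi powr (q / 2) / Gamma (q / 2)"
proof -
  assume q: "q > 0"
  then have "q / 2 \<notin> \<int>\<^sub>\<le>\<^sub>0" by (auto dest: nonpos_Ints_nonpos)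
  then have G: "Gamma (q / 2 + 1) = q / 2 * Gamma (q / 2)" by (rule Gamma_plus1)
  show ?thesis using q unfolding omega_def unit_ball_vol_def G by simp
qed

abbreviation gaussr :: "real \<Rightarrow> ennreal" where
  "gaussr h \<equiv> ennreal (exp (- pi * h\<^sup>2))"

text \<open>This is the sense in which \<open>omega a\<close> is the surface area of the unit sphere
  in real dimension \<open>a\<close>: with this factor the Gaussian has mass 1.\<close>

lemma radial_gaussr:
  assumes "a > 0"
  shows "radial a gaussr = ennreal (1 / omega a)"
proof -
  have "radial a gaussr = (\<integral>\<^sup>+h. ennreal (h powr (a - 1) * exp (- pi * h\<^sup>2)) * indicator {0<..} h \<partial>lborel)"
    unfolding radial_def by (intro nn_integral_cong) (simp add: ennreal_mult mult_ac)
  also have "\<dots> = ennreal (pi powr (- a / 2) * Gamma (a / 2) / 2)"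
    by (rule nn_integral_gauss_powr[OF assms])
  also have "pi powr (- a / 2) * Gamma (a / 2) / 2 = 1 / omega a"
    using assms by (simp add: omega_Gamma powr_minus field_simps)
  finally show ?thesis .
qed

text \<open>
  The double integral of \<open>f |x| g (r |x|)\<close> over \<open>x\<close> and \<open>r\<close>, evaluated in both orders. The
  inversion \<open>r \<mapsto> 1/r\<close> that remains is removed by comparison with the one-dimensional case.
\<close>

lemma homogeneous_integral_aux:
  fixes M :: "'a::euclidean_space measure" and F :: "'a \<Rightarrow> ennreal"
  assumes M: "sets M = sets borel" "sigma_finite_measure M" "AE x in M. x \<noteq> 0"
    and scale: "\<And>r f. r > 0 \<Longrightarrow> f \<in> borel_measurable borel \<Longrightarrow>
      ennreal (r powr m) * (\<integral>\<^sup>+x. f (r *\<^sub>R x) \<partial>M) = (\<integral>\<^sup>+x. f x \<partial>M)"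
    and F: "F \<in> borel_measurable borel" "\<And>r x. r > 0 \<Longrightarrow> F (r *\<^sub>R x) = ennreal (r powr p) * F x"
    and f: "f \<in> borel_measurable borel" and g: "g \<in> borel_measurable borel" and a: "a = m + p"
  shows "(\<integral>\<^sup>+x. f (norm x) * F x \<partial>M) * radial a g
    = (\<integral>\<^sup>+r. ennreal (r powr (- a - 1)) * f (1 / r) * indicator {0<..} r \<partial>lborel) * (\<integral>\<^sup>+x. g (norm x) * F x \<partial>M)"
proof -
  note [measurable] = F(1) f g
  note [measurable_cong] = M(1)
  interpret M: sigma_finite_measure M by (rule M(2))
  define T where "T = (\<integral>\<^sup>+r. ennreal (r powr (- a - 1)) * f (1 / r) * indicator {0<..} r \<partial>lborel)"
  define K where "K = (\<lambda>r x. f (norm x / r) * F x * ennreal (norm x powr a) * g (norm x)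
      * ennreal (r powr (- a - 1)) * indicator {0<..} r)"
  have [measurable]: "case_prod K \<in> borel_measurable (borel \<Otimes>\<^sub>M borel)"
    unfolding K_def by measurable
  have "(\<integral>\<^sup>+x. f (norm x) * F x \<partial>M) * radial a g = (\<integral>\<^sup>+x. f (norm x) * F x * radial a g \<partial>M)"
    by (subst nn_integral_multc) auto
  also have "\<dots> = (\<integral>\<^sup>+x. (\<integral>\<^sup>+r. f (norm x) * F x * ennreal (norm x powr a) * g (norm x * r)
      * ennreal (r powr (a - 1)) * indicator {0<..} r \<partial>lborel) \<partial>M)"
  proof (rule nn_integral_cong_AE, rule AE_mp[OF M(3)], intro AE_I2 impI)
    fix x :: 'a assume "x \<noteq> 0"
    then have eq: "radial a g = ennreal (norm x powr a) * radial a (\<lambda>h. g (norm x * h))"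
      by (intro radial_scale[symmetric]) auto
    show "f (norm x) * F x * radial a g = (\<integral>\<^sup>+r. f (norm x) * F x * ennreal (norm x powr a) * g (norm x * r)
      * ennreal (r powr (a - 1)) * indicator {0<..} r \<partial>lborel)"
      by (subst eq) (simp add: radial_def nn_integral_cmult[symmetric] mult_ac)
  qed
  also have "\<dots> = (\<integral>\<^sup>+r. \<integral>\<^sup>+x. f (norm x) * F x * ennreal (norm x powr a) * g (norm x * r)
      * ennreal (r powr (a - 1)) * indicator {0<..} r \<partial>M \<partial>lborel)"
    by (rule nn_integral_swap[OF M(2) lborel.sigma_finite_measure_axioms]) measurable
  also have "\<dots> = (\<integral>\<^sup>+r. \<integral>\<^sup>+x. K r x \<partial>M \<partial>lborel)"
  proof (rule nn_integral_cong)
    fix r :: real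
    show "(\<integral>\<^sup>+x. f (norm x) * F x * ennreal (norm x powr a) * g (norm x * r)
      * ennreal (r powr (a - 1)) * indicator {0<..} r \<partial>M) = (\<integral>\<^sup>+x. K r x \<partial>M)"
    proof (cases "r > 0")
      case True
      \<comment> \<open>Replacing \<open>x\<close> by \<open>r *\<^sub>R x\<close> produces
        \<open>r powr m\<close> from \<open>M\<close>, \<open>r powr p\<close> from \<open>F\<close>
        and \<open>r powr a\<close> from the norm; since \<open>m + p = a\<close>, the power left
        over from \<open>r powr (a - 1)\<close> is \<open>- a - 1\<close>.\<close>
      have "f (norm x) * F x * ennreal (norm x powr a) * g (norm x * r) * ennreal (r powr (a - 1)) * indicator {0<..} r
        = ennreal (r powr m) * K r (r *\<^sub>R x)" for x
      proof -
        have "r powr (a - 1) = r powr (m + p + a + (- a - 1))" by (simp add: a algebra_simps)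
        also have "\<dots> = r powr m * r powr p * r powr a * r powr (- a - 1)"
          by (simp only: powr_add)
        finally have "ennreal (r powr (a - 1)) = ennreal (r powr m) * ennreal (r powr p) * ennreal (r powr a) * ennreal (r powr (- a - 1))"
          by (simp add: ennreal_mult[symmetric])
        moreover have "ennreal ((r * norm x) powr a) = ennreal (r powr a) * ennreal (norm x powr a)"
          using True by (simp add: powr_mult ennreal_mult)
        ultimately show ?thesis using True by (simp add: K_def F(2) mult_ac)
      qed
      then have "(\<integral>\<^sup>+x. f (norm x) * F x * ennreal (norm x powr a) * g (norm x * r)
        * ennreal (r powr (a - 1)) * indicator {0<..} r \<partial>M) = ennreal (r powr m) * (\<integral>\<^sup>+x. K r (r *\<^sub>R x) \<partial>M)"
        by (simp add: nn_integral_cmult)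
      also have "\<dots> = (\<integral>\<^sup>+x. K r x \<partial>M)" by (rule scale[OF True]) measurable
      finally show ?thesis .
    qed (simp add: K_def)
  qed
  also have "\<dots> = (\<integral>\<^sup>+x. \<integral>\<^sup>+r. K r x \<partial>lborel \<partial>M)"
    by (rule nn_integral_swap[OF lborel.sigma_finite_measure_axioms M(2)]) measurable
  also have "\<dots> = (\<integral>\<^sup>+x. T * (g (norm x) * F x) \<partial>M)"
  proof (rule nn_integral_cong_AE, rule AE_mp[OF M(3)], intro AE_I2 impI)
    fix x :: 'a assume "x \<noteq> 0"
    define c where "c = norm x"
    have c: "c > 0" using \<open>x \<noteq> 0\<close> by (simp add: c_def)
    have "(\<integral>\<^sup>+r. f (c / r) * ennreal (r powr (- a - 1)) * indicator {0<..} r \<partial>lborel)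
      = ennreal c * (\<integral>\<^sup>+r. f (c / (c * r)) * ennreal ((c * r) powr (- a - 1)) * indicator {0<..} (c * r) \<partial>lborel)"
      using c by (subst nn_integral_real_affine[where c=c and t=0]) simp_all
    also have "\<dots> = (\<integral>\<^sup>+r. ennreal (c powr (- a)) * (ennreal (r powr (- a - 1)) * f (1 / r) * indicator {0<..} r) \<partial>lborel)"
    proof (subst nn_integral_cmult[symmetric], measurable, intro nn_integral_cong)
      fix r :: real
      have "c * (c * r) powr (- a - 1) = c powr (- a) * r powr (- a - 1)" if "r > 0"
        using c that by (simp add: powr_mult powr_diff)
      then have "r > 0 \<Longrightarrow> ennreal c * ennreal ((c * r) powr (- a - 1)) = ennreal (c powr (- a)) * ennreal (r powr (- a - 1))"
        using c by (simp add: ennreal_mult[symmetric])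
      then show "ennreal c * (f (c / (c * r)) * ennreal ((c * r) powr (- a - 1)) * indicator {0<..} (c * r))
        = ennreal (c powr (- a)) * (ennreal (r powr (- a - 1)) * f (1 / r) * indicator {0<..} r)"
        using c by (cases "r > 0") (simp_all add: zero_less_mult_iff mult_ac, metis mult.left_commute)
    qed
    also have "\<dots> = ennreal (c powr (- a)) * T"
      unfolding T_def by (rule nn_integral_cmult) measurable
    finally have 1: "(\<integral>\<^sup>+r. f (c / r) * ennreal (r powr (- a - 1)) * indicator {0<..} r \<partial>lborel) = ennreal (c powr (- a)) * T" .
    have "(\<integral>\<^sup>+r. K r x \<partial>lborel) = F x * ennreal (c powr a) * g c * (\<integral>\<^sup>+r. f (c / r) * ennreal (r powr (- a - 1)) * indicator {0<..} r \<partial>lborel)"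
      unfolding K_def c_def[symmetric] by (subst nn_integral_cmult[symmetric], measurable) (simp add: mult_ac)
    also have "\<dots> = (ennreal (c powr a) * ennreal (c powr (- a))) * (T * (g c * F x))"
      unfolding 1 by (simp only: mult_ac)
    also have "ennreal (c powr a) * ennreal (c powr (- a)) = 1"
      using c by (simp add: ennreal_mult[symmetric] powr_add[symmetric])
    finally show "(\<integral>\<^sup>+r. K r x \<partial>lborel) = T * (g (norm x) * F x)" by (simp add: c_def)
  qed
  also have "\<dots> = T * (\<integral>\<^sup>+x. g (norm x) * F x \<partial>M)" by (rule nn_integral_cmult) measurable
  finally show ?thesis by (simp add: T_def)
qed

text \<open>On the real line the function \<open>x powr (a - 1)\<close>, cut off to positive
  \<open>x\<close>, is homogeneous of degree \<open>a - 1\<close>, and integrals against it are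
  themselves \<open>radial a\<close>. With a Gaussian as second profile both sides carry the same
  finite nonzero factor.\<close>

lemma radial_inversion:
  assumes a: "a > 0" and f [measurable]: "f \<in> borel_measurable borel"
  shows "(\<integral>\<^sup>+r. ennreal (r powr (- a - 1)) * f (1 / r) * indicator {0<..} r \<partial>lborel) = radial a f"
proof -
  define F where "F = (\<lambda>x::real. ennreal (x powr (a - 1)) * indicator {0<..} x)"
  have rad: "(\<integral>\<^sup>+x. g (norm x) * F x \<partial>lborel) = radial a g" for g
    unfolding radial_def F_def by (intro nn_integral_cong) (auto simp: indicator_def)
  have "(\<integral>\<^sup>+x. f (norm x) * F x \<partial>lborel) * radial a gaussr
    = (\<integral>\<^sup>+r. ennreal (r powr (- a - 1)) * f (1 / r) * indicator {0<..} r \<partial>lborel) * (\<integral>\<^sup>+x. gaussr (norm x) * F x \<partial>lborel)"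
  proof (rule homogeneous_integral_aux[where m=1 and p="a - 1"])
    show "AE x in lborel. x \<noteq> (0::real)" by (rule AE_lborel_singleton)
    show "F (r *\<^sub>R x) = ennreal (r powr (a - 1)) * F x" if "r > 0" for r x
      using that by (cases "x > 0") (auto simp: F_def powr_mult ennreal_mult zero_less_mult_iff)
    show "ennreal (r powr 1) * (\<integral>\<^sup>+x. f (r *\<^sub>R x) \<partial>lborel) = (\<integral>\<^sup>+x. f x \<partial>lborel)"
      if "r > 0" "f \<in> borel_measurable borel" for r and f :: "real \<Rightarrow> ennreal"
      using that nn_integral_real_affine[of f r 0] by simp
  qed (auto simp: F_def lborel.sigma_finite_measure_axioms)
  then have "radial a f * ennreal (1 / omega a)
    = (\<integral>\<^sup>+r. ennreal (r powr (- a - 1)) * f (1 / r) * indicator {0<..} r \<partial>lborel) * ennreal (1 / omega a)"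
    by (simp only: rad[of f] rad[of gaussr] radial_gaussr[OF a])
  then have "radial a f * (ennreal (1 / omega a) * ennreal (omega a))
    = (\<integral>\<^sup>+r. ennreal (r powr (- a - 1)) * f (1 / r) * indicator {0<..} r \<partial>lborel) * (ennreal (1 / omega a) * ennreal (omega a))"
    by (simp only: mult.assoc[symmetric])
  moreover have "ennreal (1 / omega a) * ennreal (omega a) = 1"
    using omega_pos[OF a] by (simp add: ennreal_mult[symmetric])
  ultimately show ?thesis by simp
qed

text \<open>Scaling by 2 multiplies the mass of the origin by a factor greater than 1 and yet
  preserves it; comparison with the Gaussian shows that this mass is finite, so it is 0.\<close>

lemma AE_slb_nonzero:
  assumes U: "subspace U" "dim U > 0"
  shows "AE x in slb U. x \<noteq> 0"
proof -
  define c where "c = (\<integral>\<^sup>+x. indicator {0} x \<partial>slb U)"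
  have "c \<le> (\<integral>\<^sup>+x. gauss x \<partial>slb U)"
    unfolding c_def by (intro nn_integral_mono) (auto simp: indicator_def gauss_def)
  then have "c \<noteq> \<infinity>" by (auto simp: nn_integral_slb_gauss U top_unique)
  then obtain c' where c': "c = ennreal c'" "c' \<ge> 0" by (cases c) auto
  have "ennreal (2 ^ dim U) * (\<integral>\<^sup>+x. indicator {0} ((2::real) *\<^sub>R x) \<partial>slb U) = c"
    unfolding c_def by (rule nn_integral_slb_scale[OF U(1)]) auto
  moreover have "indicator {0} ((2::real) *\<^sub>R x) = (indicator {0} x :: ennreal)" for x :: 'a
    by (auto simp: indicator_def)
  ultimately have "ennreal (2 ^ dim U) * c = c" by (simp add: c_def)
  then have "2 ^ dim U * c' = c'" using c' by (simp add: ennreal_mult[symmetric])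
  moreover have "(2::real) ^ dim U > 1" using U(2) by (simp add: one_less_power)
  ultimately have "c' = 0" by auto
  then have "emeasure (slb U) {0} = 0" using c' by (simp add: c_def)
  then show ?thesis by (intro AE_I[of _ _ "{0}"]) auto
qed

text \<open>Polar coordinates without a measure on the sphere: the angular part of \<open>F\<close>
  is expressed by its Gaussian integral, and the radial part in effective dimension
  \<open>dim U + q\<close> takes over the profile \<open>f\<close>.\<close>

lemma nn_integral_slb_homogeneous:
  fixes F :: "'a::euclidean_space \<Rightarrow> ennreal"
  assumes U: "subspace U" "dim U > 0" and q: "real (dim U) + q > 0"
    and F: "F \<in> borel_measurable borel" "\<And>r x. r > 0 \<Longrightarrow> F (r *\<^sub>R x) = ennreal (r powr q) * F x"
    and f: "f \<in> borel_measurable borel"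
  shows "(\<integral>\<^sup>+x. f (norm x) * F x \<partial>slb U)
    = ennreal (omega (real (dim U) + q)) * radial (real (dim U) + q) f * (\<integral>\<^sup>+x. gauss x * F x \<partial>slb U)"
proof -
  let ?a = "real (dim U) + q"
  have "(\<integral>\<^sup>+x. f (norm x) * F x \<partial>slb U) * radial ?a gaussr
    = (\<integral>\<^sup>+r. ennreal (r powr (- ?a - 1)) * f (1 / r) * indicator {0<..} r \<partial>lborel) * (\<integral>\<^sup>+x. gaussr (norm x) * F x \<partial>slb U)"
    using U F f by (intro homogeneous_integral_aux[where m="real (dim U)" and p=q])
      (auto simp: sigma_finite_slb AE_slb_nonzero powr_realpow nn_integral_slb_scale)
  then have "(\<integral>\<^sup>+x. f (norm x) * F x \<partial>slb U) * ennreal (1 / omega ?a) = radial ?a f * (\<integral>\<^sup>+x. gauss x * F x \<partial>slb U)"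
    by (simp only: radial_inversion[OF q f] radial_gaussr[OF q] gauss_def)
  then have "ennreal (omega ?a) * ((\<integral>\<^sup>+x. f (norm x) * F x \<partial>slb U) * ennreal (1 / omega ?a))
     = ennreal (omega ?a) * (radial ?a f * (\<integral>\<^sup>+x. gauss x * F x \<partial>slb U))" by simp
  moreover have "ennreal (omega ?a) * (I * ennreal (1 / omega ?a)) = I" for I
    using omega_pos[OF q] by (simp add: mult.left_commute[of _ I] ennreal_mult[symmetric])
  ultimately show ?thesis by (simp add: mult.assoc)
qed

lemma nn_integral_slb_radial:
  assumes U: "subspace (U::'a::euclidean_space set)" "dim U > 0" and f: "f \<in> borel_measurable borel"
  shows "(\<integral>\<^sup>+x. f (norm x) \<partial>slb U) = ennreal (omega (dim U)) * radial (dim U) f"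
  using nn_integral_slb_homogeneous[OF U, of 0 "\<lambda>_. 1" f] U f by (simp add: nn_integral_slb_gauss)

lemma nn_integral_slb_cylinder:
  fixes g :: "'a::euclidean_space \<Rightarrow> real \<Rightarrow> ennreal"
  assumes X: "subspace X" and V: "subspace V" "V \<subseteq> X" and d: "dim V < dim X"
    and g: "case_prod g \<in> borel_measurable (borel \<Otimes>\<^sub>M borel)"
  shows "(\<integral>\<^sup>+z. g (proj V z) (norm (z - proj V z)) \<partial>slb X)
    = ennreal (omega (dim X - dim V)) * (\<integral>\<^sup>+v. radial (dim X - dim V) (g v) \<partial>slb V)"
proof -
  note [measurable] = g measurable_proj[OF V(1)]
  let ?U = "orth_in X V"
  have U: "subspace ?U" "dim ?U = dim X - dim V" "dim ?U > 0"
    using X V d by (auto simp: subspace_orth_in dim_orth_in)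
  interpret U: sigma_finite_measure "slb ?U" by (rule sigma_finite_slb[OF U(1)])
  have "(\<integral>\<^sup>+z. g (proj V z) (norm (z - proj V z)) \<partial>slb X)
    = (\<integral>\<^sup>+v. \<integral>\<^sup>+u. g (proj V (v + u)) (norm ((v + u) - proj V (v + u))) \<partial>slb ?U \<partial>slb V)"
    by (rule nn_integral_slb_split[OF X V]) measurable
  also have "\<dots> = (\<integral>\<^sup>+v. \<integral>\<^sup>+u. g v (norm u) \<partial>slb ?U \<partial>slb V)"
  proof (rule nn_integral_cong_AE, rule AE_mp[OF AE_slb[OF V(1)]], intro AE_I2 impI,
      rule nn_integral_cong_AE, rule AE_mp[OF AE_slb[OF U(1)]], intro AE_I2 impI)
    fix v u assume "v \<in> V" "u \<in> ?U"
    then have "proj V (v + u) = v" using V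
      by (intro proj_eqI) (auto simp: orth_in_def)
    then show "g (proj V (v + u)) (norm (v + u - proj V (v + u))) = g v (norm u)" by simp
  qed
  also have "\<dots> = (\<integral>\<^sup>+v. ennreal (omega (dim X - dim V)) * radial (dim X - dim V) (g v) \<partial>slb V)"
    by (intro nn_integral_cong, subst nn_integral_slb_radial[OF U(1,3)]) (simp_all add: U)
  also have "\<dots> = ennreal (omega (dim X - dim V)) * (\<integral>\<^sup>+v. radial (dim X - dim V) (g v) \<partial>slb V)"
    unfolding radial_def by (rule nn_integral_cmult) measurable
  finally show ?thesis .
qed

text \<open>If an integrand depends only on the projection to \<open>V\<close> and the distance from
  \<open>V\<close>, the ambient space enters only through the sphere constant and the power of the
  distance in cylindrical coordinates. Passing from \<open>X\<close> to \<open>W\<close> changes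
  exactly these two. This is one step of the linear Blaschke--Petkantschin formula.\<close>

lemma nn_integral_slb_restrict:
  fixes g :: "'a::euclidean_space \<Rightarrow> real \<Rightarrow> ennreal"
  assumes X: "subspace X" and W: "subspace W" "W \<subseteq> X" and V: "subspace V" "V \<subseteq> W"
    and d: "dim V < dim W"
    and g: "case_prod g \<in> borel_measurable (borel \<Otimes>\<^sub>M borel)"
  shows "(\<integral>\<^sup>+z. g (proj V z) (norm (z - proj V z)) \<partial>slb X)
    = ennreal (omega (dim X - dim V) / omega (dim W - dim V))
      * (\<integral>\<^sup>+z. g (proj V z) (norm (z - proj V z)) * ennreal (norm (z - proj V z) ^ (dim X - dim W)) \<partial>slb W)"
proof -
  note [measurable] = g
  have dW: "dim W \<le> dim X" using W by (simp add: dim_subset)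
  have rad: "radial (dim W - dim V) (\<lambda>h. g v h * ennreal (h ^ (dim X - dim W))) = radial (dim X - dim V) (g v)" for v
    unfolding radial_def
  proof (intro nn_integral_cong)
    fix h :: real
    have "h ^ (dim X - dim W) * h powr (real (dim W - dim V) - 1) = h powr (real (dim X - dim V) - 1)" if "h > 0"
    proof -
      have "real (dim X - dim V) - 1 = real (dim X - dim W) + (real (dim W - dim V) - 1)"
        using dW d by simp
      then show ?thesis using that by (simp only: powr_add powr_realpow)
    qed
    then have "h > 0 \<Longrightarrow> ennreal (h ^ (dim X - dim W)) * ennreal (h powr (real (dim W - dim V) - 1))
       = ennreal (h powr (real (dim X - dim V) - 1))" by (simp add: ennreal_mult[symmetric])
    then show "g v h * ennreal (h ^ (dim X - dim W)) * ennreal (h powr (real (dim W - dim V) - 1)) * indicator {0<..} h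
      = g v h * ennreal (h powr (real (dim X - dim V) - 1)) * indicator {0<..} h"
      by (cases "h > 0") (simp_all add: mult.assoc)
  qed
  have 1: "omega (dim W - dim V) > 0" using d by (intro omega_pos) auto
  have 2: "omega (dim X - dim V) > 0" using d dW by (intro omega_pos) auto
  have "(\<integral>\<^sup>+z. g (proj V z) (norm (z - proj V z)) * ennreal (norm (z - proj V z) ^ (dim X - dim W)) \<partial>slb W)
     = ennreal (omega (dim W - dim V)) * (\<integral>\<^sup>+v. radial (dim X - dim V) (g v) \<partial>slb V)"
    unfolding rad[symmetric]
    by (rule nn_integral_slb_cylinder[OF W(1) V d, where g="\<lambda>v h. g v h * ennreal (h ^ (dim X - dim W))"]) measurable
  then have "ennreal (omega (dim X - dim V) / omega (dim W - dim V)) *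
      (\<integral>\<^sup>+z. g (proj V z) (norm (z - proj V z)) * ennreal (norm (z - proj V z) ^ (dim X - dim W)) \<partial>slb W)
     = ennreal (omega (dim X - dim V)) * (\<integral>\<^sup>+v. radial (dim X - dim V) (g v) \<partial>slb V)"
    using 1 2 by (simp add: mult.assoc[symmetric] ennreal_mult[symmetric])
  also have "\<dots> = (\<integral>\<^sup>+z. g (proj V z) (norm (z - proj V z)) \<partial>slb X)"
    using d dW V W by (intro nn_integral_slb_cylinder[symmetric] X V g) auto
  finally show ?thesis by simp
qed

text \<open>The Gaussian splits by Pythagoras into a part along \<open>V\<close>, which integrates
  to 1, and a radial part across \<open>V\<close>, where the factor \<open>h powr q\<close> raises
  the effective dimension by \<open>q\<close>.\<close>

lemma nn_integral_slb_gauss_dist: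
  assumes X: "subspace X" and V: "subspace V" "V \<subseteq> X" and d: "dim V < dim X" and q: "real (dim X - dim V) + q > 0"
  shows "(\<integral>\<^sup>+z. gauss z * ennreal (norm (z - proj V z) powr q) \<partial>slb X)
    = ennreal (omega (dim X - dim V) / omega (real (dim X - dim V) + q))"
proof -
  let ?m = "dim X - dim V"
  have 1: "omega ?m > 0" using d by (intro omega_pos) auto
  have 2: "omega (real ?m + q) > 0" using q by (rule omega_pos)
  have rad: "radial ?m (\<lambda>h. gaussr h * ennreal (h powr q)) = ennreal (1 / omega (real ?m + q))"
  proof -
    have "radial ?m (\<lambda>h. gaussr h * ennreal (h powr q)) = radial (real ?m + q) gaussr"
      unfolding radial_def
    proof (intro nn_integral_cong)
      fix h :: real
      have "h powr q * h powr (real ?m - 1) = h powr (real ?m + q - 1)"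
        by (simp add: powr_add[symmetric] algebra_simps)
      then have "ennreal (h powr q) * ennreal (h powr (real ?m - 1)) = ennreal (h powr (real ?m + q - 1))"
        by (simp add: ennreal_mult[symmetric])
      then show "gaussr h * ennreal (h powr q) * ennreal (h powr (real ?m - 1)) * indicator {0<..} h
        = gaussr h * ennreal (h powr (real ?m + q - 1)) * indicator {0<..} h"
        by (simp add: mult.assoc)
    qed
    then show ?thesis by (simp only: radial_gaussr[OF q])
  qed
  have "(\<integral>\<^sup>+z. gauss z * ennreal (norm (z - proj V z) powr q) \<partial>slb X)
     = (\<integral>\<^sup>+z. gauss (proj V z) * (gaussr (norm (z - proj V z)) * ennreal (norm (z - proj V z) powr q)) \<partial>slb X)"
  proof (intro nn_integral_cong)
    fix z :: 'a
    have "gauss z = gauss (proj V z) * gaussr (norm (z - proj V z))"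
      by (subst gauss_def, subst norm_proj_Pythagoras[OF V(1)])
        (simp add: gauss_def ennreal_mult[symmetric] exp_add[symmetric] algebra_simps)
    then show "gauss z * ennreal (norm (z - proj V z) powr q) = gauss (proj V z) * (gaussr (norm (z - proj V z)) * ennreal (norm (z - proj V z) powr q))"
      by (simp only: mult.assoc)
  qed
  also have "\<dots> = ennreal (omega ?m) * (\<integral>\<^sup>+v. radial ?m (\<lambda>h. gauss v * (gaussr h * ennreal (h powr q))) \<partial>slb V)"
    by (rule nn_integral_slb_cylinder[OF X V d, where g="\<lambda>v h. gauss v * (gaussr h * ennreal (h powr q))"]) measurable
  also have "(\<lambda>v::'a. radial ?m (\<lambda>h. gauss v * (gaussr h * ennreal (h powr q)))) = (\<lambda>v. gauss v * ennreal (1 / omega (real ?m + q)))"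
    unfolding rad[symmetric] unfolding radial_def
    by (intro ext, subst nn_integral_cmult[symmetric], measurable) (simp add: mult.assoc)
  also have "(\<integral>\<^sup>+v. gauss v * ennreal (1 / omega (real ?m + q)) \<partial>slb V) = ennreal (1 / omega (real ?m + q))"
    by (subst nn_integral_multc) (auto simp: nn_integral_slb_gauss V)
  also have "ennreal (omega ?m) * ennreal (1 / omega (real ?m + q)) = ennreal (omega ?m / omega (real ?m + q))"
    using 1 2 by (simp add: ennreal_mult[symmetric])
  finally show ?thesis .
qed

text \<open>Change of variables in every factor of a finite product, with a weight per point and a
  constant \<open>c\<close> per factor. Used for shifts, scalings, isometries and, with genuine
  weights, for the projection \<open>fst\<close>. The restricted tuple is needed because points of
  product spaces are extensional.\<close>

lemma nn_integral_PiM_map: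
  fixes w :: "'a \<Rightarrow> ennreal" and w' :: "'b \<Rightarrow> ennreal"
  assumes M: "sigma_finite_measure M" and M': "sigma_finite_measure M'" and I: "finite I"
    and T: "T \<in> measurable M M'" and w: "w \<in> borel_measurable M" and w': "w' \<in> borel_measurable M'"
    and base: "\<And>g. g \<in> borel_measurable M' \<Longrightarrow> (\<integral>\<^sup>+x. w x * g (T x) \<partial>M) = c * (\<integral>\<^sup>+y. w' y * g y \<partial>M')"
    and G: "G \<in> borel_measurable (Pi\<^sub>M I (\<lambda>_. M'))"
  shows "(\<integral>\<^sup>+z. (\<Prod>i\<in>I. w (z i)) * G (\<lambda>i\<in>I. T (z i)) \<partial>Pi\<^sub>M I (\<lambda>_. M))
    = c ^ card I * (\<integral>\<^sup>+z. (\<Prod>i\<in>I. w' (z i)) * G z \<partial>Pi\<^sub>M I (\<lambda>_. M'))"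
  using I G
proof (induction I arbitrary: G rule: finite_induct)
  case empty
  have "(\<lambda>i. undefined) = (\<lambda>i\<in>{}. T (undefined i))" by (auto simp: fun_eq_iff)
  then show ?case by (simp add: PiM_empty nn_integral_count_space_finite)
next
  case (insert i I)
  note [measurable] = T w w' insert.prems
  interpret P: product_sigma_finite "\<lambda>_::'c. M" using M by (simp add: product_sigma_finite_def)
  interpret P': product_sigma_finite "\<lambda>_::'c. M'" using M' by (simp add: product_sigma_finite_def)
  interpret M: sigma_finite_measure M by (rule M)
  interpret M': sigma_finite_measure M' by (rule M')
  have ni: "i \<notin> I" by fact
  have prod_upd: "(\<Prod>j\<in>insert i I. v ((z(i := x)) j)) = v x * (\<Prod>j\<in>I. v (z j))"
    for v :: "'d \<Rightarrow> ennreal" and z x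
    using insert.hyps by (simp, intro arg_cong2[where f="(*)"] refl prod.cong) auto
  have restr: "(\<lambda>j\<in>insert i I. T ((z(i := x)) j)) = (\<lambda>j\<in>I. T (z j))(i := T x)" for z x
    using ni by (auto simp: fun_eq_iff)
  define H where "H = (\<lambda>Z. \<integral>\<^sup>+y. w' y * G (Z(i := y)) \<partial>M')"
  have [measurable]: "H \<in> borel_measurable (Pi\<^sub>M I (\<lambda>_. M'))" unfolding H_def by measurable
  have [measurable]: "(\<lambda>z. \<lambda>j\<in>J. T (z j)) \<in> measurable (Pi\<^sub>M J (\<lambda>_. M)) (Pi\<^sub>M J (\<lambda>_. M'))" for J :: "'c set"
    by measurable
  have "(\<integral>\<^sup>+z. (\<Prod>j\<in>insert i I. w (z j)) * G (\<lambda>j\<in>insert i I. T (z j)) \<partial>Pi\<^sub>M (insert i I) (\<lambda>_. M))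
     = (\<integral>\<^sup>+z. \<integral>\<^sup>+x. (\<Prod>j\<in>insert i I. w ((z(i := x)) j)) * G (\<lambda>j\<in>insert i I. T ((z(i := x)) j)) \<partial>M \<partial>Pi\<^sub>M I (\<lambda>_. M))"
    using insert.hyps by (intro P.product_nn_integral_insert) measurable
  also have "\<dots> = (\<integral>\<^sup>+z. \<integral>\<^sup>+x. w x * ((\<Prod>j\<in>I. w (z j)) * G ((\<lambda>j\<in>I. T (z j))(i := T x))) \<partial>M \<partial>Pi\<^sub>M I (\<lambda>_. M))"
    unfolding prod_upd restr by (simp only: mult.assoc)
  also have "\<dots> = (\<integral>\<^sup>+z. c * ((\<Prod>j\<in>I. w (z j)) * H (\<lambda>j\<in>I. T (z j))) \<partial>Pi\<^sub>M I (\<lambda>_. M))"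
  proof (rule nn_integral_cong)
    fix z assume z: "z \<in> space (Pi\<^sub>M I (\<lambda>_. M))"
    then have Z [measurable]: "(\<lambda>j\<in>I. T (z j)) \<in> space (Pi\<^sub>M I (\<lambda>_. M'))"
      using measurable_space[OF T] by (auto simp: space_PiM)
    have [measurable]: "(\<lambda>y. G ((\<lambda>j\<in>I. T (z j))(i := y))) \<in> borel_measurable M'"
      using Z by measurable
    have "(\<integral>\<^sup>+x. w x * ((\<Prod>j\<in>I. w (z j)) * G ((\<lambda>j\<in>I. T (z j))(i := T x))) \<partial>M)
      = c * (\<integral>\<^sup>+y. w' y * ((\<Prod>j\<in>I. w (z j)) * G ((\<lambda>j\<in>I. T (z j))(i := y))) \<partial>M')"
      by (rule base) measurable
    also have "(\<integral>\<^sup>+y. w' y * ((\<Prod>j\<in>I. w (z j)) * G ((\<lambda>j\<in>I. T (z j))(i := y))) \<partial>M')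
      = (\<Prod>j\<in>I. w (z j)) * H (\<lambda>j\<in>I. T (z j))"
      unfolding H_def by (subst nn_integral_cmult[symmetric]) (auto simp: mult.left_commute)
    finally show "(\<integral>\<^sup>+x. w x * ((\<Prod>j\<in>I. w (z j)) * G ((\<lambda>j\<in>I. T (z j))(i := T x))) \<partial>M)
      = c * ((\<Prod>j\<in>I. w (z j)) * H (\<lambda>j\<in>I. T (z j)))" .
  qed
  also have "\<dots> = c * (c ^ card I * (\<integral>\<^sup>+Z. (\<Prod>j\<in>I. w' (Z j)) * H Z \<partial>Pi\<^sub>M I (\<lambda>_. M')))"
    by (subst nn_integral_cmult, measurable) (simp add: insert.IH)
  also have "(\<integral>\<^sup>+Z. (\<Prod>j\<in>I. w' (Z j)) * H Z \<partial>Pi\<^sub>M I (\<lambda>_. M'))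
     = (\<integral>\<^sup>+Z. \<integral>\<^sup>+y. (\<Prod>j\<in>insert i I. w' ((Z(i := y)) j)) * G (Z(i := y)) \<partial>M' \<partial>Pi\<^sub>M I (\<lambda>_. M'))"
    unfolding H_def prod_upd
    by (intro nn_integral_cong, subst nn_integral_cmult[symmetric], measurable) (simp add: mult_ac)
  also have "\<dots> = (\<integral>\<^sup>+Z. (\<Prod>j\<in>insert i I. w' (Z j)) * G Z \<partial>Pi\<^sub>M (insert i I) (\<lambda>_. M'))"
    using insert.hyps by (intro P'.product_nn_integral_insert[symmetric]) measurable
  finally show ?case using insert.hyps by (simp add: mult.assoc)
qed

text \<open>The exceptional set for one coordinate lies in a box with one null side; the product of
  the side measures is 0 even if other sides have infinite measure.\<close>

lemma AE_PiM_all: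
  assumes M: "sigma_finite_measure M" and I: "finite I" and P: "AE x in M. P x"
  shows "AE z in Pi\<^sub>M I (\<lambda>_. M). \<forall>i\<in>I. P (z i)"
proof -
  interpret PM: product_sigma_finite "\<lambda>_::'b. M" using M by (simp add: product_sigma_finite_def)
  obtain N where N: "{x \<in> space M. \<not> P x} \<subseteq> N" "emeasure M N = 0" "N \<in> sets M"
    using P by (auto elim: AE_E)
  have "AE z in Pi\<^sub>M I (\<lambda>_. M). P (z i)" if "i \<in> I" for i
  proof (rule AE_I)
    let ?B = "Pi\<^sub>E I (\<lambda>j. if j = i then N else space M)"
    show "{z \<in> space (Pi\<^sub>M I (\<lambda>_. M)). \<not> P (z i)} \<subseteq> ?B"
      using N(1) that by (auto simp: space_PiM PiE_iff extensional_def)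
    have "emeasure (Pi\<^sub>M I (\<lambda>_. M)) ?B = (\<Prod>j\<in>I. emeasure M (if j = i then N else space M))"
      using N(3) by (intro PM.emeasure_PiM I) auto
    also have "\<dots> = 0" using that I N(2) by (auto intro!: prod_zero)
    finally show "emeasure (Pi\<^sub>M I (\<lambda>_. M)) ?B = 0" .
    show "?B \<in> sets (Pi\<^sub>M I (\<lambda>_. M))" using N(3) I by (intro sets_PiM_I_finite) auto
  qed
  then show ?thesis using I by (simp add: AE_finite_all)
qed

lemma AE_PiM_slb:
  "subspace W \<Longrightarrow> finite I \<Longrightarrow> AE z in Pi\<^sub>M I (\<lambda>_. slb W). \<forall>i\<in>I. z i \<in> W"
  by (intro AE_PiM_all sigma_finite_slb AE_slb)

lemma nn_integral_beta_square:
  assumes "a > 0" "b > 0"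
  shows "(\<integral>\<^sup>+h. ennreal (h powr (a - 1) * (1 - h\<^sup>2) powr (b - 1)) * indicator {0<..<1} h \<partial>lborel)
    = ennreal (Beta (a / 2) b / 2)"
proof -
  have "((\<lambda>t. t powr (a / 2 - 1) * (1 - t) powr (b - 1)) has_integral Beta (a / 2) b) {0..1}"
    using assms by (intro has_integral_Beta_real) auto
  then have "(\<integral>\<^sup>+t. ennreal (t powr (a / 2 - 1) * (1 - t) powr (b - 1)) * indicator {0..1} t \<partial>lborel)
    = ennreal (Beta (a / 2) b)"
    using nn_integral_has_integral_lebesgue[of "{0..1}" "\<lambda>t. t powr (a / 2 - 1) * (1 - t) powr (b - 1)"]
    by (simp add: ennreal_indicator ennreal_mult' mult.commute mult_ac)
  also have "(\<integral>\<^sup>+t. ennreal (t powr (a / 2 - 1) * (1 - t) powr (b - 1)) * indicator {0..1} t \<partial>lborel)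
    = (\<integral>\<^sup>+t. (ennreal (t powr (a / 2 - 1) * (1 - t) powr (b - 1)) * indicator {..1} t) * indicator {0..} t \<partial>lborel)"
    by (intro nn_integral_cong) (auto simp: indicator_def)
  also have "\<dots> = (\<integral>\<^sup>+h. (ennreal ((h\<^sup>2) powr (a / 2 - 1) * (1 - h\<^sup>2) powr (b - 1)) * indicator {..1} (h\<^sup>2)) * ennreal (2 * h) * indicator {0..} h \<partial>lborel)"
    by (subst nn_integral_square_subst) simp_all
  also have "\<dots> = (\<integral>\<^sup>+h. 2 * (ennreal (h powr (a - 1) * (1 - h\<^sup>2) powr (b - 1)) * indicator {0<..<1} h) \<partial>lborel)"
  proof (intro nn_integral_cong)
    fix h :: real
    consider "h \<le> 0" | "h > 1" | "h = 1" | "0 < h" "h < 1" by linarith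
    then show "(ennreal ((h\<^sup>2) powr (a / 2 - 1) * (1 - h\<^sup>2) powr (b - 1)) * indicator {..1} (h\<^sup>2)) * ennreal (2 * h) * indicator {0..} h
      = 2 * (ennreal (h powr (a - 1) * (1 - h\<^sup>2) powr (b - 1)) * indicator {0<..<1} h)"
    proof cases
      case 1 then show ?thesis by (cases "h = 0") (auto simp: indicator_def)
    next
      case 2
      then have "h\<^sup>2 > 1" by (simp add: one_less_power)
      then have "h\<^sup>2 \<notin> {..1}" by (metis atMost_iff not_le)
      then have "indicator {..1} (h\<^sup>2) = (0 :: ennreal)" by (rule indicator_simps)
      moreover have "indicator {0<..<1} h = (0 :: ennreal)" using 2 by simp
      ultimately show ?thesis by (simp only: mult_zero_left mult_zero_right)
    next
      case 3 then show ?thesis by simp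
    next
      case 4
      have h2: "h\<^sup>2 \<le> 1" using 4 by (simp add: power_le_one)
      have "(h\<^sup>2) powr (a / 2 - 1) * h = (h powr 2) powr (a / 2 - 1) * h powr 1"
        using 4 by (simp add: powr_numeral)
      also have "\<dots> = h powr (2 * (a / 2 - 1)) * h powr 1" by (simp only: powr_powr)
      also have "\<dots> = h powr (a - 1)" unfolding powr_add[symmetric] by simp
      finally have "(h\<^sup>2) powr (a / 2 - 1) * (1 - h\<^sup>2) powr (b - 1) * (2 * h) = 2 * (h powr (a - 1) * (1 - h\<^sup>2) powr (b - 1))"
        by (simp add: mult_ac)
      then show ?thesis using 4 h2
        by (simp add: ennreal_mult[symmetric] ennreal_numeral[symmetric] del: ennreal_numeral)
    qed
  qed
  also have "\<dots> = 2 * (\<integral>\<^sup>+h. ennreal (h powr (a - 1) * (1 - h\<^sup>2) powr (b - 1)) * indicator {0<..<1} h \<partial>lborel)"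
    by (rule nn_integral_cmult) measurable
  finally have *: "2 * (\<integral>\<^sup>+h. ennreal (h powr (a - 1) * (1 - h\<^sup>2) powr (b - 1)) * indicator {0<..<1} h \<partial>lborel)
     = ennreal (Beta (a / 2) b)" (is "2 * ?I = _") .
  have "ennreal (1/2) * ennreal 2 = 1" by (subst ennreal_mult[symmetric]) auto
  then have "?I = (ennreal (1/2) * 2) * ?I" by (simp only: ennreal_numeral mult_1)
  also have "\<dots> = ennreal (1/2) * ennreal (Beta (a / 2) b)" by (simp only: mult.assoc *)
  also have "\<dots> = ennreal (Beta (a / 2) b / 2)"
    using assms by (subst ennreal_mult[symmetric]) (simp_all add: Beta_def Gamma_real_pos less_imp_le)
  finally show ?thesis .
qed

section \<open>Moments of random simplices in the unit ball\<close>

abbreviation edges :: "nat \<Rightarrow> (nat \<Rightarrow> 'a::real_vector) \<Rightarrow> nat \<Rightarrow> 'a" where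
  "edges k z \<equiv> (\<lambda>i. z i - z k)"

text \<open>Evaluated at \<open>t = norm z ^ 2\<close>, this is the density on the open unit ball
  whose integral along a coordinate line is \<open>pi\<close> whenever the line meets that ball, so
  its projection to one dimension less is uniform.\<close>

definition arcsine_weight :: "real \<Rightarrow> ennreal" where
  "arcsine_weight t = ennreal ((1 - t) powr (- 1 / 2)) * indicator {..<1} t"

lemma measurable_arcsine_weight [measurable]: "arcsine_weight \<in> borel_measurable borel"
  unfolding arcsine_weight_def by measurable

text \<open>\<open>1 - (\<rho> ^ 2 * t + c)\<close> equals \<open>\<rho> ^ 2 * (1 - t)\<close>, and
  the exponent \<open>-1/2\<close> turns \<open>\<rho> ^ 2\<close> into \<open>1 / \<rho>\<close>.
  This rescales both the slice of the ball at a given height and the chord over a given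
  point.\<close>

lemma arcsine_weight_affine:
  assumes \<rho>: "\<rho> > 0" and \<rho>2: "\<rho>\<^sup>2 = 1 - c"
  shows "arcsine_weight (\<rho>\<^sup>2 * t + c) = ennreal (1 / \<rho>) * arcsine_weight t"
proof -
  have lt: "\<rho>\<^sup>2 * t + c < 1 \<longleftrightarrow> t < 1"
  proof -
    have "\<rho>\<^sup>2 * t + c < 1 \<longleftrightarrow> \<rho>\<^sup>2 * t < \<rho>\<^sup>2 * 1" unfolding mult_1_right using \<rho>2 by linarith
    also have "\<dots> \<longleftrightarrow> t < 1" using \<rho> by (subst mult_less_cancel_left_pos) auto
    finally show ?thesis .
  qed
  have "(1 - (\<rho>\<^sup>2 * t + c)) powr (- 1 / 2) = (1 / \<rho>) * (1 - t) powr (- 1 / 2)" if "t < 1"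
  proof -
    have "1 - (\<rho>\<^sup>2 * t + c) = \<rho>\<^sup>2 * (1 - t)" by (simp add: \<rho>2 algebra_simps)
    moreover have "(\<rho>\<^sup>2) powr (- 1 / 2) = 1 / \<rho>"
      using \<rho> powr_half_sqrt[of "\<rho>\<^sup>2"] by (simp add: powr_minus inverse_eq_divide)
    ultimately show ?thesis using \<rho> that by (simp add: powr_mult)
  qed
  then show ?thesis using lt \<rho>
    by (cases "t < 1") (simp_all add: arcsine_weight_def ennreal_mult[symmetric])
qed

lemma measurable_PiM_slb_component [measurable (raw)]:
  "i \<in> I \<Longrightarrow> (\<lambda>z. z i) \<in> borel_measurable (Pi\<^sub>M I (\<lambda>_. slb X))"
  by (rule measurable_compose[OF measurable_component_singleton]) auto

lemma norm_perp_scale: "norm (perp y k (r *\<^sub>R x)) = \<bar>r\<bar> * norm (perp y k x)"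
  by (simp add: linear_scale[OF linear_perp])

text \<open>The points are integrated out beginning with the last. Each contributes its distance
  from the span of its predecessors, and by \<open>dist\<close> the result depends only on the
  dimension of that span, hence not on the predecessors.\<close>

lemma nn_integral_pvol_powr:
  fixes X :: "'a::euclidean_space set" and w :: "'a \<Rightarrow> ennreal"
  assumes X: "subspace X" and w [measurable]: "w \<in> borel_measurable borel"
    and dist: "\<And>V. subspace V \<Longrightarrow> V \<subseteq> X \<Longrightarrow> dim V < dim X \<Longrightarrow>
      (\<integral>\<^sup>+y. w y * ennreal (norm (y - proj V y) powr q) \<partial>slb X) = c (dim V)"
  shows "j \<le> dim X \<Longrightarrow> (\<integral>\<^sup>+z. (\<Prod>i<j. w (z i)) * ennreal (pvol j z powr q) \<partial>Pi\<^sub>M {..<j} (\<lambda>_. slb X))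
    = (\<Prod>i<j. c i)"
proof (induction j)
  case 0
  then show ?case by (simp add: PiM_empty nn_integral_count_space_finite)
next
  case (Suc j)
  interpret P: product_sigma_finite "\<lambda>_::nat. slb X" by (rule product_sigma_finite_slb[OF X])
  let ?P = "\<lambda>j. Pi\<^sub>M {..<j} (\<lambda>_::nat. slb X)"
  have "(\<integral>\<^sup>+z. (\<Prod>i<Suc j. w (z i)) * ennreal (pvol (Suc j) z powr q) \<partial>?P (Suc j))
    = (\<integral>\<^sup>+z. \<integral>\<^sup>+y. (\<Prod>i<Suc j. w ((z(j := y)) i)) * ennreal (pvol (Suc j) (z(j := y)) powr q) \<partial>slb X \<partial>?P j)"
    unfolding lessThan_Suc by (rule P.product_nn_integral_insert) (auto simp: lessThan_Suc[symmetric])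
  also have "\<dots> = (\<integral>\<^sup>+z. (\<Prod>i<j. w (z i)) * ennreal (pvol j z powr q) * c j \<partial>?P j)"
  proof (rule nn_integral_cong_AE, rule AE_mp[OF AE_PiM_slb[OF X]], simp, intro AE_I2 impI)
    fix z assume z: "z \<in> space (?P j)" "\<forall>i\<in>{..<j}. z i \<in> X"
    have "(\<Prod>i<Suc j. w ((z(j := y)) i)) * ennreal (pvol (Suc j) (z(j := y)) powr q)
       = (\<Prod>i<j. w (z i)) * ennreal (pvol j z powr q) * (w y * ennreal (norm (perp z j y) powr q))" for y
    proof -
      have "pvol j (z(j := y)) = pvol j z" "perp (z(j := y)) j y = perp z j y"
        by (auto intro!: pvol_cong perp_cong)
      then show ?thesis by (simp add: pvol_Suc powr_mult ennreal_mult mult_ac)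
    qed
    then have "(\<integral>\<^sup>+y. (\<Prod>i<Suc j. w ((z(j := y)) i)) * ennreal (pvol (Suc j) (z(j := y)) powr q) \<partial>slb X)
      = (\<Prod>i<j. w (z i)) * ennreal (pvol j z powr q) * (\<integral>\<^sup>+y. w y * ennreal (norm (perp z j y) powr q) \<partial>slb X)"
      by (simp add: nn_integral_cmult)
    also have "\<dots> = (\<Prod>i<j. w (z i)) * ennreal (pvol j z powr q) * c j"
    \<comment> \<open>Degenerate tuples contribute nothing on either side:
      \<open>0 powr q = 0\<close>, also for negative \<open>q\<close>.\<close>
    proof (cases "pvol j z = 0")
      case False
      then have pos: "pvol j z > 0" using pvol_nonneg[of j z] by linarith
      let ?V = "span (z ` {..<j})"
      have V: "?V \<subseteq> X" "dim ?V = j"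
      proof -
        have "z ` {..<j} \<subseteq> X" using z by auto
        then show "?V \<subseteq> X" by (rule span_minimal[OF _ X])
        show "dim ?V = j" by (rule dim_span_pvol[OF pos])
      qed
      then show ?thesis using dist[OF subspace_span V(1), unfolded V(2)] Suc.prems
        by (simp add: perp_eq_proj)
    qed simp
    finally show "(\<integral>\<^sup>+y. (\<Prod>i<Suc j. w ((z(j := y)) i)) * ennreal (pvol (Suc j) (z(j := y)) powr q) \<partial>slb X)
      = (\<Prod>i<j. w (z i)) * ennreal (pvol j z powr q) * c j" .
  qed
  also have "\<dots> = (\<integral>\<^sup>+z. (\<Prod>i<j. w (z i)) * ennreal (pvol j z powr q) \<partial>?P j) * c j"
    by (rule nn_integral_multc) measurable
  also have "\<dots> = (\<Prod>i<Suc j. c i)" using Suc by simp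
  finally show ?case .
qed

section \<open>Weighted points in a space of dimension k + 1\<close>

context
  fixes X :: "'a::euclidean_space set" and k :: nat and q :: real
  assumes X: "subspace X" and dimX: "dim X = Suc k" and q: "q > -1"
begin

lemma kq: "real k + q > -1"
  using q of_nat_0_le_iff[of k, where 'a=real] by linarith

lemma kq2: "0 < (real k + q) / 2 + 1"
proof -
  have "0 < x / 2 + 1" if "x > -1" for x :: real using that by linarith
  then show ?thesis using kq by blast
qed

private abbreviation "wt z \<equiv> arcsine_weight ((norm z)\<^sup>2)"
private abbreviation "PX \<equiv> \<lambda>I::nat set. Pi\<^sub>M I (\<lambda>_. slb X)"

text \<open>The factor by which an integral homogeneous of degree \<open>q\<close> over
  \<open>X\<close> grows when the Gaussian is replaced by the arcsine weight. For
  \<open>q = 0\<close> it is the mass of that weight: \<open>pi\<close> for every point of the unit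
  \<open>k\<close>-ball.\<close>

private definition "radmass = ennreal (pi * unit_ball_vol (real k + q))"

lemma radmass: "ennreal (omega (real (Suc k) + q)) * radial (real (Suc k) + q) (\<lambda>h. arcsine_weight (h\<^sup>2)) = radmass"
proof -
  let ?a = "real (Suc k) + q"
  have a: "?a > 0" using q by simp
  have "radial ?a (\<lambda>h. arcsine_weight (h\<^sup>2))
    = (\<integral>\<^sup>+h. ennreal (h powr (?a - 1) * (1 - h\<^sup>2) powr (1 / 2 - 1)) * indicator {0<..<1} h \<partial>lborel)"
    unfolding radial_def arcsine_weight_def
  proof (intro nn_integral_cong)
    fix h :: real
    have "h > 0 \<Longrightarrow> h\<^sup>2 < 1 \<longleftrightarrow> h < 1" by (simp add: power_less_one_iff)
    then show "ennreal ((1 - h\<^sup>2) powr (- 1 / 2)) * indicator {..<1} (h\<^sup>2) * ennreal (h powr (?a - 1)) * indicator {0<..} h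
      = ennreal (h powr (?a - 1) * (1 - h\<^sup>2) powr (1 / 2 - 1)) * indicator {0<..<1} h"
      by (auto simp: indicator_def ennreal_mult mult.commute)
  qed
  also have "\<dots> = ennreal (Beta (?a / 2) (1 / 2) / 2)" by (rule nn_integral_beta_square[OF a]) simp
  finally have 1: "radial ?a (\<lambda>h. arcsine_weight (h\<^sup>2)) = ennreal (Beta (?a / 2) (1 / 2) / 2)" .
  have g: "Gamma (?a / 2) > 0" using a by (intro Gamma_real_pos) simp
  have g2: "Gamma ((real k + q) / 2 + 1) > 0" by (intro Gamma_real_pos kq2)
  have e: "?a / 2 + 1 / 2 = (real k + q) / 2 + 1" by (simp add: field_simps)
  have "omega ?a * (Beta (?a / 2) (1 / 2) / 2) = pi powr (?a / 2) * sqrt pi / Gamma ((real k + q) / 2 + 1)"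
    using g unfolding omega_Gamma[OF a] Beta_def e by (simp add: Gamma_one_half_real)
  also have "pi powr (?a / 2) * sqrt pi = pi * pi powr ((real k + q) / 2)"
  proof -
    have "pi powr (?a / 2) * sqrt pi = pi powr (?a / 2 + 1 / 2)" by (simp add: powr_add powr_half_sqrt)
    also have "\<dots> = pi powr (1 + (real k + q) / 2)" unfolding e by (simp add: add.commute)
    also have "\<dots> = pi * pi powr ((real k + q) / 2)" by (simp add: powr_add)
    finally show ?thesis .
  qed
  finally have "omega ?a * (Beta (?a / 2) (1 / 2) / 2) = pi * unit_ball_vol (real k + q)"
    by (simp add: unit_ball_vol_def)
  moreover have "Beta (?a / 2) (1 / 2) / 2 \<ge> 0"
    unfolding Beta_def e using g g2 by (simp add: Gamma_one_half_real)
  ultimately show ?thesis unfolding 1 radmass_def using omega_pos[OF a]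
    by (simp only: ennreal_mult[symmetric] less_imp_le)
qed

text \<open>The \<open>q\<close>-th power of the distance from a subspace is homogeneous of degree
  \<open>q\<close>, so the arcsine weight may be exchanged for the Gaussian at the price
  \<open>radmass\<close>.\<close>

lemma weighted_dist_integral:
  assumes V: "subspace V" "V \<subseteq> X" "dim V < dim X"
  shows "(\<integral>\<^sup>+y. wt y * ennreal (norm (y - proj V y) powr q) \<partial>slb X)
    = radmass * ennreal (omega (Suc k - dim V) / omega (real (Suc k - dim V) + q))"
proof -
  have "real (dim X - dim V) \<ge> 1" using V(3) by linarith
  then have m: "real (dim X - dim V) + q > 0" using q by linarith
  note [measurable] = measurable_proj[OF V(1)]
  have "(\<integral>\<^sup>+y. wt y * ennreal (norm (y - proj V y) powr q) \<partial>slb X)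
     = ennreal (omega (real (dim X) + q)) * radial (real (dim X) + q) (\<lambda>h. arcsine_weight (h\<^sup>2))
      * (\<integral>\<^sup>+y. gauss y * ennreal (norm (y - proj V y) powr q) \<partial>slb X)"
  proof (rule nn_integral_slb_homogeneous[OF X, where f="\<lambda>h. arcsine_weight (h\<^sup>2)"])
    show "ennreal (norm (r *\<^sub>R x - proj V (r *\<^sub>R x)) powr q) = ennreal (r powr q) * ennreal (norm (x - proj V x) powr q)"
      if "r > 0" for r x
      using that by (simp add: proj_scaleR V(1) scaleR_right_diff_distrib[symmetric] powr_mult ennreal_mult)
  qed (use q dimX in auto)
  then show ?thesis
    unfolding nn_integral_slb_gauss_dist[OF X V m] unfolding dimX radmass .
qed

definition linear_moment :: ennreal where
  "linear_moment = (\<integral>\<^sup>+z. (\<Prod>i\<le>k. wt (z i)) * ennreal (pvol (Suc k) z powr q) \<partial>PX {..k})"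

definition affine_moment :: ennreal where
  "affine_moment = (\<integral>\<^sup>+z. (\<Prod>i\<le>k. wt (z i)) * ennreal (pvol k (edges k z) powr q) \<partial>PX {..k})"

text \<open>For a unit vector \<open>e\<close> the product of the two bases is the volume of the
  edges projected along \<open>e\<close>, by \<open>pvol_remove_line\<close>; the second one is the
  cosine between \<open>e\<close> and the normal of the edges in \<open>X\<close>.\<close>

definition projected_moment :: "'a \<Rightarrow> ennreal" where
  "projected_moment e = (\<integral>\<^sup>+z. (\<Prod>i\<le>k. wt (z i)) * ennreal (pvol k (edges k z) powr q)
     * ennreal (norm (perp (edges k z) k e) powr q) \<partial>PX {..k})"

lemma linear_moment_eq:
  "linear_moment = ennreal ((pi * unit_ball_vol (real k + q)) ^ Suc k
     * (\<Prod>j=1..Suc k. omega j / omega (real j + q)))"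
proof -
  have nn: "pi * unit_ball_vol (real k + q) \<ge> 0"
  proof -
    have "(real k + q) / 2 + 1 > 0" by (rule kq2)
    then show ?thesis unfolding unit_ball_vol_def by (simp add: Gamma_real_pos less_imp_le)
  qed
  have pos: "omega (real j) / omega (real j + q) \<ge> 0" if "j \<ge> 1" for j
    using that q omega_pos[of "real j"] omega_pos[of "real j + q"] by simp
  have "linear_moment = (\<Prod>i<Suc k. radmass * ennreal (omega (Suc k - i) / omega (real (Suc k - i) + q)))"
    unfolding linear_moment_def lessThan_Suc_atMost[symmetric]
    by (rule nn_integral_pvol_powr[OF X _ weighted_dist_integral]) (simp_all add: dimX)
  also have "\<dots> = radmass ^ Suc k * (\<Prod>i<Suc k. ennreal (omega (Suc k - i) / omega (real (Suc k - i) + q)))"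
    by (simp add: prod.distrib)
  also have "(\<Prod>i<Suc k. ennreal (omega (Suc k - i) / omega (real (Suc k - i) + q)))
     = (\<Prod>j=1..Suc k. ennreal (omega j / omega (real j + q)))"
    by (rule prod.reindex_bij_witness[of _ "\<lambda>j. Suc k - j" "\<lambda>i. Suc k - i"]) auto
  also have "\<dots> = ennreal (\<Prod>j=1..Suc k. omega j / omega (real j + q))"
    by (rule prod_ennreal) (rule pos, auto)
  also have "radmass ^ Suc k * \<dots> = ennreal ((pi * unit_ball_vol (real k + q)) ^ Suc k
     * (\<Prod>j=1..Suc k. omega j / omega (real j + q)))"
    unfolding radmass_def ennreal_power[OF nn]
    by (rule ennreal_mult[symmetric]) (auto intro!: zero_le_power nn prod_nonneg pos simp del: power_Suc prod.cl_ivl_Suc)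
  finally show ?thesis .
qed

text \<open>
  Condition on the directions \<open>y\<^sub>i = z\<^sub>i - z\<^sub>k\<close>: the hyperplane through the points has distance \<open>h\<close>
  from the origin, and rescaling it by \<open>sqrt (1 - h\<^sup>2)\<close> makes its shape independent of \<open>h\<close>.
\<close>

lemma height_decomposition:
  obtains C where "\<And>G. G \<in> borel_measurable borel \<Longrightarrow>
     (\<integral>\<^sup>+z. (\<Prod>i\<le>k. wt (z i)) * ennreal (pvol k (edges k z) powr q)
        * G (norm (perp (edges k z) k (z k))) \<partial>PX {..k})
     = C * (\<integral>\<^sup>+h. G h * ennreal ((1 - h\<^sup>2) powr ((real k * (real (Suc k) + q) - 1) / 2)) * indicator {0<..<1} h \<partial>lborel)"
proof -
  interpret P: product_sigma_finite "\<lambda>_::nat. slb X" by (rule product_sigma_finite_slb[OF X])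
  interpret SX: sigma_finite_measure "slb X" by (rule sigma_finite_slb[OF X])
  have sfk: "sigma_finite_measure (PX {..<k})" by (intro P.sigma_finite) simp
  interpret Pk: sigma_finite_measure "PX {..<k}" by (rule sfk)
  \<comment> \<open>Weight of a configuration in cylindrical coordinates: edges \<open>y\<close>,
    height \<open>h\<close> of the hyperplane over the origin, and position \<open>v\<close> of the
    base point inside it.\<close>
  define g where "g = (\<lambda>y h v. (\<Prod>i<k. arcsine_weight ((norm (y i + v :: 'a))\<^sup>2 + h\<^sup>2)) * arcsine_weight ((norm v)\<^sup>2 + h\<^sup>2))"
  have g_meas [measurable (raw)]: "(\<lambda>\<omega>. g (a \<omega>) (b \<omega>) (c \<omega>)) \<in> borel_measurable M"
    if [measurable]: "\<And>i. i < k \<Longrightarrow> (\<lambda>\<omega>. a \<omega> i) \<in> borel_measurable M" "b \<in> borel_measurable M" "c \<in> borel_measurable M"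
    for a b c and M :: "'m measure"
    unfolding g_def by measurable
  \<comment> \<open>The inner integral is the one over \<open>slb\<close> of the span of
    \<open>y\<close>, written out as an ambient Gaussian integral. In this form its measurability in
    \<open>y\<close> is evident, although the subspace varies with \<open>y\<close>.\<close>
  define B where "B = (\<lambda>h. \<integral>\<^sup>+y. ennreal (pvol k y powr q)
      * (\<integral>\<^sup>+x. gauss (perp y k x) * g y h (x - perp y k x) \<partial>lborel) \<partial>PX {..<k})"
  have Bmeas [measurable]: "B \<in> borel_measurable borel" unfolding B_def by measurable
  \<comment> \<open>Rescaling by \<open>\<rho> = sqrt (1 - h ^ 2)\<close> gives
    \<open>\<rho> ^ (k + 1)\<close> for each of the \<open>k\<close> edges,
    \<open>\<rho> powr (k * q)\<close> from the volume, \<open>\<rho> ^ k\<close> from the base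
    point and \<open>(1 / \<rho>) ^ (k + 1)\<close> from the weights. The total exponent of
    \<open>\<rho>\<close> is \<open>k * (k + 1 + q) - 1 = 2 * \<gamma>\<close>.\<close>
  define \<gamma> where "\<gamma> = (real k * (real (Suc k) + q) - 1) / 2"
  have inner: "(\<integral>\<^sup>+x. gauss (perp y k x) * g y h (x - perp y k x) \<partial>lborel) = (\<integral>\<^sup>+v. g y h v \<partial>slb (span (y ` {..<k})))" for y h
    by (subst nn_integral_slb) (simp_all add: perp_eq_proj)
  have Bscale: "B h = ennreal ((1 - h\<^sup>2) powr \<gamma>) * B 0" if h: "0 < h" "h < 1" for h
  proof -
    define \<rho> where "\<rho> = sqrt (1 - h\<^sup>2)"
    have "h\<^sup>2 < 1" using h by (simp add: power_less_one_iff)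
    then have \<rho>: "\<rho> > 0" and \<rho>2: "\<rho>\<^sup>2 = 1 - h\<^sup>2" by (auto simp: \<rho>_def)
    note w = arcsine_weight_affine[OF \<rho> \<rho>2]
    have gs: "g (\<lambda>i. \<rho> *\<^sub>R y i) h (\<rho> *\<^sub>R v) = ennreal ((1 / \<rho>) ^ Suc k) * g y 0 v" for y v
    proof -
      have n: "(norm (\<rho> *\<^sub>R u))\<^sup>2 = \<rho>\<^sup>2 * (norm u)\<^sup>2" for u :: 'a by (simp add: power_mult_distrib)
      have "g (\<lambda>i. \<rho> *\<^sub>R y i) h (\<rho> *\<^sub>R v) = (\<Prod>i<k. arcsine_weight (\<rho>\<^sup>2 * (norm (y i + v))\<^sup>2 + h\<^sup>2)) * arcsine_weight (\<rho>\<^sup>2 * (norm v)\<^sup>2 + h\<^sup>2)"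
        by (simp only: g_def n scaleR_add_right[symmetric])
      also have "\<dots> = ennreal (1 / \<rho>) ^ Suc k * g y 0 v"
        by (simp add: w g_def prod.distrib mult_ac)
      also have "ennreal (1 / \<rho>) ^ Suc k = ennreal ((1 / \<rho>) ^ Suc k)"
        using \<rho> by (intro ennreal_power) simp
      finally show ?thesis .
    qed
    define A where "A = (\<lambda>y. ennreal (pvol k y powr q) * (\<integral>\<^sup>+x. gauss (perp y k x) * g y h (x - perp y k x) \<partial>lborel))"
    have A_meas: "A \<in> borel_measurable (PX {..<k})" unfolding A_def by measurable
    have A_restrict: "A (\<lambda>i\<in>{..<k}. y i) = A y" for y
    proof -
      have "pvol k (\<lambda>i\<in>{..<k}. y i) = pvol k y" "perp (\<lambda>i\<in>{..<k}. y i) k x = perp y k x" for x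
        by (auto intro!: pvol_cong perp_cong)
      moreover have "g (\<lambda>i\<in>{..<k}. y i) h v = g y h v" for v by (simp add: g_def)
      ultimately show ?thesis by (simp add: A_def)
    qed
    have As: "A (\<lambda>i. \<rho> *\<^sub>R y i) = ennreal (\<rho> powr (real k * q + real k - real (Suc k))) *
        (ennreal (pvol k y powr q) * (\<integral>\<^sup>+x. gauss (perp y k x) * g y 0 (x - perp y k x) \<partial>lborel))" for y
    proof (cases "pvol k y = 0")
      case True then show ?thesis using \<rho> by (simp add: A_def pvol_scale)
    next
      case False
      then have pos: "pvol k y > 0" using pvol_nonneg[of k y] by linarith
      let ?L = "span (y ` {..<k})"
      have L: "span ((\<lambda>i. \<rho> *\<^sub>R y i) ` {..<k}) = ?L"
        using \<rho> span_image_scale[of "y ` {..<k}" "\<lambda>_. \<rho>"] by (simp add: image_image)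
      have "(\<integral>\<^sup>+v. g (\<lambda>i. \<rho> *\<^sub>R y i) h v \<partial>slb ?L) = ennreal (\<rho> ^ k) * (\<integral>\<^sup>+v. g (\<lambda>i. \<rho> *\<^sub>R y i) h (\<rho> *\<^sub>R v) \<partial>slb ?L)"
        using nn_integral_slb_scale[OF subspace_span \<rho>, of "g (\<lambda>i. \<rho> *\<^sub>R y i) h" "y ` {..<k}"] dim_span_pvol[OF pos]
        by simp
      also have "\<dots> = ennreal (\<rho> ^ k) * (ennreal ((1 / \<rho>) ^ Suc k) * (\<integral>\<^sup>+v. g y 0 v \<partial>slb ?L))"
        by (simp only: gs) (subst nn_integral_cmult, measurable)
      finally have 1: "(\<integral>\<^sup>+v. g (\<lambda>i. \<rho> *\<^sub>R y i) h v \<partial>slb ?L) = ennreal (\<rho> ^ k) * (ennreal ((1 / \<rho>) ^ Suc k) * (\<integral>\<^sup>+v. g y 0 v \<partial>slb ?L))" .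
      have 2: "pvol k (\<lambda>i. \<rho> *\<^sub>R y i) powr q = \<rho> powr (real k * q) * pvol k y powr q"
        using \<rho> by (simp add: pvol_scale powr_mult powr_powr powr_realpow[symmetric])
      have 3: "\<rho> powr (real k * q) * \<rho> ^ k * (1 / \<rho>) ^ Suc k = \<rho> powr (real k * q + real k - real (Suc k))"
        using \<rho> by (simp add: powr_diff powr_add powr_realpow power_one_over divide_inverse power_inverse del: power_Suc of_nat_Suc)
      have 4: "ennreal (\<rho> powr (real k * q)) * (ennreal (\<rho> ^ k) * ennreal ((1 / \<rho>) ^ Suc k)) = ennreal (\<rho> powr (real k * q + real k - real (Suc k)))"
        unfolding 3[symmetric] using \<rho> by (simp add: ennreal_mult mult.assoc del: power_Suc)
      show ?thesis
        unfolding A_def inner L 1 2 ennreal_mult[OF powr_ge_zero powr_ge_zero] 4[symmetric]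
        by (simp only: mult_ac)
    qed
    have "B h = (\<integral>\<^sup>+y. (\<Prod>i<k. 1) * A y \<partial>PX {..<k})" by (simp add: B_def A_def)
    also have "\<dots> = (\<integral>\<^sup>+y. (\<Prod>i<k. ennreal (\<rho> ^ Suc k)) * A (\<lambda>i\<in>{..<k}. \<rho> *\<^sub>R y i) \<partial>PX {..<k})"
    proof (subst nn_integral_PiM_map[where M="slb X" and M'="slb X" and I="{..<k}" and T="\<lambda>x. \<rho> *\<^sub>R x" and G=A
          and w="\<lambda>_. ennreal (\<rho> ^ Suc k)" and w'="\<lambda>_. 1" and c=1])
      show "(\<integral>\<^sup>+x. ennreal (\<rho> ^ Suc k) * f (\<rho> *\<^sub>R x) \<partial>slb X) = 1 * (\<integral>\<^sup>+y. 1 * f y \<partial>slb X)"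
        if "f \<in> borel_measurable (slb X)" for f
        using that nn_integral_slb_scale[OF X \<rho>, of f] dimX by (subst nn_integral_cmult) simp_all
    qed (auto intro!: A_meas sigma_finite_slb[OF X])
    also have "\<dots> = (\<integral>\<^sup>+y. ennreal ((1 - h\<^sup>2) powr \<gamma>) *
        (ennreal (pvol k y powr q) * (\<integral>\<^sup>+x. gauss (perp y k x) * g y 0 (x - perp y k x) \<partial>lborel)) \<partial>PX {..<k})"
    proof (rule nn_integral_cong)
      fix y
      have "(\<Prod>i<k. ennreal (\<rho> ^ Suc k)) * ennreal (\<rho> powr (real k * q + real k - real (Suc k))) = ennreal ((1 - h\<^sup>2) powr \<gamma>)"
      proof -
        have "(\<rho> ^ Suc k) ^ k = \<rho> powr (real (Suc k * k))"
          using \<rho> by (subst powr_realpow) (simp_all only: power_mult)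
        then have "(\<rho> ^ Suc k) ^ k * \<rho> powr (real k * q + real k - real (Suc k)) = \<rho> powr (real (Suc k * k) + (real k * q + real k - real (Suc k)))"
          by (simp only: powr_add)
        also have "real (Suc k * k) + (real k * q + real k - real (Suc k)) = 2 * \<gamma>"
          by (simp add: \<gamma>_def field_simps)
        also have "\<rho> powr (2 * \<gamma>) = (\<rho> powr 2) powr \<gamma>" by (simp only: powr_powr)
        also have "\<rho> powr 2 = 1 - h\<^sup>2" using \<rho> \<rho>2 by (simp add: powr_numeral)
        finally show ?thesis using \<rho> by (simp add: ennreal_power ennreal_mult[symmetric] del: power_Suc)
      qed
      then show "(\<Prod>i<k. ennreal (\<rho> ^ Suc k)) * A (\<lambda>i\<in>{..<k}. \<rho> *\<^sub>R y i) = ennreal ((1 - h\<^sup>2) powr \<gamma>) *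
        (ennreal (pvol k y powr q) * (\<integral>\<^sup>+x. gauss (perp y k x) * g y 0 (x - perp y k x) \<partial>lborel))"
        unfolding A_restrict As by (simp only: mult.assoc[symmetric])
    qed
    also have "\<dots> = ennreal ((1 - h\<^sup>2) powr \<gamma>) * B 0"
      unfolding B_def by (rule nn_integral_cmult) measurable
    finally show ?thesis .
  qed
  have B0: "B h = 0" if "h \<ge> 1" for h
  proof -
    have "h\<^sup>2 \<ge> 1" using that by simp
    then have "\<not> (norm v)\<^sup>2 + h\<^sup>2 < 1" for v :: 'a by (smt (verit) zero_le_power2)
    then have "g y h v = 0" for y v by (simp add: g_def arcsine_weight_def)
    then show ?thesis by (simp add: B_def)
  qed
  show thesis
  \<comment> \<open>The orthogonal complement of the edge space in \<open>X\<close> is a line, so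
    \<open>omega 1 = 2\<close> counts its two sides. \<open>B 0\<close> is never evaluated: it does
    not depend on \<open>G\<close> and cancels when two choices of \<open>G\<close> are
    compared.\<close>
  proof (rule that[of "ennreal (omega 1) * B 0"])
    fix G :: "real \<Rightarrow> ennreal" assume G [measurable]: "G \<in> borel_measurable borel"
    define F where "F = (\<lambda>y (z::'a). (\<Prod>i<k. wt (y i + z)) * wt z * ennreal (pvol k y powr q) * G (norm (perp y k z)))"
    have F_meas [measurable (raw)]: "(\<lambda>\<omega>. F (a \<omega>) (c \<omega>)) \<in> borel_measurable M"
      if [measurable]: "\<And>i. i < k \<Longrightarrow> (\<lambda>\<omega>. a \<omega> i) \<in> borel_measurable M" "c \<in> borel_measurable M"
      for a c and M :: "'m measure"
      unfolding F_def by measurable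
    have "(\<integral>\<^sup>+z. (\<Prod>i\<le>k. wt (z i)) * ennreal (pvol k (edges k z) powr q)
        * G (norm (perp (edges k z) k (z k))) \<partial>PX {..k})
      = (\<integral>\<^sup>+z. F (edges k z) (z k) \<partial>PX (insert k {..<k}))"
      by (intro nn_integral_cong arg_cong2[where f="nn_integral"])
        (simp_all add: lessThan_Suc_atMost[symmetric] lessThan_Suc F_def mult_ac)
    also have "\<dots> = (\<integral>\<^sup>+z. \<integral>\<^sup>+y. F (edges k (y(k := z))) z \<partial>PX {..<k} \<partial>slb X)"
      by (subst P.product_nn_integral_insert_rev) auto
    also have "\<dots> = (\<integral>\<^sup>+z. \<integral>\<^sup>+y. F y z \<partial>PX {..<k} \<partial>slb X)"
    proof (rule nn_integral_cong_AE, rule AE_mp[OF AE_slb[OF X]], intro AE_I2 impI)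
      fix z assume z: "z \<in> X"
      have Fc: "F a z = F b z" if "\<And>i. i < k \<Longrightarrow> a i = b i" for a b
      proof -
        have "pvol k a = pvol k b" "perp a k z = perp b k z"
          using that by (auto intro!: pvol_cong perp_cong)
        then show ?thesis using that by (simp add: F_def)
      qed
      have "(\<integral>\<^sup>+y. F (edges k (y(k := z))) z \<partial>PX {..<k}) = (\<integral>\<^sup>+y. (\<Prod>i<k. 1) * F (\<lambda>i\<in>{..<k}. y i + (- z)) z \<partial>PX {..<k})"
        by (intro nn_integral_cong) (auto intro!: Fc)
      also have "\<dots> = 1 ^ card {..<k} * (\<integral>\<^sup>+y. (\<Prod>i<k. 1) * F y z \<partial>PX {..<k})"
      proof (rule nn_integral_PiM_map[where T="\<lambda>x. x + (- z)" and w="\<lambda>_. 1" and w'="\<lambda>_. 1" and c=1])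
        show "(\<integral>\<^sup>+x. 1 * f (x + (- z)) \<partial>slb X) = 1 * (\<integral>\<^sup>+y. 1 * f y \<partial>slb X)" if "f \<in> borel_measurable (slb X)" for f
          using that nn_integral_slb_shift[OF X, of "- z" f] z X by (simp add: subspace_neg)
      qed (auto intro: sigma_finite_slb[OF X])
      finally show "(\<integral>\<^sup>+y. F (edges k (y(k := z))) z \<partial>PX {..<k}) = (\<integral>\<^sup>+y. F y z \<partial>PX {..<k})" by simp
    qed
    also have "\<dots> = (\<integral>\<^sup>+y. \<integral>\<^sup>+z. F y z \<partial>slb X \<partial>PX {..<k})"
      by (rule nn_integral_swap[OF sigma_finite_slb[OF X] sfk]) measurable
    also have "\<dots> = (\<integral>\<^sup>+y. \<integral>\<^sup>+h. (ennreal (omega 1) * (G h * indicator {0<..} h)) * (ennreal (pvol k y powr q)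
        * (\<integral>\<^sup>+x. gauss (perp y k x) * g y h (x - perp y k x) \<partial>lborel)) \<partial>lborel \<partial>PX {..<k})"
    proof (rule nn_integral_cong_AE, rule AE_mp[OF AE_PiM_slb[OF X]], simp, intro AE_I2 impI)
      fix y assume ysp: "y \<in> space (PX {..<k})" and y: "\<forall>i\<in>{..<k}. y i \<in> X"
      show "(\<integral>\<^sup>+z. F y z \<partial>slb X) = (\<integral>\<^sup>+h. (ennreal (omega 1) * (G h * indicator {0<..} h)) * (ennreal (pvol k y powr q)
        * (\<integral>\<^sup>+x. gauss (perp y k x) * g y h (x - perp y k x) \<partial>lborel)) \<partial>lborel)"
      proof (cases "pvol k y = 0")
        case True then show ?thesis by (simp add: F_def)
      next
        case False
        then have pos: "pvol k y > 0" using pvol_nonneg[of k y] by linarith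
        define L where "L = span (y ` {..<k})"
        have L: "subspace L" "L \<subseteq> X" "dim L = k"
        proof -
          have "y ` {..<k} \<subseteq> X" using y by auto
          then show "L \<subseteq> X" unfolding L_def by (rule span_minimal[OF _ X])
          show "dim L = k" unfolding L_def by (rule dim_span_pvol[OF pos])
        qed (simp add: L_def)
        have yL: "y i \<in> L" if "i < k" for i using that by (auto simp: L_def intro: span_base)
        interpret SL: sigma_finite_measure "slb L" by (rule sigma_finite_slb[OF L(1)])
        have pyth: "(norm (u + z))\<^sup>2 = (norm (u + proj L z))\<^sup>2 + (norm (z - proj L z))\<^sup>2" if "u \<in> L" for u z
          using norm_proj_Pythagoras[OF L(1), of "u + z"] that L(1) by (simp add: proj_add)
        have Fg: "F y z = (ennreal (pvol k y powr q) * G (norm (z - proj L z))) * g y (norm (z - proj L z)) (proj L z)" for z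
        proof -
          have 1: "(\<Prod>i<k. wt (y i + z)) = (\<Prod>i<k. arcsine_weight ((norm (y i + proj L z))\<^sup>2 + (norm (z - proj L z))\<^sup>2))"
            by (intro prod.cong refl, subst pyth[OF yL]) simp_all
          have 2: "wt z = arcsine_weight ((norm (proj L z))\<^sup>2 + (norm (z - proj L z))\<^sup>2)"
            by (subst norm_proj_Pythagoras[OF L(1)]) (rule refl)
          show ?thesis unfolding F_def g_def 1 2 perp_eq_proj L_def[symmetric] by (simp only: mult_ac)
        qed
        have "(\<integral>\<^sup>+z. F y z \<partial>slb X) = ennreal (omega (dim X - dim L)) *
            (\<integral>\<^sup>+v. radial (dim X - dim L) (\<lambda>h. (ennreal (pvol k y powr q) * G h) * g y h v) \<partial>slb L)"
          unfolding Fg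
          by (rule nn_integral_slb_cylinder[OF X L(1,2), where g="\<lambda>v h. (ennreal (pvol k y powr q) * G h) * g y h v"])
            (simp_all add: L dimX)
        also have "\<dots> = (\<integral>\<^sup>+v. \<integral>\<^sup>+h. (ennreal (omega 1) * (G h * indicator {0<..} h)) * (ennreal (pvol k y powr q) * g y h v) \<partial>lborel \<partial>slb L)"
          unfolding L dimX radial_def
          by (subst nn_integral_cmult[symmetric], measurable, intro nn_integral_cong,
              subst nn_integral_cmult[symmetric], measurable, intro nn_integral_cong)
            (auto simp: indicator_def mult_ac)
        also have "\<dots> = (\<integral>\<^sup>+h. \<integral>\<^sup>+v. (ennreal (omega 1) * (G h * indicator {0<..} h)) * (ennreal (pvol k y powr q) * g y h v) \<partial>slb L \<partial>lborel)"
          by (rule nn_integral_swap[OF sigma_finite_slb[OF L(1)] lborel.sigma_finite_measure_axioms]) measurable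
        also have "\<dots> = (\<integral>\<^sup>+h. (ennreal (omega 1) * (G h * indicator {0<..} h)) * (ennreal (pvol k y powr q)
          * (\<integral>\<^sup>+x. gauss (perp y k x) * g y h (x - perp y k x) \<partial>lborel)) \<partial>lborel)"
          unfolding inner L_def[symmetric] by (intro nn_integral_cong) (simp add: nn_integral_cmult)
        finally show ?thesis .
      qed
    qed
    also have "\<dots> = (\<integral>\<^sup>+h. \<integral>\<^sup>+y. (ennreal (omega 1) * (G h * indicator {0<..} h)) * (ennreal (pvol k y powr q)
        * (\<integral>\<^sup>+x. gauss (perp y k x) * g y h (x - perp y k x) \<partial>lborel)) \<partial>PX {..<k} \<partial>lborel)"
      by (rule nn_integral_swap[OF sfk lborel.sigma_finite_measure_axioms]) measurable
    also have "\<dots> = (\<integral>\<^sup>+h. (ennreal (omega 1) * (G h * indicator {0<..} h)) * B h \<partial>lborel)"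
      unfolding B_def by (intro nn_integral_cong nn_integral_cmult) measurable
    also have "\<dots> = (\<integral>\<^sup>+h. (ennreal (omega 1) * B 0) * (G h * ennreal ((1 - h\<^sup>2) powr \<gamma>) * indicator {0<..<1} h) \<partial>lborel)"
    proof (rule nn_integral_cong)
      fix h :: real
      consider "h \<le> 0" | "h \<ge> 1" | "0 < h" "h < 1" by linarith
      then show "(ennreal (omega 1) * (G h * indicator {0<..} h)) * B h = (ennreal (omega 1) * B 0) * (G h * ennreal ((1 - h\<^sup>2) powr \<gamma>) * indicator {0<..<1} h)"
        by cases (auto simp: B0 Bscale mult_ac)
    qed
    also have "\<dots> = (ennreal (omega 1) * B 0) * (\<integral>\<^sup>+h. G h * ennreal ((1 - h\<^sup>2) powr \<gamma>) * indicator {0<..<1} h \<partial>lborel)"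
      by (rule nn_integral_cmult) measurable
    finally show "(\<integral>\<^sup>+z. (\<Prod>i\<le>k. wt (z i)) * ennreal (pvol k (edges k z) powr q)
        * G (norm (perp (edges k z) k (z k))) \<partial>PX {..k})
     = (ennreal (omega 1) * B 0) * (\<integral>\<^sup>+h. G h * ennreal ((1 - h\<^sup>2) powr ((real k * (real (Suc k) + q) - 1) / 2)) * indicator {0<..<1} h \<partial>lborel)"
      unfolding \<gamma>_def .
  qed
qed

end

text \<open>Reflection in the hyperplane orthogonal to \<open>u\<close>, with \<open>u\<close> not
  normalised. For \<open>u = 0\<close> it is the identity, so \<open>householder (a - b)\<close>
  exchanges two vectors of equal norm even if they coincide.\<close>

definition householder :: "'a::euclidean_space \<Rightarrow> 'a \<Rightarrow> 'a" where
  "householder u x = x - (2 * (x \<bullet> u) / (u \<bullet> u)) *\<^sub>R u"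

lemma linear_householder: "linear (householder u)"
  by (rule linearI)
    (simp_all add: householder_def inner_add_left algebra_simps add_divide_distrib)

lemma inner_householder: "householder u x \<bullet> householder u y = x \<bullet> y"
proof (cases "u = 0")
  case False
  then have n: "u \<bullet> u \<noteq> 0" by simp
  define a b where "a = 2 * (x \<bullet> u) / (u \<bullet> u)" and "b = 2 * (y \<bullet> u) / (u \<bullet> u)"
  have "householder u x \<bullet> householder u y = x \<bullet> y - b * (x \<bullet> u) - a * (y \<bullet> u) + a * b * (u \<bullet> u)"
  proof -
    have eqs: "householder u x = x - a *\<^sub>R u" "householder u y = y - b *\<^sub>R u"
      by (simp_all only: householder_def a_def b_def)
    show ?thesis unfolding eqs
      by (simp add: inner_diff_left inner_diff_right inner_commute[of u y] algebra_simps)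
  qed
  also have "x \<bullet> u = a * (u \<bullet> u) / 2" using n by (simp add: a_def)
  also have "y \<bullet> u = b * (u \<bullet> u) / 2" using n by (simp add: b_def)
  also have "x \<bullet> y - b * (a * (u \<bullet> u) / 2) - a * (b * (u \<bullet> u) / 2) + a * b * (u \<bullet> u) = x \<bullet> y"
    by (simp add: algebra_simps)
  finally show ?thesis .
qed (simp add: householder_def)

lemma norm_householder: "norm (householder u x) = norm x"
  by (simp add: norm_eq_sqrt_inner inner_householder)

lemma householder_swap:
  assumes "norm a = norm b"
  shows "householder (a - b) a = b"
proof (cases "a = b")
  case False
  have "a \<bullet> a = b \<bullet> b" using assms by (simp add: dot_square_norm)
  then have "(a - b) \<bullet> (a - b) = 2 * (a \<bullet> (a - b))"
    by (simp add: inner_diff_left inner_diff_right inner_commute)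
  moreover have "(a - b) \<bullet> (a - b) \<noteq> 0" using False by simp
  ultimately show ?thesis by (simp add: householder_def)
qed (simp add: householder_def)

lemma householder_fix: "x \<bullet> u = 0 \<Longrightarrow> householder u x = x"
  by (simp add: householder_def)

lemma householder_involution: "householder u (householder u x) = x"
  by (cases "u = 0") (simp_all add: householder_def inner_diff_left algebra_simps)

lemma householder_image:
  assumes "subspace X" "u \<in> X"
  shows "householder u ` X = X"
proof -
  have in_X: "householder u x \<in> X" if "x \<in> X" for x
    using assms that by (simp add: householder_def subspace_diff subspace_scale)
  show ?thesis
  proof (intro equalityI subsetI)
    fix x assume "x \<in> X"
    then show "x \<in> householder u ` X"
      by (intro image_eqI[of _ _ "householder u x"] in_X) (simp_all add: householder_involution)
  qed (use in_X in auto)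
qed

section \<open>Comparison of the linear, affine and projected moments\<close>

lemma ennreal_eq_divideI:
  assumes "x * ennreal b = ennreal a" "b > 0"
  shows "x = ennreal (a / b)"
proof -
  have "ennreal b * ennreal (1 / b) = 1" using assms(2) by (simp add: ennreal_mult[symmetric])
  then have "x = x * ennreal b * ennreal (1 / b)" by (simp add: mult.assoc)
  also have "\<dots> = ennreal (a / b)"
    unfolding assms(1) using assms(2) by (subst ennreal_mult''[symmetric]) simp_all
  finally show ?thesis .
qed

text \<open>By \<open>pvol_differences\<close> the two moments differ by the factor
  \<open>h powr q\<close>, where \<open>h\<close> is the height of the origin. Taking
  \<open>G\<close> constant and \<open>G = h powr q\<close> in \<open>height_decomposition\<close>
  leaves two Beta integrals with the common second parameter \<open>b\<close>, one more than the
  exponent of \<open>1 - h ^ 2\<close>.\<close>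

lemma affine_moment_eq:
  fixes X :: "'a::euclidean_space set"
  assumes X: "subspace X" "dim X = Suc k" and q: "q > -1"
  defines "b \<equiv> (real k * (real (Suc k) + q) + 1) / 2"
  shows "affine_moment X k q * ennreal (Beta ((1 + q) / 2) b) = linear_moment X k q * ennreal (Beta (1 / 2) b)"
proof -
  have b: "b > 0"
  proof -
    have "real (Suc k) + q \<ge> 0" using q by simp
    then have "real k * (real (Suc k) + q) \<ge> 0" by simp
    moreover have "0 < (x + 1) / 2" if "x \<ge> 0" for x :: real using that by simp
    ultimately show ?thesis unfolding b_def by blast
  qed
  have b1: "(real k * (real (Suc k) + q) - 1) / 2 = b - 1" unfolding b_def by (simp add: field_simps)
  obtain C where C: "\<And>G. G \<in> borel_measurable borel \<Longrightarrow>
     (\<integral>\<^sup>+z. (\<Prod>i\<le>k. arcsine_weight ((norm (z i))\<^sup>2)) * ennreal (pvol k (edges k z) powr q)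
        * G (norm (perp (edges k z) k (z k))) \<partial>Pi\<^sub>M {..k} (\<lambda>_. slb X))
     = C * (\<integral>\<^sup>+h. G h * ennreal ((1 - h\<^sup>2) powr (b - 1)) * indicator {0<..<1} h \<partial>lborel)"
    by (rule height_decomposition[OF X q, unfolded b1])
      (rule that, drule meta_spec, drule meta_mp, assumption, assumption)
  have S: "affine_moment X k q = C * ennreal (Beta (1 / 2) b / 2)"
  proof -
    have "affine_moment X k q = C * (\<integral>\<^sup>+h. 1 * ennreal ((1 - h\<^sup>2) powr (b - 1)) * indicator {0<..<1} h \<partial>lborel)"
      using C[of "\<lambda>_. 1"] unfolding affine_moment_def[OF X q] by simp
    also have "(\<integral>\<^sup>+h. 1 * ennreal ((1 - h\<^sup>2) powr (b - 1)) * indicator {0<..<1} h \<partial>lborel)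
      = (\<integral>\<^sup>+h. ennreal (h powr (1 - 1) * (1 - h\<^sup>2) powr (b - 1)) * indicator {0<..<1} h \<partial>lborel)"
      by (intro nn_integral_cong) (auto simp: indicator_def)
    also have "\<dots> = ennreal (Beta (1 / 2) b / 2)" by (rule nn_integral_beta_square) (use b in auto)
    finally show ?thesis .
  qed
  have D: "linear_moment X k q = C * ennreal (Beta ((1 + q) / 2) b / 2)"
  proof -
    have "linear_moment X k q = (\<integral>\<^sup>+z. (\<Prod>i\<le>k. arcsine_weight ((norm (z i))\<^sup>2)) * ennreal (pvol k (edges k z) powr q)
        * ennreal (norm (perp (edges k z) k (z k)) powr q) \<partial>Pi\<^sub>M {..k} (\<lambda>_. slb X))"
      unfolding linear_moment_def[OF X q] pvol_differences
      by (intro nn_integral_cong) (simp add: powr_mult ennreal_mult mult.assoc)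
    also have "\<dots> = C * (\<integral>\<^sup>+h. ennreal (h powr q) * ennreal ((1 - h\<^sup>2) powr (b - 1)) * indicator {0<..<1} h \<partial>lborel)"
      by (rule C) measurable
    also have "(\<integral>\<^sup>+h. ennreal (h powr q) * ennreal ((1 - h\<^sup>2) powr (b - 1)) * indicator {0<..<1} h \<partial>lborel)
      = (\<integral>\<^sup>+h. ennreal (h powr ((1 + q) - 1) * (1 - h\<^sup>2) powr (b - 1)) * indicator {0<..<1} h \<partial>lborel)"
      by (intro nn_integral_cong) (auto simp: indicator_def ennreal_mult)
    also have "\<dots> = ennreal (Beta ((1 + q) / 2) b / 2)" by (rule nn_integral_beta_square) (use q b in auto)
    finally show ?thesis .
  qed
  have "1 + q > 0" using q by simp
  then have "Gamma ((1 + q) / 2) > 0" "Gamma ((1 + q) / 2 + b) > 0" "Gamma b > 0" "Gamma (1 / 2 + b) > 0"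
    using b by (auto intro!: Gamma_real_pos add_pos_pos)
  then have "Beta (1 / 2) b \<ge> 0" "Beta ((1 + q) / 2) b \<ge> 0"
    by (simp_all add: Beta_def Gamma_one_half_real)
  then have "ennreal (Beta (1 / 2) b / 2) * ennreal (Beta ((1 + q) / 2) b)
      = ennreal (Beta ((1 + q) / 2) b / 2) * ennreal (Beta (1 / 2) b)"
    by (simp add: ennreal_mult[symmetric] mult.commute)
  then show ?thesis unfolding S D by (simp only: mult.assoc)
qed

text \<open>The reflection exchanging \<open>e\<close> and \<open>e'\<close> maps \<open>X\<close>
  onto itself and preserves weights, measures and volumes.\<close>

lemma projected_moment_unit:
  fixes X :: "'a::euclidean_space set"
  assumes X: "subspace X" "dim X = Suc k" and q: "q > -1"
    and e: "e \<in> X" "e' \<in> X" "norm e = norm e'"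
  shows "projected_moment X k q e = projected_moment X k q e'"
proof -
  define R where "R = householder (e - e')"
  have R: "linear R" "\<And>x y. R x \<bullet> R y = x \<bullet> y" "R e = e'" "R ` X = X" "\<And>x. norm (R x) = norm x"
    using e X by (auto simp: R_def linear_householder inner_householder householder_swap
        householder_image subspace_diff norm_householder)
  note [measurable] = measurable_linear[OF R(1)]
  define G where "G = (\<lambda>z. ennreal (pvol k (edges k z) powr q) * ennreal (norm (perp (edges k z) k e') powr q))"
  have Gm: "G \<in> borel_measurable (Pi\<^sub>M {..k} (\<lambda>_. slb X))" unfolding G_def by measurable
  have GR: "G (\<lambda>i\<in>{..k}. R (z i)) = ennreal (pvol k (edges k z) powr q) * ennreal (norm (perp (edges k z) k e) powr q)" for z
  proof -
    have "pvol k (edges k (\<lambda>i\<in>{..k}. R (z i))) = pvol k (\<lambda>i. R (edges k z i))"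
      by (rule pvol_cong) (simp add: linear_diff R(1))
    moreover have "perp (edges k (\<lambda>i\<in>{..k}. R (z i))) k e' = perp (\<lambda>i. R (edges k z i)) k (R e)"
      unfolding R(3) by (rule perp_cong) (simp add: linear_diff R(1))
    ultimately show ?thesis unfolding G_def
      by (simp only: pvol_isometry[OF R(1,2)] perp_isometry[OF R(1,2)] R(5))
  qed
  have "projected_moment X k q e = (\<integral>\<^sup>+z. (\<Prod>i\<le>k. arcsine_weight ((norm (z i))\<^sup>2)) * G (\<lambda>i\<in>{..k}. R (z i)) \<partial>Pi\<^sub>M {..k} (\<lambda>_. slb X))"
    unfolding projected_moment_def[OF X q] GR by (simp only: mult.assoc)
  also have "\<dots> = 1 ^ card {..k} * (\<integral>\<^sup>+z. (\<Prod>i\<le>k. arcsine_weight ((norm (z i))\<^sup>2)) * G z \<partial>Pi\<^sub>M {..k} (\<lambda>_. slb X))"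
  proof (rule nn_integral_PiM_map[where w="\<lambda>x. arcsine_weight ((norm x)\<^sup>2)" and w'="\<lambda>x. arcsine_weight ((norm x)\<^sup>2)" and c=1])
    show "(\<integral>\<^sup>+x. arcsine_weight ((norm x)\<^sup>2) * g (R x) \<partial>slb X) = 1 * (\<integral>\<^sup>+y. arcsine_weight ((norm y)\<^sup>2) * g y \<partial>slb X)"
      if "g \<in> borel_measurable (slb X)" for g
      using that nn_integral_slb_isometry[OF X(1) R(1,2), of "\<lambda>x. arcsine_weight ((norm x)\<^sup>2) * g x"]
      by (simp add: R(4,5))
  qed (auto intro!: sigma_finite_slb X Gm)
  also have "\<dots> = projected_moment X k q e'"
    unfolding projected_moment_def[OF X q] G_def by (simp add: mult.assoc)
  finally show ?thesis .
qed

text \<open>The direction is averaged over a Gaussian vector of \<open>X\<close>. Integrating over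
  the points first gives the projected moment times the Gaussian moment of the norm in dimension
  \<open>k + 1\<close>; integrating over the vector first leaves its distance from the
  \<open>k\<close>-dimensional edge space, a one-dimensional moment.\<close>

lemma projected_moment_eq:
  fixes X :: "'a::euclidean_space set"
  assumes X: "subspace X" "dim X = Suc k" and q: "q > -1" and e: "e \<in> X" "norm e = 1"
  shows "projected_moment X k q e * ennreal (omega (Suc k) / omega (real (Suc k) + q))
    = affine_moment X k q * ennreal (omega 1 / omega (1 + q))"
proof -
  let ?P = "Pi\<^sub>M {..k} (\<lambda>_. slb X)"
  interpret P: product_sigma_finite "\<lambda>_::nat. slb X" by (rule product_sigma_finite_slb[OF X(1)])
  have sfP: "sigma_finite_measure ?P" by (intro P.sigma_finite) simp
  define A where "A = (\<lambda>z. (\<Prod>i\<le>k. arcsine_weight ((norm (z i :: 'a))\<^sup>2)) * ennreal (pvol k (edges k z) powr q))"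
  have A_meas [measurable]: "A \<in> borel_measurable ?P" unfolding A_def by measurable
  define J where "J = (\<integral>\<^sup>+\<zeta>. \<integral>\<^sup>+z. gauss \<zeta> * (A z * ennreal (norm (perp (edges k z) k \<zeta>) powr q)) \<partial>?P \<partial>slb X)"
  have "J = (\<integral>\<^sup>+\<zeta>. projected_moment X k q e * (gauss \<zeta> * ennreal (norm (\<zeta> - proj {0} \<zeta>) powr q)) \<partial>slb X)"
    unfolding J_def
  proof (rule nn_integral_cong_AE, rule AE_mp[OF AE_slb[OF X(1)]], rule AE_mp[OF AE_slb_nonzero[OF X(1)]],
      simp add: X, intro AE_I2 impI)
    fix \<zeta> assume \<zeta>: "\<zeta> \<noteq> 0" "\<zeta> \<in> X"
    define u where "u = \<zeta> /\<^sub>R norm \<zeta>"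
    have u: "u \<in> X" "norm u = norm e" "\<zeta> = norm \<zeta> *\<^sub>R u"
      using \<zeta> e X by (auto simp: u_def subspace_scale)
    have p0: "proj {0} \<zeta> = 0" by (rule proj_eqI) auto
    have "norm (perp y k \<zeta>) powr q = norm \<zeta> powr q * norm (perp y k u) powr q" for y
      by (subst u(3)) (simp add: norm_perp_scale powr_mult)
    then have "(\<integral>\<^sup>+z. gauss \<zeta> * (A z * ennreal (norm (perp (edges k z) k \<zeta>) powr q)) \<partial>?P)
      = (\<integral>\<^sup>+z. (gauss \<zeta> * ennreal (norm \<zeta> powr q)) * (A z * ennreal (norm (perp (edges k z) k u) powr q)) \<partial>?P)"
      by (simp add: ennreal_mult mult_ac)
    also have "\<dots> = (gauss \<zeta> * ennreal (norm \<zeta> powr q)) * projected_moment X k q u"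
      unfolding projected_moment_def[OF X q] A_def by (rule nn_integral_cmult) measurable
    also have "projected_moment X k q u = projected_moment X k q e"
      by (rule projected_moment_unit[OF X q u(1) e(1) u(2)])
    finally show "(\<integral>\<^sup>+z. gauss \<zeta> * (A z * ennreal (norm (perp (edges k z) k \<zeta>) powr q)) \<partial>?P)
      = projected_moment X k q e * (gauss \<zeta> * ennreal (norm (\<zeta> - proj {0} \<zeta>) powr q))"
      by (simp add: p0 mult_ac)
  qed
  also have "\<dots> = projected_moment X k q e * (\<integral>\<^sup>+\<zeta>. gauss \<zeta> * ennreal (norm (\<zeta> - proj {0} \<zeta>) powr q) \<partial>slb X)"
    by (rule nn_integral_cmult) measurable
  also have "(\<integral>\<^sup>+\<zeta>. gauss \<zeta> * ennreal (norm (\<zeta> - proj {0} \<zeta>) powr q) \<partial>slb X) = ennreal (omega (Suc k) / omega (real (Suc k) + q))"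
    using nn_integral_slb_gauss_dist[OF X(1), of "{0}" q] X q by (simp add: subspace_0)
  finally have 1: "J = projected_moment X k q e * ennreal (omega (Suc k) / omega (real (Suc k) + q))" .
  have "J = (\<integral>\<^sup>+z. \<integral>\<^sup>+\<zeta>. gauss \<zeta> * (A z * ennreal (norm (perp (edges k z) k \<zeta>) powr q)) \<partial>slb X \<partial>?P)"
    unfolding J_def by (rule nn_integral_swap[OF sigma_finite_slb[OF X(1)] sfP]) measurable
  also have "\<dots> = (\<integral>\<^sup>+z. A z * ennreal (omega 1 / omega (1 + q)) \<partial>?P)"
  proof (rule nn_integral_cong_AE, rule AE_mp[OF AE_PiM_slb[OF X(1)]], simp, intro AE_I2 impI)
    fix z assume "\<forall>i\<in>{..k}. z i \<in> X"
    then have zX: "edges k z i \<in> X" if "i < k" for i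
      using that X by (intro subspace_diff) auto
    show "(\<integral>\<^sup>+\<zeta>. gauss \<zeta> * (A z * ennreal (norm (perp (edges k z) k \<zeta>) powr q)) \<partial>slb X) = A z * ennreal (omega 1 / omega (1 + q))"
    proof (cases "pvol k (edges k z) = 0")
      case True then show ?thesis by (simp add: A_def)
    next
      case False
      then have pos: "pvol k (edges k z) > 0" using pvol_nonneg[of k "edges k z"] by linarith
      let ?V = "span (edges k z ` {..<k})"
      have V: "?V \<subseteq> X" "dim ?V = k"
      proof -
        have "edges k z ` {..<k} \<subseteq> X" using zX by auto
        then show "?V \<subseteq> X" by (rule span_minimal[OF _ X(1)])
        show "dim ?V = k" by (rule dim_span_pvol[OF pos])
      qed
      have "(\<integral>\<^sup>+\<zeta>. gauss \<zeta> * ennreal (norm (\<zeta> - proj ?V \<zeta>) powr q) \<partial>slb X) = ennreal (omega (dim X - dim ?V) / omega (real (dim X - dim ?V) + q))"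
      proof (rule nn_integral_slb_gauss_dist[OF X(1) subspace_span V(1)])
        show "dim ?V < dim X" unfolding V(2) X(2) by simp
        show "0 < real (dim X - dim ?V) + q" unfolding V(2) X(2) using q by simp
      qed
      then have "(\<integral>\<^sup>+\<zeta>. gauss \<zeta> * ennreal (norm (perp (edges k z) k \<zeta>) powr q) \<partial>slb X) = ennreal (omega 1 / omega (1 + q))"
        unfolding V(2) X(2) perp_eq_proj by simp
      moreover have "(\<integral>\<^sup>+\<zeta>. gauss \<zeta> * (A z * ennreal (norm (perp (edges k z) k \<zeta>) powr q)) \<partial>slb X)
        = A z * (\<integral>\<^sup>+\<zeta>. gauss \<zeta> * ennreal (norm (perp (edges k z) k \<zeta>) powr q) \<partial>slb X)"
        by (subst nn_integral_cmult[symmetric], measurable) (simp add: mult_ac)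
      ultimately show ?thesis by simp
    qed
  qed
  also have "\<dots> = affine_moment X k q * ennreal (omega 1 / omega (1 + q))"
    unfolding affine_moment_def[OF X q] A_def by (rule nn_integral_multc) measurable
  finally show ?thesis using 1 by simp
qed

section \<open>Projection from W x R to the unit ball of W\<close>

lemma slb_times_real:
  fixes W :: "'a::euclidean_space set" and f :: "'a \<times> real \<Rightarrow> ennreal"
  assumes W: "subspace W" and f [measurable]: "f \<in> borel_measurable borel"
  shows "(\<integral>\<^sup>+x. f x \<partial>slb (W \<times> UNIV)) = (\<integral>\<^sup>+s. \<integral>\<^sup>+w. f (w, s) \<partial>slb W \<partial>lborel)"
proof -
  define \<iota> where "\<iota> = (\<lambda>w::'a. (w, 0::real))"
  have \<iota>: "linear \<iota>" "\<And>x y. \<iota> x \<bullet> \<iota> y = x \<bullet> y"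
    by (auto simp: \<iota>_def intro!: linearI)
  have sub: "subspace (\<iota> ` W)" using W \<iota>(1) by (simp add: linear_subspace_image)
  have sp: "span (insert (0, 1) (\<iota> ` W)) = W \<times> (UNIV :: real set)"
  proof -
    have "span (insert (0, 1) (\<iota> ` W)) = {x. \<exists>s. x - s *\<^sub>R (0, 1) \<in> span (\<iota> ` W)}"
      by (simp add: span_insert)
    also have "span (\<iota> ` W) = \<iota> ` W" using sub by (simp add: span_eq_iff[THEN iffD2])
    also have "{x. \<exists>s. x - s *\<^sub>R (0, 1) \<in> \<iota> ` W} = W \<times> UNIV"
      by (auto simp: \<iota>_def image_iff)
    finally show ?thesis .
  qed
  have "(\<integral>\<^sup>+x. f x \<partial>slb (W \<times> UNIV)) = (\<integral>\<^sup>+s. \<integral>\<^sup>+x. f (x + s *\<^sub>R (0, 1)) \<partial>slb (\<iota> ` W) \<partial>lborel)"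
    unfolding sp[symmetric] by (rule nn_integral_slb_insert[OF sub]) (auto simp: \<iota>_def norm_Pair)
  also have "\<dots> = (\<integral>\<^sup>+s. \<integral>\<^sup>+w. f (\<iota> w + s *\<^sub>R (0, 1)) \<partial>slb W \<partial>lborel)"
    by (intro nn_integral_cong nn_integral_slb_isometry[OF W \<iota>, symmetric]) measurable
  finally show ?thesis by (simp add: \<iota>_def)
qed

lemma dim_times_real:
  fixes W :: "'a::euclidean_space set"
  assumes "subspace W"
  shows "dim (W \<times> (UNIV :: real set)) = Suc (dim W)"
  using dim_Times[OF assms subspace_UNIV, where 'b = real] by simp

lemma nn_integral_even:
  fixes f :: "real \<Rightarrow> ennreal"
  assumes [measurable]: "f \<in> borel_measurable borel" and even: "\<And>x. f (- x) = f x"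
  shows "(\<integral>\<^sup>+x. f x \<partial>lborel) = 2 * (\<integral>\<^sup>+x. f x * indicator {0<..} x \<partial>lborel)"
proof -
  have neg: "(\<integral>\<^sup>+x. f x * indicator {..<0} x \<partial>lborel) = (\<integral>\<^sup>+x. f x * indicator {0<..} x \<partial>lborel)"
    by (subst nn_integral_lborel_uminus[symmetric]) (auto intro!: nn_integral_cong simp: indicator_def even)
  have "(\<integral>\<^sup>+x. f x \<partial>lborel) = (\<integral>\<^sup>+x. f x * indicator {0<..} x + f x * indicator {..<0} x \<partial>lborel)"
    by (intro nn_integral_cong_AE, rule AE_mp[OF AE_lborel_singleton[of 0]]) (auto simp: indicator_def)
  also have "\<dots> = (\<integral>\<^sup>+x. f x * indicator {0<..} x \<partial>lborel) + (\<integral>\<^sup>+x. f x * indicator {..<0} x \<partial>lborel)"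
    by (rule nn_integral_add) measurable
  finally show ?thesis unfolding neg by (simp only: mult_2)
qed

text \<open>Rescaling the fibre by \<open>\<rho> = sqrt (1 - t)\<close> gives the factors
  \<open>\<rho>\<close> and \<open>1 / \<rho>\<close>, which cancel; what remains is
  \<open>Beta (1 / 2) (1 / 2) = pi\<close>. Here the exponent \<open>-1/2\<close> is
  decisive.\<close>

lemma nn_integral_arcsine_weight:
  "(\<integral>\<^sup>+s. arcsine_weight (t + s\<^sup>2) \<partial>lborel) = ennreal pi * indicator {..<1} t"
proof (cases "t < 1")
  case False
  then have "\<not> t + s\<^sup>2 < 1" for s
    using zero_le_power2[of s] by linarith
  then have "arcsine_weight (t + s\<^sup>2) = 0" for s
    by (simp add: arcsine_weight_def)
  then show ?thesis using False by simp
next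
  case True
  have base: "(\<integral>\<^sup>+s. arcsine_weight (s\<^sup>2) \<partial>lborel) = ennreal pi"
  proof -
    have "(\<integral>\<^sup>+s. arcsine_weight (s\<^sup>2) \<partial>lborel) = 2 * (\<integral>\<^sup>+s. arcsine_weight (s\<^sup>2) * indicator {0<..} s \<partial>lborel)"
      by (rule nn_integral_even) auto
    also have "(\<integral>\<^sup>+s. arcsine_weight (s\<^sup>2) * indicator {0<..} s \<partial>lborel)
      = (\<integral>\<^sup>+h. ennreal (h powr (1 - 1) * (1 - h\<^sup>2) powr (1 / 2 - 1)) * indicator {0<..<1} h \<partial>lborel)"
    proof (intro nn_integral_cong)
      fix h :: real
      have "h > 0 \<Longrightarrow> h\<^sup>2 < 1 \<longleftrightarrow> h < 1" by (simp add: power_less_one_iff)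
      then show "arcsine_weight (h\<^sup>2) * indicator {0<..} h = ennreal (h powr (1 - 1) * (1 - h\<^sup>2) powr (1 / 2 - 1)) * indicator {0<..<1} h"
        by (auto simp: indicator_def arcsine_weight_def)
    qed
    also have "\<dots> = ennreal (Beta (1 / 2) (1 / 2) / 2)" by (rule nn_integral_beta_square) auto
    also have "Beta (1 / 2) (1 / 2) = pi" by (simp add: Beta_def Gamma_one_half_real)
    also have "2 * ennreal (pi / 2) = ennreal (2 * (pi / 2))" by (subst ennreal_mult) simp_all
    finally show ?thesis by simp
  qed
  define \<rho> where "\<rho> = sqrt (1 - t)"
  have \<rho>: "\<rho> > 0" "\<rho>\<^sup>2 = 1 - t" using True by (auto simp: \<rho>_def)
  have "(\<integral>\<^sup>+s. arcsine_weight (t + s\<^sup>2) \<partial>lborel) = ennreal \<rho> * (\<integral>\<^sup>+s. arcsine_weight (\<rho>\<^sup>2 * s\<^sup>2 + t) \<partial>lborel)"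
    using \<rho>(1) by (subst nn_integral_real_affine[where c=\<rho> and t=0]) (simp_all add: power_mult_distrib add.commute)
  also have "\<dots> = ennreal \<rho> * (ennreal (1 / \<rho>) * (\<integral>\<^sup>+s. arcsine_weight (s\<^sup>2) \<partial>lborel))"
    unfolding arcsine_weight_affine[OF \<rho>] by (subst nn_integral_cmult) auto
  also have "\<dots> = (ennreal \<rho> * ennreal (1 / \<rho>)) * ennreal pi" by (simp only: base mult.assoc)
  also have "ennreal \<rho> * ennreal (1 / \<rho>) = 1" using \<rho>(1) by (simp add: ennreal_mult[symmetric])
  finally show ?thesis using True by simp
qed

definition ball_moment :: "'a::euclidean_space set \<Rightarrow> nat \<Rightarrow> real \<Rightarrow> ennreal" where
  "ball_moment W k q = (\<integral>\<^sup>+x. (\<Prod>i\<le>k. indicator (cball 0 1) (x i)) * ennreal (pvol k (edges k x) powr q)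
     \<partial>Pi\<^sub>M {..k} (\<lambda>_. slb W))"

text \<open>The weighted points project to the open ball, while the moments are taken over the
  closed ball.\<close>

lemma AE_slb_sphere:
  assumes "subspace (W :: 'a::euclidean_space set)"
  shows "AE x in slb W. norm x \<noteq> 1"
proof (cases "dim W = 0")
  case True
  then have "W \<subseteq> {0}" by simp
  then show ?thesis using AE_slb[OF assms] by (auto elim!: eventually_mono)
next
  case False
  have [measurable]: "{x::'a. norm x = 1} \<in> sets borel" by (intro borel_closed closed_Collect_eq continuous_intros)
  have "emeasure (slb W) {x. norm x = 1} = (\<integral>\<^sup>+x. indicator {1} (norm x) \<partial>slb W)"
  proof -
    have "indicator {1} (norm x) = (indicator {x. norm x = 1} x :: ennreal)" for x :: 'a
      by (simp add: indicator_def)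
    then show ?thesis by simp
  qed
  also have "\<dots> = ennreal (omega (dim W)) * radial (dim W) (indicator {1})"
    using False by (intro nn_integral_slb_radial assms) auto
  also have "radial (dim W) (indicator {1}) = nn_integral lborel (\<lambda>h::real. 0)"
    unfolding radial_def
    by (intro nn_integral_cong_AE, rule AE_mp[OF AE_lborel_singleton[of "1::real"]]) (auto simp: indicator_def)
  finally have "emeasure (slb W) {x. norm x = 1} = 0" by simp
  then show ?thesis by (intro AE_I[of _ _ "{x. norm x = 1}"]) auto
qed

text \<open>The fibre over each of the \<open>k + 1\<close> points of the ball has weight
  \<open>pi\<close>, and projecting the edges along \<open>(0, 1)\<close> is the same as taking
  differences of the first components.\<close>

lemma ball_moment_projected:
  fixes W :: "'a::euclidean_space set"
  assumes W: "subspace W" "dim W = k" and q: "q > -1"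
  shows "projected_moment (W \<times> (UNIV :: real set)) k q (0, 1) = ennreal (pi ^ Suc k) * ball_moment W k q"
proof -
  let ?X = "W \<times> (UNIV :: real set)"
  let ?P = "Pi\<^sub>M {..k} (\<lambda>_. slb ?X)"
  have X: "subspace ?X" "dim ?X = Suc k"
    using W by (simp_all add: subspace_Times dim_times_real)
  define G where "G = (\<lambda>x::nat \<Rightarrow> 'a. ennreal (pvol k (edges k x) powr q))"
  have Gm: "G \<in> borel_measurable (Pi\<^sub>M {..k} (\<lambda>_. slb W))" unfolding G_def by measurable
  have fstm: "fst \<in> measurable (slb ?X) (slb W)"
    unfolding measurable_cong_sets[OF sets_slb sets_slb]
    by (intro borel_measurable_continuous_onI continuous_intros)
  have eq: "ennreal (pvol k (edges k z) powr q) * ennreal (norm (perp (edges k z) k (0, 1)) powr q)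
    = G (\<lambda>i\<in>{..k}. fst (z i))" for z :: "nat \<Rightarrow> 'a \<times> real"
  proof -
    let ?e = "(0, 1) :: 'a \<times> real" and ?\<iota> = "\<lambda>w::'a. (w, 0::real)"
    have e: "norm ?e = 1" "?e \<bullet> ?e = 1" by (simp_all add: norm_Pair)
    have \<iota>: "linear ?\<iota>" "\<And>x y. ?\<iota> x \<bullet> ?\<iota> y = x \<bullet> y" by (auto intro!: linearI)
    have "pvol k (edges k z) * norm (perp (edges k z) k ?e) = pvol k (\<lambda>i. edges k z i - ((edges k z i \<bullet> ?e) / (?e \<bullet> ?e)) *\<^sub>R ?e)"
      using pvol_remove_line[of ?e k "edges k z"] by (simp only: e mult_1)
    also have "\<dots> = pvol k (\<lambda>i. ?\<iota> (edges k (\<lambda>i\<in>{..k}. fst (z i)) i))"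
      by (rule pvol_cong) (simp add: prod_eq_iff inner_prod_def)
    also have "\<dots> = pvol k (edges k (\<lambda>i\<in>{..k}. fst (z i)))" by (rule pvol_isometry[OF \<iota>])
    finally show ?thesis
      unfolding G_def by (simp add: ennreal_mult[symmetric] powr_mult[symmetric])
  qed
  have "projected_moment ?X k q (0, 1) = (\<integral>\<^sup>+z. (\<Prod>i\<le>k. arcsine_weight ((norm (z i))\<^sup>2)) * G (\<lambda>i\<in>{..k}. fst (z i)) \<partial>?P)"
    unfolding projected_moment_def[OF X q] mult.assoc eq ..
  also have "\<dots> = ennreal pi ^ card {..k} * (\<integral>\<^sup>+x. (\<Prod>i\<le>k. indicator (ball 0 1) (x i)) * G x \<partial>Pi\<^sub>M {..k} (\<lambda>_. slb W))"
  proof (rule nn_integral_PiM_map[where T=fst and w="\<lambda>x. arcsine_weight ((norm x)\<^sup>2)" and w'="indicator (ball 0 1)" and c="ennreal pi"])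
    fix g :: "'a \<Rightarrow> ennreal" assume "g \<in> borel_measurable (slb W)"
    then have [measurable]: "g \<in> borel_measurable borel" by simp
    interpret SW: sigma_finite_measure "slb W" by (rule sigma_finite_slb[OF W(1)])
    have [measurable]: "ball (0::'a) 1 \<in> sets borel" by simp
    have [measurable]: "(\<lambda>x::'a \<times> real. g (fst x)) \<in> borel_measurable borel"
      by (rule measurable_compose[OF _ \<open>g \<in> borel_measurable borel\<close>])
        (intro borel_measurable_continuous_onI continuous_intros)
    have "(\<integral>\<^sup>+x. arcsine_weight ((norm x)\<^sup>2) * g (fst x) \<partial>slb ?X)
      = (\<integral>\<^sup>+s. \<integral>\<^sup>+w. arcsine_weight ((norm (w, s::real))\<^sup>2) * g (fst (w, s)) \<partial>slb W \<partial>lborel)"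
      by (rule slb_times_real[OF W(1), where f="\<lambda>x. arcsine_weight ((norm x)\<^sup>2) * g (fst x)"]) measurable
    also have "\<dots> = (\<integral>\<^sup>+s. \<integral>\<^sup>+w. arcsine_weight ((norm w)\<^sup>2 + s\<^sup>2) * g w \<partial>slb W \<partial>lborel)"
      by (simp add: norm_Pair)
    also have "\<dots> = (\<integral>\<^sup>+w. \<integral>\<^sup>+s. arcsine_weight ((norm w)\<^sup>2 + s\<^sup>2) * g w \<partial>lborel \<partial>slb W)"
      by (rule nn_integral_swap[OF lborel.sigma_finite_measure_axioms sigma_finite_slb[OF W(1)]]) measurable
    also have "\<dots> = (\<integral>\<^sup>+w. ennreal pi * (indicator (ball 0 1) w * g w) \<partial>slb W)"
    proof (rule nn_integral_cong)
      fix w :: 'a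
      have "indicator {..<1} ((norm w)\<^sup>2) = (indicator (ball 0 1) w :: ennreal)"
        by (auto simp: indicator_def power_less_one_iff)
      then show "(\<integral>\<^sup>+s. arcsine_weight ((norm w)\<^sup>2 + s\<^sup>2) * g w \<partial>lborel) = ennreal pi * (indicator (ball 0 1) w * g w)"
        by (subst nn_integral_multc) (auto simp: nn_integral_arcsine_weight mult.assoc)
    qed
    also have "\<dots> = ennreal pi * (\<integral>\<^sup>+w. indicator (ball 0 1) w * g w \<partial>slb W)"
      by (rule nn_integral_cmult) measurable
    finally show "(\<integral>\<^sup>+x. arcsine_weight ((norm x)\<^sup>2) * g (fst x) \<partial>slb ?X) = ennreal pi * (\<integral>\<^sup>+w. indicator (ball 0 1) w * g w \<partial>slb W)" .
  qed (auto intro!: sigma_finite_slb X W Gm fstm borel_measurable_indicator)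
  also have "(\<integral>\<^sup>+x. (\<Prod>i\<le>k. indicator (ball 0 1) (x i)) * G x \<partial>Pi\<^sub>M {..k} (\<lambda>_. slb W)) = ball_moment W k q"
    unfolding ball_moment_def G_def
  proof (rule nn_integral_cong_AE, rule AE_mp[OF AE_PiM_all[OF sigma_finite_slb[OF W(1)] _ AE_slb_sphere[OF W(1)]]],
      simp, intro AE_I2 impI)
    fix x assume "\<forall>i\<in>{..k}. norm (x i :: 'a) \<noteq> 1"
    then have "(\<Prod>i\<le>k. indicator (ball 0 1) (x i)) = (\<Prod>i\<le>k. indicator (cball 0 1) (x i) :: ennreal)"
      by (intro prod.cong refl) (auto simp: indicator_def less_le)
    then show "(\<Prod>i\<le>k. indicator (ball 0 1) (x i)) * ennreal (pvol k (edges k x) powr q)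
      = (\<Prod>i\<le>k. indicator (cball 0 1) (x i)) * ennreal (pvol k (edges k x) powr q)" by simp
  qed
  finally show ?thesis by (simp add: ennreal_power del: power_Suc)
qed

text \<open>\<open>Gamma b\<close> and \<open>Gamma ((1 + q) / 2)\<close> cancel. The two remaining
  Gamma values are those in the denominators of the two ball volumes, and the powers of
  \<open>pi\<close> match.\<close>

lemma moment_constant:
  fixes q :: real and k :: nat
  assumes q: "q > -1"
  defines "a \<equiv> real k + q" and "b \<equiv> (real k * (real (Suc k) + q) + 1) / 2"
  shows "Beta (1 / 2) b / Beta ((1 + q) / 2) b * (omega 1 / omega (1 + q))
    = unit_ball_vol (real k * a + real k) / unit_ball_vol (real (k + 1) * a)"
    and "Beta (1 / 2) b > 0" and "Beta ((1 + q) / 2) b > 0"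
proof -
  have q1: "1 + q > 0" using q by simp
  have "real k * (real (Suc k) + q) \<ge> 0" using q by simp
  moreover have "0 < (x + 1) / 2" if "x \<ge> 0" for x :: real using that by simp
  ultimately have b: "b > 0" unfolding b_def by blast
  have e1: "1 / 2 + b = (real k * a + real k) / 2 + 1" by (simp add: a_def b_def field_simps)
  have e2: "(1 + q) / 2 + b = (real (k + 1) * a) / 2 + 1" by (simp add: a_def b_def field_simps)
  have g: "Gamma b > 0" "Gamma (1 / 2 + b) > 0" "Gamma ((1 + q) / 2 + b) > 0" "Gamma ((1 + q) / 2) > 0"
    using b q1 by (auto intro!: Gamma_real_pos add_pos_pos)
  show "Beta (1 / 2) b > 0" "Beta ((1 + q) / 2) b > 0"
    using g by (simp_all add: Beta_def Gamma_one_half_real)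
  have om: "omega 1 = 2" by (simp add: omega_def)
  have "Beta (1 / 2) b / Beta ((1 + q) / 2) b * (omega 1 / omega (1 + q))
    = (sqrt pi / pi powr ((1 + q) / 2)) * Gamma ((1 + q) / 2 + b) / Gamma (1 / 2 + b)"
    unfolding om omega_Gamma[OF q1] Beta_def Gamma_one_half_real using g by (simp add: field_simps)
  also have "sqrt pi / pi powr ((1 + q) / 2) = pi powr ((real k * a + real k) / 2) / pi powr ((real (k + 1) * a) / 2)"
  proof -
    have "sqrt pi / pi powr ((1 + q) / 2) = pi powr (1 / 2 - (1 + q) / 2)"
      by (simp add: powr_diff powr_half_sqrt)
    also have "1 / 2 - (1 + q) / 2 = (real k * a + real k) / 2 - (real (k + 1) * a) / 2"
      by (simp add: a_def field_simps)
    finally show ?thesis by (simp add: powr_diff)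
  qed
  finally show "Beta (1 / 2) b / Beta ((1 + q) / 2) b * (omega 1 / omega (1 + q))
    = unit_ball_vol (real k * a + real k) / unit_ball_vol (real (k + 1) * a)"
    unfolding unit_ball_vol_def e1 e2 by (simp add: mult.commute)
qed

text \<open>The linear moment is converted by a Beta quotient into the affine one, by
  \<open>r1 / r\<close> into the projected one, and by \<open>pi ^ (k + 1)\<close> into the moment
  of the ball. The factor of the linear moment with index \<open>k + 1\<close> is \<open>r\<close>
  and cancels; the other \<open>k\<close> form \<open>Q\<close>, the reciprocal of
  \<open>b_coeff a k\<close>.\<close>

theorem ball_moment_eq:
  fixes W :: "'a::euclidean_space set"
  assumes W: "subspace W" "dim W = k" and q: "q > -1"
  defines "a \<equiv> real k + q"
  shows "ball_moment W k q = ennreal (unit_ball_vol a ^ (k + 1)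
     * (unit_ball_vol (real k * a + real k) / unit_ball_vol (real (k + 1) * a)) / b_coeff a k)"
proof -
  let ?X = "W \<times> (UNIV :: real set)"
  have X: "subspace ?X" "dim ?X = Suc k"
    using W by (simp_all add: subspace_Times dim_times_real)
  define b where "b = (real k * (real (Suc k) + q) + 1) / 2"
  note mc = moment_constant[OF q, of k, folded a_def b_def]
  have om: "omega (real j) > 0" "omega (real j + q) > 0" if "j \<ge> 1" for j
    using that q by (auto intro!: omega_pos)
  define Q where "Q = (\<Prod>j=1..k. omega j / omega (real j + q))"
  have Q: "Q > 0" unfolding Q_def by (intro prod_pos) (auto simp: om)
  define r where "r = omega (Suc k) / omega (real (Suc k) + q)"
  have r: "r > 0" unfolding r_def using om[of "Suc k"] by simp
  define r1 where "r1 = omega 1 / omega (1 + q)"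
  have r1: "r1 > 0" unfolding r1_def using om[of 1] by simp
  have ua: "unit_ball_vol a > 0" using kq2[OF X q] by (simp add: unit_ball_vol_def a_def Gamma_real_pos)
  define D where "D = (pi * unit_ball_vol a) ^ Suc k * (Q * r)"
  have D0: "D > 0" using ua Q r by (simp add: D_def)
  have D: "linear_moment ?X k q = ennreal D"
    unfolding linear_moment_eq[OF X q] D_def a_def Q_def r_def by simp
  define S where "S = D * Beta (1 / 2) b / Beta ((1 + q) / 2) b"
  have S0: "S > 0" using D0 mc by (simp add: S_def)
  have S: "affine_moment ?X k q = ennreal S"
    unfolding S_def
  proof (rule ennreal_eq_divideI)
    show "affine_moment ?X k q * ennreal (Beta ((1 + q) / 2) b) = ennreal (D * Beta (1 / 2) b)"
      unfolding b_def affine_moment_eq[OF X q] D using D0 mc(2)[unfolded b_def] by (simp add: ennreal_mult)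
  qed (rule mc)
  have P: "projected_moment ?X k q (0, 1) = ennreal (S * r1 / r)"
  proof (rule ennreal_eq_divideI)
    have "projected_moment ?X k q (0, 1) * ennreal r = ennreal S * ennreal r1"
      unfolding r_def r1_def S[symmetric] using W
      by (intro projected_moment_eq[OF X q]) (simp_all add: subspace_0 norm_Pair)
    then show "projected_moment ?X k q (0, 1) * ennreal r = ennreal (S * r1)"
      using S0 r1 by (simp only: ennreal_mult less_imp_le)
  qed (rule r)
  have N: "ball_moment W k q = ennreal (S * r1 / r / pi ^ Suc k)"
  proof (rule ennreal_eq_divideI)
    show "ball_moment W k q * ennreal (pi ^ Suc k) = ennreal (S * r1 / r)"
      using P unfolding ball_moment_projected[OF W q] by (simp add: mult.commute)
  qed simp
  have bc: "b_coeff a k = 1 / Q"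
  proof -
    have "b_coeff a k = (\<Prod>i=1..k. omega (real i + q)) / (\<Prod>i=1..k. omega (real i))"
      by (simp add: b_coeff_def a_def add_ac)
    then show ?thesis by (simp add: Q_def prod_dividef)
  qed
  have "S * r1 / r / pi ^ Suc k = unit_ball_vol a ^ Suc k * Q * (Beta (1 / 2) b / Beta ((1 + q) / 2) b * r1)"
    using r by (simp add: S_def D_def power_mult_distrib del: power_Suc)
  also have "\<dots> = unit_ball_vol a ^ Suc k * Q * (unit_ball_vol (real k * a + real k) / unit_ball_vol (real (k + 1) * a))"
    unfolding r1_def mc(1) ..
  finally show ?thesis unfolding N bc by (simp add: mult_ac)
qed

lemma ball_moment_dim_0:
  fixes W :: "'a::euclidean_space set"
  assumes "subspace W" "dim W = 0"
  shows "ball_moment W 0 q = 1"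
proof -
  have W0: "W = {0}" using assms subspace_0[OF assms(1)] by auto
  interpret P: product_sigma_finite "\<lambda>_::nat. slb W" by (rule product_sigma_finite_slb[OF assms(1)])
  have "ball_moment W 0 q = (\<integral>\<^sup>+x. indicator (cball 0 1) (x 0) \<partial>Pi\<^sub>M {0::nat} (\<lambda>_. slb W))"
    unfolding ball_moment_def by simp
  also have "\<dots> = (\<integral>\<^sup>+x. indicator (cball 0 1) x \<partial>slb W)"
    by (rule P.product_nn_integral_singleton) (auto intro!: borel_measurable_indicator)
  also have "\<dots> = 1" unfolding W0 by (subst nn_integral_slb_zero) (auto intro!: borel_measurable_indicator)
  finally show ?thesis .
qed

lemma measurable_fun_upd_section:
  assumes "F \<in> measurable (Pi\<^sub>M (insert j J) (\<lambda>_. M)) N" "y \<in> space (Pi\<^sub>M J (\<lambda>_. M))"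
  shows "(\<lambda>z. F (y(j := z))) \<in> measurable M N"
proof -
  have "(\<lambda>z. y(j := z)) \<in> measurable M (Pi\<^sub>M (insert j J) (\<lambda>_. M))"
    by (rule measurable_fun_upd[where J=J]) (use assms(2) in auto)
  then show ?thesis using assms(1) by (rule measurable_compose)
qed

section \<open>The Blaschke--Petkantschin formula\<close>

text \<open>Stated for extensional tuples, the points of product spaces; the image tuple is
  restricted to the index set for the same reason.\<close>

definition isometry_invariant :: "nat \<Rightarrow> ((nat \<Rightarrow> 'a::euclidean_space) \<Rightarrow> ennreal) \<Rightarrow> bool" where
  "isometry_invariant j F \<longleftrightarrow> (\<forall>Q. linear Q \<longrightarrow> (\<forall>x y. Q x \<bullet> Q y = x \<bullet> y) \<longrightarrow>
     (\<forall>y \<in> extensional {..<j}. F (\<lambda>i\<in>{..<j}. Q (y i)) = F y))"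

text \<open>
  The linear Blaschke--Petkantschin formula for invariant integrands. By invariance the points can
  be moved into \<open>W\<close> one after the other, and each of them contributes a power of its distance from
  the span of its predecessors.
\<close>

lemma invariant_integral_restrict:
  fixes W :: "'a::euclidean_space set" and F :: "(nat \<Rightarrow> 'a) \<Rightarrow> ennreal"
  assumes W: "subspace W" "dim W < DIM('a)"
  shows "j \<le> dim W \<Longrightarrow> F \<in> borel_measurable (Pi\<^sub>M {..<j} (\<lambda>_. lborel)) \<Longrightarrow> isometry_invariant j F \<Longrightarrow>
    (\<integral>\<^sup>+y. F y \<partial>Pi\<^sub>M {..<j} (\<lambda>_. lborel))
     = (\<Prod>i<j. ennreal (omega (DIM('a) - i) / omega (dim W - i)))
       * (\<integral>\<^sup>+y. F y * ennreal (pvol j y ^ (DIM('a) - dim W)) \<partial>Pi\<^sub>M {..<j} (\<lambda>_. slb W))"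
proof (induction j arbitrary: F)
  case 0
  then show ?case by (simp add: PiM_empty nn_integral_count_space_finite)
next
  case (Suc j)
  let ?n = "DIM('a) - dim W"
  interpret PW: product_sigma_finite "\<lambda>_::nat. slb W" by (rule product_sigma_finite_slb[OF W(1)])
  have sets_eq: "sets (Pi\<^sub>M J (\<lambda>_. slb W)) = sets (Pi\<^sub>M J (\<lambda>_. lborel :: 'a measure))" for J :: "nat set"
    by (intro sets_PiM_cong) auto
  have F [measurable]: "F \<in> borel_measurable (Pi\<^sub>M (insert j {..<j}) (\<lambda>_. lborel))"
    using Suc.prems(2) by (simp add: lessThan_Suc)
  have FW [measurable]: "F \<in> borel_measurable (Pi\<^sub>M (insert j {..<j}) (\<lambda>_. slb W))"
    using F by (simp add: measurable_cong_sets[OF sets_eq refl])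
  define G where "G = (\<lambda>y. F y * ennreal (pvol (Suc j) y ^ ?n))"
  have [measurable]: "G \<in> borel_measurable (Pi\<^sub>M (insert j {..<j}) (\<lambda>_. slb W))"
  proof -
    have [measurable]: "(\<lambda>y. pvol (Suc j) y) \<in> borel_measurable (Pi\<^sub>M (insert j {..<j}) (\<lambda>_. slb W))"
      by (rule measurable_pvol, rule measurable_PiM_slb_component) auto
    show ?thesis unfolding G_def by measurable
  qed
  have inv: "F (\<lambda>i\<in>{..<Suc j}. Q (y i)) = F y"
    if "linear Q" "\<And>x y. Q x \<bullet> Q y = x \<bullet> y" "y \<in> extensional {..<Suc j}" for Q :: "'a \<Rightarrow> 'a" and y :: "nat \<Rightarrow> 'a"
    using Suc.prems(3) that unfolding isometry_invariant_def by blast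
  \<comment> \<open>Integrating out the last point leaves an isometry invariant function of the
    others, to which the induction hypothesis applies.\<close>
  define F' where "F' = (\<lambda>y. \<integral>\<^sup>+z. F (y(j := z)) \<partial>lborel)"
  have F'm: "F' \<in> borel_measurable (Pi\<^sub>M {..<j} (\<lambda>_. lborel))" unfolding F'_def by measurable
  have F'inv: "isometry_invariant j F'"
    unfolding isometry_invariant_def
  proof (intro allI impI ballI)
    fix Q :: "'a \<Rightarrow> 'a" and y :: "nat \<Rightarrow> 'a" assume Q: "linear Q" "\<forall>x y. Q x \<bullet> Q y = x \<bullet> y" and y: "y \<in> extensional {..<j}"
    have ysp: "(\<lambda>i\<in>{..<j}. Q (y i)) \<in> space (Pi\<^sub>M {..<j} (\<lambda>_. lborel :: 'a measure))" by (simp add: space_PiM)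
    have m: "(\<lambda>z. F ((\<lambda>i\<in>{..<j}. Q (y i))(j := z))) \<in> borel_measurable borel"
      by (rule measurable_fun_upd_section[OF F ysp, unfolded measurable_cong_sets[OF sets_lborel refl]])
    have "F' (\<lambda>i\<in>{..<j}. Q (y i)) = (\<integral>\<^sup>+z. F ((\<lambda>i\<in>{..<j}. Q (y i))(j := Q z)) \<partial>lborel)"
      unfolding F'_def by (rule nn_integral_lborel_isometry[OF Q(1) Q(2)[rule_format] m, symmetric])
    also have "\<dots> = F' y" unfolding F'_def
    proof (rule nn_integral_cong)
      fix z
      have "(\<lambda>i\<in>{..<j}. Q (y i))(j := Q z) = (\<lambda>i\<in>{..<Suc j}. Q ((y(j := z)) i))"
        by (auto simp: fun_eq_iff)
      then show "F ((\<lambda>i\<in>{..<j}. Q (y i))(j := Q z)) = F (y(j := z))"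
        using inv[of Q "y(j := z)"] Q y by (auto simp: extensional_def)
    qed
    finally show "F' (\<lambda>i\<in>{..<j}. Q (y i)) = F' y" .
  qed
  let ?c = "ennreal (omega (DIM('a) - j) / omega (dim W - j))"
  have step: "F' y * ennreal (pvol j y ^ ?n)
      = ?c * (\<integral>\<^sup>+z. F (y(j := z)) * ennreal (pvol (Suc j) (y(j := z)) ^ ?n) \<partial>slb W)"
    if ysp: "y \<in> space (Pi\<^sub>M {..<j} (\<lambda>_. slb W))" and yW: "\<forall>i\<in>{..<j}. y i \<in> W" for y
  proof -
    have pv: "pvol (Suc j) (y(j := z)) = pvol j y * norm (perp y j z)" for z
    proof -
      have "pvol j (y(j := z)) = pvol j y" "perp (y(j := z)) j z = perp y j z"
        by (auto intro!: pvol_cong perp_cong)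
      then show ?thesis by (simp add: pvol_Suc)
    qed
    show ?thesis
    proof (cases "pvol j y = 0")
      case True
      \<comment> \<open>Since \<open>W\<close> is a proper subspace the exponent \<open>?n\<close>
        is positive, and the power of the vanishing volume is 0 on both sides.\<close>
      then show ?thesis using W(2) by (simp add: pv power_0_left)
    next
      case False
      then have pos: "pvol j y > 0" using pvol_nonneg[of j y] by linarith
      define V where "V = span (y ` {..<j})"
      have V: "subspace V" "V \<subseteq> W" "dim V = j"
      proof -
        have "y ` {..<j} \<subseteq> W" using yW by auto
        then show "V \<subseteq> W" unfolding V_def by (rule span_minimal[OF _ W(1)])
        show "dim V = j" unfolding V_def by (rule dim_span_pvol[OF pos])
      qed (simp add: V_def)
      obtain u where u: "norm u = 1" "\<And>v. v \<in> V \<Longrightarrow> u \<bullet> v = 0"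
      proof -
        have "dim (orth_in UNIV V) > 0"
          using Suc.prems(1) W(2) by (subst dim_orth_in) (simp_all add: V dim_UNIV)
        then have "\<not> orth_in UNIV V \<subseteq> {0}" by (metis dim_eq_0 less_irrefl)
        then obtain x where x: "x \<in> orth_in UNIV V" "x \<noteq> 0" by blast
        then show thesis
          by (intro that[of "x /\<^sub>R norm x"]) (auto simp: orth_in_def)
      qed
      define g where "g = (\<lambda>v h. F (y(j := v + h *\<^sub>R u)))"
      have ysp': "y \<in> space (Pi\<^sub>M {..<j} (\<lambda>_. lborel))" using ysp by (simp add: space_PiM)
      have yext: "y \<in> extensional {..<j}" using ysp by (simp add: space_PiM PiE_iff)
      have gm: "case_prod g \<in> borel_measurable (borel \<Otimes>\<^sub>M borel)"
      proof -
        have [measurable]: "(\<lambda>z. F (y(j := z))) \<in> borel_measurable borel"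
          using measurable_fun_upd_section[OF F ysp'] by simp
        show ?thesis unfolding g_def by measurable
      qed
      \<comment> \<open>With \<open>u\<close> a fixed unit normal of \<open>V\<close>, the
        reflection taking \<open>z - proj V z\<close> to a multiple of \<open>u\<close> fixes
        \<open>V\<close>, hence all earlier points. By invariance \<open>F\<close> sees of
        \<open>z\<close> only its projection to \<open>V\<close> and its distance from
        \<open>V\<close>.\<close>
      have Fg: "F (y(j := z)) = g (proj V z) (norm (z - proj V z))" for z
      proof -
        define a where "a = z - proj V z"
        define b where "b = norm a *\<^sub>R u"
        define R where "R = householder (a - b)"
        have Rab: "R a = b" unfolding R_def by (rule householder_swap) (simp add: b_def u)
        have RV: "R v = v" if "v \<in> V" for v
          unfolding R_def using that u(2)[OF that] proj_orth[OF V(1) that, of z]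
          by (intro householder_fix) (simp add: a_def b_def inner_diff_right inner_commute)
        have "R z = R (proj V z) + R a"
          unfolding R_def by (simp add: linear_add[OF linear_householder, symmetric] a_def)
        then have Rz: "R z = proj V z + norm a *\<^sub>R u"
          by (simp add: RV proj_in V Rab b_def)
        have "F (y(j := z)) = F (\<lambda>i\<in>{..<Suc j}. R ((y(j := z)) i))"
          unfolding R_def using yext
          by (intro inv[symmetric] linear_householder inner_householder) (auto simp: extensional_def)
        also have "(\<lambda>i\<in>{..<Suc j}. R ((y(j := z)) i)) = y(j := R z)"
        proof
          fix i show "(\<lambda>i\<in>{..<Suc j}. R ((y(j := z)) i)) i = (y(j := R z)) i"
            using yext by (cases "i < j") (auto simp: extensional_def V_def intro!: RV span_base)
        qed
        finally show ?thesis unfolding g_def Rz a_def .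
      qed
      have "F' y = (\<integral>\<^sup>+z. g (proj V z) (norm (z - proj V z)) \<partial>slb UNIV)"
        unfolding F'_def Fg by simp
      also have "\<dots> = ennreal (omega (dim (UNIV::'a set) - dim V) / omega (dim W - dim V))
          * (\<integral>\<^sup>+z. g (proj V z) (norm (z - proj V z)) * ennreal (norm (z - proj V z) ^ (dim (UNIV::'a set) - dim W)) \<partial>slb W)"
        using Suc.prems(1) by (intro nn_integral_slb_restrict subspace_UNIV W V gm) (auto simp: V)
      also have "\<dots> = ?c * (\<integral>\<^sup>+z. F (y(j := z)) * ennreal (norm (perp y j z) ^ ?n) \<partial>slb W)"
        by (simp only: V(3) dim_UNIV Fg perp_eq_proj V_def[symmetric])
      finally have "F' y * ennreal (pvol j y ^ ?n) = ?c * ((\<integral>\<^sup>+z. F (y(j := z)) * ennreal (norm (perp y j z) ^ ?n) \<partial>slb W) * ennreal (pvol j y ^ ?n))"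
        by (simp add: mult_ac)
      also have "(\<integral>\<^sup>+z. F (y(j := z)) * ennreal (norm (perp y j z) ^ ?n) \<partial>slb W) * ennreal (pvol j y ^ ?n)
        = (\<integral>\<^sup>+z. F (y(j := z)) * ennreal (pvol (Suc j) (y(j := z)) ^ ?n) \<partial>slb W)"
      proof -
        have "(\<lambda>z. F (y(j := z))) \<in> borel_measurable (slb W)"
          by (rule measurable_fun_upd_section[OF FW ysp])
        then show ?thesis unfolding pv
          by (subst nn_integral_multc[symmetric], measurable)
            (simp add: power_mult_distrib ennreal_mult mult_ac)
      qed
      finally show ?thesis .
    qed
  qed
  have "(\<integral>\<^sup>+y. F y \<partial>Pi\<^sub>M {..<Suc j} (\<lambda>_. lborel)) = (\<integral>\<^sup>+y. F' y \<partial>Pi\<^sub>M {..<j} (\<lambda>_. lborel))"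
    unfolding F'_def lessThan_Suc by (rule lborel_product.product_nn_integral_insert) auto
  also have "\<dots> = (\<Prod>i<j. ennreal (omega (DIM('a) - i) / omega (dim W - i)))
       * (\<integral>\<^sup>+y. F' y * ennreal (pvol j y ^ ?n) \<partial>Pi\<^sub>M {..<j} (\<lambda>_. slb W))"
    using Suc.prems by (intro Suc.IH F'm F'inv) auto
  also have "(\<integral>\<^sup>+y. F' y * ennreal (pvol j y ^ ?n) \<partial>Pi\<^sub>M {..<j} (\<lambda>_. slb W))
     = (\<integral>\<^sup>+y. ?c * (\<integral>\<^sup>+z. G (y(j := z)) \<partial>slb W) \<partial>Pi\<^sub>M {..<j} (\<lambda>_. slb W))"
    unfolding G_def by (rule nn_integral_cong_AE, rule AE_mp[OF AE_PiM_slb[OF W(1)]], simp, intro AE_I2 impI step)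
  also have "\<dots> = ?c * (\<integral>\<^sup>+y. \<integral>\<^sup>+z. G (y(j := z)) \<partial>slb W \<partial>Pi\<^sub>M {..<j} (\<lambda>_. slb W))"
    by (rule nn_integral_cmult) measurable
  also have "(\<integral>\<^sup>+y. \<integral>\<^sup>+z. G (y(j := z)) \<partial>slb W \<partial>Pi\<^sub>M {..<j} (\<lambda>_. slb W))
    = (\<integral>\<^sup>+y. G y \<partial>Pi\<^sub>M {..<Suc j} (\<lambda>_. slb W))"
    unfolding lessThan_Suc by (rule PW.product_nn_integral_insert[symmetric]) auto
  also note G_def
  finally show ?case by (simp add: mult_ac)
qed

theorem invariant_integral_subspace:
  fixes W :: "'a::euclidean_space set" and F :: "(nat \<Rightarrow> 'a) \<Rightarrow> ennreal"
  assumes W: "subspace W" "dim W = k"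
    and F: "F \<in> borel_measurable (Pi\<^sub>M {..<k} (\<lambda>_. lborel))" "isometry_invariant k F"
  shows "(\<integral>\<^sup>+y. F y \<partial>Pi\<^sub>M {..<k} (\<lambda>_. lborel))
     = ennreal (b_coeff DIM('a) k) * (\<integral>\<^sup>+y. F y * ennreal (pvol k y ^ (DIM('a) - k)) \<partial>Pi\<^sub>M {..<k} (\<lambda>_. slb W))"
proof -
  have kd: "k \<le> DIM('a)" using dim_subset_UNIV[of W] W by simp
  have b: "(\<Prod>i<k. ennreal (omega (DIM('a) - i) / omega (k - i))) = ennreal (b_coeff DIM('a) k)"
  proof -
    have "(\<Prod>i<k. ennreal (omega (DIM('a) - i) / omega (k - i))) = (\<Prod>i=1..k. ennreal (omega (real DIM('a) - real k + real i) / omega i))"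
      by (rule prod.reindex_bij_witness[of _ "\<lambda>j. k - j" "\<lambda>i. k - i"])
        (use kd in \<open>auto simp: of_nat_diff\<close>)
    also have "\<dots> = ennreal (\<Prod>i=1..k. omega (real DIM('a) - real k + real i) / omega i)"
      using kd by (intro prod_ennreal divide_nonneg_nonneg less_imp_le omega_pos) auto
    finally show ?thesis by (simp add: b_coeff_def prod_dividef)
  qed
  show ?thesis
  \<comment> \<open>In full dimension \<open>W\<close> is the whole space, the exponent of
    \<open>pvol\<close> is 0 and \<open>b_coeff\<close> is 1.\<close>
  proof (cases "k = DIM('a)")
    case True
    then have "W = UNIV" using W by (metis dim_eq_full span_eq_iff)
    moreover have "b_coeff DIM('a) k = 1"
    proof -
      have "omega (real i) \<noteq> 0" if "i \<in> {Suc 0..DIM('a)}" for i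
        using that omega_pos[of "real i"] by simp
      then show ?thesis using True by (simp add: b_coeff_def)
    qed
    ultimately show ?thesis using True by simp
  next
    case False
    then show ?thesis
      using invariant_integral_restrict[OF W(1), of k F] kd F b W by simp
  qed
qed

section \<open>Volumes in flats\<close>

lemma emeasure_slb_bounded:
  assumes W: "subspace W" and S: "bounded S"
  shows "emeasure (slb W) S < \<infinity>"
proof (cases "S \<in> sets borel")
  case True
  obtain R where R: "\<And>x. x \<in> S \<Longrightarrow> norm x \<le> R" using S by (auto simp: bounded_iff)
  have "emeasure (slb W) S = (\<integral>\<^sup>+x. indicator S x \<partial>slb W)" using True by simp
  also have "\<dots> \<le> (\<integral>\<^sup>+x. ennreal (exp (pi * R\<^sup>2)) * gauss x \<partial>slb W)"
  proof (intro nn_integral_mono)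
    fix x :: 'a
    have "1 \<le> exp (pi * R\<^sup>2) * exp (- pi * (norm x)\<^sup>2)" if "norm x \<le> R"
      using that by (simp add: exp_add[symmetric] power_mono)
    then show "indicator S x \<le> ennreal (exp (pi * R\<^sup>2)) * gauss x"
      using R by (auto simp: indicator_def gauss_def ennreal_mult[symmetric] ennreal_1[symmetric]
          simp del: ennreal_1 intro!: ennreal_leI)
  qed
  also have "\<dots> = ennreal (exp (pi * R\<^sup>2))"
    by (subst nn_integral_cmult) (auto simp: nn_integral_slb_gauss W)
  finally show ?thesis by (simp add: order_le_less_trans[OF _ ennreal_less_top])
qed (simp add: emeasure_notin_sets)

lemma emeasure_slb_subspace:
  assumes L: "subspace L" and V: "subspace V" "V \<subseteq> L" "dim V < dim L"
  shows "emeasure (slb L) V = 0"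
proof -
  have [measurable]: "V \<in> sets borel" by (intro borel_closed closed_subspace V)
  have "z \<in> V \<longleftrightarrow> norm (z - proj V z) = 0" for z
    using proj_in[OF V(1), of z] V(1) by auto
  then have ind: "indicator V z = (indicator {0} (norm (z - proj V z)) :: ennreal)" for z
    by (simp add: indicator_def)
  have "emeasure (slb L) V = (\<integral>\<^sup>+z. indicator {0} (norm (z - proj V z)) \<partial>slb L)"
    unfolding ind[symmetric] by simp
  also have "\<dots> = ennreal (omega (dim L - dim V)) * (\<integral>\<^sup>+v. radial (dim L - dim V) (indicator {0}) \<partial>slb V)"
    by (rule nn_integral_slb_cylinder[OF L V, where g="\<lambda>_. indicator {0}"]) measurable
  also have "radial (dim L - dim V) (indicator {0}) = 0"
    unfolding radial_def by (subst nn_integral_0_iff_AE) (auto simp: indicator_def)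
  finally show ?thesis by simp
qed

lemma emeasure_slb_translate:
  assumes L: "subspace L" and S: "S \<in> sets borel" and w: "w - u \<in> L"
  shows "emeasure (slb L) {x. u + x \<in> S} = emeasure (slb L) {x. w + x \<in> S}"
proof -
  note [measurable] = S
  have eq: "emeasure (slb L) {x. a + x \<in> S} = (\<integral>\<^sup>+x. indicator S (a + x) \<partial>slb L)" for a
  proof -
    have "{x. a + x \<in> S} \<in> sets borel" by measurable
    moreover have "indicator S (a + x) = (indicator {x. a + x \<in> S} x :: ennreal)" for x by (simp add: indicator_def)
    ultimately show ?thesis by simp
  qed
  have "(\<integral>\<^sup>+x. indicator S (u + (x + (w - u))) \<partial>slb L) = (\<integral>\<^sup>+x. indicator S (u + x) \<partial>slb L)"
    by (rule nn_integral_slb_shift[OF L w, where f="\<lambda>x. indicator S (u + x)"]) measurable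
  then show ?thesis unfolding eq by (simp add: algebra_simps)
qed

text \<open>Seen from a common point of \<open>S\<close>, either the direction spaces agree and only
  a translation is involved, or \<open>S\<close> lies in their intersection, which is null in both.
  This makes the arbitrary choice of the flat in \<open>k_volume\<close> harmless.\<close>

lemma emeasure_slb_flat_unique:
  assumes L: "subspace L" "dim L = k" "S \<subseteq> (\<lambda>x. u + x) ` L"
    and L': "subspace L'" "dim L' = k" "S \<subseteq> (\<lambda>x. u' + x) ` L'" and S: "S \<in> sets borel"
  shows "emeasure (slb L) {x. u + x \<in> S} = emeasure (slb L') {x. u' + x \<in> S}"
proof (cases "S = {}")
  case False
  then obtain s where s: "s \<in> S" by auto
  have "s - u \<in> L" "s - u' \<in> L'" using s L L' by auto
  then have 1: "emeasure (slb L) {x. u + x \<in> S} = emeasure (slb L) {x. s + x \<in> S}"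
    "emeasure (slb L') {x. u' + x \<in> S} = emeasure (slb L') {x. s + x \<in> S}"
    by (auto intro!: emeasure_slb_translate L L' S)
  have sub: "{x. s + x \<in> S} \<subseteq> L \<inter> L'"
  proof
    fix x assume "x \<in> {x. s + x \<in> S}"
    then have "(s + x) - u \<in> L" "(s + x) - u' \<in> L'" using L L' by auto
    then have "((s + x) - u) - (s - u) \<in> L" "((s + x) - u') - (s - u') \<in> L'"
      using \<open>s - u \<in> L\<close> \<open>s - u' \<in> L'\<close> by (simp_all only: subspace_diff[OF L(1)] subspace_diff[OF L'(1)])
    moreover have "((s + x) - a) - (s - a) = x" for a by simp
    ultimately show "x \<in> L \<inter> L'" by simp
  qed
  show ?thesis
  proof (cases "L = L'")
    case False
    have I: "subspace (L \<inter> L')" using L L' by (simp add: subspace_inter)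
    have "dim (L \<inter> L') < k"
    proof (rule ccontr)
      assume "\<not> dim (L \<inter> L') < k"
      then have "dim L \<le> dim (L \<inter> L')" "dim L' \<le> dim (L \<inter> L')" using L(2) L'(2) by simp_all
      then have "L \<inter> L' = L" "L \<inter> L' = L'"
        using subspace_dim_equal[OF I L(1) Int_lower1] subspace_dim_equal[OF I L'(1) Int_lower2] by blast+
      then show False using False by simp
    qed
    then have "emeasure (slb L) (L \<inter> L') = 0" "emeasure (slb L') (L \<inter> L') = 0"
      using L L' I by (auto intro!: emeasure_slb_subspace)
    moreover have "L \<inter> L' \<in> sets borel" by (intro borel_closed closed_subspace I)
    ultimately have "emeasure (slb L) {x. s + x \<in> S} = 0" "emeasure (slb L') {x. s + x \<in> S} = 0"
      using sub by (metis emeasure_mono le_zero_eq sets_slb)+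
    then show ?thesis by (simp add: 1)
  next
    case True
    then show ?thesis using 1 by simp
  qed
qed simp

lemma lincomb_in_span: "lincomb k y t \<in> span (y ` {..<k})"
  unfolding lincomb_def by (intro span_sum span_mul span_base) auto

lemma orthonormal_expansion:
  fixes b :: "nat \<Rightarrow> 'a::euclidean_space"
  assumes b: "\<And>i j. i < k \<Longrightarrow> j < k \<Longrightarrow> b i \<bullet> b j = (if i = j then 1 else 0)" and x: "x \<in> span (b ` {..<k})"
  shows "x = lincomb k b (\<lambda>i. x \<bullet> b i)"
proof -
  let ?y = "lincomb k b (\<lambda>i. x \<bullet> b i)"
  have "perp b k (x - ?y) = 0"
    unfolding perp_zero_iff by (intro span_diff x lincomb_in_span)
  moreover have "perp b k (x - ?y) = x - ?y"
  proof (rule perp_eqI)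
    fix i assume i: "i < k"
    have "?y \<bullet> b i = (\<Sum>j<k. if i = j then x \<bullet> b j else 0)"
      unfolding lincomb_def inner_sum_left by (intro sum.cong refl) (auto simp: b i)
    then show "(x - ?y) \<bullet> b i = 0" using i by (simp add: inner_diff_left)
  qed (simp add: span_zero)
  ultimately show ?thesis by simp
qed

text \<open>The orthonormal directions chosen in \<open>k_volume\<close> have \<open>pvol\<close>
  equal to 1, so the chosen coordinates carry \<open>slb\<close> of their span; uniqueness moves the
  value to the flat at hand. Boundedness makes the measure finite, so that \<open>measure\<close>
  loses nothing.\<close>

lemma k_volume_eq_slb:
  fixes L :: "(real^'n) set"
  assumes L: "subspace L" "dim L = k" and S: "S \<subseteq> (\<lambda>x. u + x) ` L" "S \<in> sets borel" "bounded S"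
  shows "ennreal (k_volume k S) = emeasure (slb L) {x. u + x \<in> S}"
proof -
  let ?M = "\<Pi>\<^sub>M i\<in>{..<k}. (lborel :: real measure)"
  let ?P = "\<lambda>(a, b). orthonormal_family k b \<and> S \<subseteq> range (flat_point k a b)"
  have "\<exists>ab. ?P ab"
  proof -
    obtain b where b: "\<And>i j. i < k \<Longrightarrow> j < k \<Longrightarrow> b i \<bullet> b j = (if i = j then 1 else 0)"
      "span (b ` {..<k}) = L"
      using orthonormal_enumeration[OF L] by metis
    have "S \<subseteq> range (flat_point k u b)"
    proof
      fix s assume "s \<in> S"
      then obtain x where x: "x \<in> L" "s = u + x" using S by auto
      then have "s = flat_point k u b (\<lambda>i. x \<bullet> b i)"
        using orthonormal_expansion[OF b(1), where x=x] b(2) by (simp add: flat_point_def lincomb_def)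
      then show "s \<in> range (flat_point k u b)" by blast
    qed
    then have "?P (u, b)" using b(1) by (auto simp: orthonormal_family_def)
    then show ?thesis by blast
  qed
  then have "?P (SOME ab. ?P ab)" by (rule someI_ex)
  then obtain a b where ab: "(SOME ab. ?P ab) = (a, b)" "orthonormal_family k b" "S \<subseteq> range (flat_point k a b)"
    by (metis (mono_tags, lifting) case_prodE)
  define L' where "L' = span (b ` {..<k})"
  have fp: "flat_point k a b t = a + lincomb k b t" for t by (simp add: flat_point_def lincomb_def)
  have pb: "pvol k b = 1" using ab(2) by (intro orthonormal_pvol) (auto simp: orthonormal_family_def)
  have L': "subspace L'" "dim L' = k" "S \<subseteq> (\<lambda>x. a + x) ` L'"
    using dim_span_pvol[of k b] pb ab(3) by (auto simp: L'_def fp lincomb_in_span)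
  note [measurable] = S(2)
  have meas: "{t \<in> space ?M. flat_point k a b t \<in> S} \<in> sets ?M"
    unfolding fp by measurable
  have "emeasure ?M {t \<in> space ?M. flat_point k a b t \<in> S} = (\<integral>\<^sup>+t. indicator {t \<in> space ?M. flat_point k a b t \<in> S} t \<partial>?M)"
    using meas by simp
  also have "\<dots> = (\<integral>\<^sup>+t. indicator S (a + lincomb k b t) \<partial>?M)"
    by (intro nn_integral_cong) (simp add: indicator_def fp)
  also have "\<dots> = (\<integral>\<^sup>+x. indicator S (a + x) \<partial>slb L')"
    using nn_integral_slb_span[of k b "\<lambda>x. indicator S (a + x)"] by (simp add: pb L'_def)
  also have "\<dots> = (\<integral>\<^sup>+x. indicator {x. a + x \<in> S} x \<partial>slb L')"
    by (intro nn_integral_cong) (simp add: indicator_def)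
  also have "\<dots> = emeasure (slb L') {x. a + x \<in> S}"
    by (rule nn_integral_indicator) simp
  also have "\<dots> = emeasure (slb L) {x. u + x \<in> S}"
    by (rule emeasure_slb_flat_unique[OF L' L S(1,2)])
  finally have eq: "emeasure ?M {t \<in> space ?M. flat_point k a b t \<in> S} = emeasure (slb L) {x. u + x \<in> S}" .
  have "{x. u + x \<in> S} = (\<lambda>x. - u + x) ` S" by (auto simp: image_iff algebra_simps intro!: bexI[of _ "u + _"])
  then have "bounded {x. u + x \<in> S}" using bounded_translation[OF S(3), of "- u"] by simp
  then have fin: "emeasure (slb L) {x. u + x \<in> S} < \<infinity>"
    by (intro emeasure_slb_bounded L)
  have "k_volume k S = measure ?M {t \<in> space ?M. flat_point k a b t \<in> S}"
    unfolding k_volume_def ab(1) by simp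
  then show ?thesis using fin eq by (simp add: measure_def)
qed

section \<open>Volumes of simplices\<close>

lemma extend_subspace:
  fixes V :: "'a::euclidean_space set"
  assumes "subspace V" "dim V \<le> k" "k \<le> DIM('a)"
  obtains L where "subspace L" "V \<subseteq> L" "dim L = k"
proof -
  have "k \<le> DIM('a) \<longrightarrow> (\<exists>L. subspace L \<and> V \<subseteq> L \<and> dim L = k)"
    using assms(2)
  proof (induction k rule: dec_induct)
    case base
    then show ?case using assms(1) by blast
  next
    case (step m)
    show ?case
    proof
      assume m: "Suc m \<le> DIM('a)"
      then obtain L where L: "subspace L" "V \<subseteq> L" "dim L = m" using step by auto
      have "L \<noteq> UNIV" using L(3) m by (metis dim_UNIV Suc_n_not_le_n)
      then obtain a where a: "a \<notin> L" by blast
      have "dim (span (insert a L)) = Suc m"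
        using a L by (simp add: dim_insert span_eq_iff[THEN iffD2])
      moreover have "V \<subseteq> span (insert a L)" using L(2) span_superset[of "insert a L"] by auto
      ultimately show "\<exists>L. subspace L \<and> V \<subseteq> L \<and> dim L = Suc m" by blast
    qed
  qed
  then show thesis using assms(3) that by blast
qed

lemma lincomb_zero:
  fixes y :: "nat \<Rightarrow> 'a::euclidean_space"
  assumes "pvol k y > 0" "lincomb k y t = 0" "i < k"
  shows "t i = 0"
  using assms
proof (induction k)
  case (Suc k)
  have eq: "t k *\<^sub>R y k = - lincomb k y t"
    using Suc.prems(2) by (simp add: lincomb_def add_eq_0_iff)
  have pos: "pvol k y > 0" and nin: "y k \<notin> span (y ` {..<k})" using Suc.prems(1) by (auto simp: pvol_pos_iff)
  have tk: "t k = 0"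
  proof (rule ccontr)
    assume "t k \<noteq> 0"
    then have "y k = (1 / t k) *\<^sub>R (t k *\<^sub>R y k)" by simp
    also have "\<dots> \<in> span (y ` {..<k})" unfolding eq by (intro span_mul span_neg lincomb_in_span)
    finally show False using nin by simp
  qed
  moreover have "lincomb k y t = 0" using eq tk by simp
  ultimately show ?case using Suc.IH[OF pos] Suc.prems(3) by (cases "i = k") auto
qed simp

lemma convex_hull_edges:
  fixes x :: "nat \<Rightarrow> 'a::real_vector"
  shows "convex hull (x ` {..k}) = {x k + lincomb k (edges k x) t | t. (\<forall>i<k. 0 \<le> t i) \<and> sum t {..<k} \<le> 1}" (is "?H = ?C")
proof (rule antisym)
  have "convex ?C"
  proof (rule convexI)
    fix p q u v :: _ assume pq: "p \<in> ?C" "q \<in> ?C" and uv: "(0::real) \<le> u" "0 \<le> v" "u + v = 1"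
    obtain s where s: "p = x k + lincomb k (edges k x) s" "\<forall>i<k. 0 \<le> s i" "sum s {..<k} \<le> 1" using pq by auto
    obtain t where t: "q = x k + lincomb k (edges k x) t" "\<forall>i<k. 0 \<le> t i" "sum t {..<k} \<le> 1" using pq by auto
    have "u *\<^sub>R x k + v *\<^sub>R x k = x k" using uv by (simp add: scaleR_left_distrib[symmetric])
    have lin: "u *\<^sub>R lincomb k y s + v *\<^sub>R lincomb k y t = lincomb k y (\<lambda>i. u * s i + v * t i)"
      for y :: "nat \<Rightarrow> 'a"
      by (simp add: lincomb_def scaleR_left_distrib sum.distrib scaleR_sum_right)
    have "u *\<^sub>R p + v *\<^sub>R q = (u *\<^sub>R x k + v *\<^sub>R x k)
        + (u *\<^sub>R lincomb k (edges k x) s + v *\<^sub>R lincomb k (edges k x) t)"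
      unfolding s(1) t(1) scaleR_right_distrib by (simp only: ac_simps)
    then have "u *\<^sub>R p + v *\<^sub>R q = x k + lincomb k (edges k x) (\<lambda>i. u * s i + v * t i)"
      unfolding lin \<open>u *\<^sub>R x k + v *\<^sub>R x k = x k\<close> .
    moreover have "(\<Sum>i<k. u * s i + v * t i) \<le> 1"
    proof -
      have "(\<Sum>i<k. u * s i + v * t i) = u * sum s {..<k} + v * sum t {..<k}"
        by (simp add: sum.distrib sum_distrib_left)
      also have "\<dots> \<le> u * 1 + v * 1" using uv s t by (intro add_mono mult_left_mono) auto
      finally show ?thesis using uv by simp
    qed
    ultimately show "u *\<^sub>R p + v *\<^sub>R q \<in> ?C" using s t uv
      by (auto intro!: exI[of _ "\<lambda>i. u * s i + v * t i"])
  qed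
  moreover have "x i \<in> ?C" if "i \<le> k" for i
  proof (cases "i = k")
    case True then show ?thesis by (auto intro!: exI[of _ "\<lambda>_. 0"] simp: lincomb_def)
  next
    case False
    then have "i < k" using that by simp
    have "lincomb k (edges k x) (\<lambda>j. if j = i then 1 else 0) = (\<Sum>j<k. if j = i then edges k x j else 0)"
      unfolding lincomb_def by (intro sum.cong) auto
    also have "\<dots> = x i - x k" using \<open>i < k\<close> by simp
    finally have "x i = x k + lincomb k (edges k x) (\<lambda>j. if j = i then 1 else 0)" by simp
    then show ?thesis using \<open>i < k\<close> by (auto intro!: exI[of _ "\<lambda>j. if j = i then 1 else 0"])
  qed
  ultimately show "?H \<subseteq> ?C" by (intro hull_minimal) auto
next
  show "?C \<subseteq> ?H"
  proof
    fix p assume "p \<in> ?C"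
    then obtain t where t: "p = x k + lincomb k (edges k x) t" "\<forall>i<k. 0 \<le> t i" "sum t {..<k} \<le> 1" by auto
    define c where "c = (\<lambda>i. if i = k then 1 - sum t {..<k} else t i)"
    have "p = (\<Sum>i\<le>k. c i *\<^sub>R x i)"
    proof -
      have f1: "lincomb k (edges k x) t = (\<Sum>i<k. t i *\<^sub>R x i) - (\<Sum>i<k. t i) *\<^sub>R x k"
        by (simp add: lincomb_def scaleR_right_diff_distrib sum_subtractf scaleR_left.sum)
      have f2: "(\<Sum>i\<le>k. c i *\<^sub>R x i) = (\<Sum>i<k. t i *\<^sub>R x i) + (1 - sum t {..<k}) *\<^sub>R x k"
        by (simp add: lessThan_Suc_atMost[symmetric] c_def)
      show ?thesis unfolding t(1) f1 f2 by (simp add: scaleR_left_diff_distrib)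
    qed
    also have "\<dots> \<in> ?H"
    proof (rule convex_sum)
      show "(\<Sum>i\<le>k. c i) = 1" by (simp add: lessThan_Suc_atMost[symmetric] c_def)
      show "0 \<le> c i" if "i \<in> {..k}" for i using that t by (auto simp: c_def)
      show "x i \<in> convex hull (x ` {..k})" if "i \<in> {..k}" for i using that by (intro hull_inc) auto
    qed auto
    finally show "p \<in> ?H" .
  qed
qed

text \<open>In edge coordinates a nondegenerate simplex is the standard simplex, of volume
  \<open>1 / fact k\<close>, and the Jacobian of these coordinates is \<open>pvol\<close>.\<close>

lemma k_volume_simplex:
  fixes x :: "nat \<Rightarrow> real^'n"
  assumes k: "k \<le> CARD('n)"
  shows "k_volume k (convex hull (x ` {..k})) = pvol k (edges k x) / fact k"
proof -
  let ?S = "convex hull (x ` {..k})" and ?y = "edges k x" and ?M = "Pi\<^sub>M {..<k} (\<lambda>_. lborel :: real measure)"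
  let ?V = "span (?y ` {..<k})"
  let ?T = "{t. (\<forall>i\<in>{..<k}. 0 \<le> t i) \<and> sum t {..<k} \<le> (1::real)}"
  have S: "compact ?S" by (simp add: finite_imp_compact_convex_hull)
  then have Sb: "?S \<in> sets borel" "bounded ?S" by (auto intro: borel_compact compact_imp_bounded)
  note [measurable] = Sb(1)
  have SV: "?S \<subseteq> (\<lambda>v. x k + v) ` ?V" unfolding convex_hull_edges by (auto simp: lincomb_in_span)
  have kv: "k_volume k ?S \<ge> 0" by (simp add: k_volume_def case_prod_unfold)
  have "ennreal (k_volume k ?S) = ennreal (pvol k ?y / fact k)"
  proof (cases "pvol k ?y = 0")
    case True
    then have d: "dim ?V < k" by (rule dim_span_less_pvol_zero)
    \<comment> \<open>A degenerate simplex is null in any \<open>k\<close>-flat that contains it;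
      such a flat exists because \<open>k\<close> is at most the dimension of the space.\<close>
    obtain L where L: "subspace L" "?V \<subseteq> L" "dim L = k"
      using extend_subspace[of ?V k] d k by auto
    have "ennreal (k_volume k ?S) = emeasure (slb L) {v. x k + v \<in> ?S}"
      using SV L by (intro k_volume_eq_slb Sb) auto
    also have "\<dots> \<le> emeasure (slb L) ?V"
      using SV by (intro emeasure_mono) (auto intro!: borel_closed closed_subspace)
    also have "\<dots> = 0" using L d by (intro emeasure_slb_subspace) auto
    finally show ?thesis using True by simp
  next
    case False
    then have pos: "pvol k ?y > 0" using pvol_nonneg[of k ?y] by linarith
    have "ennreal (k_volume k ?S) = emeasure (slb ?V) {v. x k + v \<in> ?S}"
      using SV dim_span_pvol[OF pos] by (intro k_volume_eq_slb Sb) auto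
    also have "\<dots> = (\<integral>\<^sup>+v. indicator {v. x k + v \<in> ?S} v \<partial>slb ?V)"
      by (rule nn_integral_indicator[symmetric]) simp
    also have "\<dots> = (\<integral>\<^sup>+v. indicator ?S (x k + v) \<partial>slb ?V)"
      by (intro nn_integral_cong) (simp add: indicator_def)
    also have "\<dots> = ennreal (pvol k ?y) * (\<integral>\<^sup>+t. indicator ?S (x k + lincomb k ?y t) \<partial>?M)"
      by (rule nn_integral_slb_span[OF pos, symmetric]) measurable
    also have "(\<integral>\<^sup>+t. indicator ?S (x k + lincomb k ?y t) \<partial>?M) = (\<integral>\<^sup>+t. indicator (?T \<inter> space ?M) t \<partial>?M)"
    proof (rule nn_integral_cong)
      fix t assume t: "t \<in> space ?M"
      have "x k + lincomb k ?y t \<in> ?S \<longleftrightarrow> t \<in> ?T"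
      proof
        assume "x k + lincomb k ?y t \<in> ?S"
        then obtain s where s: "lincomb k ?y t = lincomb k ?y s" "\<forall>i<k. 0 \<le> s i" "sum s {..<k} \<le> 1"
          unfolding convex_hull_edges by auto
        have "lincomb k ?y (\<lambda>i. t i - s i) = 0"
          using s(1) by (simp add: lincomb_def scaleR_left_diff_distrib sum_subtractf)
        then have "t i = s i" if "i < k" for i using lincomb_zero[OF pos _ that] by fastforce
        then show "t \<in> ?T" using s by auto
      qed (auto simp: convex_hull_edges)
      then show "indicator ?S (x k + lincomb k ?y t) = (indicator (?T \<inter> space ?M) t :: ennreal)"
        using t by (simp add: indicator_def)
    qed
    also have "\<dots> = emeasure ?M (?T \<inter> space ?M)"
    proof (rule nn_integral_indicator)
      have "?T \<inter> space ?M = {t \<in> space ?M. (\<forall>i\<in>{..<k}. 0 \<le> t i) \<and> sum t {..<k} \<le> (1::real)}" by auto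
      also have "\<dots> \<in> sets ?M" by measurable
      finally show "?T \<inter> space ?M \<in> sets ?M" .
    qed
    also have "\<dots> = ennreal (1 / fact k)"
      using emeasure_std_simplex_aux[of "{..<k}" 1] by simp
    finally show ?thesis by (simp add: ennreal_mult[symmetric])
  qed
  then show ?thesis using kv by simp
qed

section \<open>Random isometries\<close>

definition onb :: "(nat \<Rightarrow> 'a::euclidean_space) \<Rightarrow> bool" where
  "onb b \<longleftrightarrow> (\<forall>i<DIM('a). \<forall>j<DIM('a). b i \<bullet> b j = (if i = j then 1 else 0))"

lemma onb_span:
  fixes b :: "nat \<Rightarrow> 'a::euclidean_space"
  assumes "onb b"
  shows "span (b ` {..<DIM('a)}) = UNIV"
proof -
  have "pvol DIM('a) b = 1" using assms by (intro orthonormal_pvol) (auto simp: onb_def)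
  then have "dim (span (b ` {..<DIM('a)})) = DIM('a)" using dim_span_pvol[of "DIM('a)" b] by simp
  then show ?thesis by (metis dim_eq_full span_span)
qed

lemma onb_expansion:
  fixes b :: "nat \<Rightarrow> 'a::euclidean_space"
  assumes "onb b"
  shows "x = (\<Sum>i<DIM('a). (x \<bullet> b i) *\<^sub>R b i)"
  using orthonormal_expansion[of "DIM('a)" b x] assms onb_span[OF assms]
  by (simp add: onb_def lincomb_def)

definition frame_map :: "(nat \<Rightarrow> 'a) \<Rightarrow> (nat \<Rightarrow> 'a) \<Rightarrow> 'a::euclidean_space \<Rightarrow> 'a" where
  "frame_map e b x = (\<Sum>i<DIM('a). (x \<bullet> e i) *\<^sub>R b i)"

lemma linear_frame_map: "linear (frame_map e b)"
  by (rule linearI)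
    (simp_all add: frame_map_def inner_add_left scaleR_left_distrib sum.distrib scaleR_sum_right)

lemma inner_frame_map:
  fixes e b :: "nat \<Rightarrow> 'a::euclidean_space"
  assumes "onb e" "onb b"
  shows "frame_map e b x \<bullet> frame_map e b y = x \<bullet> y"
proof -
  have "frame_map e b x \<bullet> frame_map e b y = (\<Sum>i<DIM('a). \<Sum>j<DIM('a). (x \<bullet> e i) * (y \<bullet> e j) * (b i \<bullet> b j))"
    by (simp add: frame_map_def inner_sum_left) (simp add: inner_sum_right sum_distrib_left mult_ac)
  also have "\<dots> = (\<Sum>i<DIM('a). \<Sum>j<DIM('a). if i = j then (x \<bullet> e i) * (y \<bullet> e j) else 0)"
    using assms(2) by (intro sum.cong refl) (auto simp: onb_def)
  also have "\<dots> = (\<Sum>i<DIM('a). (x \<bullet> e i) * (y \<bullet> e i))"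
    by (intro sum.cong refl) simp
  also have "\<dots> = (\<Sum>i<DIM('a). (x \<bullet> e i) *\<^sub>R e i) \<bullet> y"
    by (simp add: inner_sum_left inner_commute[of y])
  also have "\<dots> = x \<bullet> y" using onb_expansion[OF assms(1), of x] by simp
  finally show ?thesis .
qed

lemma frame_map_frame:
  fixes e b :: "nat \<Rightarrow> 'a::euclidean_space"
  assumes "onb e" "i < DIM('a)"
  shows "frame_map e b (e i) = b i"
proof -
  have "frame_map e b (e i) = (\<Sum>j<DIM('a). if j = i then b j else 0)"
    unfolding frame_map_def using assms by (intro sum.cong refl) (auto simp: onb_def)
  then show ?thesis using assms(2) by simp
qed

lemma adapted_onb:
  fixes W :: "'a::euclidean_space set"
  assumes W: "subspace W"
  obtains b where "onb b" "span (b ` {..<dim W}) = W"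
proof -
  let ?U = "orth_in UNIV W"
  have kd: "dim W \<le> DIM('a)" by (rule dim_subset_UNIV)
  have dU: "dim ?U = DIM('a) - dim W" using W by (simp add: dim_orth_in dim_UNIV)
  obtain b1 where b1: "\<And>i j. i < dim W \<Longrightarrow> j < dim W \<Longrightarrow> b1 i \<bullet> b1 j = (if i = j then 1 else 0)"
    "span (b1 ` {..<dim W}) = W"
    using orthonormal_enumeration[OF W refl] by metis
  obtain b2 where b2: "\<And>i j. i < dim ?U \<Longrightarrow> j < dim ?U \<Longrightarrow> b2 i \<bullet> b2 j = (if i = j then 1 else 0)"
    "span (b2 ` {..<dim ?U}) = ?U"
    using orthonormal_enumeration[OF subspace_orth_in[OF subspace_UNIV] refl] by metis
  define b where "b = (\<lambda>i. if i < dim W then b1 i else b2 (i - dim W))"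
  have 1: "b1 i \<in> W" if "i < dim W" for i using that b1(2) by (auto intro: span_base)
  have 2: "b2 i \<in> ?U" if "i < dim ?U" for i using that b2(2) by (auto intro: span_base)
  have orth: "b1 i \<bullet> b2 j = 0" if "i < dim W" "j < dim ?U" for i j
    using 1[OF that(1)] 2[OF that(2)] by (auto simp: orth_in_def inner_commute)
  show thesis
  proof (rule that)
    show "onb b" unfolding onb_def
    proof (intro allI impI)
      fix i j assume ij: "i < DIM('a)" "j < DIM('a)"
      show "b i \<bullet> b j = (if i = j then 1 else 0)"
      proof (cases "i < dim W"; cases "j < dim W")
        assume "\<not> i < dim W" "\<not> j < dim W"
        then have "i - dim W < dim ?U" "j - dim W < dim ?U" "(i - dim W = j - dim W) = (i = j)"
          using ij kd dU by auto
        then show ?thesis using \<open>\<not> i < dim W\<close> \<open>\<not> j < dim W\<close> b2(1) by (simp add: b_def)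
      next
        assume a: "i < dim W" "\<not> j < dim W"
        then have "j - dim W < dim ?U" using ij kd dU by auto
        then show ?thesis using a orth by (auto simp: b_def)
      next
        assume a: "\<not> i < dim W" "j < dim W"
        then have "i - dim W < dim ?U" using ij kd dU by auto
        then show ?thesis using a orth by (auto simp: b_def inner_commute)
      qed (simp add: b_def b1)
    qed
    have "b ` {..<dim W} = b1 ` {..<dim W}" by (auto simp: b_def)
    then show "span (b ` {..<dim W}) = W" using b1(2) by simp
  qed
qed

lemma isometry_between_subspaces:
  fixes L W :: "'a::euclidean_space set"
  assumes L: "subspace L" and W: "subspace W" and d: "dim L = dim W"
  obtains R :: "'a \<Rightarrow> 'a" where "linear R" "\<And>x y. R x \<bullet> R y = x \<bullet> y" "R ` L = W"
proof -
  obtain e where e: "onb e" "span (e ` {..<dim L}) = L" using adapted_onb[OF L] .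
  obtain b where b: "onb b" "span (b ` {..<dim W}) = W" using adapted_onb[OF W] .
  have "dim L \<le> DIM('a)" by (rule dim_subset_UNIV)
  then have "(\<lambda>i. frame_map e b (e i)) ` {..<dim L} = b ` {..<dim W}"
    using frame_map_frame[OF e(1), of _ b] d by (intro image_cong) auto
  then have "frame_map e b ` L = W"
    using span_image_linear[OF linear_frame_map, of e b e "{..<dim L}"] e(2) b(2) by simp
  then show thesis
    by (intro that[of "frame_map e b"] linear_frame_map inner_frame_map e b)
qed

definition std_frame :: "nat \<Rightarrow> 'a::euclidean_space" where
  "std_frame = (SOME b. onb b)"

lemma onb_std_frame: "onb (std_frame :: nat \<Rightarrow> 'a::euclidean_space)"
proof -
  obtain b :: "nat \<Rightarrow> 'a" where "onb b" using adapted_onb[OF subspace_UNIV] by metis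
  then show ?thesis unfolding std_frame_def by (rule someI[of onb b])
qed

definition gs_frame :: "(nat \<Rightarrow> 'a::euclidean_space) \<Rightarrow> nat \<Rightarrow> 'a" where
  "gs_frame z i = perp z i (z i) /\<^sub>R norm (perp z i (z i))"

lemma onb_gs_frame:
  fixes z :: "nat \<Rightarrow> 'a::euclidean_space"
  assumes "pvol DIM('a) z > 0"
  shows "onb (gs_frame z)"
proof -
  have ne: "perp z i (z i) \<noteq> 0" if "i < DIM('a)" for i
    using assms that by (auto simp: pvol_pos_iff perp_zero_iff)
  have orth: "gs_frame z j \<bullet> gs_frame z i = 0" if "i < j" for i j
  proof -
    have "z i \<in> span (z ` {..<j})" using that by (auto intro: span_base)
    moreover have "z i - perp z i (z i) \<in> span (z ` {..<j})"
      using perp_diff_in_span[of "z i" z i] span_mono[of "z ` {..<i}" "z ` {..<j}"] that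
        image_mono[of "{..<i}" "{..<j}" z] by auto
    ultimately have "z i - (z i - perp z i (z i)) \<in> span (z ` {..<j})" by (rule span_diff)
    then have "perp z j (z j) \<bullet> perp z i (z i) = 0" by (intro perp_orth_span) simp
    then show ?thesis by (simp add: gs_frame_def)
  qed
  show ?thesis unfolding onb_def
  proof (intro allI impI)
    fix i j assume ij: "i < DIM('a)" "j < DIM('a)"
    consider "i = j" | "i < j" | "j < i" by linarith
    then show "gs_frame z i \<bullet> gs_frame z j = (if i = j then 1 else 0)"
    proof cases
      case 1
      have "norm (gs_frame z i) = 1" using ne[OF ij(1)] by (simp add: gs_frame_def)
      then show ?thesis using 1 by (simp add: norm_eq_1)
    next
      case 2 then show ?thesis using orth[OF 2] by (simp add: inner_commute)
    next
      case 3 then show ?thesis using orth[OF 3] by simp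
    qed
  qed
qed

lemma gs_frame_isometry:
  assumes R: "linear R" "\<And>x y. R x \<bullet> R y = x \<bullet> y"
  shows "gs_frame (\<lambda>i. R (z i)) i = R (gs_frame z i)"
proof -
  have "norm (R x) = norm x" for x by (simp add: norm_eq_sqrt_inner R)
  then show ?thesis by (simp add: gs_frame_def perp_isometry[OF R] linear_scale[OF R(1)])
qed

lemma gs_frame_cong: "(\<And>j. j \<le> i \<Longrightarrow> y j = z j) \<Longrightarrow> gs_frame y i = gs_frame z i"
proof -
  assume "\<And>j. j \<le> i \<Longrightarrow> y j = z j"
  then have "perp y i x = perp z i x" "y i = z i" for x by (auto intro!: perp_cong)
  then show ?thesis by (simp add: gs_frame_def)
qed

text \<open>
  A random isometry: Gram--Schmidt orthonormalisation of a tuple \<open>z\<close>. Weighting Lebesgue measure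
  on the tuples by \<open>gs_weight\<close> makes its law a multiple of Haar measure; \<open>gs_weight\<close> vanishes on
  the degenerate tuples.
\<close>

definition gs_isometry :: "(nat \<Rightarrow> 'a) \<Rightarrow> 'a::euclidean_space \<Rightarrow> 'a" where
  "gs_isometry z = frame_map (gs_frame z) std_frame"

definition gs_weight :: "(nat \<Rightarrow> 'a::euclidean_space) \<Rightarrow> ennreal" where
  "gs_weight z = (\<Prod>i<DIM('a). gauss (z i)) * ennreal (pvol DIM('a) z)"

abbreviation (input) gs_space :: "(nat \<Rightarrow> 'a::euclidean_space) measure" where
  "gs_space \<equiv> Pi\<^sub>M {..<DIM('a)} (\<lambda>_. lborel)"

lemma linear_gs_isometry: "linear (gs_isometry z)"
  by (simp add: gs_isometry_def linear_frame_map)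

lemma inner_gs_isometry:
  fixes z :: "nat \<Rightarrow> 'a::euclidean_space"
  shows "pvol DIM('a) z > 0 \<Longrightarrow> gs_isometry z x \<bullet> gs_isometry z y = x \<bullet> y"
  unfolding gs_isometry_def by (intro inner_frame_map onb_gs_frame onb_std_frame)

text \<open>Gram--Schmidt commutes with \<open>R\<close>, so the tuple moved by \<open>R\<close>
  yields the isometry composed with the inverse of \<open>R\<close>. Together with
  \<open>gs_weight_invariant\<close> this is the invariance of Haar measure under translation in the
  group.\<close>

lemma gs_isometry_compose:
  fixes R :: "'a::euclidean_space \<Rightarrow> 'a" and z :: "nat \<Rightarrow> 'a"
  assumes R: "linear R" "\<And>x y. R x \<bullet> R y = x \<bullet> y"
  shows "gs_isometry (\<lambda>i\<in>{..<DIM('a)}. R (z i)) (R v) = gs_isometry z v"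
proof -
  have "gs_frame (\<lambda>i\<in>{..<DIM('a)}. R (z i)) i = R (gs_frame z i)" if "i < DIM('a)" for i
    unfolding gs_frame_isometry[OF R, symmetric] using that by (intro gs_frame_cong) auto
  then show ?thesis by (simp add: gs_isometry_def frame_map_def R)
qed

lemma measurable_gs_isometry [measurable (raw)]:
  fixes z :: "'m \<Rightarrow> nat \<Rightarrow> 'a::euclidean_space"
  assumes "\<And>i. i < DIM('a) \<Longrightarrow> (\<lambda>\<omega>. z \<omega> i) \<in> borel_measurable M" "v \<in> borel_measurable M"
  shows "(\<lambda>\<omega>. gs_isometry (z \<omega>) (v \<omega>)) \<in> borel_measurable M"
proof -
  have [measurable]: "(\<lambda>\<omega>. gs_frame (z \<omega>) i) \<in> borel_measurable M" if "i < DIM('a)" for i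
  proof -
    have [measurable]: "(\<lambda>\<omega>. perp (z \<omega>) i (z \<omega> i)) \<in> borel_measurable M"
      using that by (intro measurable_perp assms) auto
    show ?thesis unfolding gs_frame_def by measurable
  qed
  note [measurable] = assms(2)
  show ?thesis unfolding gs_isometry_def frame_map_def by measurable
qed

lemma measurable_gs_weight [measurable]:
  "(gs_weight :: (nat \<Rightarrow> 'a::euclidean_space) \<Rightarrow> ennreal) \<in> borel_measurable gs_space"
proof -
  have [measurable]: "(\<lambda>z::nat \<Rightarrow> 'a. z i) \<in> borel_measurable gs_space" if "i < DIM('a)" for i
    using that by (intro measurable_compose[OF measurable_component_singleton]) auto
  have [measurable]: "(\<lambda>z::nat \<Rightarrow> 'a. pvol DIM('a) z) \<in> borel_measurable gs_space" by (intro measurable_pvol) measurable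
  show ?thesis unfolding gs_weight_def by measurable
qed

lemma sigma_finite_gs_space: "sigma_finite_measure gs_space"
  by (intro lborel_product.sigma_finite) simp

text \<open>Only positivity and finiteness of the total weight matter: it occurs on both sides of
  the final comparison and is cancelled there.\<close>

lemma gs_weight_total:
  obtains m where "m > 0" "(\<integral>\<^sup>+z. gs_weight z \<partial>(gs_space :: (nat \<Rightarrow> 'a::euclidean_space) measure)) = ennreal m"
proof -
  define c where "c = (\<lambda>m::nat. omega (DIM('a) - m) / omega (real (DIM('a) - m) + 1))"
  have "(\<integral>\<^sup>+z. gs_weight z \<partial>(gs_space :: (nat \<Rightarrow> 'a) measure))
    = (\<integral>\<^sup>+z. (\<Prod>i<DIM('a). gauss (z i)) * ennreal (pvol DIM('a) z powr 1) \<partial>Pi\<^sub>M {..<DIM('a)} (\<lambda>_. slb (UNIV :: 'a set)))"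
    by (simp add: gs_weight_def)
  also have "\<dots> = (\<Prod>i<DIM('a). ennreal (c i))"
  proof (rule nn_integral_pvol_powr[OF subspace_UNIV])
    fix V :: "'a set" assume V: "subspace V" "V \<subseteq> UNIV" "dim V < dim (UNIV :: 'a set)"
    show "(\<integral>\<^sup>+y. gauss y * ennreal (norm (y - proj V y) powr 1) \<partial>slb UNIV) = ennreal (c (dim V))"
      using nn_integral_slb_gauss_dist[OF subspace_UNIV V, of 1] by (simp add: c_def dim_UNIV)
  qed (simp_all add: dim_UNIV)
  also have "\<dots> = ennreal (\<Prod>i<DIM('a). c i)"
    unfolding c_def by (intro prod_ennreal divide_nonneg_nonneg less_imp_le omega_pos) auto
  finally show thesis
    by (intro that[of "\<Prod>i<DIM('a). c i"]) (auto intro!: prod_pos divide_pos_pos omega_pos simp: c_def)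
qed

lemma gs_weight_invariant:
  fixes R :: "'a::euclidean_space \<Rightarrow> 'a" and H :: "(nat \<Rightarrow> 'a) \<Rightarrow> ennreal"
  assumes R: "linear R" "\<And>x y. R x \<bullet> R y = x \<bullet> y" and H: "H \<in> borel_measurable gs_space"
  shows "(\<integral>\<^sup>+z. gs_weight z * H (\<lambda>i\<in>{..<DIM('a)}. R (z i)) \<partial>gs_space) = (\<integral>\<^sup>+z. gs_weight z * H z \<partial>gs_space)"
proof -
  note [measurable] = measurable_linear[OF R(1)] H
  have nR: "norm (R x) = norm x" for x by (simp add: norm_eq_sqrt_inner R)
  have w: "gs_weight (\<lambda>i\<in>{..<DIM('a)}. R (z i)) = gs_weight z" for z
  proof -
    have "pvol DIM('a) (\<lambda>i\<in>{..<DIM('a)}. R (z i)) = pvol DIM('a) z"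
      by (rule trans[OF pvol_cong pvol_isometry[OF R]]) simp
    then show ?thesis by (simp add: gs_weight_def gauss_def nR)
  qed
  have "(\<integral>\<^sup>+z. gs_weight z * H (\<lambda>i\<in>{..<DIM('a)}. R (z i)) \<partial>gs_space)
    = (\<integral>\<^sup>+z. (\<Prod>i<DIM('a). 1) * (\<lambda>z. gs_weight z * H z) (\<lambda>i\<in>{..<DIM('a)}. R (z i)) \<partial>gs_space)"
    by (simp add: w)
  also have "\<dots> = 1 ^ card {..<DIM('a)} * (\<integral>\<^sup>+z. (\<Prod>i<DIM('a). 1) * (gs_weight z * H z) \<partial>gs_space)"
  proof (rule nn_integral_PiM_map[where w="\<lambda>_. 1" and w'="\<lambda>_. 1" and c=1])
    show "(\<integral>\<^sup>+x. 1 * g (R x) \<partial>lborel) = 1 * (\<integral>\<^sup>+y. 1 * g y \<partial>lborel)" if "g \<in> borel_measurable lborel" for g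
      using that by (simp add: nn_integral_lborel_isometry[OF R])
  qed (auto simp: lborel.sigma_finite_measure_axioms)
  finally show ?thesis by simp
qed

section \<open>The affine Blaschke--Petkantschin formula\<close>

definition base_point_map :: "nat \<Rightarrow> 'a::real_vector \<Rightarrow> (nat \<Rightarrow> 'a) \<Rightarrow> nat \<Rightarrow> 'a" where
  "base_point_map k x y = (\<lambda>i\<in>{..k}. if i < k then y i + x else x)"

lemma nn_integral_base_point:
  fixes X :: "'a::euclidean_space set"
  assumes X: "subspace X" and f: "f \<in> borel_measurable (Pi\<^sub>M {..k} (\<lambda>_. slb X))"
  shows "(\<integral>\<^sup>+x. f x \<partial>Pi\<^sub>M {..k} (\<lambda>_. slb X))
    = (\<integral>\<^sup>+x. \<integral>\<^sup>+y. f (base_point_map k x y) \<partial>Pi\<^sub>M {..<k} (\<lambda>_. slb X) \<partial>slb X)"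
proof -
  interpret P: product_sigma_finite "\<lambda>_::nat. slb X" by (rule product_sigma_finite_slb[OF X])
  have ins: "{..k} = insert k {..<k}" by auto
  have fm: "f \<in> borel_measurable (Pi\<^sub>M (insert k {..<k}) (\<lambda>_. slb X))" using f by (simp add: ins)
  have "(\<integral>\<^sup>+x. f x \<partial>Pi\<^sub>M {..k} (\<lambda>_. slb X)) = (\<integral>\<^sup>+x. \<integral>\<^sup>+y. f (y(k := x)) \<partial>Pi\<^sub>M {..<k} (\<lambda>_. slb X) \<partial>slb X)"
    unfolding ins by (rule P.product_nn_integral_insert_rev) (use fm in auto)
  also have "\<dots> = (\<integral>\<^sup>+x. \<integral>\<^sup>+y. f (base_point_map k x y) \<partial>Pi\<^sub>M {..<k} (\<lambda>_. slb X) \<partial>slb X)"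
  proof (rule nn_integral_cong_AE, rule AE_mp[OF AE_slb[OF X]], intro AE_I2 impI)
    fix x assume x: "x \<in> X"
    have sec: "(\<lambda>y. f (y(k := x))) \<in> borel_measurable (Pi\<^sub>M {..<k} (\<lambda>_. slb X))"
    proof -
      have "(\<lambda>y. y(k := x)) \<in> measurable (Pi\<^sub>M {..<k} (\<lambda>_. slb X)) (Pi\<^sub>M (insert k {..<k}) (\<lambda>_. slb X))"
        by (rule measurable_fun_upd[where J="{..<k}"]) auto
      then show ?thesis using fm by (rule measurable_compose)
    qed
    have "base_point_map k x y = (\<lambda>i\<in>{..<k}. y i + x)(k := x)" for y
      by (auto simp: base_point_map_def fun_eq_iff)
    then have "(\<integral>\<^sup>+y. f (base_point_map k x y) \<partial>Pi\<^sub>M {..<k} (\<lambda>_. slb X))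
      = (\<integral>\<^sup>+y. (\<Prod>i<k. 1) * (\<lambda>y. f (y(k := x))) (\<lambda>i\<in>{..<k}. y i + x) \<partial>Pi\<^sub>M {..<k} (\<lambda>_. slb X))" by simp
    also have "\<dots> = 1 ^ card {..<k} * (\<integral>\<^sup>+y. (\<Prod>i<k. 1) * f (y(k := x)) \<partial>Pi\<^sub>M {..<k} (\<lambda>_. slb X))"
    proof (rule nn_integral_PiM_map[where w="\<lambda>_. 1" and w'="\<lambda>_. 1" and c=1])
      show "(\<integral>\<^sup>+z. 1 * g (z + x) \<partial>slb X) = 1 * (\<integral>\<^sup>+z. 1 * g z \<partial>slb X)" if "g \<in> borel_measurable (slb X)" for g
        using that nn_integral_slb_shift[OF X x, of g] by simp
    qed (auto intro: sigma_finite_slb X sec)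
    finally show "(\<integral>\<^sup>+y. f (y(k := x)) \<partial>Pi\<^sub>M {..<k} (\<lambda>_. slb X)) = (\<integral>\<^sup>+y. f (base_point_map k x y) \<partial>Pi\<^sub>M {..<k} (\<lambda>_. slb X))"
      by simp
  qed
  finally show ?thesis .
qed

lemma pvol_base_point: "pvol k (edges k (base_point_map k x y)) = pvol k y"
  by (rule pvol_cong) (simp add: base_point_map_def)

lemma prod_base_point: "(\<Prod>i\<le>k. g (base_point_map k x y i)) = (\<Prod>i<k. g (y i + x)) * g x"
proof -
  have "(\<Prod>i<Suc k. g (base_point_map k x y i)) = (\<Prod>i<k. g (base_point_map k x y i)) * g (base_point_map k x y k)"
    by simp
  also have "(\<Prod>i<k. g (base_point_map k x y i)) = (\<Prod>i<k. g (y i + x))"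
    by (intro prod.cong refl) (simp add: base_point_map_def)
  finally show ?thesis by (simp add: lessThan_Suc_atMost base_point_map_def)
qed

definition set_moment :: "nat \<Rightarrow> real \<Rightarrow> 'a::euclidean_space set \<Rightarrow> 'a set \<Rightarrow> 'a \<Rightarrow> ennreal" where
  "set_moment k q W K u = (\<integral>\<^sup>+x. (\<Prod>i\<le>k. indicator K (u + x i)) * ennreal (pvol k (edges k x) powr q)
     \<partial>Pi\<^sub>M {..k} (\<lambda>_. slb W))"

text \<open>Rotating \<open>K\<close> does not change its moment, so the moment may be averaged over
  rotations. The integrand, averaged over rotation and base point, is an isometry invariant function
  of the edges, and the linear formula confines these to \<open>W\<close>. The factor
  \<open>pvol ^ (DIM('a) - k)\<close> raises the order of the moment.\<close>

theorem blaschke_petkantschin: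
  fixes W K :: "'a::euclidean_space set"
  assumes W: "subspace W" "dim W = k" and K: "K \<in> sets borel"
  shows "(\<integral>\<^sup>+z. gs_weight z \<partial>(gs_space :: (nat \<Rightarrow> 'a) measure)) * set_moment k p UNIV K 0
    = ennreal (b_coeff DIM('a) k) * (\<integral>\<^sup>+z. gs_weight z *
        (\<integral>\<^sup>+u. set_moment k (p + (DIM('a) - k)) W (gs_isometry z -` K) u \<partial>slb (orth_in UNIV W)) \<partial>gs_space)"
proof -
  let ?G = "gs_space :: (nat \<Rightarrow> 'a) measure" and ?PW = "Pi\<^sub>M {..<k} (\<lambda>_. slb W)" and ?PL = "Pi\<^sub>M {..<k} (\<lambda>_. lborel :: 'a measure)"
  note [measurable] = K
  note sfG = sigma_finite_gs_space[where 'a='a]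
  interpret G: sigma_finite_measure ?G by (rule sfG)
  interpret PW: product_sigma_finite "\<lambda>_::nat. slb W" by (rule product_sigma_finite_slb[OF W(1)])
  have sfPW: "sigma_finite_measure ?PW" by (intro PW.sigma_finite) simp
  have sfPL: "sigma_finite_measure ?PL" by (intro lborel_product.sigma_finite) simp
  interpret sPW: sigma_finite_measure ?PW by (rule sfPW)
  interpret sPL: sigma_finite_measure ?PL by (rule sfPL)
  have comp [measurable]: "(\<lambda>y. y i) \<in> borel_measurable ?PL" if "i < k" for i
    using that by (intro measurable_compose[OF measurable_component_singleton]) auto
  have compG [measurable]: "(\<lambda>y. y i) \<in> borel_measurable ?G" if "i < DIM('a)" for i
    using that by (intro measurable_compose[OF measurable_component_singleton]) auto
  define f where "f = (\<lambda>Q x (y::nat \<Rightarrow> 'a). (\<Prod>i<k. indicator K (Q (y i + x))) * indicator K (Q x) * ennreal (pvol k y powr p))" for Q :: "'a \<Rightarrow> 'a"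
  have f_meas [measurable (raw)]: "(\<lambda>\<omega>. f (gs_isometry (a \<omega>)) (b \<omega>) (c \<omega>)) \<in> borel_measurable M"
    if [measurable]: "\<And>i. i < DIM('a) \<Longrightarrow> (\<lambda>\<omega>. a \<omega> i) \<in> borel_measurable M" "b \<in> borel_measurable M"
      "\<And>i. i < k \<Longrightarrow> (\<lambda>\<omega>. c \<omega> i) \<in> borel_measurable M" for a b c and M :: "'m measure"
    unfolding f_def by measurable
  have fid_meas [measurable (raw)]: "(\<lambda>\<omega>. f (\<lambda>v. v) (b \<omega>) (c \<omega>)) \<in> borel_measurable M"
    if [measurable]: "b \<in> borel_measurable M"
      "\<And>i. i < k \<Longrightarrow> (\<lambda>\<omega>. c \<omega> i) \<in> borel_measurable M" for b c and M :: "'m measure"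
    unfolding f_def by measurable
  have f_iso: "f (\<lambda>v. v) (Q x) (\<lambda>i\<in>{..<k}. Q (y i)) = f Q x y"
    if Q: "linear Q" "\<And>x y. Q x \<bullet> Q y = x \<bullet> y" for Q x y
  proof -
    have "pvol k (\<lambda>i\<in>{..<k}. Q (y i)) = pvol k y"
      by (rule trans[OF pvol_cong pvol_isometry[OF Q]]) simp
    then show ?thesis by (simp add: f_def linear_add[OF Q(1)])
  qed
  have I0: "set_moment k p UNIV K 0 = (\<integral>\<^sup>+x. \<integral>\<^sup>+y. f (\<lambda>v. v) x y \<partial>?PL \<partial>lborel)"
  proof -
    have [measurable]: "(\<lambda>x. x i) \<in> borel_measurable (Pi\<^sub>M {..k} (\<lambda>_. lborel :: 'a measure))" if "i \<le> k" for i
      using that by (intro measurable_compose[OF measurable_component_singleton]) auto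
    have [measurable]: "(\<lambda>x. pvol k (edges k x)) \<in> borel_measurable (Pi\<^sub>M {..k} (\<lambda>_. lborel :: 'a measure))"
      by (intro measurable_pvol) measurable
    have "set_moment k p UNIV K 0 = (\<integral>\<^sup>+x. (\<Prod>i\<le>k. indicator K (x i)) * ennreal (pvol k (edges k x) powr p) \<partial>Pi\<^sub>M {..k} (\<lambda>_. slb UNIV))"
      by (simp add: set_moment_def)
    also have "\<dots> = (\<integral>\<^sup>+x. \<integral>\<^sup>+y. (\<Prod>i\<le>k. indicator K (base_point_map k x y i)) * ennreal (pvol k (edges k (base_point_map k x y)) powr p)
       \<partial>Pi\<^sub>M {..<k} (\<lambda>_. slb UNIV) \<partial>slb UNIV)"
      by (rule nn_integral_base_point[OF subspace_UNIV]) simp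
    finally show ?thesis by (simp add: prod_base_point pvol_base_point f_def)
  qed
  have IQ: "set_moment k p UNIV K 0 = (\<integral>\<^sup>+x. \<integral>\<^sup>+y. f Q x y \<partial>?PL \<partial>lborel)"
    if Q: "linear Q" "\<And>x y. Q x \<bullet> Q y = x \<bullet> y" for Q
  proof -
    note [measurable] = measurable_linear[OF Q(1)]
    have "(\<integral>\<^sup>+x. \<integral>\<^sup>+y. f Q x y \<partial>?PL \<partial>lborel)
      = (\<integral>\<^sup>+x. \<integral>\<^sup>+y. (\<Prod>i<k. 1) * f (\<lambda>v. v) (Q x) (\<lambda>i\<in>{..<k}. Q (y i)) \<partial>?PL \<partial>lborel)"
      by (simp add: f_iso[OF Q])
    also have "\<dots> = (\<integral>\<^sup>+x. 1 ^ card {..<k} * (\<integral>\<^sup>+y. (\<Prod>i<k. 1) * f (\<lambda>v. v) (Q x) y \<partial>?PL) \<partial>lborel)"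
    proof (rule nn_integral_cong, rule nn_integral_PiM_map[where w="\<lambda>_. 1" and w'="\<lambda>_. 1" and c=1])
      show "(\<integral>\<^sup>+x. 1 * g (Q x) \<partial>lborel) = 1 * (\<integral>\<^sup>+y. 1 * g y \<partial>lborel)" if "g \<in> borel_measurable lborel" for g
        using that by (simp add: nn_integral_lborel_isometry[OF Q])
      show "f (\<lambda>v. v) (Q x) \<in> borel_measurable ?PL" for x
        by (rule fid_meas) (use comp in auto)
    qed (auto simp: lborel.sigma_finite_measure_axioms)
    also have "\<dots> = (\<integral>\<^sup>+x. \<integral>\<^sup>+y. f (\<lambda>v. v) (Q x) y \<partial>?PL \<partial>lborel)" by simp
    also have "\<dots> = (\<integral>\<^sup>+x. \<integral>\<^sup>+y. f (\<lambda>v. v) x y \<partial>?PL \<partial>lborel)"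
      by (rule nn_integral_lborel_isometry[OF Q, where f="\<lambda>x. \<integral>\<^sup>+y. f (\<lambda>v. v) x y \<partial>?PL"]) measurable
    finally show ?thesis using I0 by simp
  qed
  \<comment> \<open>A function of the edges alone: base point and rotation are integrated out, which
    is what makes it isometry invariant.\<close>
  define F where "F = (\<lambda>y. \<integral>\<^sup>+x. \<integral>\<^sup>+z. gs_weight z * f (gs_isometry z) x y \<partial>?G \<partial>lborel)"
  have "(\<integral>\<^sup>+z. gs_weight z \<partial>?G) * set_moment k p UNIV K 0 = (\<integral>\<^sup>+z. gs_weight z * set_moment k p UNIV K 0 \<partial>?G)"
    by (rule nn_integral_multc[symmetric]) measurable
  also have "\<dots> = (\<integral>\<^sup>+z. gs_weight z * (\<integral>\<^sup>+x. \<integral>\<^sup>+y. f (gs_isometry z) x y \<partial>?PL \<partial>lborel) \<partial>?G)"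
  proof (rule nn_integral_cong)
    fix z :: "nat \<Rightarrow> 'a"
    show "gs_weight z * set_moment k p UNIV K 0 = gs_weight z * (\<integral>\<^sup>+x. \<integral>\<^sup>+y. f (gs_isometry z) x y \<partial>?PL \<partial>lborel)"
    proof (cases "pvol DIM('a) z = 0")
      case True then show ?thesis by (simp add: gs_weight_def)
    next
      case False
      then have "pvol DIM('a) z > 0" using pvol_nonneg[of "DIM('a)" z] by linarith
      then show ?thesis using IQ[OF linear_gs_isometry inner_gs_isometry] by simp
    qed
  qed
  also have "\<dots> = (\<integral>\<^sup>+z. \<integral>\<^sup>+x. \<integral>\<^sup>+y. gs_weight z * f (gs_isometry z) x y \<partial>?PL \<partial>lborel \<partial>?G)"
    by (intro nn_integral_cong, subst nn_integral_cmult[symmetric], measurable,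
        intro nn_integral_cong, subst nn_integral_cmult[symmetric], measurable)
  also have "\<dots> = (\<integral>\<^sup>+x. \<integral>\<^sup>+z. \<integral>\<^sup>+y. gs_weight z * f (gs_isometry z) x y \<partial>?PL \<partial>?G \<partial>lborel)"
    by (rule nn_integral_swap[OF sfG lborel.sigma_finite_measure_axioms]) measurable
  also have "\<dots> = (\<integral>\<^sup>+x. \<integral>\<^sup>+y. \<integral>\<^sup>+z. gs_weight z * f (gs_isometry z) x y \<partial>?G \<partial>?PL \<partial>lborel)"
    by (rule nn_integral_cong, rule nn_integral_swap[OF sfG sfPL]) measurable
  also have "\<dots> = (\<integral>\<^sup>+y. F y \<partial>?PL)"
    unfolding F_def by (rule nn_integral_swap[OF lborel.sigma_finite_measure_axioms sfPL]) measurable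
  also have "\<dots> = ennreal (b_coeff DIM('a) k) * (\<integral>\<^sup>+y. F y * ennreal (pvol k y ^ (DIM('a) - k)) \<partial>?PW)"
  proof (rule invariant_integral_subspace[OF W])
    show "F \<in> borel_measurable ?PL" unfolding F_def by measurable
    show "isometry_invariant k F"
      unfolding isometry_invariant_def
    proof (intro allI impI ballI)
      fix R :: "'a \<Rightarrow> 'a" and y :: "nat \<Rightarrow> 'a" assume R: "linear R" "\<forall>x y. R x \<bullet> R y = x \<bullet> y" and y: "y \<in> extensional {..<k}"
      note R' = R(1) R(2)[rule_format]
      note [measurable] = measurable_linear[OF R(1)]
      \<comment> \<open>Base point and random tuple are both replaced by their images under
        \<open>R\<close>. Neither substitution changes the averages, and
        \<open>gs_isometry_compose\<close> then removes \<open>R\<close> from all arguments at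
        once.\<close>
      have "F (\<lambda>i\<in>{..<k}. R (y i)) = (\<integral>\<^sup>+x. \<integral>\<^sup>+z. gs_weight z * f (gs_isometry z) (R x) (\<lambda>i\<in>{..<k}. R (y i)) \<partial>?G \<partial>lborel)"
        unfolding F_def by (rule nn_integral_lborel_isometry[OF R', symmetric,
              where f="\<lambda>x. \<integral>\<^sup>+z. gs_weight z * f (gs_isometry z) x (\<lambda>i\<in>{..<k}. R (y i)) \<partial>?G"]) measurable
      also have "\<dots> = (\<integral>\<^sup>+x. \<integral>\<^sup>+z. gs_weight z * f (gs_isometry (\<lambda>i\<in>{..<DIM('a)}. R (z i))) (R x) (\<lambda>i\<in>{..<k}. R (y i)) \<partial>?G \<partial>lborel)"
        by (rule nn_integral_cong, rule gs_weight_invariant[OF R', symmetric]) measurable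
      also have "\<dots> = F y"
      proof -
        have "f (gs_isometry (\<lambda>i\<in>{..<DIM('a)}. R (z i))) (R x) (\<lambda>i\<in>{..<k}. R (y i)) = f (gs_isometry z) x y" for x z
        proof -
          have "pvol k (\<lambda>i\<in>{..<k}. R (y i)) = pvol k y"
            by (rule trans[OF pvol_cong pvol_isometry[OF R']]) simp
          then show ?thesis
            by (simp add: f_def gs_isometry_compose[OF R'] linear_add[OF R'(1), symmetric])
        qed
        then show ?thesis by (simp add: F_def)
      qed
      finally show "F (\<lambda>i\<in>{..<k}. R (y i)) = F y" .
    qed
  qed
  also have "(\<integral>\<^sup>+y. F y * ennreal (pvol k y ^ (DIM('a) - k)) \<partial>?PW)
    = (\<integral>\<^sup>+z. gs_weight z * (\<integral>\<^sup>+x. \<integral>\<^sup>+y. f (gs_isometry z) x y * ennreal (pvol k y ^ (DIM('a) - k)) \<partial>?PW \<partial>lborel) \<partial>?G)"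
  proof -
    have "(\<integral>\<^sup>+y. F y * ennreal (pvol k y ^ (DIM('a) - k)) \<partial>?PW)
      = (\<integral>\<^sup>+y. \<integral>\<^sup>+x. \<integral>\<^sup>+z. gs_weight z * f (gs_isometry z) x y * ennreal (pvol k y ^ (DIM('a) - k)) \<partial>?G \<partial>lborel \<partial>?PW)"
      unfolding F_def
    proof (rule nn_integral_cong)
      fix y assume "y \<in> space ?PW"
      let ?c = "ennreal (pvol k y ^ (DIM('a) - k))"
      have "(\<integral>\<^sup>+x. \<integral>\<^sup>+z. gs_weight z * f (gs_isometry z) x y * ?c \<partial>?G \<partial>lborel)
        = (\<integral>\<^sup>+x. (\<integral>\<^sup>+z. gs_weight z * f (gs_isometry z) x y \<partial>?G) * ?c \<partial>lborel)"
        by (rule nn_integral_cong, rule nn_integral_multc) measurable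
      also have "\<dots> = (\<integral>\<^sup>+x. \<integral>\<^sup>+z. gs_weight z * f (gs_isometry z) x y \<partial>?G \<partial>lborel) * ?c"
        by (rule nn_integral_multc) measurable
      finally show "(\<integral>\<^sup>+x. \<integral>\<^sup>+z. gs_weight z * f (gs_isometry z) x y \<partial>?G \<partial>lborel) * ?c
        = (\<integral>\<^sup>+x. \<integral>\<^sup>+z. gs_weight z * f (gs_isometry z) x y * ?c \<partial>?G \<partial>lborel)" ..
    qed
    also have "\<dots> = (\<integral>\<^sup>+x. \<integral>\<^sup>+y. \<integral>\<^sup>+z. gs_weight z * f (gs_isometry z) x y * ennreal (pvol k y ^ (DIM('a) - k)) \<partial>?G \<partial>?PW \<partial>lborel)"
      by (rule nn_integral_swap[OF sfPW lborel.sigma_finite_measure_axioms]) measurable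
    also have "\<dots> = (\<integral>\<^sup>+x. \<integral>\<^sup>+z. \<integral>\<^sup>+y. gs_weight z * f (gs_isometry z) x y * ennreal (pvol k y ^ (DIM('a) - k)) \<partial>?PW \<partial>?G \<partial>lborel)"
      by (rule nn_integral_cong, rule nn_integral_swap[OF sfPW sfG]) measurable
    also have "\<dots> = (\<integral>\<^sup>+z. \<integral>\<^sup>+x. \<integral>\<^sup>+y. gs_weight z * f (gs_isometry z) x y * ennreal (pvol k y ^ (DIM('a) - k)) \<partial>?PW \<partial>lborel \<partial>?G)"
      by (rule nn_integral_swap[OF lborel.sigma_finite_measure_axioms sfG]) measurable
    also have "\<dots> = (\<integral>\<^sup>+z. gs_weight z * (\<integral>\<^sup>+x. \<integral>\<^sup>+y. f (gs_isometry z) x y * ennreal (pvol k y ^ (DIM('a) - k)) \<partial>?PW \<partial>lborel) \<partial>?G)"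
      unfolding mult.assoc
      by (intro nn_integral_cong, subst nn_integral_cmult[symmetric], measurable,
          intro nn_integral_cong, subst nn_integral_cmult[symmetric], measurable)
    finally show ?thesis .
  qed
  also have "\<dots> = (\<integral>\<^sup>+z. gs_weight z *
        (\<integral>\<^sup>+u. set_moment k (p + (DIM('a) - k)) W (gs_isometry z -` K) u \<partial>slb (orth_in UNIV W)) \<partial>?G)"
  proof (rule nn_integral_cong, rule arg_cong2[where f="(*)"], rule refl)
    fix z :: "nat \<Rightarrow> 'a"
    let ?Q = "gs_isometry z" and ?U = "orth_in UNIV W" and ?q = "p + (DIM('a) - k)"
    note [measurable] = measurable_linear[OF linear_gs_isometry[of z]]
    have U: "subspace ?U" by (simp add: subspace_orth_in)
    define h where "h = (\<lambda>x y. (\<Prod>i<k. indicator K (?Q (y i + x))) * indicator K (?Q x) * ennreal (pvol k y powr ?q))"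
    have h_meas [measurable (raw)]: "(\<lambda>\<omega>. h (b \<omega>) (c \<omega>)) \<in> borel_measurable M"
      if [measurable]: "b \<in> borel_measurable M"
        "\<And>i. i < k \<Longrightarrow> (\<lambda>\<omega>. c \<omega> i) \<in> borel_measurable M" for b c and M :: "'m measure"
      unfolding h_def by measurable
    have fh: "f ?Q x y * ennreal (pvol k y ^ (DIM('a) - k)) = h x y" for x y
    proof -
      have "pvol k y powr p * pvol k y ^ (DIM('a) - k) = pvol k y powr ?q"
      proof (cases "pvol k y = 0")
        case False
        then have "pvol k y > 0" using pvol_nonneg[of k y] by linarith
        then show ?thesis by (simp add: powr_add powr_realpow)
      qed simp
      then have "ennreal (pvol k y powr p) * ennreal (pvol k y ^ (DIM('a) - k)) = ennreal (pvol k y powr ?q)"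
        by (simp add: ennreal_mult[symmetric])
      then show ?thesis by (simp add: f_def h_def mult.assoc)
    qed
    have "(\<integral>\<^sup>+x. \<integral>\<^sup>+y. f ?Q x y * ennreal (pvol k y ^ (DIM('a) - k)) \<partial>?PW \<partial>lborel)
      = (\<integral>\<^sup>+x. \<integral>\<^sup>+y. h x y \<partial>?PW \<partial>slb UNIV)" by (simp add: fh)
    \<comment> \<open>The base point is split along \<open>W\<close>: its part in \<open>W\<close>
      completes the edges to \<open>k + 1\<close> points of \<open>W\<close>, and its orthogonal
      part \<open>u\<close> enumerates the translates of \<open>W\<close>.\<close>
    also have "\<dots> = (\<integral>\<^sup>+v. \<integral>\<^sup>+u. \<integral>\<^sup>+y. h (v + u) y \<partial>?PW \<partial>slb ?U \<partial>slb W)"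
      by (rule nn_integral_slb_split[OF subspace_UNIV W(1)]) simp_all
    also have "\<dots> = (\<integral>\<^sup>+u. \<integral>\<^sup>+v. \<integral>\<^sup>+y. h (v + u) y \<partial>?PW \<partial>slb W \<partial>slb ?U)"
      by (rule nn_integral_swap[OF sigma_finite_slb[OF W(1)] sigma_finite_slb[OF U]]) measurable
    also have "\<dots> = (\<integral>\<^sup>+u. set_moment k ?q W (?Q -` K) u \<partial>slb ?U)"
    proof (rule nn_integral_cong)
      fix u :: 'a
      have [measurable]: "(\<lambda>x. indicator (?Q -` K) (u + x i) :: ennreal) \<in> borel_measurable (Pi\<^sub>M {..k} (\<lambda>_. slb W))" if "i \<le> k" for i
      proof -
        have [measurable]: "(\<lambda>x. x i) \<in> borel_measurable (Pi\<^sub>M {..k} (\<lambda>_. slb W))"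
          using that by (intro measurable_PiM_slb_component) simp
        have "(\<lambda>x. indicator K (?Q (u + x i)) :: ennreal) \<in> borel_measurable (Pi\<^sub>M {..k} (\<lambda>_. slb W))"
          by measurable
        then show ?thesis by (simp add: indicator_def)
      qed
      have "set_moment k ?q W (?Q -` K) u = (\<integral>\<^sup>+v. \<integral>\<^sup>+y. (\<Prod>i\<le>k. indicator (?Q -` K) (u + base_point_map k v y i))
          * ennreal (pvol k (edges k (base_point_map k v y)) powr ?q) \<partial>?PW \<partial>slb W)"
        unfolding set_moment_def by (rule nn_integral_base_point[OF W(1)]) measurable
      also have "\<dots> = (\<integral>\<^sup>+v. \<integral>\<^sup>+y. h (v + u) y \<partial>?PW \<partial>slb W)"
        unfolding pvol_base_point prod_base_point[where g="\<lambda>x. indicator (?Q -` K) (u + x)"]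
        by (simp add: h_def indicator_def add_ac)
      finally show "(\<integral>\<^sup>+v. \<integral>\<^sup>+y. h (v + u) y \<partial>?PW \<partial>slb W) = set_moment k ?q W (?Q -` K) u" ..
    qed
    finally show "(\<integral>\<^sup>+x. \<integral>\<^sup>+y. f ?Q x y * ennreal (pvol k y ^ (DIM('a) - k)) \<partial>?PW \<partial>lborel)
      = (\<integral>\<^sup>+u. set_moment k ?q W (?Q -` K) u \<partial>slb ?U)" .
  qed
  finally show ?thesis .
qed

section \<open>Sections of ellipsoids\<close>

lemma emeasure_slb_cball:
  fixes W :: "'a::euclidean_space set"
  assumes W: "subspace W"
  shows "emeasure (slb W) (cball 0 1) = ennreal (unit_ball_vol (dim W))"
proof (cases "dim W = 0")
  case True
  then have W0: "W = {0}" using subspace_0[OF W] by auto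
  have "emeasure (slb W) (cball 0 1) = (\<integral>\<^sup>+x. indicator (cball 0 1) x \<partial>slb {0::'a})" by (simp add: W0)
  also have "\<dots> = 1" by (subst nn_integral_slb_zero) (auto intro!: borel_measurable_indicator)
  finally show ?thesis by (simp add: True)
next
  case False
  then have k: "real (dim W) > 0" by (metis neq0_conv of_nat_0_less_iff)
  have "emeasure (slb W) (cball 0 1) = (\<integral>\<^sup>+x. indicator {..1} (norm x) \<partial>slb W)"
  proof -
    have "indicator {..1} (norm x) = (indicator (cball 0 1) x :: ennreal)" for x :: 'a
      by (simp add: indicator_def)
    then show ?thesis by simp
  qed
  also have "\<dots> = ennreal (omega (dim W)) * radial (dim W) (indicator {..1})"
    using False by (intro nn_integral_slb_radial W) auto
  also have "radial (dim W) (indicator {..1})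
    = (\<integral>\<^sup>+h. ennreal (h powr (real (dim W) - 1) * (1 - h\<^sup>2) powr (1 - 1)) * indicator {0<..<1} h \<partial>lborel)"
    unfolding radial_def
    by (intro nn_integral_cong_AE, rule AE_mp[OF AE_lborel_singleton[of "1::real"]])
      (auto simp: indicator_def power2_eq_1_iff)
  also have "\<dots> = ennreal (Beta (real (dim W) / 2) 1 / 2)"
    by (rule nn_integral_beta_square[OF k]) simp
  also have "Beta (real (dim W) / 2) 1 / 2 = 1 / real (dim W)"
  proof -
    have "real (dim W) / 2 \<notin> \<int>\<^sub>\<le>\<^sub>0" using k by (auto dest: nonpos_Ints_nonpos)
    then have G: "Gamma (real (dim W) / 2 + 1) = real (dim W) / 2 * Gamma (real (dim W) / 2)" by (rule Gamma_plus1)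
    have "Gamma (real (dim W) / 2) > 0" using k by (intro Gamma_real_pos) simp
    then show ?thesis unfolding Beta_def G by simp
  qed
  also have "ennreal (omega (dim W)) * ennreal (1 / real (dim W)) = ennreal (unit_ball_vol (dim W))"
  proof -
    have "unit_ball_vol (real (dim W)) > 0" by (intro unit_ball_vol_pos) simp
    then have "ennreal (omega (dim W)) * ennreal (1 / real (dim W)) = ennreal (omega (dim W) * (1 / real (dim W)))"
      using k unfolding omega_def by (intro ennreal_mult[symmetric]) (simp_all only: zero_le_mult_iff zero_le_divide_iff less_imp_le zero_le_one simp_thms)
    moreover have "omega (dim W) * (1 / real (dim W)) = unit_ball_vol (dim W)"
      using less_imp_neq[OF k] unfolding omega_def by (simp only: nonzero_mult_div_cancel_left times_divide_eq_right mult_1_right not_sym[of 0] simp_thms)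
    ultimately show ?thesis by simp
  qed
  finally show ?thesis .
qed

lemma AE_slb_neq:
  assumes W: "subspace W" "dim W > 0" and a: "a \<in> W"
  shows "AE x in slb W. x \<noteq> a"
proof -
  have "(\<integral>\<^sup>+x. indicator {0} (x + - a) \<partial>slb W) = (\<integral>\<^sup>+x. indicator {0} x \<partial>slb W)"
    using nn_integral_slb_shift[OF W(1), of "- a" "indicator {0}"] a W(1) by (simp add: subspace_neg)
  moreover have "indicator {0} (x + - a) = (indicator {a} x :: ennreal)" for x by (simp add: indicator_def)
  ultimately have "emeasure (slb W) {a} = emeasure (slb W) {0}" by simp
  also have "\<dots> = 0" using AE_slb_nonzero[OF W] by (subst (asm) AE_iff_measurable[of "{0}"]) auto
  finally show ?thesis by (intro AE_I[of _ _ "{a}"]) auto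
qed

lemma vimage_add_borel:
  fixes S :: "'a::euclidean_space set"
  assumes [measurable]: "S \<in> sets borel"
  shows "{x. u + x \<in> S} \<in> sets borel"
proof -
  have "(\<lambda>x. u + x) -` S \<inter> space borel \<in> sets borel" by measurable
  then show ?thesis by (simp add: vimage_def)
qed

lemma set_moment_point:
  fixes K :: "'a::euclidean_space set"
  assumes K: "K \<in> sets borel"
  shows "set_moment 0 q {0} K u = indicator K u" "emeasure (slb {0}) {x. u + x \<in> K} = indicator K u"
proof -
  have z: "subspace {0::'a}" by simp
  note [measurable] = K
  interpret P: product_sigma_finite "\<lambda>_::nat. slb {0::'a}" by (rule product_sigma_finite_slb[OF z])
  have "set_moment 0 q {0} K u = (\<integral>\<^sup>+x. indicator K (u + x 0) \<partial>Pi\<^sub>M {0::nat} (\<lambda>_. slb {0}))"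
    unfolding set_moment_def by simp
  also have "\<dots> = (\<integral>\<^sup>+x. indicator K (u + x) \<partial>slb {0})"
    by (rule P.product_nn_integral_singleton) measurable
  also have "\<dots> = indicator K u" by (subst nn_integral_slb_zero) auto
  finally show "set_moment 0 q {0} K u = indicator K u" .
  have "emeasure (slb {0}) {x. u + x \<in> K} = (\<integral>\<^sup>+x. indicator {x. u + x \<in> K} x \<partial>slb {0})"
    using vimage_add_borel[OF K] by simp
  also have "\<dots> = indicator {x. u + x \<in> K} 0"
    by (rule nn_integral_slb_zero) (intro borel_measurable_indicator vimage_add_borel K)
  finally show "emeasure (slb {0}) {x. u + x \<in> K} = indicator K u" by (simp add: indicator_def)
qed

text \<open>
  A section of an ellipsoid by a translate of \<open>W\<close> is null or an affine image of a unit ball.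
\<close>

theorem set_moment_ellipsoid:
  fixes W :: "'a::euclidean_space set" and T :: "'a \<Rightarrow> 'a"
  assumes W: "subspace W" "dim W = k" and q: "q > -1" and T: "linear T" "inj T"
    and K: "K = (\<lambda>v. c + T v) ` cball 0 1"
  shows "set_moment k q W K u = ball_moment W k q
    * ennreal ((enn2real (emeasure (slb W) {x. u + x \<in> K}) / unit_ball_vol k) powr (real (k + 1) + q))"
proof -
  have Kc: "compact K"
    unfolding K by (intro compact_continuous_image continuous_intros linear_continuous_on compact_cball)
      (simp add: T(1) linear_conv_bounded_linear[symmetric])
  then have Kb [measurable]: "K \<in> sets borel" by (rule borel_compact)
  show ?thesis
  \<comment> \<open>In dimension 0 a single point has mass 1, so a flat touching the ellipsoid in
    one point is not negligible as it is for positive \<open>k\<close>.\<close>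
  proof (cases "k = 0")
    case True
    then have W0: "W = {0}" using W subspace_0[OF W(1)] by auto
    have N: "ball_moment W 0 q = 1" using ball_moment_dim_0 W True by simp
    show ?thesis
      unfolding True N by (simp add: W0 set_moment_point[OF Kb] indicator_def)
  next
    case False
    obtain A where A: "linear A" "\<And>x. A (T x) = x" "\<And>x. T (A x) = x"
      using linear_injective_isomorphism[OF T] by metis
    have injA: "inj A" by (metis A(3) injI)
    define W' where "W' = A ` W"
    have W': "subspace W'" "dim W' = k"
      using W A(1) injA by (auto simp: W'_def linear_subspace_image dim_image_eq inj_on_subset)
    have TW': "T ` W' = W" by (simp add: W'_def image_image A(3))
    \<comment> \<open>In the coordinates in which the ellipsoid is the unit ball, the flat has
      direction \<open>W'\<close> and foot \<open>u'\<close>, orthogonal to \<open>W'\<close>. The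
      section is then a ball of squared radius \<open>1 - norm u' ^ 2\<close>, and \<open>a\<close>
      below is its centre transported back to \<open>W\<close>.\<close>
    define w' where "w' = proj W' (A (u - c))"
    define u' where "u' = A (u - c) - w'"
    have w': "w' \<in> W'" unfolding w'_def by (rule proj_in[OF W'(1)])
    have u': "u' \<bullet> x = 0" if "x \<in> W'" for x
      unfolding u'_def w'_def by (rule proj_orth[OF W'(1) that])
    define a where "a = - T w'"
    have a: "a \<in> W" using w' TW' W(1) by (auto simp: a_def subspace_neg)
    have mem: "u + x \<in> K \<longleftrightarrow> (norm u')\<^sup>2 + (norm (A (x - a)))\<^sup>2 \<le> 1" if x: "x \<in> W" for x
    proof -
      have "u + x \<in> K \<longleftrightarrow> norm (A (u + x - c)) \<le> 1"
      proof
        assume "u + x \<in> K"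
        then obtain v where "norm v \<le> 1" "u + x = c + T v" by (auto simp: K)
        then show "norm (A (u + x - c)) \<le> 1" by (simp add: A)
      next
        assume "norm (A (u + x - c)) \<le> 1"
        then show "u + x \<in> K" unfolding K by (intro image_eqI[of _ _ "A (u + x - c)"]) (auto simp: A)
      qed
      also have "A (u + x - c) = u' + A (x - a)"
        by (simp add: u'_def a_def linear_diff[OF A(1)] linear_add[OF A(1)] linear_neg[OF A(1)] A(2))
      also have "norm (u' + A (x - a)) \<le> 1 \<longleftrightarrow> (norm (u' + A (x - a)))\<^sup>2 \<le> 1"
        by (simp add: power_le_one_iff abs_le_square_iff[of _ 1, simplified])
      also have "(norm (u' + A (x - a)))\<^sup>2 = (norm u')\<^sup>2 + (norm (A (x - a)))\<^sup>2"
        using u'[of "A (x - a)"] x a W(1)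
        by (subst norm_add_Pythagorean) (auto simp: W'_def orthogonal_def subspace_diff)
      finally show ?thesis .
    qed
    show ?thesis
    proof (cases "(norm u')\<^sup>2 < 1")
      case False
      have "AE x in slb W. u + x \<notin> K"
      proof (rule AE_mp[OF AE_slb[OF W(1)]], rule AE_mp[OF AE_slb_neq[OF W(1) _ a]])
        show "0 < dim W" using \<open>k \<noteq> 0\<close> W(2) by simp
        show "AE x in slb W. x \<noteq> a \<longrightarrow> x \<in> W \<longrightarrow> u + x \<notin> K"
        proof (intro AE_I2 impI)
          fix x assume x: "x \<noteq> a" "x \<in> W"
          have "A (x - a) \<noteq> 0" using x(1) A(1) injA by (metis linear_injective_0 right_minus_eq)
          then have "(norm (A (x - a)))\<^sup>2 > 0" by simp
          then show "u + x \<notin> K" using False unfolding mem[OF x(2)] by linarith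
        qed
      qed
      note AE_K = this
      have "emeasure (slb W) {x. u + x \<in> K} = 0"
        using AE_K vimage_add_borel[OF Kb, of u] by (subst (asm) AE_iff_measurable[of "{x. u + x \<in> K}"]) auto
      moreover have "set_moment k q W K u = (\<integral>\<^sup>+x. 0 \<partial>Pi\<^sub>M {..k} (\<lambda>_. slb W))"
        unfolding set_moment_def
      proof (rule nn_integral_cong_AE, rule AE_mp[OF AE_PiM_all[OF sigma_finite_slb[OF W(1)] _ AE_K]], simp, intro AE_I2 impI)
        fix x assume "\<forall>i\<in>{..k}. u + x i \<notin> K"
        then have "(\<Prod>i\<le>k. indicator K (u + x i) :: ennreal) = 0"
          by (intro prod_zero) (auto simp: indicator_def)
        then show "(\<Prod>i\<le>k. indicator K (u + x i)) * ennreal (pvol k (edges k x) powr q) = 0" by simp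
      qed
      ultimately show ?thesis by simp
    next
      case True
      define \<rho> where "\<rho> = sqrt (1 - (norm u')\<^sup>2)"
      have \<rho>: "\<rho> > 0" "\<rho>\<^sup>2 = 1 - (norm u')\<^sup>2" using True by (auto simp: \<rho>_def)
      define S where "S = (\<lambda>x. a + \<rho> *\<^sub>R T x)"
      have SW: "S x \<in> W" if "x \<in> W'" for x
        unfolding S_def using that a TW' W(1) by (auto intro!: subspace_add subspace_scale)
      have memS: "u + S x \<in> K \<longleftrightarrow> x \<in> cball 0 1" if "x \<in> W'" for x
      proof -
        have "A (S x - a) = \<rho> *\<^sub>R x" by (simp add: S_def linear_scale[OF A(1)] A(2))
        then have "u + S x \<in> K \<longleftrightarrow> (norm u')\<^sup>2 + \<rho>\<^sup>2 * (norm x)\<^sup>2 \<le> 1"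
          by (simp add: mem[OF SW[OF that]] power_mult_distrib)
        also have "\<dots> \<longleftrightarrow> \<rho>\<^sup>2 * (norm x)\<^sup>2 \<le> \<rho>\<^sup>2 * 1" unfolding mult_1_right using \<rho>(2) by linarith
        also have "\<dots> \<longleftrightarrow> (norm x)\<^sup>2 \<le> 1" using \<rho>(1) by (subst mult_le_cancel_left_pos) auto
        finally show ?thesis by (simp add: abs_square_le_1)
      qed
      obtain \<delta> where \<delta>: "\<delta> > 0"
        "\<And>f. f \<in> borel_measurable borel \<Longrightarrow> ennreal \<delta> * (\<integral>\<^sup>+x. f (T x) \<partial>slb W') = (\<integral>\<^sup>+x. f x \<partial>slb W)"
        "\<And>y. (\<And>i. i < k \<Longrightarrow> y i \<in> W') \<Longrightarrow> pvol k (\<lambda>i. T (y i)) = \<delta> * pvol k y"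
        using slb_linear_image[OF W' T(1) inj_on_subset[OF T(2) subset_UNIV]] unfolding TW' by metis
      \<comment> \<open>The Jacobian of \<open>S\<close> on \<open>W'\<close>:
        \<open>\<delta>\<close> from the linear map, \<open>\<rho> ^ k\<close> from the homothety.
        It multiplies the volume of the section once, and the moment \<open>k + 1\<close> times
        through the points and with power \<open>q\<close> through \<open>pvol\<close>.\<close>
      define t where "t = \<delta> * \<rho> ^ k"
      have t: "t > 0" using \<delta>(1) \<rho>(1) by (simp add: t_def)
      have meas_T [measurable]: "T \<in> borel_measurable borel" by (rule measurable_linear[OF T(1)])
      have S_meas [measurable]: "S \<in> borel_measurable borel" unfolding S_def by measurable
      have int: "(\<integral>\<^sup>+x. g x \<partial>slb W) = ennreal t * (\<integral>\<^sup>+x. g (S x) \<partial>slb W')"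
        if [measurable]: "g \<in> borel_measurable borel" for g
      proof -
        have "ennreal t * (\<integral>\<^sup>+x. g (S x) \<partial>slb W') = ennreal (\<rho> ^ k) * (ennreal \<delta> * (\<integral>\<^sup>+x. g (a + \<rho> *\<^sub>R T x) \<partial>slb W'))"
          using \<delta>(1) \<rho>(1) by (simp add: t_def S_def ennreal_mult mult_ac)
        also have "\<dots> = ennreal (\<rho> ^ k) * (\<integral>\<^sup>+x. g (a + \<rho> *\<^sub>R x) \<partial>slb W)"
          by (subst \<delta>(2)[of "\<lambda>x. g (a + \<rho> *\<^sub>R x)"]) auto
        also have "\<dots> = (\<integral>\<^sup>+x. g (a + x) \<partial>slb W)"
          using nn_integral_slb_scale[OF W(1) \<rho>(1), of "\<lambda>x. g (a + x)"] by (simp add: W(2))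
        also have "\<dots> = (\<integral>\<^sup>+x. g x \<partial>slb W)"
          using nn_integral_slb_shift[OF W(1) a, of g] by (simp add: add.commute)
        finally show ?thesis ..
      qed
      have tinv: "ennreal (1 / t) * (ennreal t * x) = x" for x
        using t by (subst mult.assoc[symmetric], subst ennreal_mult[symmetric]) auto
      have em: "emeasure (slb W) {x. u + x \<in> K} = ennreal (t * unit_ball_vol k)"
      proof -
        have "emeasure (slb W) {x. u + x \<in> K} = (\<integral>\<^sup>+x. indicator K (u + x) \<partial>slb W)"
        proof -
          have "indicator K (u + x) = (indicator {x. u + x \<in> K} x :: ennreal)" for x by (simp add: indicator_def)
          then show ?thesis using vimage_add_borel[OF Kb, of u] by simp
        qed
        also have "\<dots> = ennreal t * (\<integral>\<^sup>+x. indicator K (u + S x) \<partial>slb W')" by (rule int) measurable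
        also have "(\<integral>\<^sup>+x. indicator K (u + S x) \<partial>slb W') = (\<integral>\<^sup>+x. indicator (cball 0 1) x \<partial>slb W')"
          by (rule nn_integral_cong_AE, rule AE_mp[OF AE_slb[OF W'(1)]], intro AE_I2 impI)
            (use memS in \<open>auto simp: indicator_def\<close>)
        also have "\<dots> = ennreal (unit_ball_vol k)" using emeasure_slb_cball[OF W'(1)] W'(2) by simp
        finally show ?thesis using t by (simp add: ennreal_mult)
      qed
      have sm: "set_moment k q W K u = ennreal (t powr (real (k + 1) + q)) * ball_moment W' k q"
      proof -
        define G where "G = (\<lambda>x. (\<Prod>i\<le>k. indicator K (u + x i)) * ennreal (pvol k (edges k x) powr q))"
        have [measurable]: "(\<lambda>x. x i) \<in> borel_measurable (Pi\<^sub>M {..k} (\<lambda>_. slb W))" if "i \<le> k" for i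
          using that by (intro measurable_PiM_slb_component) simp
        have Gm: "G \<in> borel_measurable (Pi\<^sub>M {..k} (\<lambda>_. slb W))" unfolding G_def by measurable
        have "(\<integral>\<^sup>+x. (\<Prod>i\<le>k. 1) * G (\<lambda>i\<in>{..k}. S (x i)) \<partial>Pi\<^sub>M {..k} (\<lambda>_. slb W'))
          = ennreal (1 / t) ^ card {..k} * (\<integral>\<^sup>+x. (\<Prod>i\<le>k. 1) * G x \<partial>Pi\<^sub>M {..k} (\<lambda>_. slb W))"
        proof (rule nn_integral_PiM_map[where w="\<lambda>_. 1" and w'="\<lambda>_. 1"])
          show "(\<integral>\<^sup>+x. 1 * g (S x) \<partial>slb W') = ennreal (1 / t) * (\<integral>\<^sup>+y. 1 * g y \<partial>slb W)"
            if "g \<in> borel_measurable (slb W)" for g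
            using that int[of g] by (simp add: tinv)
        qed (auto intro: sigma_finite_slb W W' Gm)
        then have "(\<integral>\<^sup>+x. G (\<lambda>i\<in>{..k}. S (x i)) \<partial>Pi\<^sub>M {..k} (\<lambda>_. slb W')) = ennreal (1 / t) ^ (k + 1) * set_moment k q W K u"
          by (simp add: set_moment_def G_def)
        moreover have "ennreal t ^ (k + 1) * (ennreal (1 / t) ^ (k + 1) * y) = y" for y
          using t by (simp add: mult.assoc[symmetric] power_mult_distrib[symmetric] ennreal_mult[symmetric] del: power_Suc)
        ultimately have "set_moment k q W K u = ennreal t ^ (k + 1) * (\<integral>\<^sup>+x. G (\<lambda>i\<in>{..k}. S (x i)) \<partial>Pi\<^sub>M {..k} (\<lambda>_. slb W'))"
          by metis
        also have "(\<integral>\<^sup>+x. G (\<lambda>i\<in>{..k}. S (x i)) \<partial>Pi\<^sub>M {..k} (\<lambda>_. slb W')) = (\<integral>\<^sup>+x. ennreal (t powr q) *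
            ((\<Prod>i\<le>k. indicator (cball 0 1) (x i)) * ennreal (pvol k (edges k x) powr q)) \<partial>Pi\<^sub>M {..k} (\<lambda>_. slb W'))"
        proof (rule nn_integral_cong_AE, rule AE_mp[OF AE_PiM_slb[OF W'(1)]], simp, intro AE_I2 impI)
          fix x assume x: "\<forall>i\<in>{..k}. x i \<in> W'"
          have e: "edges k x i \<in> W'" if "i < k" for i using x that by (intro subspace_diff[OF W'(1)]) auto
          have "pvol k (edges k (\<lambda>i\<in>{..k}. S (x i))) = pvol k (\<lambda>i. \<rho> *\<^sub>R T (edges k x i))"
            by (rule pvol_cong) (simp add: S_def linear_diff[OF T(1)] scaleR_right_diff_distrib)
          also have "\<dots> = t * pvol k (edges k x)" using \<rho>(1) \<delta>(3)[of "edges k x"] e by (simp add: pvol_scale t_def)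
          finally have "pvol k (edges k (\<lambda>i\<in>{..k}. S (x i))) powr q = t powr q * pvol k (edges k x) powr q"
            using t by (simp add: powr_mult)
          moreover have "(\<Prod>i\<le>k. indicator K (u + (\<lambda>i\<in>{..k}. S (x i)) i)) = (\<Prod>i\<le>k. indicator (cball 0 1) (x i) :: ennreal)"
            using x memS by (intro prod.cong refl) (auto simp: indicator_def)
          ultimately show "G (\<lambda>i\<in>{..k}. S (x i)) = ennreal (t powr q) *
            ((\<Prod>i\<le>k. indicator (cball 0 1) (x i)) * ennreal (pvol k (edges k x) powr q))"
            unfolding G_def by (simp add: ennreal_mult mult_ac)
        qed
        also have "\<dots> = ennreal (t powr q) * ball_moment W' k q"
          unfolding ball_moment_def
        proof (rule nn_integral_cmult)
          have [measurable]: "(\<lambda>x. x i) \<in> borel_measurable (Pi\<^sub>M {..k} (\<lambda>_. slb W'))" if "i \<le> k" for i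
            using that by (intro measurable_PiM_slb_component) simp
          have [measurable]: "cball (0::'a) 1 \<in> sets borel" by simp
          show "(\<lambda>x. (\<Prod>i\<le>k. indicator (cball 0 1) (x i)) * ennreal (pvol k (edges k x) powr q)) \<in> borel_measurable (Pi\<^sub>M {..k} (\<lambda>_. slb W'))"
            by measurable
        qed
        also have "ennreal t ^ (k + 1) * (ennreal (t powr q) * ball_moment W' k q) = ennreal (t powr (real (k + 1) + q)) * ball_moment W' k q"
        proof -
          have "t powr (real (k + 1) + q) = t ^ (k + 1) * t powr q" using t by (simp only: powr_add powr_realpow)
          then have "ennreal t ^ (k + 1) * ennreal (t powr q) = ennreal (t powr (real (k + 1) + q))"
            using t by (simp only: ennreal_power less_imp_le) (simp add: ennreal_mult[symmetric])
          then show ?thesis by (simp only: mult.assoc[symmetric])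
        qed
        finally show ?thesis .
      qed
      \<comment> \<open>The explicit value of the ball moment depends on the subspace only through
        its dimension.\<close>
      have "ball_moment W' k q = ball_moment W k q"
        by (simp only: ball_moment_eq[OF W q] ball_moment_eq[OF W' q])
      moreover have "unit_ball_vol (real k) \<noteq> 0" using unit_ball_vol_pos[of "real k"] by (metis less_irrefl of_nat_0_le_iff)
      ultimately show ?thesis unfolding sm em using t by (simp add: mult.commute)
    qed
  qed
qed

section \<open>Orientation of isometries\<close>

lemma det_matrix_compose:
  fixes f g :: "real^'n \<Rightarrow> real^'n"
  assumes "linear f" "linear g"
  shows "det (matrix (\<lambda>x. g (f x))) = det (matrix g) * det (matrix f)"
  using matrix_compose[OF assms] by (simp add: o_def det_mul)

lemma det_isometry:
  fixes f :: "real^'n \<Rightarrow> real^'n"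
  assumes "linear f" "\<And>x y. f x \<bullet> f y = x \<bullet> y"
  shows "det (matrix f) = 1 \<or> det (matrix f) = - 1"
proof -
  have "orthogonal_transformation f" using assms by (simp add: orthogonal_transformation_def)
  then have "orthogonal_matrix (matrix f)" by (simp add: orthogonal_transformation_matrix)
  then show ?thesis by (rule det_orthogonal_matrix)
qed

text \<open>Conjugation by the reflection \<open>H\<close> that exchanges \<open>u\<close> with a
  coordinate vector reduces the claim to a diagonal matrix; \<open>H\<close> enters twice, so its
  determinant drops out.\<close>

lemma det_householder:
  fixes u :: "real^'n"
  assumes "norm u = 1"
  shows "det (matrix (householder u)) = - 1"
proof -
  fix i :: 'n
  define e where "e = (axis i 1 :: real^'n)"
  have e: "norm e = 1" by (simp add: e_def)
  have mat_e: "matrix (householder e) $ r $ s = (if r = s then if r = i then - 1 else 1 else 0)" for r s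
  proof -
    have "householder e x = x - (2 * x $ i) *\<^sub>R axis i 1" for x
      by (simp add: householder_def e_def inner_axis inner_axis_axis)
    then show ?thesis by (simp add: matrix_def axis_def)
  qed
  define H where "H = householder (u - e)"
  have H: "linear H" "\<And>x y. H x \<bullet> H y = x \<bullet> y" "H u = e" "\<And>x. H (H x) = x"
    by (auto simp: H_def linear_householder inner_householder householder_involution householder_swap assms e)
  have "householder u x = H (householder e (H x))" for x
  proof -
    have "H e = u" using H(3,4) by metis
    moreover have "H x \<bullet> e = x \<bullet> u" using H(2)[of x u] H(3) by simp
    moreover have "e \<bullet> e = 1" "u \<bullet> u = 1" using e assms by (simp_all add: norm_eq_1)
    ultimately show ?thesis
      by (simp add: householder_def linear_diff[OF H(1)] linear_scale[OF H(1)] H(4))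
  qed
  then have eq: "householder u = (\<lambda>x. H (householder e (H x)))" by (rule ext)
  have "det (matrix (householder u)) = det (matrix H) * (det (matrix (householder e)) * det (matrix H))"
    unfolding eq
    by (subst det_matrix_compose[where g=H and f="\<lambda>x. householder e (H x)"])
      (auto intro!: H linear_compose[OF H(1) linear_householder, unfolded o_def] simp: det_matrix_compose[OF H(1) linear_householder])
  also have "\<dots> = det (matrix (householder e))" using det_isometry[OF H(1,2)] by auto
  also have "det (matrix (householder e)) = (\<Prod>r\<in>UNIV. matrix (householder e) $ r $ r)"
    by (rule det_diagonal) (auto simp: mat_e)
  also have "\<dots> = (\<Prod>r\<in>UNIV. if r = i then - 1 else 1)"
    by (intro prod.cong refl) (simp add: mat_e)
  also have "\<dots> = - 1" by simp
  finally show ?thesis .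
qed

text \<open>An orientation reversing isometry is corrected by a reflection that maps
  \<open>W\<close> onto itself. Its normal is the projection to \<open>W\<close> of a coordinate
  vector \<open>v\<close>, or \<open>v\<close> itself if that projection vanishes.\<close>

lemma rotation_between_subspaces:
  fixes L W :: "(real^'n) set"
  assumes L: "subspace L" and W: "subspace W" and d: "dim L = dim W"
  obtains R where "linear R" "\<And>x y. R x \<bullet> R y = x \<bullet> y" "R ` L = W" "det (matrix R) = 1"
proof -
  obtain R where R: "linear R" "\<And>x y. R x \<bullet> R y = x \<bullet> y" "R ` L = W"
    using isometry_between_subspaces[OF L W d] by metis
  consider "det (matrix R) = 1" | "det (matrix R) = - 1" using det_isometry[OF R(1,2)] by blast
  then show thesis
  proof cases
    case 1 then show thesis using R that by blast
  next
    case 2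
    obtain u where u: "norm u = 1" "householder u ` W = W"
    proof -
      fix i :: 'n
      define v where "v = (axis i 1 :: real^'n)"
      have fixW: "householder (v - proj W v) ` W = W"
      proof -
        have "householder (v - proj W v) w = w" if "w \<in> W" for w
          using proj_orth[OF W that, of v] by (intro householder_fix) (simp add: inner_commute)
        then show ?thesis by auto
      qed
      have pW: "householder (proj W v) ` W = W" by (rule householder_image[OF W proj_in[OF W]])
      have scale: "householder ((1 / norm x) *\<^sub>R x) = householder x" if "x \<noteq> 0" for x :: "real^'n"
        using that by (auto simp: householder_def fun_eq_iff power2_eq_square[symmetric] power2_norm_eq_inner[symmetric])
      show thesis
      proof (cases "proj W v = 0")
        case True
        then show thesis using fixW by (intro that[of v]) (auto simp: v_def)
      next
        case False
        then show thesis using pW scale[OF False] by (intro that[of "(1 / norm (proj W v)) *\<^sub>R proj W v"]) auto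
      qed
    qed
    show thesis
    proof (rule that[of "\<lambda>x. householder u (R x)"])
      show "linear (\<lambda>x. householder u (R x))"
        using linear_compose[OF R(1) linear_householder] by (simp add: o_def)
      show "(\<lambda>x. householder u (R x)) ` L = W" using R(3) u(2) by (metis image_image)
      show "det (matrix (\<lambda>x. householder u (R x))) = 1"
        by (simp add: det_matrix_compose R linear_householder det_householder u 2)
    qed (simp add: inner_householder R)
  qed
qed

lemma measurable_det_gs_isometry [measurable]:
  "(\<lambda>z. det (matrix (gs_isometry z))) \<in> borel_measurable (gs_space :: (nat \<Rightarrow> real^'n) measure)"
proof -
  have [measurable]: "(\<lambda>z::nat \<Rightarrow> real^'n. z i) \<in> borel_measurable gs_space" if "i < DIM(real^'n)" for i
    using that by (intro measurable_compose[OF measurable_component_singleton]) auto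
  have [measurable]: "(\<lambda>z::nat \<Rightarrow> real^'n. gs_isometry z v) \<in> borel_measurable gs_space" for v
    by measurable
  have "(\<lambda>z::nat \<Rightarrow> real^'n. matrix (gs_isometry z) $ i $ j) \<in> borel_measurable gs_space" for i j
  proof -
    have "matrix (gs_isometry z) $ i $ j = gs_isometry z (axis j 1) \<bullet> axis i 1" for z :: "nat \<Rightarrow> real^'n"
      by (simp add: matrix_def inner_axis)
    then show ?thesis by (simp only:) measurable
  qed
  note [measurable] = this
  show ?thesis unfolding det_def by measurable
qed

section \<open>The invariant measure on flats\<close>

text \<open>Orthogonality of \<open>u\<close> to \<open>L\<close> makes the representation unique:
  \<open>u\<close> is the point of \<open>E\<close> nearest to the origin.\<close>

definition flat_rep :: "'a::euclidean_space set \<Rightarrow> 'a set \<Rightarrow> 'a \<Rightarrow> bool" where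
  "flat_rep E L u \<longleftrightarrow> subspace L \<and> (\<forall>x\<in>L. u \<bullet> x = 0) \<and> E = (\<lambda>x. u + x) ` L"

lemma flat_rep_exists:
  fixes E :: "(real^'n) set"
  assumes "E \<in> affine_grassmannian k"
  obtains L u where "flat_rep E L u" "dim L = k"
proof -
  have E: "affine E" "aff_dim E = int k" using assms by (auto simp: affine_grassmannian_def)
  then have "E \<noteq> {}" by auto
  then obtain a where a: "a \<in> E" by auto
  define L where "L = (\<lambda>x. - a + x) ` E"
  have L: "subspace L" unfolding L_def by (rule affine_diffs_subspace[OF E(1) a])
  have "int (dim L) = int k"
    using aff_dim_subspace[OF L] E(2) unfolding L_def by (simp add: aff_dim_translation_eq aff_dim_translation_eq_subtract)
  then have d: "dim L = k" by simp
  define u where "u = a - proj L a"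
  have EL: "E = (\<lambda>x. a + x) ` L" by (auto simp: L_def image_image)
  have "E = (\<lambda>x. u + x) ` L"
  proof -
    have m: "proj L a + x \<in> L" "x - proj L a \<in> L" if "x \<in> L" for x
      using that proj_in[OF L] L by (auto intro: subspace_add subspace_diff)
    have "a + x = u + (proj L a + x)" "u + x = a + (x - proj L a)" for x by (simp_all add: u_def)
    then show ?thesis unfolding EL by (intro equalityI subsetI) (blast intro: m)+
  qed
  then have "flat_rep E L u" using L proj_orth[OF L] by (simp add: flat_rep_def u_def)
  then show thesis using d by (rule that)
qed

lemma flat_in_grassmannian:
  fixes L :: "(real^'n) set"
  assumes "subspace L" "dim L = k"
  shows "(\<lambda>x. u + x) ` L \<in> affine_grassmannian k"
  using assms by (simp add: affine_grassmannian_def affine_translation[symmetric] subspace_imp_affine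
      aff_dim_translation_eq aff_dim_subspace)

lemma flat_nearest:
  assumes E: "flat_rep E L u"
  shows "u + proj L x \<in> E" and "infdist x E = norm (x - proj L x - u)" and "dist x (u + proj L x) = infdist x E"
proof -
  have L: "subspace L" "\<And>y. y \<in> L \<Longrightarrow> u \<bullet> y = 0" "E = (\<lambda>x. u + x) ` L" using E by (auto simp: flat_rep_def)
  show in_E: "u + proj L x \<in> E" using L(3) proj_in[OF L(1)] by auto
  have d: "dist x (u + proj L x) = norm (x - proj L x - u)" by (simp add: dist_norm algebra_simps)
  show inf: "infdist x E = norm (x - proj L x - u)"
  proof (rule antisym)
    show "infdist x E \<le> norm (x - proj L x - u)" using infdist_le[OF in_E, of x] d by simp
    have "norm (x - proj L x - u) \<le> dist x y" if y: "y \<in> E" for y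
    proof -
      obtain l where l: "l \<in> L" "y = u + l" using y L(3) by auto
      have m: "proj L x - l \<in> L" using l(1) proj_in[OF L(1)] L(1) by (auto intro: subspace_diff)
      have "(x - proj L x - u) \<bullet> (proj L x - l) = 0"
        using proj_orth[OF L(1) m, of x] L(2)[OF m] by (simp add: inner_diff_left)
      then have "(norm ((x - proj L x - u) + (proj L x - l)))\<^sup>2 = (norm (x - proj L x - u))\<^sup>2 + (norm (proj L x - l))\<^sup>2"
        by (intro norm_add_Pythagorean) (simp add: orthogonal_def)
      moreover have "(x - proj L x - u) + (proj L x - l) = x - y" by (simp add: l)
      ultimately have "(norm (x - proj L x - u))\<^sup>2 \<le> (dist x y)\<^sup>2" by (simp add: dist_norm)
      then show ?thesis by (rule power2_le_imp_le) simp
    qed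
    then show "norm (x - proj L x - u) \<le> infdist x E"
      using in_E unfolding infdist_def by (auto intro!: cINF_greatest)
  qed
  show "dist x (u + proj L x) = infdist x E" using d inf by simp
qed

text \<open>
  The direction space and the foot of a flat are recovered, by polarisation, from its distances to
  points, because these are visibly measurable.
\<close>

definition flat_form :: "'a::euclidean_space set \<Rightarrow> 'a \<Rightarrow> 'a \<Rightarrow> real" where
  "flat_form E x y = (let q = (\<lambda>v. ((infdist v E)\<^sup>2 + (infdist (- v) E)\<^sup>2) / 2 - (infdist 0 E)\<^sup>2)
     in (q (x + y) - q x - q y) / 2)"

definition flat_perp :: "'a::euclidean_space set \<Rightarrow> 'a \<Rightarrow> 'a" where
  "flat_perp E x = (\<Sum>c\<in>Basis. (x \<bullet> c) *\<^sub>R (\<Sum>b\<in>Basis. flat_form E c b *\<^sub>R b))"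

definition flat_foot :: "'a::euclidean_space set \<Rightarrow> 'a" where
  "flat_foot E = (\<Sum>b\<in>Basis. (((infdist (- b) E)\<^sup>2 - (infdist b E)\<^sup>2) / 4) *\<^sub>R b)"

text \<open>With \<open>p\<close> the projection onto the complement of \<open>L\<close>, the
  squared distance of \<open>v\<close> from \<open>E\<close> is
  \<open>p v \<bullet> p v - 2 * (v \<bullet> u) + u \<bullet> u\<close>. The even part in
  \<open>v\<close>, minus the value at 0, is a quadratic form that polarises to \<open>p\<close>;
  the odd part gives \<open>u\<close>.\<close>

lemma flat_rep_perp_foot:
  assumes E: "flat_rep E L u"
  shows "flat_perp E x = x - proj L x" and "flat_foot E = u"
proof -
  have L: "subspace L" "\<And>y. y \<in> L \<Longrightarrow> u \<bullet> y = 0" using E by (auto simp: flat_rep_def)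
  define p where "p = (\<lambda>x. x - proj L x)"
  have lin: "linear p" unfolding p_def by (intro linear_compose_sub linear_proj L linear_id[unfolded id_def])
  have pu: "p x \<bullet> u = x \<bullet> u" for x
    using L(2)[OF proj_in[OF L(1), of x]] by (simp add: p_def inner_diff_left inner_diff_right inner_commute)
  have pp: "p x \<bullet> p y = p x \<bullet> y" for x y
    using proj_orth[OF L(1) proj_in[OF L(1), of y], of x] by (simp add: p_def inner_diff_right)
  have sq: "(infdist v E)\<^sup>2 = p v \<bullet> p v - 2 * (v \<bullet> u) + u \<bullet> u" for v
  proof -
    have "infdist v E = norm (p v - u)" by (simp add: flat_nearest(2)[OF E] p_def)
    moreover have "(p v - u) \<bullet> (p v - u) = p v \<bullet> p v - 2 * (p v \<bullet> u) + u \<bullet> u"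
      by (simp add: inner_diff_left inner_diff_right inner_commute)
    ultimately show ?thesis by (simp add: power2_norm_eq_inner pu)
  qed
  have p0: "p 0 = 0" using lin by (rule linear_0)
  have q: "((infdist v E)\<^sup>2 + (infdist (- v) E)\<^sup>2) / 2 - (infdist 0 E)\<^sup>2 = p v \<bullet> p v" for v
    unfolding sq by (simp add: linear_neg[OF lin] p0 field_simps)
  have form: "flat_form E c b = p c \<bullet> b" for c b
    unfolding flat_form_def Let_def q linear_add[OF lin] pp[of c b, symmetric]
    by (simp add: inner_add_left inner_add_right inner_commute[of "p b" "p c"])
  have "flat_perp E x = (\<Sum>c\<in>Basis. (x \<bullet> c) *\<^sub>R p c)"
    unfolding flat_perp_def form by (simp add: euclidean_representation)
  also have "\<dots> = p (\<Sum>c\<in>Basis. (x \<bullet> c) *\<^sub>R c)" by (simp add: linear_sum[OF lin] linear_scale[OF lin])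
  finally show "flat_perp E x = x - proj L x" by (simp add: euclidean_representation p_def)
  have "((infdist (- b) E)\<^sup>2 - (infdist b E)\<^sup>2) / 4 = u \<bullet> b" for b
    unfolding sq by (simp add: linear_neg[OF lin] inner_commute)
  then show "flat_foot E = u" unfolding flat_foot_def by (simp add: euclidean_representation)
qed

lemma flat_rep_translate:
  assumes E: "flat_rep E L u"
  shows "flat_rep ((\<lambda>x. t + x) ` E) L (u + (t - proj L t))"
proof -
  have L: "subspace L" "\<And>y. y \<in> L \<Longrightarrow> u \<bullet> y = 0" "E = (\<lambda>x. u + x) ` L" using E by (auto simp: flat_rep_def)
  have "(\<lambda>x. t + x) ` E = (\<lambda>x. u + (t - proj L t) + x) ` L"
  proof -
    have m: "proj L t + x \<in> L" "x - proj L t \<in> L" if "x \<in> L" for x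
      using that proj_in[OF L(1)] L(1) by (auto intro: subspace_add subspace_diff)
    have "t + (u + x) = u + (t - proj L t) + (proj L t + x)" "u + (t - proj L t) + x = t + (u + (x - proj L t))" for x
      by (simp_all add: algebra_simps)
    then show ?thesis unfolding L(3) image_image by (intro equalityI subsetI) (blast intro: m)+
  qed
  moreover have "(u + (t - proj L t)) \<bullet> x = 0" if "x \<in> L" for x
    using L(2)[OF that] proj_orth[OF L(1) that, of t] by (simp add: inner_add_left)
  ultimately show ?thesis using L(1) unfolding flat_rep_def by blast
qed

lemma flat_rep_isometry:
  assumes E: "flat_rep E L u" and Q: "linear Q" "\<And>x y. Q x \<bullet> Q y = x \<bullet> y"
  shows "flat_rep (Q ` E) (Q ` L) (Q u)"
  using E Q unfolding flat_rep_def
  by (auto simp: linear_subspace_image image_image linear_add)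

lemma orth_in_isometry:
  fixes Q :: "'a::euclidean_space \<Rightarrow> 'a"
  assumes Q: "linear Q" "\<And>x y. Q x \<bullet> Q y = x \<bullet> y"
  shows "orth_in UNIV (Q ` L) = Q ` orth_in UNIV L"
proof -
  have "Q x = 0 \<Longrightarrow> x = 0" for x using Q(2)[of x x] by simp
  then have "inj Q" using Q(1) by (metis linear_injective_0)
  then have "surj Q" using Q(1) by (simp add: linear_injective_imp_surjective)
  then show ?thesis unfolding orth_in_def using Q(2)
    by (auto simp: image_iff) (metis surjD)
qed

lemma proj_orth_in: "subspace L \<Longrightarrow> proj (orth_in UNIV L) x = x - proj L x"
  by (rule proj_eqI[OF subspace_orth_in[OF subspace_UNIV]])
    (auto simp: orth_in_def proj_orth inner_commute[of _ "x - proj L x"] inner_commute[of "proj L x"] proj_in)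

section \<open>Integrals of powers of section volumes\<close>

definition ball_power :: "nat \<Rightarrow> real \<Rightarrow> ennreal \<Rightarrow> ennreal" where
  "ball_power k s v = ennreal ((enn2real v / unit_ball_vol k) powr s)"

lemma measurable_ball_power [measurable]: "ball_power k s \<in> borel_measurable borel"
  unfolding ball_power_def by measurable

text \<open>All translates of \<open>L\<close> are cut with the preimage of \<open>K\<close> under
  \<open>Q\<close>; for isometric \<open>Q\<close> this amounts to cutting \<open>K\<close> itself
  with the flats of direction \<open>Q\<close> applied to \<open>L\<close>.\<close>

definition sections :: "nat \<Rightarrow> real \<Rightarrow> 'a::euclidean_space set \<Rightarrow> ('a \<Rightarrow> 'a) \<Rightarrow> 'a set \<Rightarrow> ennreal" where
  "sections k s K Q L = (\<integral>\<^sup>+v. ball_power k s (\<integral>\<^sup>+x. indicator K (Q (v + x)) \<partial>slb L) \<partial>slb (orth_in UNIV L))"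

lemma sections_isometry:
  assumes L: "subspace L" and K: "K \<in> sets borel" and Q: "Q \<in> borel_measurable borel"
    and R: "linear R" "\<And>x y. R x \<bullet> R y = x \<bullet> y"
  shows "sections k s K Q (R ` L) = sections k s K (\<lambda>x. Q (R x)) L"
proof -
  note [measurable] = K Q measurable_linear[OF R(1)]
  interpret S: sigma_finite_measure "slb L" by (rule sigma_finite_slb[OF L])
  have RL: "subspace (R ` L)" using L R(1) by (simp add: linear_subspace_image)
  interpret SR: sigma_finite_measure "slb (R ` L)" by (rule sigma_finite_slb[OF RL])
  have "sections k s K Q (R ` L) = (\<integral>\<^sup>+v. ball_power k s (\<integral>\<^sup>+x. indicator K (Q (R v + x)) \<partial>slb (R ` L)) \<partial>slb (orth_in UNIV L))"
    unfolding sections_def orth_in_isometry[OF R]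
    by (rule nn_integral_slb_isometry[OF subspace_orth_in[OF subspace_UNIV] R, symmetric]) measurable
  also have "\<dots> = sections k s K (\<lambda>x. Q (R x)) L"
    unfolding sections_def
  proof (rule nn_integral_cong, rule arg_cong[where f="ball_power k s"])
    fix v
    show "(\<integral>\<^sup>+x. indicator K (Q (R v + x)) \<partial>slb (R ` L)) = (\<integral>\<^sup>+x. indicator K (Q (R (v + x))) \<partial>slb L)"
      unfolding linear_add[OF R(1)]
      by (rule nn_integral_slb_isometry[OF L R, symmetric]) measurable
  qed
  finally show ?thesis .
qed

text \<open>The section integral over the direction space of \<open>E\<close>, unfolded into an
  ambient Gaussian integral in terms of \<open>flat_perp\<close>. The direction space thus enters
  only through functions that are measurable in \<open>E\<close>.\<close>

definition flat_section :: "nat \<Rightarrow> real \<Rightarrow> 'a::euclidean_space set \<Rightarrow> ('a \<Rightarrow> 'a) \<Rightarrow> 'a set \<Rightarrow> 'a \<Rightarrow> ennreal" where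
  "flat_section k s K Q E v = ball_power k s
     (\<integral>\<^sup>+x. gauss (flat_perp E x) * indicator K (Q (v + (x - flat_perp E x))) \<partial>lborel)"

definition flat_sections :: "nat \<Rightarrow> real \<Rightarrow> 'a::euclidean_space set \<Rightarrow> ('a \<Rightarrow> 'a) \<Rightarrow> 'a set \<Rightarrow> ennreal" where
  "flat_sections k s K Q E = (\<integral>\<^sup>+t. gauss (t - flat_perp E t) * flat_section k s K Q E (flat_perp E t) \<partial>lborel)"

lemma flat_section_eq:
  assumes E: "flat_rep E L u" and K: "K \<in> sets borel" and Q: "Q \<in> borel_measurable borel"
  shows "flat_section k s K Q E v = ball_power k s (\<integral>\<^sup>+x. indicator K (Q (v + x)) \<partial>slb L)"
proof -
  note [measurable] = K Q
  have L: "subspace L" using E by (simp add: flat_rep_def)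
  show ?thesis unfolding flat_section_def flat_rep_perp_foot(1)[OF E]
    by (subst nn_integral_slb[OF L]) simp_all
qed

lemma flat_sections_eq:
  assumes E: "flat_rep E L u" and K: "K \<in> sets borel" and Q: "Q \<in> borel_measurable borel"
  shows "flat_sections k s K Q E = sections k s K Q L"
proof -
  note [measurable] = K Q
  have L: "subspace L" using E by (simp add: flat_rep_def)
  interpret S: sigma_finite_measure "slb L" by (rule sigma_finite_slb[OF L])
  have U: "subspace (orth_in UNIV L)" by (simp add: subspace_orth_in)
  show ?thesis
    unfolding flat_sections_def flat_section_eq[OF E K Q] flat_rep_perp_foot(1)[OF E] sections_def
    by (subst nn_integral_slb[OF U]) (simp_all add: proj_orth_in[OF L])
qed

section \<open>Integration against an invariant measure on flats\<close>

locale invariant_flats =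
  fixes k :: nat and \<mu> :: "(real^'n) set measure"
  assumes \<mu>: "invariant_flat_measure k \<mu>" and k: "k \<le> CARD('n)"
begin

lemma space_flats: "space \<mu> = affine_grassmannian k" and
  sets_flats: "sets \<mu> = sigma_sets (affine_grassmannian k) {flats_hitting k K | K. compact K}"
  using \<mu> by (simp_all add: invariant_flat_measure_def affine_grassmannian_algebra_def)

lemma flats_hitting_sets: "compact K \<Longrightarrow> flats_hitting k K \<in> sets \<mu>"
  unfolding sets_flats by (intro sigma_sets.Basic) auto

lemma affine_grassmannian_image:
  fixes Q :: "real^'n \<Rightarrow> real^'n"
  assumes Q: "linear Q" "\<And>x y. Q x \<bullet> Q y = x \<bullet> y" and E: "E \<in> affine_grassmannian k"
  shows "(\<lambda>x. a + Q x) ` E \<in> affine_grassmannian k"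
proof -
  obtain L u where Lu: "flat_rep E L u" "dim L = k" using flat_rep_exists[OF E] .
  have L: "subspace L" "E = (\<lambda>x. u + x) ` L" using Lu by (auto simp: flat_rep_def)
  have "Q x = 0 \<Longrightarrow> x = 0" for x using Q(2)[of x x] by simp
  then have "inj Q" using Q(1) by (metis linear_injective_0)
  then have "dim (Q ` L) = k" using Q(1) Lu(2) by (simp add: dim_image_eq inj_on_subset)
  moreover have "subspace (Q ` L)" using L Q(1) by (simp add: linear_subspace_image)
  moreover have "(\<lambda>x. a + Q x) ` E = (\<lambda>x. (a + Q u) + x) ` (Q ` L)"
    by (simp add: L(2) image_image linear_add[OF Q(1)] add.assoc)
  ultimately show ?thesis using flat_in_grassmannian[of "Q ` L" k "a + Q u"] by simp
qed

text \<open>The axiom speaks of images of measurable sets; for integrals the action on flats must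
  itself be measurable. On the generators this holds because a flat moved by \<open>g\<close> hits
  \<open>K\<close> exactly if the flat hits the compact image of \<open>K\<close> under the inverse
  motion.\<close>

lemma nn_integral_rigid:
  fixes Q :: "real^'n \<Rightarrow> real^'n" and f :: "(real^'n) set \<Rightarrow> ennreal"
  assumes Q: "linear Q" "\<And>x y. Q x \<bullet> Q y = x \<bullet> y" "det (matrix Q) = 1" and f: "f \<in> borel_measurable \<mu>"
  shows "(\<integral>\<^sup>+E. f ((\<lambda>x. a + Q x) ` E) \<partial>\<mu>) = (\<integral>\<^sup>+E. f E \<partial>\<mu>)"
proof -
  define g where "g = (\<lambda>x. a + Q x)"
  have "Q x = 0 \<Longrightarrow> x = 0" for x using Q(2)[of x x] by simp
  then have "inj Q" using Q(1) by (metis linear_injective_0)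
  then obtain P where P: "linear P" "\<And>x. P (Q x) = x" "\<And>x. Q (P x) = x"
    using linear_injective_isomorphism[OF Q(1)] by metis
  have Pi: "P x \<bullet> P y = x \<bullet> y" for x y using Q(2)[of "P x" "P y"] by (simp add: P)
  have dP: "det (matrix P) = 1"
  proof -
    have "(\<lambda>x. P (Q x)) = (\<lambda>x. x)" by (simp add: P)
    then have "det (matrix P) * det (matrix Q) = det (matrix (\<lambda>x::real^'n. x))"
      using det_matrix_compose[OF Q(1) P(1)] by simp
    then show ?thesis using Q(3) matrix_id by (simp add: id_def)
  qed
  define h where "h = (\<lambda>x. - P a + P x)"
  have gh: "g (h x) = x" "h (g x) = x" for x
    by (simp_all add: g_def h_def linear_add[OF Q(1)] linear_diff[OF Q(1)] linear_neg[OF Q(1)] linear_add[OF P(1)] P)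
  have rigid: "rigid_motion h"
  proof -
    have "orthogonal_transformation P" using P(1) Pi by (simp add: orthogonal_transformation_def)
    then have "rotation_matrix (matrix P)"
      using dP by (simp add: rotation_matrix_def orthogonal_transformation_matrix)
    moreover have "h = (\<lambda>x. - P a + matrix P *v x)" using P(1) by (simp add: h_def matrix_works fun_eq_iff)
    ultimately show ?thesis unfolding rigid_motion_def by blast
  qed
  have g_in: "g ` E \<in> affine_grassmannian k" if "E \<in> affine_grassmannian k" for E
    unfolding g_def by (rule affine_grassmannian_image[OF Q(1,2) that])
  have h_in: "h ` E \<in> affine_grassmannian k" if "E \<in> affine_grassmannian k" for E
    unfolding h_def by (rule affine_grassmannian_image[OF P(1) Pi that])
  have g_meas: "(\<lambda>E. g ` E) \<in> measurable \<mu> \<mu>"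
  proof (rule measurable_sigma_sets[OF sets_flats])
    show "{flats_hitting k K |K. compact K} \<subseteq> Pow (affine_grassmannian k :: (real^'n) set set)" by (auto simp: flats_hitting_def)
    show "(\<lambda>E. g ` E) \<in> space \<mu> \<rightarrow> affine_grassmannian k" using g_in by (simp add: space_flats)
    fix A :: "(real^'n) set set" assume "A \<in> {flats_hitting k K |K. compact K}"
    then obtain K where K: "compact K" "A = flats_hitting k K" by blast
    have "compact (h ` K)" unfolding h_def
      by (intro compact_continuous_image continuous_intros linear_continuous_on K)
        (simp add: P(1) linear_conv_bounded_linear[symmetric])
    moreover have "(\<lambda>E. g ` E) -` A \<inter> space \<mu> = flats_hitting k (h ` K)"
    proof -
      have "g ` E \<inter> K \<noteq> {} \<longleftrightarrow> E \<inter> h ` K \<noteq> {}" for E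
        by (auto simp: gh) (metis IntI gh(1) image_eqI empty_iff gh(2))+
      then show ?thesis using g_in by (auto simp: K space_flats flats_hitting_def)
    qed
    ultimately show "(\<lambda>E. g ` E) -` A \<inter> space \<mu> \<in> sets \<mu>" by (simp add: flats_hitting_sets)
  qed
  have "distr \<mu> \<mu> (\<lambda>E. g ` E) = \<mu>"
  proof (rule measure_eqI)
    fix A assume "A \<in> sets (distr \<mu> \<mu> (\<lambda>E. g ` E))"
    then have A: "A \<in> sets \<mu>" by simp
    \<comment> \<open>The preimage under \<open>g\<close> is the image under the inverse motion
      \<open>h\<close>, the form to which the axiom applies.\<close>
    have "(\<lambda>E. g ` E) -` A \<inter> space \<mu> = (\<lambda>E. h ` E) ` A"
    proof -
      have Asp: "A \<subseteq> affine_grassmannian k" using sets.sets_into_space[OF A] by (simp add: space_flats)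
      have gh': "g ` h ` E = E" "h ` g ` E = E" for E by (simp_all add: image_image gh)
      show ?thesis
      proof (intro equalityI subsetI)
        fix E assume "E \<in> (\<lambda>E. g ` E) -` A \<inter> space \<mu>"
        then show "E \<in> (\<lambda>E. h ` E) ` A" by (intro image_eqI[of _ _ "g ` E"]) (auto simp: gh')
      next
        fix E assume "E \<in> (\<lambda>E. h ` E) ` A"
        then show "E \<in> (\<lambda>E. g ` E) -` A \<inter> space \<mu>" using Asp h_in by (auto simp: gh' space_flats)
      qed
    qed
    then have "emeasure (distr \<mu> \<mu> (\<lambda>E. g ` E)) A = emeasure \<mu> ((\<lambda>E. h ` E) ` A)"
      using emeasure_distr[OF g_meas A] by simp
    also have "\<dots> = emeasure \<mu> A" using \<mu> rigid A by (auto simp: invariant_flat_measure_def)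
    finally show "emeasure (distr \<mu> \<mu> (\<lambda>E. g ` E)) A = emeasure \<mu> A" .
  qed simp
  then have "(\<integral>\<^sup>+E. f E \<partial>\<mu>) = (\<integral>\<^sup>+E. f E \<partial>distr \<mu> \<mu> (\<lambda>E. g ` E))" by simp
  also have "\<dots> = (\<integral>\<^sup>+E. f (g ` E) \<partial>\<mu>)" by (rule nn_integral_distr[OF g_meas]) (simp add: f)
  finally show ?thesis by (simp add: g_def)
qed

lemma nn_integral_translate:
  assumes "f \<in> borel_measurable \<mu>"
  shows "(\<integral>\<^sup>+E. f ((\<lambda>x. a + x) ` E) \<partial>\<mu>) = (\<integral>\<^sup>+E. f E \<partial>\<mu>)"
proof -
  have "det (matrix (\<lambda>x::real^'n. x)) = 1" using matrix_id by (simp add: id_def)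
  then show ?thesis
    using nn_integral_rigid[of "\<lambda>x. x" f a] assms linear_id by (simp add: id_def)
qed

lemma flat_hits_iff:
  assumes E: "E \<in> affine_grassmannian k"
  shows "E \<inter> cball x r \<noteq> {} \<longleftrightarrow> infdist x E \<le> r"
proof
  assume "E \<inter> cball x r \<noteq> {}"
  then obtain y where "y \<in> E" "dist x y \<le> r" by auto
  then show "infdist x E \<le> r" using infdist_le[of y E x] by simp
next
  assume r: "infdist x E \<le> r"
  obtain L u where Lu: "flat_rep E L u" using flat_rep_exists[OF E] by metis
  have "u + proj L x \<in> E \<inter> cball x r" using flat_nearest[OF Lu, of x] r by simp
  then show "E \<inter> cball x r \<noteq> {}" by blast
qed

text \<open>Sublevel sets of the distance from \<open>x\<close> are sets of flats hitting a closed
  ball, hence generators of the sigma-algebra.\<close>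

lemma measurable_infdist_flat [measurable]: "(\<lambda>E. infdist x E) \<in> borel_measurable \<mu>"
proof (rule borel_measurableI_le)
  fix r
  have "{E \<in> space \<mu>. infdist x E \<le> r} = flats_hitting k (cball x r)"
    using flat_hits_iff by (auto simp: space_flats flats_hitting_def)
  then show "{E \<in> space \<mu>. infdist x E \<le> r} \<in> sets \<mu>" by (simp add: flats_hitting_sets)
qed

lemma measurable_flat_perp [measurable (raw)]:
  assumes [measurable]: "E \<in> measurable M \<mu>" "x \<in> borel_measurable M"
  shows "(\<lambda>\<omega>. flat_perp (E \<omega>) (x \<omega>)) \<in> borel_measurable M"
proof -
  have [measurable]: "(\<lambda>\<omega>. flat_form (E \<omega>) c b) \<in> borel_measurable M" for c b
    unfolding flat_form_def Let_def by measurable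
  show ?thesis unfolding flat_perp_def by measurable
qed

lemma measurable_flat_foot [measurable]: "flat_foot \<in> borel_measurable \<mu>"
  unfolding flat_foot_def by measurable

text \<open>Every flat hits a unit ball centred in a countable dense set, and by translation
  invariance and the normalisation the flats hitting one such ball have finite measure.\<close>

lemma sigma_finite_flats: "sigma_finite_measure \<mu>"
proof
  obtain D :: "(real^'n) set" where D: "countable D" "\<And>X. open X \<Longrightarrow> X \<noteq> {} \<Longrightarrow> \<exists>d\<in>D. d \<in> X"
    using countable_dense_exists by blast
  have fin: "emeasure \<mu> (flats_hitting k (cball d 1)) \<noteq> \<infinity>" for d :: "real^'n"
  proof -
    have fhm: "flats_hitting k (cball a 1) \<in> sets \<mu>" for a :: "real^'n" by (intro flats_hitting_sets compact_cball)
    have "(\<integral>\<^sup>+E. indicator (flats_hitting k (cball d 1)) ((\<lambda>x. d + x) ` E) \<partial>\<mu>) = (\<integral>\<^sup>+E. indicator (flats_hitting k (cball d 1)) E \<partial>\<mu>)"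
      by (intro nn_integral_translate borel_measurable_indicator fhm)
    also have "\<dots> = emeasure \<mu> (flats_hitting k (cball d 1))" by (simp add: fhm)
    also have "(\<integral>\<^sup>+E. indicator (flats_hitting k (cball d 1)) ((\<lambda>x. d + x) ` E) \<partial>\<mu>) = (\<integral>\<^sup>+E. indicator (flats_hitting k (cball 0 1)) E \<partial>\<mu>)"
    proof (rule nn_integral_cong)
      fix E assume "E \<in> space \<mu>"
      then have E: "E \<in> affine_grassmannian k" by (simp add: space_flats)
      have E': "(\<lambda>x. d + x) ` E \<in> affine_grassmannian k"
        using affine_grassmannian_image[of "\<lambda>x. x" E d] E linear_id by (simp add: id_def)
      have "(\<lambda>x. d + x) ` E \<inter> cball d 1 \<noteq> {} \<longleftrightarrow> E \<inter> cball 0 1 \<noteq> {}"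
      proof -
        have "(\<lambda>x. d + x) ` E \<inter> cball d 1 = (\<lambda>x. d + x) ` (E \<inter> cball 0 1)" by (auto simp: dist_norm)
        then show ?thesis by simp
      qed
      then show "indicator (flats_hitting k (cball d 1)) ((\<lambda>x. d + x) ` E) = (indicator (flats_hitting k (cball 0 1)) E :: ennreal)"
        using E E' by (simp add: flats_hitting_def indicator_def)
    qed
    also have "\<dots> = emeasure \<mu> (flats_hitting k (cball 0 1))" by (simp add: fhm)
    finally have "emeasure \<mu> (flats_hitting k (cball d 1)) = emeasure \<mu> (flats_hitting k (cball 0 1))" ..
    then show ?thesis using \<mu> by (simp add: invariant_flat_measure_def)
  qed
  have "\<Union>((\<lambda>d. flats_hitting k (cball d 1)) ` D) = space \<mu>"
  proof (intro equalityI subsetI)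
    fix E assume "E \<in> space \<mu>"
    then have E: "E \<in> affine_grassmannian k" by (simp add: space_flats)
    then have "E \<noteq> {}" by (auto simp: affine_grassmannian_def)
    then obtain a where a: "a \<in> E" by auto
    obtain d where d: "d \<in> D" "d \<in> ball a 1" using D(2)[of "ball a 1"] by auto
    then have "a \<in> E \<inter> cball d 1" using a by (simp add: dist_commute less_imp_le)
    then have "E \<in> flats_hitting k (cball d 1)" using E unfolding flats_hitting_def by blast
    then show "E \<in> \<Union>((\<lambda>d. flats_hitting k (cball d 1)) ` D)" using d(1) by blast
  qed (auto simp: flats_hitting_def space_flats)
  then show "\<exists>A. countable A \<and> A \<subseteq> sets \<mu> \<and> \<Union>A = space \<mu> \<and> (\<forall>a\<in>A. emeasure \<mu> a \<noteq> \<infinity>)"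
    using D(1) fin by (intro exI[of _ "(\<lambda>d. flats_hitting k (cball d 1)) ` D"])
      (auto intro!: flats_hitting_sets compact_cball)
qed

end

lemma flat_rep_translate_eqs:
  assumes E: "flat_rep E L u"
  shows "flat_perp ((\<lambda>x. t + x) ` E) = flat_perp E"
    and "flat_foot ((\<lambda>x. t + x) ` E) = flat_foot E + flat_perp E t"
    and "flat_section k s K Q ((\<lambda>x. t + x) ` E) = flat_section k s K Q E"
proof -
  note E' = flat_rep_translate[OF E, of t]
  show p: "flat_perp ((\<lambda>x. t + x) ` E) = flat_perp E"
    by (rule ext) (simp add: flat_rep_perp_foot(1)[OF E] flat_rep_perp_foot(1)[OF E'])
  show "flat_foot ((\<lambda>x. t + x) ` E) = flat_foot E + flat_perp E t"
    by (simp add: flat_rep_perp_foot(1)[OF E] flat_rep_perp_foot(2)[OF E] flat_rep_perp_foot(2)[OF E'])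
  show "flat_section k s K Q ((\<lambda>x. t + x) ` E) = flat_section k s K Q E"
    by (rule ext) (simp add: flat_section_def p)
qed

lemma measurable_sections:
  fixes K :: "'a::euclidean_space set"
  assumes L: "subspace L" and [measurable]: "K \<in> sets borel" "(\<lambda>p. Q (fst p) (snd p)) \<in> borel_measurable (M \<Otimes>\<^sub>M borel)"
  shows "(\<lambda>\<omega>. sections k s K (Q \<omega>) L) \<in> borel_measurable M"
proof -
  interpret S: sigma_finite_measure "slb L" by (rule sigma_finite_slb[OF L])
  interpret O: sigma_finite_measure "slb (orth_in UNIV L)" by (intro sigma_finite_slb subspace_orth_in subspace_UNIV)
  have [measurable]: "(\<lambda>\<omega>. Q (f \<omega>) (g \<omega>)) \<in> borel_measurable N"
    if "f \<in> measurable N M" "g \<in> borel_measurable N" for f g and N :: "'m measure"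
    using measurable_compose[OF measurable_Pair[OF that] assms(3)] by simp
  show ?thesis unfolding sections_def by measurable
qed

section \<open>Averaging over translations\<close>

context invariant_flats
begin

lemma measurable_flat_section [measurable (raw)]:
  fixes K :: "(real^'n) set"
  assumes [measurable]: "K \<in> sets borel" "E \<in> measurable M \<mu>" "v \<in> borel_measurable M"
    and Q: "(\<lambda>p. Q (fst p) (snd p)) \<in> borel_measurable (M \<Otimes>\<^sub>M borel)"
  shows "(\<lambda>\<omega>. flat_section k s K (Q \<omega>) (E \<omega>) (v \<omega>)) \<in> borel_measurable M"
proof -
  have [measurable]: "(\<lambda>\<omega>. Q (f \<omega>) (g \<omega>)) \<in> borel_measurable N"
    if "f \<in> measurable N M" "g \<in> borel_measurable N" for f g and N :: "'m measure"
    using measurable_compose[OF measurable_Pair[OF that] Q] by simp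
  show ?thesis unfolding flat_section_def by measurable
qed

lemma measurable_flat_sections [measurable (raw)]:
  fixes K :: "(real^'n) set"
  assumes [measurable]: "K \<in> sets borel" "E \<in> measurable M \<mu>"
    and Q: "(\<lambda>p. Q (fst p) (snd p)) \<in> borel_measurable (M \<Otimes>\<^sub>M borel)"
  shows "(\<lambda>\<omega>. flat_sections k s K (Q \<omega>) (E \<omega>)) \<in> borel_measurable M"
proof -
  have [measurable]: "(\<lambda>\<omega>. Q (f \<omega>) (g \<omega>)) \<in> borel_measurable N"
    if "f \<in> measurable N M" "g \<in> borel_measurable N" for f g and N :: "'m measure"
    using measurable_compose[OF measurable_Pair[OF that] Q] by simp
  show ?thesis unfolding flat_sections_def by measurable
qed

text \<open>The Gaussian integrates out the part of \<open>t\<close> along \<open>E\<close>, leaving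
  the volume of the unit ball in the complement. The value is the same for all flats.\<close>

lemma nn_integral_flat_perp_ball:
  fixes E :: "(real^'n) set"
  assumes E: "E \<in> affine_grassmannian k"
  shows "(\<integral>\<^sup>+t. gauss (t - flat_perp E t) * indicator (cball 0 1) (flat_perp E t) \<partial>lborel)
    = ennreal (unit_ball_vol (real CARD('n) - real k))"
proof -
  obtain L u where Lu: "flat_rep E L u" "dim L = k" using flat_rep_exists[OF E] .
  have L: "subspace L" using Lu by (simp add: flat_rep_def)
  have U: "subspace (orth_in UNIV L)" by (simp add: subspace_orth_in)
  have "(\<integral>\<^sup>+t. gauss (t - flat_perp E t) * indicator (cball 0 1) (flat_perp E t) \<partial>lborel)
    = (\<integral>\<^sup>+x. indicator (cball 0 1) x \<partial>slb (orth_in UNIV L))"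
    by (subst nn_integral_slb[OF U]) (simp_all add: proj_orth_in[OF L] flat_rep_perp_foot(1)[OF Lu(1)] borel_measurable_indicator)
  also have "\<dots> = emeasure (slb (orth_in UNIV L)) (cball 0 1)" by simp
  also have "\<dots> = ennreal (unit_ball_vol (dim (orth_in UNIV L)))" by (rule emeasure_slb_cball[OF U])
  also have "real (dim (orth_in UNIV L)) = real CARD('n) - real k"
    using k by (simp add: dim_orth_in[OF subspace_UNIV L] Lu(2) of_nat_diff)
  finally show ?thesis .
qed

text \<open>A flat meets the unit ball exactly if its foot lies in it, so the normalisation of \<mu>
  gives the same constant as the average over translations of a single flat.\<close>

lemma nn_integral_foot_ball:
  "(\<integral>\<^sup>+E. indicator (cball 0 1) (flat_foot E) \<partial>\<mu>) = ennreal (unit_ball_vol (real CARD('n) - real k))"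
proof -
  have "(\<integral>\<^sup>+E. indicator (cball 0 1) (flat_foot E) \<partial>\<mu>) = (\<integral>\<^sup>+E. indicator (flats_hitting k (cball 0 1)) E \<partial>\<mu>)"
  proof (rule nn_integral_cong)
    fix E assume "E \<in> space \<mu>"
    then have E: "E \<in> affine_grassmannian k" by (simp add: space_flats)
    obtain L u where Lu: "flat_rep E L u" "dim L = k" using flat_rep_exists[OF E] .
    have L: "subspace L" using Lu by (simp add: flat_rep_def)
    have "proj L 0 = 0" by (simp add: linear_0 linear_proj[OF L])
    then have "infdist 0 E = norm (flat_foot E)"
      by (simp add: flat_nearest(2)[OF Lu(1)] flat_rep_perp_foot(2)[OF Lu(1)])
    then show "indicator (cball 0 1) (flat_foot E) = (indicator (flats_hitting k (cball 0 1)) E :: ennreal)"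
      using flat_hits_iff[OF E, of 0 1] E by (simp add: flats_hitting_def indicator_def)
  qed
  also have "\<dots> = emeasure \<mu> (flats_hitting k (cball 0 1))"
    by (intro nn_integral_indicator flats_hitting_sets compact_cball)
  also have "\<dots> = ennreal (unit_ball_vol (real CARD('n) - real k))"
    using \<mu> by (simp add: invariant_flat_measure_def)
  finally show ?thesis .
qed

text \<open>
  Averaging over all translations \<open>t\<close>, once in each direction, trades the section through the foot
  for an integral over all parallel sections.
\<close>

lemma nn_integral_section_at_foot:
  fixes K :: "(real^'n) set"
  assumes K [measurable]: "K \<in> sets borel" and Q [measurable]: "Q \<in> borel_measurable borel"
  shows "ennreal (unit_ball_vol (real CARD('n) - real k)) * (\<integral>\<^sup>+E. flat_section k s K Q E (flat_foot E) \<partial>\<mu>)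
    = (\<integral>\<^sup>+E. indicator (cball 0 1) (flat_foot E) * flat_sections k s K Q E \<partial>\<mu>)"
proof -
  interpret M: sigma_finite_measure \<mu> by (rule sigma_finite_flats)
  have rep: "\<exists>L u. flat_rep E L u" if "E \<in> space \<mu>" for E
    using that flat_rep_exists[of E k] unfolding space_flats by metis
  have eqs: "flat_perp ((\<lambda>x. t + x) ` E) = flat_perp E" "flat_foot ((\<lambda>x. t + x) ` E) = flat_foot E + flat_perp E t"
    "flat_section k s K Q ((\<lambda>x. t + x) ` E) = flat_section k s K Q E" if E: "E \<in> space \<mu>" for E t
  proof -
    obtain L u where Lu: "flat_rep E L u" using rep[OF E] by blast
    show "flat_perp ((\<lambda>x. t + x) ` E) = flat_perp E" "flat_foot ((\<lambda>x. t + x) ` E) = flat_foot E + flat_perp E t"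
      "flat_section k s K Q ((\<lambda>x. t + x) ` E) = flat_section k s K Q E"
      by (rule flat_rep_translate_eqs[OF Lu])+
  qed
  note swap = nn_integral_swap[OF sigma_finite_flats lborel.sigma_finite_measure_axioms]
  define U where "U = (indicator (cball 0 1) :: real^'n \<Rightarrow> ennreal)"
  have U [measurable]: "U \<in> borel_measurable borel" unfolding U_def by (intro borel_measurable_indicator) simp
  have U_minus: "U (- x) = U x" for x by (simp add: U_def indicator_def)
  let ?SV = "flat_section k s K Q" and ?g = "\<lambda>E t. gauss (t - flat_perp E t)"
  have "ennreal (unit_ball_vol (real CARD('n) - real k)) * (\<integral>\<^sup>+E. ?SV E (flat_foot E) \<partial>\<mu>)
    = (\<integral>\<^sup>+E. ennreal (unit_ball_vol (real CARD('n) - real k)) * ?SV E (flat_foot E) \<partial>\<mu>)"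
    by (rule nn_integral_cmult[symmetric]) measurable
  \<comment> \<open>The constant is replaced by an integral over \<open>t\<close> that has this
    value for every \<open>E\<close>; the integration variable then serves as a translation of
    \<open>E\<close>.\<close>
  also have "\<dots> = (\<integral>\<^sup>+E. \<integral>\<^sup>+t. ?g E t * U (flat_perp E t) * ?SV E (flat_foot E) \<partial>lborel \<partial>\<mu>)"
    by (rule nn_integral_cong, subst nn_integral_multc)
      (measurable, simp add: space_flats nn_integral_flat_perp_ball[folded U_def])
  also have "\<dots> = (\<integral>\<^sup>+t. \<integral>\<^sup>+E. ?g E t * U (flat_perp E t) * ?SV E (flat_foot E) \<partial>\<mu> \<partial>lborel)"
    by (rule swap) measurable
  also have "\<dots> = (\<integral>\<^sup>+t. \<integral>\<^sup>+E. ?g E t * U (flat_perp E t) * ?SV E (flat_foot E + flat_perp E t) \<partial>\<mu> \<partial>lborel)"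
  proof (rule nn_integral_cong)
    fix t
    have "(\<integral>\<^sup>+E. ?g E t * U (flat_perp E t) * ?SV E (flat_foot E + flat_perp E t) \<partial>\<mu>)
      = (\<integral>\<^sup>+E. (\<lambda>E. ?g E t * U (flat_perp E t) * ?SV E (flat_foot E)) ((\<lambda>x. t + x) ` E) \<partial>\<mu>)"
      by (rule nn_integral_cong) (simp add: eqs)
    also have "\<dots> = (\<integral>\<^sup>+E. ?g E t * U (flat_perp E t) * ?SV E (flat_foot E) \<partial>\<mu>)"
      by (rule nn_integral_translate) measurable
    finally show "(\<integral>\<^sup>+E. ?g E t * U (flat_perp E t) * ?SV E (flat_foot E) \<partial>\<mu>)
      = (\<integral>\<^sup>+E. ?g E t * U (flat_perp E t) * ?SV E (flat_foot E + flat_perp E t) \<partial>\<mu>)" ..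
  qed
  also have "\<dots> = (\<integral>\<^sup>+E. \<integral>\<^sup>+t. ?g E t * U (flat_perp E t) * ?SV E (flat_foot E + flat_perp E t) \<partial>lborel \<partial>\<mu>)"
    by (rule swap[symmetric]) measurable
  \<comment> \<open>For fixed \<open>E\<close>, \<open>t\<close> is shifted by the foot, which is
    orthogonal to \<open>E\<close>: the foot moves from the argument of the section into the window
    \<open>U\<close>, and the Gaussian factor does not change.\<close>
  also have "\<dots> = (\<integral>\<^sup>+E. \<integral>\<^sup>+t. ?g E t * U (flat_perp E t - flat_foot E) * ?SV E (flat_perp E t) \<partial>lborel \<partial>\<mu>)"
  proof (rule nn_integral_cong)
    fix E assume E [measurable]: "E \<in> space \<mu>"
    obtain L u where Lu: "flat_rep E L u" using rep[OF E] by blast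
    have L: "subspace L" "\<And>x. x \<in> L \<Longrightarrow> u \<bullet> x = 0" using Lu by (auto simp: flat_rep_def)
    have "proj L u = 0" by (intro proj_eqI L subspace_0) (simp add: L)
    then have "flat_perp E (t - u) = flat_perp E t - u" for t
      by (simp add: flat_rep_perp_foot(1)[OF Lu] linear_diff[OF linear_proj[OF L(1)]])
    then have p: "flat_perp E (t + - u) = flat_perp E t - u" for t by simp
    have "(\<integral>\<^sup>+t. ?g E t * U (flat_perp E t) * ?SV E (u + flat_perp E t) \<partial>lborel)
      = (\<integral>\<^sup>+t. ?g E (t + - u) * U (flat_perp E (t + - u)) * ?SV E (u + flat_perp E (t + - u)) \<partial>lborel)"
      by (rule nn_integral_lborel_shift[symmetric]) measurable
    also have "\<dots> = (\<integral>\<^sup>+t. ?g E t * U (flat_perp E t - u) * ?SV E (flat_perp E t) \<partial>lborel)"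
      unfolding p by simp
    finally show "(\<integral>\<^sup>+t. ?g E t * U (flat_perp E t) * ?SV E (flat_foot E + flat_perp E t) \<partial>lborel)
      = (\<integral>\<^sup>+t. ?g E t * U (flat_perp E t - flat_foot E) * ?SV E (flat_perp E t) \<partial>lborel)"
      by (simp add: flat_rep_perp_foot(2)[OF Lu])
  qed
  also have "\<dots> = (\<integral>\<^sup>+t. \<integral>\<^sup>+E. ?g E t * U (flat_perp E t - flat_foot E) * ?SV E (flat_perp E t) \<partial>\<mu> \<partial>lborel)"
    by (rule swap) measurable
  \<comment> \<open>Translating \<open>E\<close> by \<open>t\<close> adds
    \<open>flat_perp E t\<close> to its foot, so the argument of the symmetric window becomes the
    negative of the foot.\<close>
  also have "\<dots> = (\<integral>\<^sup>+t. \<integral>\<^sup>+E. ?g E t * U (flat_foot E) * ?SV E (flat_perp E t) \<partial>\<mu> \<partial>lborel)"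
  proof (rule nn_integral_cong)
    fix t
    have "(\<integral>\<^sup>+E. ?g E t * U (flat_foot E) * ?SV E (flat_perp E t) \<partial>\<mu>)
      = (\<integral>\<^sup>+E. (\<lambda>E. ?g E t * U (flat_perp E t - flat_foot E) * ?SV E (flat_perp E t)) ((\<lambda>x. t + x) ` E) \<partial>\<mu>)"
      by (rule nn_integral_cong) (simp add: eqs U_minus)
    also have "\<dots> = (\<integral>\<^sup>+E. ?g E t * U (flat_perp E t - flat_foot E) * ?SV E (flat_perp E t) \<partial>\<mu>)"
      by (rule nn_integral_translate) measurable
    finally show "(\<integral>\<^sup>+E. ?g E t * U (flat_perp E t - flat_foot E) * ?SV E (flat_perp E t) \<partial>\<mu>)
      = (\<integral>\<^sup>+E. ?g E t * U (flat_foot E) * ?SV E (flat_perp E t) \<partial>\<mu>)" ..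
  qed
  also have "\<dots> = (\<integral>\<^sup>+E. \<integral>\<^sup>+t. ?g E t * U (flat_foot E) * ?SV E (flat_perp E t) \<partial>lborel \<partial>\<mu>)"
    by (rule swap[symmetric]) measurable
  also have "\<dots> = (\<integral>\<^sup>+E. U (flat_foot E) * flat_sections k s K Q E \<partial>\<mu>)"
    unfolding flat_sections_def
    by (rule nn_integral_cong, subst nn_integral_cmult[symmetric]) (measurable, simp add: mult_ac)
  finally show ?thesis unfolding U_def .
qed

end

section \<open>Averaging over rotations\<close>

context invariant_flats
begin

text \<open>
  Only rotations preserve \<open>\<mu>\<close> by assumption. The isometry \<open>S\<close> composes with the random isometries of
  determinant \<open>\<sigma>\<close> to rotations.
\<close>

lemma mean_section_oriented:
  fixes K W :: "(real^'n) set" and S :: "real^'n \<Rightarrow> real^'n"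
  assumes K [measurable]: "K \<in> sets borel" and W: "subspace W" "dim W = k"
    and S: "linear S" "\<And>x y. S x \<bullet> S y = x \<bullet> y" "det (matrix S) = \<sigma>" "\<sigma> * \<sigma> = 1"
  defines "h \<equiv> (\<lambda>z. gs_weight z * indicator {\<sigma>} (det (matrix (gs_isometry z))))"
  shows "(\<integral>\<^sup>+z. h z \<partial>gs_space) * (\<integral>\<^sup>+E. indicator (cball 0 1) (flat_foot E) * flat_sections k s K (\<lambda>x. x) E \<partial>\<mu>)
    = ennreal (unit_ball_vol (real CARD('n) - real k)) * (\<integral>\<^sup>+z. h z * sections k s K (gs_isometry z) W \<partial>gs_space)"
proof -
  let ?G = "gs_space :: (nat \<Rightarrow> real^'n) measure"
  interpret M: sigma_finite_measure \<mu> by (rule sigma_finite_flats)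
  note sfG = sigma_finite_gs_space[where 'a="real^'n"]
  interpret G: sigma_finite_measure ?G by (rule sfG)
  have compG [measurable]: "(\<lambda>y. y i) \<in> borel_measurable ?G" if "i < DIM(real^'n)" for i
    using that by (intro measurable_compose[OF measurable_component_singleton]) auto
  note [measurable] = measurable_linear[OF S(1)]
  have h [measurable]: "h \<in> borel_measurable ?G"
    unfolding h_def by (intro borel_measurable_times_ennreal measurable_gs_weight
        measurable_compose[OF measurable_det_gs_isometry] borel_measurable_indicator) simp
  define U where "U = (indicator (cball 0 1) :: real^'n \<Rightarrow> ennreal)"
  have U [measurable]: "U \<in> borel_measurable borel" unfolding U_def by (intro borel_measurable_indicator) simp
  define I where "I = (\<integral>\<^sup>+E. U (flat_foot E) * flat_sections k s K (\<lambda>x. x) E \<partial>\<mu>)"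
  define J where "J = (\<integral>\<^sup>+z. h z * sections k s K (gs_isometry z) W \<partial>?G)"
  have rep: "\<exists>L u. flat_rep E L u \<and> dim L = k" if "E \<in> space \<mu>" for E
    using that flat_rep_exists[of E k] unfolding space_flats by metis
  \<comment> \<open>Where \<open>h z\<close> does not vanish, composing \<open>gs_isometry z\<close>
    with \<open>S\<close> gives a rotation \<open>P\<close>. Invariance of \<mu> under
    \<open>P\<close> replaces \<open>K\<close> by its preimage under \<open>P\<close>; the norm of
    the foot is unchanged.\<close>
  have rot: "h z * I = h z * (\<integral>\<^sup>+E. U (flat_foot E) * flat_sections k s K (\<lambda>x. gs_isometry z (S x)) E \<partial>\<mu>)" for z
  proof (cases "h z = 0")
    case False
    then have "pvol DIM(real^'n) z \<noteq> 0" and det: "det (matrix (gs_isometry z)) = \<sigma>"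
      by (auto simp: h_def gs_weight_def indicator_def split: if_splits)
    then have pos: "pvol DIM(real^'n) z > 0" using pvol_nonneg[of "DIM(real^'n)" z] by linarith
    define P where "P = (\<lambda>x. gs_isometry z (S x))"
    have P: "linear P" "\<And>x y. P x \<bullet> P y = x \<bullet> y"
      using linear_compose[OF S(1) linear_gs_isometry[of z]] inner_gs_isometry[OF pos] S(2) by (auto simp: P_def o_def)
    have dP: "det (matrix P) = 1"
      unfolding P_def det_matrix_compose[OF S(1) linear_gs_isometry] det S(3,4) ..
    have "(\<integral>\<^sup>+E. (\<lambda>E. U (flat_foot E) * flat_sections k s K (\<lambda>x. x) E) ((\<lambda>x. 0 + P x) ` E) \<partial>\<mu>) = I"
      unfolding I_def by (rule nn_integral_rigid[OF P dP]) measurable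
    moreover have "(\<integral>\<^sup>+E. (\<lambda>E. U (flat_foot E) * flat_sections k s K (\<lambda>x. x) E) ((\<lambda>x. 0 + P x) ` E) \<partial>\<mu>)
      = (\<integral>\<^sup>+E. U (flat_foot E) * flat_sections k s K P E \<partial>\<mu>)"
    proof (rule nn_integral_cong)
      fix E assume E: "E \<in> space \<mu>"
      obtain L u where Lu: "flat_rep E L u" "dim L = k" using rep[OF E] by blast
      have L: "subspace L" using Lu by (simp add: flat_rep_def)
      note PE = flat_rep_isometry[OF Lu(1) P]
      have Pm: "P \<in> borel_measurable borel" by (rule measurable_linear[OF P(1)])
      have "norm (P u) = norm u" by (simp add: norm_eq_sqrt_inner P)
      then have "U (flat_foot (P ` E)) = U (flat_foot E)"
        by (simp add: flat_rep_perp_foot(2)[OF Lu(1)] flat_rep_perp_foot(2)[OF PE] U_def indicator_def)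
      moreover have "flat_sections k s K (\<lambda>x. x) (P ` E) = sections k s K (\<lambda>x. x) (P ` L)"
        by (rule flat_sections_eq[OF PE K]) simp
      moreover have "sections k s K (\<lambda>x. x) (P ` L) = sections k s K P L"
        by (rule sections_isometry[OF L K _ P]) simp
      moreover have "flat_sections k s K P E = sections k s K P L"
        by (rule flat_sections_eq[OF Lu(1) K Pm])
      ultimately show "(\<lambda>E. U (flat_foot E) * flat_sections k s K (\<lambda>x. x) E) ((\<lambda>x. 0 + P x) ` E)
        = U (flat_foot E) * flat_sections k s K P E"
        by simp
    qed
    ultimately show ?thesis by (simp add: P_def)
  qed simp
  \<comment> \<open>The average over \<open>z\<close> is the same for every \<open>E\<close>: a
    rotation \<open>R\<close> takes the image of the direction space under \<open>S\<close> to
    \<open>W\<close>, the weighted tuples are invariant under \<open>R\<close>, and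
    \<open>det (matrix R) = 1\<close> keeps the orientation class selected by
    \<open>h\<close>.\<close>
  have avg: "(\<integral>\<^sup>+z. h z * flat_sections k s K (\<lambda>x. gs_isometry z (S x)) E \<partial>?G) = J" if E: "E \<in> space \<mu>" for E
  proof -
    obtain L u where Lu: "flat_rep E L u" "dim L = k" using rep[OF E] by blast
    have L: "subspace L" using Lu by (simp add: flat_rep_def)
    have SL: "subspace (S ` L)" using L S(1) by (simp add: linear_subspace_image)
    have "S x = 0 \<Longrightarrow> x = 0" for x using S(2)[of x x] by simp
    then have "inj S" using S(1) by (metis linear_injective_0)
    then have "dim (S ` L) = dim W" using S(1) Lu(2) W(2) by (simp add: dim_image_eq inj_on_subset)
    then obtain R where R: "linear R" "\<And>x y. R x \<bullet> R y = x \<bullet> y" "R ` (S ` L) = W" "det (matrix R) = 1"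
      using rotation_between_subspaces[OF SL W(1)] by metis
    define H where "H = (\<lambda>z. indicator {\<sigma>} (det (matrix (gs_isometry z))) * sections k s K (gs_isometry z) W)"
    have H: "H \<in> borel_measurable ?G"
      unfolding H_def by (intro borel_measurable_times_ennreal
        measurable_compose[OF measurable_det_gs_isometry] borel_measurable_indicator measurable_sections W) (simp, measurable)
    have gm: "gs_isometry z \<in> borel_measurable borel" for z :: "nat \<Rightarrow> real^'n"
      by (rule measurable_linear[OF linear_gs_isometry])
    have "(\<integral>\<^sup>+z. h z * flat_sections k s K (\<lambda>x. gs_isometry z (S x)) E \<partial>?G)
      = (\<integral>\<^sup>+z. gs_weight z * H (\<lambda>i\<in>{..<DIM(real^'n)}. R (z i)) \<partial>?G)"
    proof (rule nn_integral_cong)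
      fix z :: "nat \<Rightarrow> real^'n"
      define z' where "z' = (\<lambda>i\<in>{..<DIM(real^'n)}. R (z i))"
      have z': "(\<lambda>v. gs_isometry z' (R v)) = gs_isometry z"
        unfolding z'_def using gs_isometry_compose[OF R(1,2), of z] by (rule ext)
      have "det (matrix (gs_isometry z)) = det (matrix (gs_isometry z')) * det (matrix R)"
        unfolding z'[symmetric] by (rule det_matrix_compose[OF R(1) linear_gs_isometry])
      then have d: "det (matrix (gs_isometry z')) = det (matrix (gs_isometry z))" by (simp add: R(4))
      have "sections k s K (gs_isometry z') W = sections k s K (gs_isometry z') (R ` (S ` L))" by (simp add: R(3))
      also have "\<dots> = sections k s K (gs_isometry z) (S ` L)"
        by (subst sections_isometry[OF SL K gm R(1,2)]) (simp only: z')
      also have "\<dots> = sections k s K (\<lambda>x. gs_isometry z (S x)) L"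
        by (rule sections_isometry[OF L K gm S(1,2)])
      also have "\<dots> = flat_sections k s K (\<lambda>x. gs_isometry z (S x)) E"
        by (rule flat_sections_eq[OF Lu(1) K, symmetric]) (use gm in measurable)
      finally show "h z * flat_sections k s K (\<lambda>x. gs_isometry z (S x)) E = gs_weight z * H (\<lambda>i\<in>{..<DIM(real^'n)}. R (z i))"
        unfolding z'_def[symmetric] H_def h_def d by (simp only: mult_ac)
    qed
    also have "\<dots> = (\<integral>\<^sup>+z. gs_weight z * H z \<partial>?G)" by (rule gs_weight_invariant[OF R(1,2) H])
    finally show ?thesis by (simp only: J_def H_def h_def mult_ac)
  qed
  have "(\<integral>\<^sup>+z. h z \<partial>?G) * I = (\<integral>\<^sup>+z. h z * I \<partial>?G)" by (rule nn_integral_multc[symmetric]) (rule h)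
  also have "\<dots> = (\<integral>\<^sup>+z. h z * (\<integral>\<^sup>+E. U (flat_foot E) * flat_sections k s K (\<lambda>x. gs_isometry z (S x)) E \<partial>\<mu>) \<partial>?G)"
    by (simp only: rot)
  also have "\<dots> = (\<integral>\<^sup>+z. \<integral>\<^sup>+E. h z * (U (flat_foot E) * flat_sections k s K (\<lambda>x. gs_isometry z (S x)) E) \<partial>\<mu> \<partial>?G)"
    by (rule nn_integral_cong, rule nn_integral_cmult[symmetric]) measurable
  also have "\<dots> = (\<integral>\<^sup>+E. \<integral>\<^sup>+z. h z * (U (flat_foot E) * flat_sections k s K (\<lambda>x. gs_isometry z (S x)) E) \<partial>?G \<partial>\<mu>)"
    by (rule nn_integral_swap[OF sfG sigma_finite_flats]) measurable
  also have "\<dots> = (\<integral>\<^sup>+E. U (flat_foot E) * J \<partial>\<mu>)"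
  proof (rule nn_integral_cong)
    fix E assume E [measurable]: "E \<in> space \<mu>"
    have "(\<integral>\<^sup>+z. h z * (U (flat_foot E) * flat_sections k s K (\<lambda>x. gs_isometry z (S x)) E) \<partial>?G)
      = (\<integral>\<^sup>+z. U (flat_foot E) * (h z * flat_sections k s K (\<lambda>x. gs_isometry z (S x)) E) \<partial>?G)"
      by (simp only: mult_ac)
    also have "\<dots> = U (flat_foot E) * (\<integral>\<^sup>+z. h z * flat_sections k s K (\<lambda>x. gs_isometry z (S x)) E \<partial>?G)"
      by (rule nn_integral_cmult) measurable
    finally show "(\<integral>\<^sup>+z. h z * (U (flat_foot E) * flat_sections k s K (\<lambda>x. gs_isometry z (S x)) E) \<partial>?G) = U (flat_foot E) * J"
      by (simp only: avg[OF E])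
  qed
  also have "\<dots> = (\<integral>\<^sup>+E. U (flat_foot E) \<partial>\<mu>) * J" by (rule nn_integral_multc) measurable
  also have "(\<integral>\<^sup>+E. U (flat_foot E) \<partial>\<mu>) = ennreal (unit_ball_vol (real CARD('n) - real k))"
    unfolding U_def by (rule nn_integral_foot_ball)
  finally show ?thesis unfolding I_def U_def J_def .
qed

text \<open>The tuples split by the determinant of their isometry; \<open>S\<close> is the identity
  on one class and a reflection on the other. Both averages, over translations and over rotations,
  carry the same positive finite ball volume, which cancels.\<close>

theorem nn_integral_section_at_foot_eq:
  fixes K W :: "(real^'n) set"
  assumes K [measurable]: "K \<in> sets borel" and W: "subspace W" "dim W = k"
  shows "(\<integral>\<^sup>+z. gs_weight z \<partial>(gs_space :: (nat \<Rightarrow> real^'n) measure)) * (\<integral>\<^sup>+E. flat_section k s K (\<lambda>x. x) E (flat_foot E) \<partial>\<mu>)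
    = (\<integral>\<^sup>+z. gs_weight z * sections k s K (gs_isometry z) W \<partial>gs_space)"
proof -
  let ?G = "gs_space :: (nat \<Rightarrow> real^'n) measure"
  let ?\<kappa> = "ennreal (unit_ball_vol (real CARD('n) - real k))"
  define h :: "real \<Rightarrow> (nat \<Rightarrow> real^'n) \<Rightarrow> ennreal"
    where "h = (\<lambda>\<sigma> z. gs_weight z * indicator {\<sigma>} (det (matrix (gs_isometry z))))"
  have compG [measurable]: "(\<lambda>y. y i) \<in> borel_measurable ?G" if "i < DIM(real^'n)" for i
    using that by (intro measurable_compose[OF measurable_component_singleton]) auto
  have h [measurable]: "h \<sigma> \<in> borel_measurable ?G" for \<sigma>
    unfolding h_def by (intro borel_measurable_times_ennreal measurable_gs_weight
        measurable_compose[OF measurable_det_gs_isometry] borel_measurable_indicator) simp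
  define sec where "sec = (\<lambda>z. sections k s K (gs_isometry z) W)"
  have sec [measurable]: "sec \<in> borel_measurable ?G"
    unfolding sec_def by (intro measurable_sections W) measurable
  have sum: "gs_weight z = h 1 z + h (- 1) z" for z
  proof (cases "pvol DIM(real^'n) z = 0")
    case True then show ?thesis by (simp add: h_def gs_weight_def)
  next
    case False
    then have "pvol DIM(real^'n) z > 0" using pvol_nonneg[of "DIM(real^'n)" z] by linarith
    then have "det (matrix (gs_isometry z)) = 1 \<or> det (matrix (gs_isometry z)) = - 1"
      by (intro det_isometry linear_gs_isometry inner_gs_isometry)
    then show ?thesis by (auto simp: h_def)
  qed
  define I where "I = (\<integral>\<^sup>+E. indicator (cball 0 1) (flat_foot E) * flat_sections k s K (\<lambda>x. x) E \<partial>\<mu>)"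
  have "det (matrix (\<lambda>x::real^'n. x)) = 1" using matrix_id by (simp add: id_def)
  then have plus: "(\<integral>\<^sup>+z. h 1 z \<partial>?G) * I = ?\<kappa> * (\<integral>\<^sup>+z. h 1 z * sec z \<partial>?G)"
    unfolding h_def I_def sec_def
    by (intro mean_section_oriented[OF K W, of "\<lambda>x. x"]) (auto simp: linear_id[unfolded id_def])
  have minus: "(\<integral>\<^sup>+z. h (- 1) z \<partial>?G) * I = ?\<kappa> * (\<integral>\<^sup>+z. h (- 1) z * sec z \<partial>?G)"
  proof -
    fix i :: 'n
    show ?thesis
      unfolding h_def I_def sec_def
      by (intro mean_section_oriented[OF K W, of "householder (axis i 1)"])
        (auto simp: linear_householder inner_householder det_householder)
  qed
  have total: "(\<integral>\<^sup>+z. gs_weight z \<partial>?G) = (\<integral>\<^sup>+z. h 1 z \<partial>?G) + (\<integral>\<^sup>+z. h (- 1) z \<partial>?G)"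
    unfolding sum by (rule nn_integral_add) (rule h)+
  have "?\<kappa> * ((\<integral>\<^sup>+z. gs_weight z \<partial>?G) * (\<integral>\<^sup>+E. flat_section k s K (\<lambda>x. x) E (flat_foot E) \<partial>\<mu>))
    = (\<integral>\<^sup>+z. gs_weight z \<partial>?G) * (?\<kappa> * (\<integral>\<^sup>+E. flat_section k s K (\<lambda>x. x) E (flat_foot E) \<partial>\<mu>))"
    by (simp only: mult_ac)
  also have "\<dots> = (\<integral>\<^sup>+z. gs_weight z \<partial>?G) * I"
    by (subst nn_integral_section_at_foot[OF K]) (simp_all add: I_def)
  also have "(\<integral>\<^sup>+z. gs_weight z \<partial>?G) * I
    = ?\<kappa> * ((\<integral>\<^sup>+z. h 1 z * sec z \<partial>?G) + (\<integral>\<^sup>+z. h (- 1) z * sec z \<partial>?G))"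
    unfolding total distrib_right plus minus distrib_left ..
  also have "(\<integral>\<^sup>+z. h 1 z * sec z \<partial>?G) + (\<integral>\<^sup>+z. h (- 1) z * sec z \<partial>?G) = (\<integral>\<^sup>+z. gs_weight z * sec z \<partial>?G)"
    unfolding sum distrib_right by (rule nn_integral_add[symmetric]) measurable
  finally have "?\<kappa> * ((\<integral>\<^sup>+z. gs_weight z \<partial>?G) * (\<integral>\<^sup>+E. flat_section k s K (\<lambda>x. x) E (flat_foot E) \<partial>\<mu>))
    = ?\<kappa> * (\<integral>\<^sup>+z. gs_weight z * sec z \<partial>?G)" .
  moreover have "?\<kappa> \<noteq> 0" "?\<kappa> \<noteq> top"
  proof -
    have "unit_ball_vol (real CARD('n) - real k) > 0" using k by (intro unit_ball_vol_pos) simp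
    then show "?\<kappa> \<noteq> 0" "?\<kappa> \<noteq> top" by (simp_all only: ennreal_eq_0_iff ennreal_neq_top not_le simp_thms)
  qed
  ultimately show ?thesis unfolding sec_def by (simp only: ennreal_mult_cancel_left simp_thms)
qed

end

section \<open>The moment identity\<close>

lemma k_volume_nonneg: "k_volume k S \<ge> 0"
  by (simp add: k_volume_def Let_def split_def)

lemma b_coeff_nonneg:
  assumes "q > real k - 1"
  shows "b_coeff q k \<ge> 0"
  unfolding b_coeff_def using assms
  by (intro divide_nonneg_nonneg prod_nonneg less_imp_le[OF omega_pos]) auto

text \<open>The sign is needed to split \<open>ennreal\<close> of a product. For
  \<open>k = 0\<close> the number \<open>a\<close> may be negative, so that case is treated
  apart.\<close>

lemma ball_moment_constant_nonneg:
  assumes a: "a > real k - 1"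
  shows "unit_ball_vol a ^ (k + 1) * (unit_ball_vol (real k * a + real k) / unit_ball_vol (real (k + 1) * a)) / b_coeff a k \<ge> 0"
proof -
  have u: "unit_ball_vol x \<ge> 0" if "x > - 1" for x
  proof -
    have "Gamma (x / 2 + 1) > 0" using that by (intro Gamma_real_pos) simp
    then show ?thesis by (simp add: unit_ball_vol_def)
  qed
  have a1: "a > - 1" using a by linarith
  have "real (k + 1) * a > - 1"
  proof (cases "k = 0")
    case False
    then have "a > 0" using a by simp
    then have "real (k + 1) * a > 0" by simp
    then show ?thesis by linarith
  qed (use a1 in simp)
  moreover have "real k * a + real k > - 1"
  proof -
    have "real k * (a + 1) \<ge> 0" using a1 by simp
    then show ?thesis by (simp add: distrib_left)
  qed
  ultimately show ?thesis
    using a a1 by (intro divide_nonneg_nonneg mult_nonneg_nonneg zero_le_power u b_coeff_nonneg)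
qed

lemma set_moment_isometry_ellipsoid:
  fixes W :: "'a::euclidean_space set" and T :: "'a \<Rightarrow> 'a"
  assumes W: "subspace W" "dim W = k" and q: "q > -1" and T: "linear T" "inj T"
    and K: "K = (\<lambda>v. c + T v) ` cball 0 1" and g: "linear g" "inj g"
  shows "set_moment k q W (g -` K) u
    = ball_moment W k q * ball_power k (real (k + 1) + q) (\<integral>\<^sup>+x. indicator K (g (u + x)) \<partial>slb W)"
proof -
  obtain h where h: "linear h" "\<And>x. h (g x) = x" "\<And>x. g (h x) = x"
    using linear_injective_isomorphism[OF g] by metis
  have hT: "linear (\<lambda>v. h (T v))" "inj (\<lambda>v. h (T v))"
    using linear_compose[OF T(1) h(1)] T(2) h(3) by (auto simp: o_def inj_def) metis
  have eq: "g -` K = (\<lambda>v. h c + h (T v)) ` cball 0 1"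
  proof (intro equalityI subsetI)
    fix x assume "x \<in> g -` K"
    then obtain v where v: "v \<in> cball 0 1" "g x = c + T v" by (auto simp: K)
    have "x = h c + h (T v)" using v(2) h(2)[of x] by (simp add: linear_add[OF h(1)])
    then show "x \<in> (\<lambda>v. h c + h (T v)) ` cball 0 1" using v(1) by (rule image_eqI)
  next
    fix x assume "x \<in> (\<lambda>v. h c + h (T v)) ` cball 0 1"
    then obtain v where v: "v \<in> cball 0 1" "x = h c + h (T v)" by blast
    have "g x = c + T v" by (simp add: v(2) linear_add[OF g(1)] h(3))
    then show "x \<in> g -` K" using v(1) by (auto simp: K)
  qed
  have "compact (g -` K)"
    unfolding eq by (intro compact_continuous_image continuous_intros linear_continuous_on compact_cball)
      (simp add: hT(1) linear_conv_bounded_linear[symmetric])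
  then have gK: "g -` K \<in> sets borel" by (rule borel_compact)
  have "emeasure (slb W) {x. u + x \<in> g -` K} = (\<integral>\<^sup>+x. indicator {x. u + x \<in> g -` K} x \<partial>slb W)"
    using vimage_add_borel[OF gK] by simp
  also have "\<dots> = (\<integral>\<^sup>+x. indicator K (g (u + x)) \<partial>slb W)" by (simp add: indicator_def)
  finally show ?thesis
    unfolding ball_power_def using set_moment_ellipsoid[OF W q hT eq, of u] by simp
qed

text \<open>The Blaschke--Petkantschin formula and the average over rotations lead to the same
  average of \<open>sections\<close>, and the total weight \<open>m\<close> cancels.\<close>

lemma (in invariant_flats) set_moment_eq_section_integral:
  fixes K W :: "(real^'n) set" and T :: "real^'n \<Rightarrow> real^'n"
  assumes W: "subspace W" "dim W = k" and p: "p > real k - real CARD('n) - 1"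
    and T: "linear T" "inj T" and K: "K = (\<lambda>v. c + T v) ` cball 0 1"
  shows "set_moment k p UNIV K 0 = ennreal (b_coeff (real CARD('n)) k) * ball_moment W k (p + (CARD('n) - k))
    * (\<integral>\<^sup>+E. flat_section k (p + real CARD('n) + 1) K (\<lambda>x. x) E (flat_foot E) \<partial>\<mu>)"
proof -
  let ?G = "gs_space :: (nat \<Rightarrow> real^'n) measure"
  \<comment> \<open>The assumption on \<open>p\<close> is exactly \<open>q > - 1\<close>.\<close>
  define q where "q = p + real (CARD('n) - k)"
  have q: "q > - 1" "real (k + 1) + q = p + real CARD('n) + 1" using p k by (auto simp: q_def of_nat_diff)
  define s where "s = p + real CARD('n) + 1"
  have "compact K"
    unfolding K by (intro compact_continuous_image continuous_intros linear_continuous_on compact_cball)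
      (simp add: T(1) linear_conv_bounded_linear[symmetric])
  then have Kb [measurable]: "K \<in> sets borel" by (rule borel_compact)
  have compG [measurable]: "(\<lambda>y. y i) \<in> borel_measurable ?G" if "i < DIM(real^'n)" for i
    using that by (intro measurable_compose[OF measurable_component_singleton]) auto
  interpret S: sigma_finite_measure "slb W" by (rule sigma_finite_slb[OF W(1)])
  obtain m where m: "m > 0" "(\<integral>\<^sup>+z. gs_weight z \<partial>?G) = ennreal m" using gs_weight_total .
  have sec: "(\<lambda>z. sections k s K (gs_isometry z) W) \<in> borel_measurable ?G"
    by (intro measurable_sections W) measurable
  have "ennreal m * set_moment k p UNIV K 0 = ennreal (b_coeff (real CARD('n)) k) * (\<integral>\<^sup>+z. gs_weight z *
        (\<integral>\<^sup>+u. set_moment k q W (gs_isometry z -` K) u \<partial>slb (orth_in UNIV W)) \<partial>?G)"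
    using blaschke_petkantschin[OF W Kb, of p] m(2) by (simp add: q_def)
  also have "(\<integral>\<^sup>+z. gs_weight z * (\<integral>\<^sup>+u. set_moment k q W (gs_isometry z -` K) u \<partial>slb (orth_in UNIV W)) \<partial>?G)
    = (\<integral>\<^sup>+z. ball_moment W k q * (gs_weight z * sections k s K (gs_isometry z) W) \<partial>?G)"
  proof (rule nn_integral_cong)
    fix z :: "nat \<Rightarrow> real^'n"
    show "gs_weight z * (\<integral>\<^sup>+u. set_moment k q W (gs_isometry z -` K) u \<partial>slb (orth_in UNIV W))
      = ball_moment W k q * (gs_weight z * sections k s K (gs_isometry z) W)"
    proof (cases "pvol DIM(real^'n) z = 0")
      case True then show ?thesis by (simp add: gs_weight_def)
    next
      case False
      then have pos: "pvol DIM(real^'n) z > 0" using pvol_nonneg[of "DIM(real^'n)" z] by linarith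
      have "gs_isometry z x = 0 \<Longrightarrow> x = 0" for x using inner_gs_isometry[OF pos, of x x] by simp
      then have inj: "inj (gs_isometry z)" using linear_gs_isometry by (metis linear_injective_0)
      note [measurable] = measurable_linear[OF linear_gs_isometry[of z]]
      have "(\<integral>\<^sup>+u. set_moment k q W (gs_isometry z -` K) u \<partial>slb (orth_in UNIV W))
        = ball_moment W k q * sections k s K (gs_isometry z) W"
        unfolding set_moment_isometry_ellipsoid[OF W q(1) T K linear_gs_isometry inj] sections_def q(2) s_def
        by (rule nn_integral_cmult) measurable
      then show ?thesis by (simp only: mult_ac)
    qed
  qed
  also have "\<dots> = ball_moment W k q * (\<integral>\<^sup>+z. gs_weight z * sections k s K (gs_isometry z) W \<partial>?G)"
    by (intro nn_integral_cmult borel_measurable_times_ennreal measurable_gs_weight sec)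
  also have "(\<integral>\<^sup>+z. gs_weight z * sections k s K (gs_isometry z) W \<partial>?G)
    = ennreal m * (\<integral>\<^sup>+E. flat_section k s K (\<lambda>x. x) E (flat_foot E) \<partial>\<mu>)"
    unfolding nn_integral_section_at_foot_eq[OF Kb W, symmetric] m(2) ..
  finally have "ennreal m * set_moment k p UNIV K 0 = ennreal m * (ennreal (b_coeff (real CARD('n)) k) * ball_moment W k q
    * (\<integral>\<^sup>+E. flat_section k s K (\<lambda>x. x) E (flat_foot E) \<partial>\<mu>))" by (simp only: mult_ac)
  then show ?thesis using m(1) by (simp add: ennreal_mult_cancel_left q_def s_def)
qed

text \<open>With the foot as origin of the flat, \<open>slb L\<close> is concentrated on
  \<open>L\<close>, so intersecting with \<open>E\<close> may be dropped.
  \<open>flat_section\<close> measures relative to the unit \<open>k\<close>-ball, whence the extra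
  factor.\<close>

lemma (in invariant_flats) k_volume_flat_section:
  fixes K :: "(real^'n) set"
  assumes K: "compact K" and E: "E \<in> affine_grassmannian k"
  shows "ennreal (k_volume k (K \<inter> E) powr s)
    = ennreal (unit_ball_vol k powr s) * flat_section k s K (\<lambda>x. x) E (flat_foot E)"
proof -
  obtain L u where Lu: "flat_rep E L u" "dim L = k" using flat_rep_exists[OF E] .
  have L: "subspace L" "E = (\<lambda>x. u + x) ` L" using Lu by (auto simp: flat_rep_def)
  have Kb: "K \<in> sets borel" using K by (rule borel_compact)
  have "closed E" unfolding L(2) by (intro closed_translation closed_subspace L)
  then have KE: "compact (K \<inter> E)" using K by (intro compact_Int_closed)
  have "ennreal (k_volume k (K \<inter> E)) = emeasure (slb L) {x. u + x \<in> K \<inter> E}"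
    using L(2) KE by (intro k_volume_eq_slb L(1) Lu(2)) (auto intro: borel_compact compact_imp_bounded)
  also have "\<dots> = emeasure (slb L) {x. u + x \<in> K}"
  proof (rule emeasure_eq_AE)
    show "AE x in slb L. x \<in> {x. u + x \<in> K \<inter> E} \<longleftrightarrow> x \<in> {x. u + x \<in> K}"
      by (rule AE_mp[OF AE_slb[OF L(1)]]) (auto simp: L(2))
  qed (simp_all only: sets_slb vimage_add_borel[OF borel_compact[OF KE]] vimage_add_borel[OF Kb])
  also have "\<dots> = (\<integral>\<^sup>+x. indicator {x. u + x \<in> K} x \<partial>slb L)"
    using vimage_add_borel[OF Kb] by simp
  also have "\<dots> = (\<integral>\<^sup>+x. indicator K (u + x) \<partial>slb L)" by (simp add: indicator_def)
  finally have "(\<integral>\<^sup>+x. indicator K (u + x) \<partial>slb L) = ennreal (k_volume k (K \<inter> E))" ..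
  then have "flat_section k s K (\<lambda>x. x) E (flat_foot E) = ennreal ((k_volume k (K \<inter> E) / unit_ball_vol k) powr s)"
    unfolding flat_rep_perp_foot(2)[OF Lu(1)]
    by (subst flat_section_eq[OF Lu(1) Kb]) (simp_all add: ball_power_def k_volume_nonneg)
  moreover have "unit_ball_vol (real k) \<noteq> 0" using unit_ball_vol_pos[of "real k"] by (metis less_irrefl of_nat_0_le_iff)
  then have "unit_ball_vol k powr s * (k_volume k (K \<inter> E) / unit_ball_vol k) powr s = k_volume k (K \<inter> E) powr s"
    using k_volume_nonneg[of k "K \<inter> E"] by (subst powr_mult[symmetric]) auto
  ultimately show ?thesis by (simp add: ennreal_mult[symmetric])
qed

theorem theorem1p11:
  fixes \<E> :: "(real^'n) set" and \<mu> :: "(real^'n) set measure" and d k :: nat and p :: real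
  assumes "d = CARD('n)"
    and "nondegenerate_ellipsoid \<E>"
    and "k \<le> d"
    and "p > - real d + real k - 1"
    and "invariant_flat_measure k \<mu>"
  shows "(\<integral>\<^sup>+ x \<in> (\<Pi>\<^sub>E i\<in>{..k}. \<E>). ennreal (k_volume k (convex hull (x ` {..k})) powr p)
            \<partial>(\<Pi>\<^sub>M i\<in>{..k}. (lborel :: (real^'n) measure))) =
         ennreal (1 / (fact k powr p)
           * (unit_ball_vol (real d + p) ^ (k + 1) / unit_ball_vol (real k) powr (p + real d + 1))
           * (unit_ball_vol (real k * (real d + p) + real k) / unit_ball_vol (real (k + 1) * (real d + p)))
           * (b_coeff (real d) k / b_coeff (real d + p) k))
         * (\<integral>\<^sup>+ E. ennreal (k_volume k (\<E> \<inter> E) powr (p + real d + 1)) \<partial>\<mu>)"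
proof -
  interpret invariant_flats k \<mu> using assms by unfold_locales auto
  obtain A :: "real^'n^'n" and c where A: "invertible A" "\<E> = (\<lambda>v. c + A *v v) ` cball 0 1"
    using assms(2) by (auto simp: nondegenerate_ellipsoid_def)
  have T: "linear ((*v) A)" "inj ((*v) A)" by (auto intro: inj_matrix_vector_mult A)
  have cpt: "compact \<E>"
    unfolding A(2) by (intro compact_continuous_image continuous_intros linear_continuous_on compact_cball)
      (simp add: linear_conv_bounded_linear[symmetric])
  then have Kb [measurable]: "\<E> \<in> sets borel" by (rule borel_compact)
  have kd: "k \<le> CARD('n)" using assms by simp
  \<comment> \<open>Any \<open>k\<close>-dimensional subspace will do: it is only the reference
    position that the random isometries move.\<close>
  obtain W :: "(real^'n) set" where W: "subspace W" "dim W = k"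
    using extend_subspace[of "{0 :: real^'n}" k] kd by auto
  define s where "s = p + real d + 1"
  define a where "a = real d + p"
  define \<Phi> where "\<Phi> = (\<integral>\<^sup>+E. flat_section k s \<E> (\<lambda>x. x) E (flat_foot E) \<partial>\<mu>)"
  \<comment> \<open>The moment of the unit ball of order \<open>p + d - k\<close>; adding
    \<open>k\<close> to this order gives \<open>a = d + p\<close>, the only quantity in which the
    constant is expressed.\<close>
  define N where "N = unit_ball_vol a ^ (k + 1) * (unit_ball_vol (real k * a + real k) / unit_ball_vol (real (k + 1) * a)) / b_coeff a k"
  have N: "N \<ge> 0" unfolding N_def using assms by (intro ball_moment_constant_nonneg) (simp add: a_def)
  have b: "b_coeff (real d) k \<ge> 0" using assms by (intro b_coeff_nonneg) simp
  have \<kappa>: "unit_ball_vol (real k) \<noteq> 0" using unit_ball_vol_pos[of "real k"] by (metis less_irrefl of_nat_0_le_iff)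
  have SM: "set_moment k p UNIV \<E> 0 = ennreal (b_coeff (real d) k * N) * \<Phi>"
  proof -
    have "real k + (p + real (CARD('n) - k)) = a" "p + real (CARD('n) - k) > - 1"
      using assms kd by (simp_all add: a_def of_nat_diff)
    then have "ball_moment W k (p + real (CARD('n) - k)) = ennreal N"
      using ball_moment_eq[OF W, of "p + real (CARD('n) - k)"] by (simp only: N_def)
    then show ?thesis
      using set_moment_eq_section_integral[OF W _ T A(2), of p] assms b N
      by (simp add: \<Phi>_def s_def ennreal_mult)
  qed
  have left: "(\<integral>\<^sup>+ x \<in> (\<Pi>\<^sub>E i\<in>{..k}. \<E>). ennreal (k_volume k (convex hull (x ` {..k})) powr p) \<partial>(\<Pi>\<^sub>M i\<in>{..k}. (lborel :: (real^'n) measure)))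
    = ennreal (1 / fact k powr p) * set_moment k p UNIV \<E> 0"
  proof -
    let ?M = "\<Pi>\<^sub>M i\<in>{..k}. (lborel :: (real^'n) measure)"
    have [measurable]: "(\<lambda>x. x i) \<in> borel_measurable ?M" if "i \<le> k" for i
      using that by (intro measurable_compose[OF measurable_component_singleton]) auto
    have [measurable]: "(\<lambda>x. pvol k (edges k x)) \<in> borel_measurable ?M"
      by (intro measurable_pvol) measurable
    have "(\<integral>\<^sup>+ x \<in> (\<Pi>\<^sub>E i\<in>{..k}. \<E>). ennreal (k_volume k (convex hull (x ` {..k})) powr p) \<partial>?M)
      = (\<integral>\<^sup>+x. ennreal (1 / fact k powr p) * ((\<Prod>i\<le>k. indicator \<E> (0 + x i)) * ennreal (pvol k (edges k x) powr p)) \<partial>?M)"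
    proof (rule nn_integral_cong)
      fix x :: "nat \<Rightarrow> real^'n" assume x: "x \<in> space ?M"
      have ind: "indicator (\<Pi>\<^sub>E i\<in>{..k}. \<E>) x = (\<Prod>i\<le>k. indicator \<E> (0 + x i) :: ennreal)"
      proof (cases "\<forall>i\<le>k. x i \<in> \<E>")
        case True
        then show ?thesis using x by (simp add: indicator_def space_PiM PiE_iff)
      next
        case False
        then have "(\<Prod>i\<le>k. indicator \<E> (0 + x i) :: ennreal) = 0" by (auto simp: indicator_def)
        then show ?thesis using False by (auto simp: indicator_def PiE_iff)
      qed
      have "k_volume k (convex hull (x ` {..k})) powr p = 1 / fact k powr p * pvol k (edges k x) powr p"
        unfolding k_volume_simplex[OF kd] using pvol_nonneg[of k "edges k x"] by (simp add: powr_divide)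
      then show "ennreal (k_volume k (convex hull (x ` {..k})) powr p) * indicator (\<Pi>\<^sub>E i\<in>{..k}. \<E>) x
        = ennreal (1 / fact k powr p) * ((\<Prod>i\<le>k. indicator \<E> (0 + x i)) * ennreal (pvol k (edges k x) powr p))"
        unfolding ind by (simp only: ennreal_mult powr_ge_zero divide_nonneg_nonneg zero_le_one mult_ac)
    qed
    also have "\<dots> = ennreal (1 / fact k powr p) * set_moment k p UNIV \<E> 0"
      unfolding set_moment_def slb_UNIV by (rule nn_integral_cmult) measurable
    finally show ?thesis .
  qed
  \<comment> \<open>Undoing the normalisation of \<open>flat_section\<close> by the unit ball is the
    source of the power of \<open>unit_ball_vol k\<close> in the denominator of the
    constant.\<close>
  have right: "(\<integral>\<^sup>+ E. ennreal (k_volume k (\<E> \<inter> E) powr s) \<partial>\<mu>) = ennreal (unit_ball_vol k powr s) * \<Phi>"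
  proof -
    have "(\<integral>\<^sup>+ E. ennreal (k_volume k (\<E> \<inter> E) powr s) \<partial>\<mu>)
      = (\<integral>\<^sup>+ E. ennreal (unit_ball_vol k powr s) * flat_section k s \<E> (\<lambda>x. x) E (flat_foot E) \<partial>\<mu>)"
      by (rule nn_integral_cong, rule k_volume_flat_section[OF cpt]) (simp add: space_flats)
    also have "\<dots> = ennreal (unit_ball_vol k powr s) * \<Phi>"
      unfolding \<Phi>_def by (rule nn_integral_cmult) measurable
    finally show ?thesis .
  qed
  define C where "C = 1 / (fact k powr p)
           * (unit_ball_vol a ^ (k + 1) / unit_ball_vol (real k) powr s)
           * (unit_ball_vol (real k * a + real k) / unit_ball_vol (real (k + 1) * a))
           * (b_coeff (real d) k / b_coeff a k)"
  have C: "C = 1 / fact k powr p * (b_coeff (real d) k * N) / unit_ball_vol (real k) powr s"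
    unfolding C_def N_def by (simp add: mult_ac)
  have "C * unit_ball_vol (real k) powr s = 1 / fact k powr p * (b_coeff (real d) k * N)"
    unfolding C using \<kappa> by simp
  moreover have "C \<ge> 0" unfolding C using b N by simp
  ultimately have "ennreal (1 / fact k powr p) * ennreal (b_coeff (real d) k * N) = ennreal C * ennreal (unit_ball_vol k powr s)"
    using b N by (subst (1 2) ennreal_mult[symmetric]) simp_all
  then show ?thesis
    unfolding left SM a_def[symmetric] s_def[symmetric] right C_def[symmetric]
    by (simp only: mult.assoc[symmetric])
qed

end
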